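(* Let $d,p,k\ge 1$ be integers and let $F\in C^\infty(\mathbb{R}^d,\mathbb{R}^p)$ satisfy: $F(0)=0$; $JF(x)\neq 0$ for every $x\in F^{-1}(0)$; and there exist $\mathtt{m},\alpha>0$ and $R\ge 0$ such that $\|F(x)\|\ge \mathtt{m}\|x\|^{\alpha}$ for all $x\in\mathbb{R}^d$ with $\|x\|\ge R$. Then $\pi_\varepsilon$ is well-defined for every $\varepsilon\ge 0$. Let $\mathsf{U}\subset\mathbb{R}^d$ be open and bounded with $F^{-1}(0)\subset \mathsf{U}$. (i) For every $\varphi\in C(\mathbb{R}^d,\mathbb{R})$ for which there is $C_\varphi\ge 0$ with $|\varphi(x)|\le C_\varphi\exp[C_\varphi\|x\|^{\alpha k}]$ for all $x\in\mathbb{R}^d$, one has $\lim_{\varepsilon\to 0}|\pi_\varepsilon[\varphi]-\pi_0[\varphi]|=0$. (ii) There exist a continuous non-decreasing function $A:[0,+\infty)\to[0,+\infty)$ and a continuous non-increasing function $\bar\varepsilon:[0,+\infty)\to(0,+\infty)$, not depending on $\varphi$, such that for every $\varphi\in C(\mathbb{R}^d,\mathbb{R})$ and $C_\varphi\ge 0$ with $|\varphi(x)|\le C_\varphi\exp[C_\varphi\|x\|^{\alpha k}]$ for all $x\in\mathbb{R}^d$, and such that $\varphi$ is $M_{1,\varphi}$-Lipschitz on $\mathsf{U}$ with $M_{1,\varphi}\ge 0$, one has for all $\varepsilon\in(0,\bar\varepsilon(C_\varphi))$ $$|\pi_\varepsilon[\varphi]-\pi_0[\varphi]|\le A(C_\varphi)\,(1+M_{0,\varphi}+M_{1,\varphi})\,\varepsilon^{1/k},$$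 where $M_{0,\varphi}=\sup\{|\varphi(x)|: x\in \mathsf{U}\}$.
   Context: For a differentiable map $F:\mathbb{R}^d\to\mathbb{R}^p$, $DF(x)$ is the $p\times d$ Jacobian matrix and the generalized Jacobian is $JF(x)=\det(DF(x)DF(x)^\top)^{1/2}$ if $d\ge p$ and $JF(x)=\det(DF(x)^\top DF(x))^{1/2}$ if $d\le p$; $JF(x)^{-1}$ denotes $1/JF(x)$. $\|\cdot\|$ is the Euclidean norm and $\mathcal{H}^r$ is the $r$-dimensional Hausdorff measure. For $\varepsilon>0$, $\pi_\varepsilon$ is the probability measure on $\mathbb{R}^d$ with $\pi_\varepsilon(\mathsf{A})=\int_{\mathsf{A}}\exp[-\|F(x)\|^k/\varepsilon]\,dx\big/\int_{\mathbb{R}^d}\exp[-\|F(x)\|^k/\varepsilon]\,dx$ for Borel $\mathsf{A}$, and $\pi_0(\mathsf{A})=\int_{F^{-1}(0)\cap \mathsf{A}}JF(x)^{-1}\,d\mathcal{H}^{d-\min(d,p)}(x)\big/\int_{F^{-1}(0)}JF(x)^{-1}\,d\mathcal{H}^{d-\min(d,p)}(x)$. For a measure $\pi$, $\pi[\varphi]=\int\varphi\,d\pi$. *)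

theory Defs
  imports "HOL-Analysis.Analysis" "HOL-Probability.Probability_Measure"
begin

section \<open>Hausdorff measure\<close>

text \<open>
  Size-\<open>\<delta>\<close> approximation of the \<open>r\<close>-dimensional Hausdorff measure, normalised so that
  \<open>r = n\<close> gives Lebesgue measure on \<open>n\<close>-dimensional Euclidean space. The empty set contributes
  \<open>0\<close> also for \<open>r = 0\<close>, where every nonempty set contributes \<open>1\<close> (as \<open>0 ^ 0 = 1\<close>). Boundedness is
  required explicitly because \<^const>\<open>diameter\<close> is only meaningful on bounded sets.
\<close>

definition hausdorff_gauge :: "nat \<Rightarrow> 'a::metric_space set \<Rightarrow> ennreal" where
  "hausdorff_gauge r S =
     (if S = {} then 0 else ennreal (unit_ball_vol (real r) * (diameter S / 2) ^ r))"

definition hausdorff_content :: "real \<Rightarrow> nat \<Rightarrow> 'a::metric_space set \<Rightarrow> ennreal" where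
  "hausdorff_content \<delta> r A =
     (INF C \<in> {C :: nat \<Rightarrow> 'a set. A \<subseteq> (\<Union>i. C i) \<and> (\<forall>i. bounded (C i) \<and> diameter (C i) \<le> \<delta>)}.
        \<Sum>i. hausdorff_gauge r (C i))"

definition hausdorff_outer :: "nat \<Rightarrow> 'a::metric_space set \<Rightarrow> ennreal" where
  "hausdorff_outer r A = (SUP \<delta> \<in> {0<..}. hausdorff_content \<delta> r A)"

definition hausdorff_measure :: "nat \<Rightarrow> 'a::metric_space measure" where
  "hausdorff_measure r = measure_of UNIV (sets borel) (hausdorff_outer r)"

lemma sets_hausdorff_measure [simp, measurable_cong]: "sets (hausdorff_measure r) = sets borel"
  by (simp add: hausdorff_measure_def sets.sigma_sets_eq[of borel, simplified])

lemma space_hausdorff_measure [simp]: "space (hausdorff_measure r) = UNIV"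
  by (simp add: hausdorff_measure_def)

text \<open>
  \<^const>\<open>measure_of\<close> yields the null measure unless the given set function is a measure; the next
  lemmas show that Hausdorff outer measure is one on the Borel sets.
\<close>

lemma hausdorff_content_empty [simp]: "\<delta> > 0 \<Longrightarrow> hausdorff_content \<delta> r ({} :: 'a::metric_space set) = 0"
proof -
  assume "\<delta> > 0"
  then have "hausdorff_content \<delta> r ({}::'a set) \<le> (\<Sum>i::nat. hausdorff_gauge r ({}::'a set))"
    unfolding hausdorff_content_def by (intro INF_lower2[of "\<lambda>_. {}"]) auto
  then show ?thesis by (simp add: hausdorff_gauge_def)
qed

lemma hausdorff_content_mono: "A \<subseteq> B \<Longrightarrow> hausdorff_content \<delta> r A \<le> hausdorff_content \<delta> r B"
  unfolding hausdorff_content_def by (rule INF_superset_mono) auto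

lemma hausdorff_content_antimono:
  "\<delta> \<le> \<delta>' \<Longrightarrow> hausdorff_content \<delta>' r A \<le> hausdorff_content \<delta> r A"
  unfolding hausdorff_content_def by (rule INF_superset_mono) (auto intro: order_trans)

lemma hausdorff_content_le_outer: "\<delta> > 0 \<Longrightarrow> hausdorff_content \<delta> r A \<le> hausdorff_outer r A"
  unfolding hausdorff_outer_def by (rule SUP_upper) auto

lemma hausdorff_content_UN:
  fixes A :: "nat \<Rightarrow> 'a::metric_space set"
  assumes "\<delta> > 0"
  shows "hausdorff_content \<delta> r (\<Union>i. A i) \<le> (\<Sum>i. hausdorff_content \<delta> r (A i))"
proof (cases "(\<Sum>i. hausdorff_content \<delta> r (A i)) = top")
  case False
  then have fin: "hausdorff_content \<delta> r (A i) < top" for i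
    by (metis ennreal_suminf_lessD less_top)
  show ?thesis
  proof (rule ennreal_le_epsilon)
    fix e :: real assume e: "0 < e"
    have "\<exists>C. A i \<subseteq> (\<Union>j. C j) \<and> (\<forall>j. bounded (C j) \<and> diameter (C j) \<le> \<delta>) \<and>
            (\<Sum>j. hausdorff_gauge r (C j)) \<le> hausdorff_content \<delta> r (A i) + ennreal (e * (1/2) ^ Suc i)"
      for i
    proof -
      have "hausdorff_content \<delta> r (A i) < hausdorff_content \<delta> r (A i) + ennreal (e * (1/2) ^ Suc i)"
        using fin[of i] e by (simp add: ennreal_add_left_cancel_less less_top)
      then have "\<exists>C\<in>{C :: nat \<Rightarrow> 'a set. A i \<subseteq> (\<Union>j. C j) \<and> (\<forall>j. bounded (C j) \<and> diameter (C j) \<le> \<delta>)}.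
          (\<Sum>j. hausdorff_gauge r (C j)) < hausdorff_content \<delta> r (A i) + ennreal (e * (1/2) ^ Suc i)"
        unfolding hausdorff_content_def[of \<delta> r "A i"] Inf_less_iff by blast
      then show ?thesis by (auto intro: less_imp_le)
    qed
    then obtain C where C: "\<And>i. A i \<subseteq> (\<Union>j. C i j)"
      "\<And>i j. bounded (C i j) \<and> diameter (C i j) \<le> \<delta>"
      "\<And>i. (\<Sum>j. hausdorff_gauge r (C i j)) \<le> hausdorff_content \<delta> r (A i) + ennreal (e * (1/2) ^ Suc i)"
      by metis
    have "(\<Union>i. A i) \<subseteq> (\<Union>n. case_prod C (prod_decode n))"
    proof
      fix x assume "x \<in> (\<Union>i. A i)"
      then obtain i j where "x \<in> C i j" using C(1) by blast
      then have "x \<in> case_prod C (prod_decode (prod_encode (i, j)))" by simp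
      then show "x \<in> (\<Union>n. case_prod C (prod_decode n))" by (rule UN_I[OF UNIV_I])
    qed
    then have "hausdorff_content \<delta> r (\<Union>i. A i) \<le> (\<Sum>n. hausdorff_gauge r (case_prod C (prod_decode n)))"
      unfolding hausdorff_content_def using C(2)
      by (intro INF_lower2[of "\<lambda>n. case_prod C (prod_decode n)"]) (auto split: prod.split)
    also have "\<dots> = (\<Sum>n. (\<lambda>(i,j). hausdorff_gauge r (C i j)) (prod_decode n))"
      by (simp add: case_prod_beta)
    also have "\<dots> = (\<Sum>i. \<Sum>j. hausdorff_gauge r (C i j))"
      by (rule suminf_ennreal_2dimen) simp
    also have "\<dots> \<le> (\<Sum>i. hausdorff_content \<delta> r (A i) + ennreal (e * (1/2) ^ Suc i))"
      by (intro suminf_le C(3) summableI)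
    also have "\<dots> = (\<Sum>i. hausdorff_content \<delta> r (A i)) + (\<Sum>i. ennreal (e * (1/2) ^ Suc i))"
      by (intro suminf_add[symmetric] summableI)
    also have "(\<Sum>i. ennreal (e * (1/2) ^ Suc i)) = ennreal e"
    proof -
      have "(\<lambda>i. e * (1/2) ^ Suc i) sums (e * 1)"
        by (intro sums_mult power_half_series)
      then show ?thesis using e by (intro suminf_ennreal_eq) auto
    qed
    finally show "hausdorff_content \<delta> r (\<Union>i. A i) \<le> (\<Sum>i. hausdorff_content \<delta> r (A i)) + ennreal e" .
  qed
qed simp

lemma outer_measure_space_hausdorff:
  "outer_measure_space (Pow UNIV) (hausdorff_outer r :: 'a::metric_space set \<Rightarrow> ennreal)"
  unfolding outer_measure_space_def
proof (intro conjI)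
  show "positive (Pow UNIV) (hausdorff_outer r :: 'a set \<Rightarrow> ennreal)"
    by (simp add: positive_def hausdorff_outer_def)
  show "increasing (Pow UNIV) (hausdorff_outer r :: 'a set \<Rightarrow> ennreal)"
    unfolding increasing_def hausdorff_outer_def
    by (auto intro!: SUP_mono' hausdorff_content_mono)
  show "countably_subadditive (Pow UNIV) (hausdorff_outer r :: 'a set \<Rightarrow> ennreal)"
    unfolding countably_subadditive_def
  proof (intro allI impI)
    fix A :: "nat \<Rightarrow> 'a set"
    show "hausdorff_outer r (\<Union>i. A i) \<le> (\<Sum>i. hausdorff_outer r (A i))"
      unfolding hausdorff_outer_def[of r "\<Union>i. A i"]
    proof (rule SUP_least)
      fix \<delta> :: real assume "\<delta> \<in> {0<..}"
      then have "hausdorff_content \<delta> r (\<Union>i. A i) \<le> (\<Sum>i. hausdorff_content \<delta> r (A i))"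
        by (intro hausdorff_content_UN) auto
      also have "\<dots> \<le> (\<Sum>i. hausdorff_outer r (A i))"
        using \<open>\<delta> \<in> {0<..}\<close> by (intro suminf_le summableI hausdorff_content_le_outer) auto
      finally show "hausdorff_content \<delta> r (\<Union>i. A i) \<le> (\<Sum>i. hausdorff_outer r (A i))" .
    qed
  qed
qed

lemma hausdorff_outer_separated:
  assumes "s > 0" and sep: "\<And>a b. a \<in> A \<Longrightarrow> b \<in> B \<Longrightarrow> s \<le> dist a b"
  shows "hausdorff_outer r A + hausdorff_outer r B \<le> hausdorff_outer r (A \<union> B)"
proof -
  have content: "hausdorff_content \<delta> r A + hausdorff_content \<delta> r B \<le> hausdorff_content \<delta> r (A \<union> B)"
    if \<delta>: "0 < \<delta>" "\<delta> < s" for \<delta>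
    unfolding hausdorff_content_def[of \<delta> r "A \<union> B"]
  proof (rule INF_greatest)
    fix C :: "nat \<Rightarrow> 'a set"
    assume "C \<in> {C. A \<union> B \<subseteq> (\<Union>i. C i) \<and> (\<forall>i. bounded (C i) \<and> diameter (C i) \<le> \<delta>)}"
    then have cov: "A \<union> B \<subseteq> (\<Union>i. C i)" and C: "\<forall>i. bounded (C i) \<and> diameter (C i) \<le> \<delta>"
      by auto
    let ?P = "\<lambda>S i. if C i \<inter> S = {} then {} else C i"
    have one: "?P A i = {} \<or> ?P B i = {}" for i
    proof (rule ccontr)
      assume "\<not> ?thesis"
      then obtain a b where "a \<in> A" "b \<in> B" "a \<in> C i" "b \<in> C i" by (auto split: if_splits)
      then have "s \<le> diameter (C i)"
        using sep[of a b] diameter_bounded_bound[of "C i" a b] C by fastforce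
      then show False using C \<delta> by (metis leD order_trans)
    qed
    have le: "hausdorff_content \<delta> r S \<le> (\<Sum>i. hausdorff_gauge r (?P S i))" if "S \<subseteq> A \<union> B" for S
      unfolding hausdorff_content_def
    proof (rule INF_lower, rule CollectI, intro conjI)
      show "S \<subseteq> (\<Union>i. ?P S i)"
      proof
        fix x assume "x \<in> S"
        then have "x \<in> (\<Union>i. C i)" using that cov by (meson subsetD)
        then obtain i where "x \<in> C i" by (elim UN_E)
        then have "x \<in> ?P S i" using \<open>x \<in> S\<close> by auto
        then show "x \<in> (\<Union>i. ?P S i)" by (rule UN_I[OF UNIV_I])
      qed
      show "\<forall>i. bounded (?P S i) \<and> diameter (?P S i) \<le> \<delta>" using C \<delta> by auto
    qed
    have "hausdorff_content \<delta> r A + hausdorff_content \<delta> r B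
        \<le> (\<Sum>i. hausdorff_gauge r (?P A i)) + (\<Sum>i. hausdorff_gauge r (?P B i))"
      by (intro add_mono le) auto
    also have "\<dots> = (\<Sum>i. hausdorff_gauge r (?P A i) + hausdorff_gauge r (?P B i))"
      by (intro suminf_add summableI)
    also have "\<dots> \<le> (\<Sum>i. hausdorff_gauge r (C i))"
    proof (intro suminf_le summableI)
      fix i show "hausdorff_gauge r (?P A i) + hausdorff_gauge r (?P B i) \<le> hausdorff_gauge r (C i)"
        using one[of i] by (auto simp: hausdorff_gauge_def split: if_splits)
    qed
    finally show "hausdorff_content \<delta> r A + hausdorff_content \<delta> r B \<le> (\<Sum>i. hausdorff_gauge r (C i))" .
  qed
  have "hausdorff_content \<delta> r A + hausdorff_content \<delta>' r B \<le> hausdorff_outer r (A \<union> B)"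
    if "\<delta> > 0" "\<delta>' > 0" for \<delta> \<delta>'
  proof -
    let ?m = "min (s / 2) (min \<delta> \<delta>')"
    have "hausdorff_content \<delta> r A + hausdorff_content \<delta>' r B
        \<le> hausdorff_content ?m r A + hausdorff_content ?m r B"
      by (intro add_mono hausdorff_content_antimono) auto
    also have "\<dots> \<le> hausdorff_content ?m r (A \<union> B)"
      using that \<open>s > 0\<close> by (intro content) auto
    also have "\<dots> \<le> hausdorff_outer r (A \<union> B)"
      using that \<open>s > 0\<close> by (intro hausdorff_content_le_outer) auto
    finally show ?thesis .
  qed
  then have "hausdorff_outer r A + hausdorff_content \<delta>' r B \<le> hausdorff_outer r (A \<union> B)"
    if "\<delta>' > 0" for \<delta>'
    using that unfolding hausdorff_outer_def[of r A]
    by (subst add.commute, subst ennreal_SUP_add_right) (auto intro!: SUP_least simp: add.commute)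
  then show ?thesis
    unfolding hausdorff_outer_def[of r B]
    by (subst ennreal_SUP_add_right) (auto intro!: SUP_least)
qed

lemma closed_in_lambda_system_hausdorff:
  fixes F :: "'a::metric_space set"
  assumes "closed F"
  shows "F \<in> lambda_system UNIV (Pow UNIV) (hausdorff_outer r)"
proof (cases "F = {}")
  case True
  then show ?thesis
    using outer_measure_space_hausdorff[where 'a='a and r=r]
    by (auto simp: lambda_system_def outer_measure_space_def positive_def)
next
  case False
  let ?f = "hausdorff_outer r :: 'a set \<Rightarrow> ennreal"
  have pos: "positive (Pow UNIV) ?f" and inc: "increasing (Pow UNIV) ?f"
    and csa: "countably_subadditive (Pow UNIV) ?f"
    using outer_measure_space_hausdorff[where 'a='a and r=r] by (auto simp: outer_measure_space_def)
  interpret sigma_algebra UNIV "Pow (UNIV :: 'a set)" by (rule sigma_algebra_Pow)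
  have sa: "?f (X \<union> Y) \<le> ?f X + ?f Y" for X Y
  proof -
    have "subadditive (Pow UNIV) ?f" by (rule countably_subadditive_subadditive[OF pos csa])
    then have "?f (X \<union> (Y - X)) \<le> ?f X + ?f (Y - X)" by (rule subadditiveD) auto
    also have "\<dots> \<le> ?f X + ?f Y" by (intro add_left_mono increasingD[OF inc]) auto
    finally show ?thesis by simp
  qed
  have mono: "X \<subseteq> Y \<Longrightarrow> ?f X \<le> ?f Y" for X Y by (rule increasingD[OF inc]) auto
  have main: "?f (F \<inter> A) + ?f (A - F) \<le> ?f A" for A
  proof (cases "?f A = top")
    case fA: False
    define S where "S n = {x \<in> A. 1 / real (Suc n) \<le> infdist x F}" for n
    define D where "D n = {x \<in> A. 1 / real (Suc (Suc n)) \<le> infdist x F \<and> infdist x F < 1 / real (Suc n)}" for n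
    have sepF: "?f (F \<inter> A) + ?f (S n) \<le> ?f A" for n
    proof -
      have "?f (F \<inter> A) + ?f (S n) \<le> ?f ((F \<inter> A) \<union> S n)"
      proof (rule hausdorff_outer_separated[of "1 / real (Suc n)"])
        fix a b assume "a \<in> F \<inter> A" "b \<in> S n"
        then have "1 / real (Suc n) \<le> infdist b F" "infdist b F \<le> dist b a"
          by (auto simp: S_def intro: infdist_le)
        then show "1 / real (Suc n) \<le> dist a b" by (simp add: dist_commute)
      qed simp
      also have "\<dots> \<le> ?f A" by (rule mono) (auto simp: S_def)
      finally show ?thesis .
    qed
    have step: "(\<Sum>k<N. ?f (D (2 * k + c))) \<le> ?f (\<Union>k<N. D (2 * k + c))" for c N
    proof (induction N)
      case (Suc N)
      have "(\<Sum>k<Suc N. ?f (D (2 * k + c))) \<le> ?f (\<Union>k<N. D (2 * k + c)) + ?f (D (2 * N + c))"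
        using Suc by (auto intro: add_right_mono)
      also have "\<dots> \<le> ?f ((\<Union>k<N. D (2 * k + c)) \<union> D (2 * N + c))"
      proof (rule hausdorff_outer_separated)
        let ?n = "real (2 * N + c)"
        show "(0::real) < (if N = 0 then 1 else 1 / ?n - 1 / (?n + 1))"
          by (auto intro!: divide_strict_left_mono mult_pos_pos)
        fix a b assume a: "a \<in> (\<Union>k<N. D (2 * k + c))" and b: "b \<in> D (2 * N + c)"
        then obtain k where k: "k < N" "a \<in> D (2 * k + c)" by auto
        have "1 / ?n \<le> 1 / real (Suc (Suc (2 * k + c)))"
          using k by (intro divide_left_mono) auto
        also have "\<dots> \<le> infdist a F" using k by (auto simp: D_def)
        also have "\<dots> \<le> infdist b F + dist a b" by (rule infdist_triangle)
        also have "infdist b F < 1 / (?n + 1)" using b by (auto simp: D_def add.commute)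
        finally show "(if N = 0 then 1 else 1 / ?n - 1 / (?n + 1)) \<le> dist a b" using k by simp
      qed
      also have "(\<Union>k<N. D (2 * k + c)) \<union> D (2 * N + c) = (\<Union>k<Suc N. D (2 * k + c))"
        by (auto simp: lessThan_Suc)
      finally show ?case .
    qed (use pos in \<open>simp add: positive_def\<close>)
    have half: "(\<Sum>k<N. ?f (D (2 * k + c))) \<le> ?f A" for c N
      using step[where c=c and N=N] mono[of "\<Union>k<N. D (2 * k + c)" A] by (force simp: D_def)
    have "(\<Sum>k<n. ?f (D k)) \<le> ?f A + ?f A" for n
    proof -
      have "(\<Sum>k<n. ?f (D k)) \<le> (\<Sum>k<2 * n. ?f (D k))" by (intro sum_mono2) auto
      also have "\<dots> = (\<Sum>k<n. ?f (D (2 * k + 0))) + (\<Sum>k<n. ?f (D (2 * k + 1)))"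
        by (induction n) (auto simp: algebra_simps)
      also have "\<dots> \<le> ?f A + ?f A" by (intro add_mono half)
      finally show ?thesis .
    qed
    then have "(\<Sum>k. ?f (D k)) \<le> ?f A + ?f A" by (intro suminf_le_const summableI)
    then have Dfin: "(\<Sum>k. ?f (D k)) \<noteq> top" using fA
      by (metis ennreal_add_eq_top top.extremum_unique)
    have tail: "?f (A - F) \<le> ?f (S n) + (\<Sum>k. ?f (D (k + n)))" for n
    proof -
      have "A - F \<subseteq> S n \<union> (\<Union>k. D (k + n))"
      proof
        fix x assume x: "x \<in> A - F"
        then have "infdist x F > 0"
          using assms False by (metis DiffD2 in_closed_iff_infdist_zero infdist_nonneg less_eq_real_def)
        show "x \<in> S n \<union> (\<Union>k. D (k + n))"
        proof (cases "x \<in> S n")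
          case False
          obtain m where m: "1 / real (Suc m) < infdist x F"
            using \<open>infdist x F > 0\<close> by (metis nat_approx_posE)
          define j where "j = (LEAST j. 1 / real (Suc j) \<le> infdist x F)"
          have j: "1 / real (Suc j) \<le> infdist x F"
            unfolding j_def by (rule LeastI[of _ m]) (use m in simp)
          have "j > n"
          proof (rule ccontr)
            assume "\<not> j > n"
            then have "1 / real (Suc n) \<le> 1 / real (Suc j)" by (intro divide_left_mono) auto
            with j False x show False by (auto simp: S_def)
          qed
          then obtain k where k: "j = Suc (k + n)" by (metis less_iff_Suc_add add.commute)
          have "\<not> 1 / real (Suc (k + n)) \<le> infdist x F"
            using not_less_Least[of "k + n" "\<lambda>j. 1 / real (Suc j) \<le> infdist x F"] k
            by (simp add: j_def)
          then have "x \<in> D (k + n)" using j k x by (auto simp: D_def)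
          then show ?thesis by blast
        qed auto
      qed
      then have "?f (A - F) \<le> ?f (S n \<union> (\<Union>k. D (k + n)))" by (rule mono)
      also have "\<dots> \<le> ?f (S n) + ?f (\<Union>k. D (k + n))" by (rule sa)
      also have "?f (\<Union>k. D (k + n)) \<le> (\<Sum>k. ?f (D (k + n)))"
      proof -
        have "disjoint_family (\<lambda>k. D (k + n))"
          unfolding disjoint_family_on_def
        proof (intro ballI impI)
          have *: "D i \<inter> D j = {}" if "i < j" for i j
          proof -
            have "1 / real (Suc j) \<le> 1 / real (Suc (Suc i))" using that by (intro divide_left_mono) auto
            then show ?thesis by (auto simp: D_def)
          qed
          fix i j :: nat assume "i \<noteq> j"
          then show "D (i + n) \<inter> D (j + n) = {}"
            using *[of "i + n" "j + n"] *[of "j + n" "i + n"] by (cases "i < j") auto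
        qed
        then show ?thesis using csa unfolding countably_subadditive_def by auto
      qed
      finally show ?thesis by (simp add: add_left_mono)
    qed
    show ?thesis
    proof (rule ennreal_le_epsilon)
      fix e :: real assume e: "0 < e"
      obtain g where g: "\<And>k. 0 \<le> g k" "\<And>k. ?f (D k) = ennreal (g k)"
      proof -
        have "?f (D k) < top" for k using Dfin by (metis ennreal_suminf_lessD less_top)
        then show ?thesis using that[of "\<lambda>k. enn2real (?f (D k))"] by auto
      qed
      have gs: "summable g"
        using Dfin g by (intro summable_suminf_not_top) auto
      obtain n where n: "norm (\<Sum>k. g (k + n)) < e"
        using suminf_exist_split[OF e gs] by (meson order_refl)
      have "(\<Sum>k. ?f (D (k + n))) = ennreal (\<Sum>k. g (k + n))"
        using g gs by (simp add: suminf_ennreal2 summable_ignore_initial_segment)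
      also have "\<dots> \<le> ennreal e" using n by (intro ennreal_leI) auto
      finally have t: "(\<Sum>k. ?f (D (k + n))) \<le> ennreal e" .
      have "?f (F \<inter> A) + ?f (A - F) \<le> ?f (F \<inter> A) + (?f (S n) + ennreal e)"
        by (intro add_left_mono order_trans[OF tail[of n]] t)
      also have "\<dots> = (?f (F \<inter> A) + ?f (S n)) + ennreal e" by (simp add: add.assoc)
      also have "\<dots> \<le> ?f A + ennreal e" by (intro add_right_mono sepF)
      finally show "?f (F \<inter> A) + ?f (A - F) \<le> ?f A + ennreal e" .
    qed
  qed simp
  have "?f A \<le> ?f (F \<inter> A) + ?f (A - F)" for A
    using sa[of "F \<inter> A" "A - F"] by (metis Int_Diff_Un Int_commute)
  with main show ?thesis
    by (auto simp: lambda_system_def Diff_eq Int_commute intro: antisym)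
qed

lemma measure_space_hausdorff:
  "measure_space UNIV (sets borel) (hausdorff_outer r :: 'a::metric_space set \<Rightarrow> ennreal)"
proof -
  interpret sigma_algebra UNIV "Pow (UNIV :: 'a set)" by (rule sigma_algebra_Pow)
  let ?L = "lambda_system UNIV (Pow UNIV) (hausdorff_outer r :: 'a set \<Rightarrow> ennreal)"
  have L: "measure_space UNIV ?L (hausdorff_outer r)"
    by (rule caratheodory_lemma[OF outer_measure_space_hausdorff])
  have "sigma_sets UNIV (Collect closed) \<subseteq> ?L"
    using L closed_in_lambda_system_hausdorff
    by (intro sigma_algebra.sigma_sets_subset) (auto simp: measure_space_def)
  then have "sets borel \<subseteq> ?L" by (simp add: borel_eq_closed)
  then show ?thesis
    using sets.sigma_algebra_axioms[of borel] by (intro measure_down[OF L]) auto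
qed

lemma emeasure_hausdorff_measure:
  "A \<in> sets borel \<Longrightarrow> emeasure (hausdorff_measure r) A = hausdorff_outer r A"
  unfolding hausdorff_measure_def
  using measure_space_hausdorff[of r] sets.sigma_algebra_axioms[of borel]
  by (intro emeasure_measure_of_sigma) (auto simp: measure_space_def)


section \<open>Smooth maps and the generalized Jacobian\<close>

text \<open>
  For finite-dimensional domains, \<open>cont_diff n f\<close> is the usual \<open>C\<^sup>n\<close> property on the whole space:
  continuity of the derivative is equivalent to continuity of all directional derivatives.
\<close>

primrec cont_diff :: "nat \<Rightarrow> ('a::real_normed_vector \<Rightarrow> 'b::real_normed_vector) \<Rightarrow> bool" where
  "cont_diff 0 f \<longleftrightarrow> continuous_on UNIV f"
| "cont_diff (Suc n) f \<longleftrightarrow>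
     (\<forall>x. f differentiable (at x)) \<and> (\<forall>v. cont_diff n (\<lambda>x. frechet_derivative f (at x) v))"

definition smooth :: "('a::real_normed_vector \<Rightarrow> 'b::real_normed_vector) \<Rightarrow> bool" where
  "smooth f \<longleftrightarrow> (\<forall>n. cont_diff n f)"

definition gen_jacobian :: "(real ^ 'd \<Rightarrow> real ^ 'p) \<Rightarrow> real ^ 'd \<Rightarrow> real" where
  "gen_jacobian F x =
     (let DF = jacobian F (at x) in
      if CARD('p) \<le> CARD('d) then sqrt (det (DF ** transpose DF))
      else sqrt (det (transpose DF ** DF)))"


section \<open>The measures \<open>\<pi>\<^sub>\<epsilon>\<close> and \<open>\<pi>\<^sub>0\<close>\<close>

definition gibbs_norm :: "(real ^ 'd \<Rightarrow> real ^ 'p) \<Rightarrow> nat \<Rightarrow> real \<Rightarrow> ennreal" where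
  "gibbs_norm F k \<epsilon> = (\<integral>\<^sup>+x. ennreal (exp (- (norm (F x) ^ k / \<epsilon>))) \<partial>lborel)"

definition gibbs_measure :: "(real ^ 'd \<Rightarrow> real ^ 'p) \<Rightarrow> nat \<Rightarrow> real \<Rightarrow> (real ^ 'd) measure" where
  "gibbs_measure F k \<epsilon> =
     density lborel (\<lambda>x. ennreal (exp (- (norm (F x) ^ k / \<epsilon>))) / gibbs_norm F k \<epsilon>)"

definition zero_set_hausdorff :: "(real ^ 'd \<Rightarrow> real ^ 'p) \<Rightarrow> (real ^ 'd) measure" where
  "zero_set_hausdorff F = hausdorff_measure (CARD('d) - min CARD('d) CARD('p))"

definition limit_norm :: "(real ^ 'd \<Rightarrow> real ^ 'p) \<Rightarrow> ennreal" where
  "limit_norm F = (\<integral>\<^sup>+x\<in>F -` {0}. ennreal (1 / gen_jacobian F x) \<partial>zero_set_hausdorff F)"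

definition limit_measure :: "(real ^ 'd \<Rightarrow> real ^ 'p) \<Rightarrow> (real ^ 'd) measure" where
  "limit_measure F =
     density (zero_set_hausdorff F)
       (\<lambda>x. ennreal (1 / gen_jacobian F x) * indicator (F -` {0}) x / limit_norm F)"

lemma emeasure_gibbs_measure:
  assumes [measurable]: "F \<in> borel_measurable borel" "A \<in> sets borel"
  shows "emeasure (gibbs_measure F k \<epsilon>) A =
    (\<integral>\<^sup>+x\<in>A. ennreal (exp (- (norm (F x) ^ k / \<epsilon>))) \<partial>lborel) / gibbs_norm F k \<epsilon>"
proof -
  have "emeasure (gibbs_measure F k \<epsilon>) A =
    (\<integral>\<^sup>+x. (ennreal (exp (- (norm (F x) ^ k / \<epsilon>))) / gibbs_norm F k \<epsilon>) * indicator A x \<partial>lborel)"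
    unfolding gibbs_measure_def by (rule emeasure_density) measurable
  also have "\<dots> =
    (\<integral>\<^sup>+x. (ennreal (exp (- (norm (F x) ^ k / \<epsilon>))) * indicator A x) / gibbs_norm F k \<epsilon> \<partial>lborel)"
    by (intro nn_integral_cong) (simp add: divide_ennreal_def ac_simps)
  also have "\<dots> =
    (\<integral>\<^sup>+x\<in>A. ennreal (exp (- (norm (F x) ^ k / \<epsilon>))) \<partial>lborel) / gibbs_norm F k \<epsilon>"
    by (rule nn_integral_divide) measurable
  finally show ?thesis .
qed

lemma emeasure_limit_measure:
  assumes [measurable]: "F \<in> borel_measurable borel" "gen_jacobian F \<in> borel_measurable borel"
    "A \<in> sets borel"
  shows "emeasure (limit_measure F) A =
    (\<integral>\<^sup>+x\<in>F -` {0} \<inter> A. ennreal (1 / gen_jacobian F x) \<partial>zero_set_hausdorff F) / limit_norm F"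
proof -
  have [measurable_cong]: "sets (zero_set_hausdorff F) = sets borel"
    by (simp add: zero_set_hausdorff_def)
  have [measurable]: "F -` {0} \<in> sets borel"
    using measurable_sets[OF assms(1), of "{0}"] by simp
  have "emeasure (limit_measure F) A =
    (\<integral>\<^sup>+x. (ennreal (1 / gen_jacobian F x) * indicator (F -` {0}) x / limit_norm F) * indicator A x
       \<partial>zero_set_hausdorff F)"
    unfolding limit_measure_def by (rule emeasure_density) measurable
  also have "\<dots> =
    (\<integral>\<^sup>+x. (ennreal (1 / gen_jacobian F x) * indicator (F -` {0} \<inter> A) x) / limit_norm F
       \<partial>zero_set_hausdorff F)"
    by (intro nn_integral_cong) (simp add: divide_ennreal_def indicator_inter_arith ac_simps)
  also have "\<dots> =
    (\<integral>\<^sup>+x\<in>F -` {0} \<inter> A. ennreal (1 / gen_jacobian F x) \<partial>zero_set_hausdorff F) / limit_norm F"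
    by (rule nn_integral_divide) measurable
  finally show ?thesis .
qed

end

theory Submission
  imports Defs
begin

text \<open>
  Let \<open>q = min d p\<close>, \<open>n = d - q\<close> and \<open>Z = F -` {0}\<close>. At small \<open>\<epsilon>\<close> the weight
  \<open>exp (- (norm (F x) ^ k / \<epsilon>))\<close> lives at distance about \<open>\<epsilon>\<close> to the power \<open>1/k\<close> from \<open>Z\<close>, and the
  theorem is the quotient of two instances (for \<open>\<phi>\<close> and for the constant \<open>1\<close>) of the Laplace
  expansion
  \<open>\<epsilon> powr (-q/k) * (\<integral> \<phi> exp (-|F|^k/\<epsilon>)) = c * (\<integral>\<^sub>Z \<phi> / JF dH) + O(\<epsilon> powr (1/k))\<close>
  for Lipschitz \<open>\<phi>\<close>, where \<open>H\<close> is \<open>n\<close>-dimensional Hausdorff measure and \<open>c > 0\<close> depends only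
  on \<open>d\<close>, \<open>p\<close>, \<open>k\<close>. Only the independence of \<open>c\<close> from \<open>\<phi>\<close> and from the point of \<open>Z\<close> matters, since
  \<open>c\<close> cancels in the quotient.

  If \<open>p \<le> d\<close>, then around \<open>z \<in> Z\<close> there is a chart \<open>G\<close> whose derivative at \<open>z\<close> is orthogonal and
  \<open>p\<close> of whose coordinates are \<open>M (F x)\<close> for a linear \<open>M\<close> with \<open>|det M| * JF z = 1\<close>. On a small ball
  \<open>G\<close> distorts distances and volumes, and \<open>JF\<close> varies, by at most a factor \<open>\<theta>\<close> as close to \<open>1\<close> as
  desired. The chart carries \<open>Z\<close> into a coordinate subspace and makes the weight a function of the \<open>p\<close> transverse
  coordinates alone. By Fubini the transverse integral produces the power of \<open>\<epsilon>\<close> and the factor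
  \<open>|det M| = 1 / JF z\<close>, and the Lipschitz bound makes the error \<open>O(\<epsilon> powr (1/k))\<close>; this is
  \<open>local_laplace_straightened\<close> and \<open>local_laplace_submersion\<close>. The limit is compared with the integral
  over \<open>Z\<close> only up to a power of \<open>\<theta>\<close>, because Hausdorff measure is distorted at most by \<open>\<theta> ^ n\<close>. The
  exact value comes from a limiting argument: a partition of unity turns the local statements into a
  global one with some limit \<open>\<Lambda>\<close> (\<open>neighbourhood_expansion_approx\<close>); being a limit as \<open>\<epsilon> \<rightarrow> 0\<close>,
  \<open>\<Lambda>\<close> does not depend on \<open>\<theta>\<close>, so letting \<open>\<theta> \<rightarrow> 1\<close> identifies it (\<open>neighbourhood_expansion_nonneg\<close>).

  If \<open>d < p\<close>, the zeros are isolated, \<open>H\<close> counts points, and the substitution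
  \<open>x = z + \<epsilon> powr (1/k) * v\<close> with a quadratic Taylor remainder gives the expansion
  (\<open>local_laplace_immersion\<close>).

  Hausdorff measure is linked to Lebesgue measure through invariance. On a coordinate subspace \<open>H\<close> is
  translation invariant and gives the unit cube a mass in \<open>(0, \<infinity>)\<close>. Hence the product of \<open>H\<close> with
  Lebesgue measure in the transverse directions is a constant multiple of Lebesgue measure on the
  whole space (\<open>nn_integral_flat_decompose\<close>), and the constant is absorbed into \<open>c\<close>.

  Away from \<open>Z\<close>, \<open>norm (F x)\<close> is bounded below, so half of the exponent is already smaller than any
  power of \<open>\<epsilon>\<close>, while the other half dominates \<open>exp (C * norm x powr (\<alpha> * k))\<close> as soon as
  \<open>2 * \<epsilon> * (C + 1) \<le> m ^ k\<close> (\<open>tail_estimate\<close>). This is where the dependence of \<open>A\<close> and \<open>\<epsilon>bar\<close> on \<open>C\<close>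
  comes from. The rate follows from the expansion by dividing (\<open>Lipschitz_rate\<close>). A merely continuous
  \<open>\<phi>\<close> is uniformly close to a polynomial on the closure of \<open>U\<close>, and polynomials are Lipschitz on the
  bounded set \<open>U\<close>, which gives the convergence without a rate (\<open>weak_convergence\<close>).
\<close>

section \<open>Change of variables over an arbitrary finite index type\<close>

text \<open>
  A change of variables for an injective differentiable map of \<open>real ^ 'n\<close> is first stated over a
  well-ordered index type. Ordering a copy of a finite type by an injection into the naturals and
  permuting coordinates carries it to every finite index type.
\<close>

typedef 'a ranked = "UNIV :: 'a set" by simp

definition finite_rank :: "'a::finite \<Rightarrow> nat" where "finite_rank = (SOME f. inj f)"

lemma inj_finite_rank: "inj (finite_rank :: 'a::finite \<Rightarrow> nat)"
proof -
  have "\<exists>f :: 'a \<Rightarrow> nat. inj f"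
    using finite_imp_inj_to_nat_seg[of "UNIV :: 'a set"] by auto
  then show ?thesis unfolding finite_rank_def by (rule someI_ex)
qed

instance ranked :: (finite) finite
proof
  show "finite (UNIV :: 'a ranked set)"
    using finite_imageI[OF finite_class.finite_UNIV, of Abs_ranked]
    by (simp add: type_definition.Abs_image[OF type_definition_ranked])
qed

instantiation ranked :: (finite) wellorder
begin

definition less_eq_ranked :: "'a ranked \<Rightarrow> 'a ranked \<Rightarrow> bool" where
  "less_eq_ranked x y \<longleftrightarrow> finite_rank (Rep_ranked x) \<le> finite_rank (Rep_ranked y)"

definition less_ranked :: "'a ranked \<Rightarrow> 'a ranked \<Rightarrow> bool" where
  "less_ranked x y \<longleftrightarrow> finite_rank (Rep_ranked x) < finite_rank (Rep_ranked y)"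

instance
proof
  fix P :: "'a ranked \<Rightarrow> bool" and a
  assume "\<And>x. (\<And>y. y < x \<Longrightarrow> P y) \<Longrightarrow> P x"
  then show "P a"
    unfolding less_ranked_def
    by (rule measure_induct_rule[of "\<lambda>x. finite_rank (Rep_ranked x)"])
qed (auto simp: less_eq_ranked_def less_ranked_def inj_eq[OF inj_finite_rank] Rep_ranked_inject)

end

definition reindex :: "('b \<Rightarrow> 'a) \<Rightarrow> real ^ 'a \<Rightarrow> real ^ 'b" where
  "reindex \<sigma> x = (\<chi> i. x $ \<sigma> i)"

lemma reindex_nth [simp]: "reindex \<sigma> x $ i = x $ \<sigma> i"
  by (simp add: reindex_def)

lemma linear_reindex: "linear (reindex \<sigma>)"
  by (rule linearI) (auto simp: vec_eq_iff)

lemma reindex_reindex: "reindex \<tau> (reindex \<sigma> x) = reindex (\<sigma> \<circ> \<tau>) x"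
  by (simp add: vec_eq_iff)

lemma reindex_id [simp]: "reindex (\<lambda>x. x) x = x"
  by (simp add: vec_eq_iff)

lemma bounded_linear_reindex: "bounded_linear (reindex \<sigma> :: real ^ 'a \<Rightarrow> real ^ 'b)"
  by (simp add: linear_conv_bounded_linear[symmetric] linear_reindex)

lemma continuous_on_reindex: "continuous_on A (reindex \<sigma> :: real ^ 'a \<Rightarrow> real ^ 'b)"
  by (rule linear_continuous_on[OF bounded_linear_reindex])

lemma measurable_reindex [measurable]: "(reindex \<sigma> :: real ^ 'a \<Rightarrow> real ^ 'b) \<in> borel_measurable borel"
  by (rule borel_measurable_continuous_onI[OF continuous_on_reindex])

text \<open>
  Permuting coordinates maps boxes to boxes and permutes the factors of their volume.
\<close>

lemma lborel_distr_reindex: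
  fixes \<sigma> :: "'b::finite \<Rightarrow> 'a::finite"
  assumes "bij \<sigma>"
  shows "distr lborel borel (reindex \<sigma>) = (lborel :: (real ^ 'b) measure)"
proof (rule lborel_eqI[symmetric])
  fix l u :: "real ^ 'b"
  assume le: "\<And>b. b \<in> Basis \<Longrightarrow> l \<bullet> b \<le> u \<bullet> b"
  let ?\<tau> = "inv \<sigma>"
  have \<tau>: "bij ?\<tau>" using assms bij_imp_bij_inv by blast
  have [simp]: "?\<tau> (\<sigma> i) = i" "\<sigma> (?\<tau> j) = j" for i j
    using assms by (simp_all add: bij_is_inj bij_is_surj surj_f_inv_f)
  have "reindex \<sigma> -` box l u = box (reindex ?\<tau> l) (reindex ?\<tau> u)"
    by (auto simp: mem_box_cart) (metis \<open>\<And>j. \<sigma> (inv \<sigma> j) = j\<close> \<open>\<And>i. inv \<sigma> (\<sigma> i) = i\<close>)+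
  moreover have le': "l $ i \<le> u $ i" for i
    using le[of "axis i 1"] by (simp add: inner_axis axis_in_Basis_iff)
  ultimately have "emeasure (distr lborel borel (reindex \<sigma>)) (box l u)
      = emeasure lborel (box (reindex ?\<tau> l) (reindex ?\<tau> u))"
    by (simp add: emeasure_distr)
  also have "\<dots> = (\<Prod>b\<in>Basis. (reindex ?\<tau> u - reindex ?\<tau> l) \<bullet> b)"
    using le' by (subst emeasure_lborel_box) (auto simp: Basis_vec_def inner_axis)
  also have "(\<Prod>b\<in>Basis. (reindex ?\<tau> u - reindex ?\<tau> l) \<bullet> b) = (\<Prod>i\<in>UNIV. u $ ?\<tau> i - l $ ?\<tau> i)"
    unfolding Basis_vec_def
    by (subst prod.UNION_disjoint) (auto simp: inner_axis axis_eq_axis)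
  also have "\<dots> = (\<Prod>i\<in>UNIV. u $ i - l $ i)"
    using \<tau> by (rule prod.reindex_bij_betw)
  also have "\<dots> = (\<Prod>b\<in>Basis. (u - l) \<bullet> b)"
    unfolding Basis_vec_def
    by (subst prod.UNION_disjoint) (auto simp: inner_axis axis_eq_axis)
  finally show "emeasure (distr lborel borel (reindex \<sigma>)) (box l u) = (\<Prod>b\<in>Basis. (u - l) \<bullet> b)" .
qed simp

text \<open>
  Conjugation turns a product of transpositions into a product of equally many transpositions.
\<close>

lemma sign_conjugate:
  fixes \<sigma> :: "'b::finite \<Rightarrow> 'a::finite"
  assumes "bij \<sigma>" "p permutes UNIV"
  shows "sign (\<sigma> \<circ> p \<circ> inv \<sigma>) = sign p"
proof -
  have swap: "swapidseq n (\<sigma> \<circ> p \<circ> inv \<sigma>)" if "swapidseq n p" for n p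
    using that
  proof induction
    case id
    have eq: "\<sigma> \<circ> id \<circ> inv \<sigma> = id"
      using surj_f_inv_f[OF bij_is_surj[OF assms(1)]] by (intro ext) (simp only: comp_apply id_apply)
    show ?case unfolding eq by (rule swapidseq.id)
  next
    case (comp_Suc n p a b)
    have "\<sigma> \<circ> (Transposition.transpose a b \<circ> p) \<circ> inv \<sigma> = Transposition.transpose (\<sigma> a) (\<sigma> b) \<circ> (\<sigma> \<circ> p \<circ> inv \<sigma>)"
      using assms(1) by (auto simp: fun_eq_iff Transposition.transpose_def bij_is_inj inj_eq)
    moreover have "\<sigma> a \<noteq> \<sigma> b"
      using comp_Suc assms(1) by (simp add: bij_is_inj inj_eq)
    ultimately show ?case
      using comp_Suc by (metis swapidseq.comp_Suc)
  qed
  obtain n where n: "swapidseq n p"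
    using assms(2) permutation_permutes[of p] unfolding permutation_def by auto
  then show ?thesis
    using swap[OF n] by (metis evenperm_unique sign_def)
qed

lemma det_reindex:
  fixes A :: "real ^ 'a ^ 'a" and \<sigma> :: "'b::finite \<Rightarrow> 'a::finite"
  assumes "bij \<sigma>"
  shows "det (\<chi> i j. A $ \<sigma> i $ \<sigma> j) = det A"
proof -
  have inv [simp]: "inv \<sigma> (\<sigma> i) = i" "\<sigma> (inv \<sigma> j) = j" for i j
    using assms by (simp_all add: bij_is_inj bij_is_surj surj_f_inv_f)
  let ?c = "\<lambda>p. \<sigma> \<circ> p \<circ> inv \<sigma>"
  have bij: "bij_betw ?c {p. p permutes UNIV} {q. q permutes UNIV}"
  proof (rule bij_betw_byWitness[where f' = "\<lambda>q. inv \<sigma> \<circ> q \<circ> \<sigma>"])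
    have "bij (inv \<sigma>)" using assms by (rule bij_imp_bij_inv)
    then show "?c ` {p. p permutes UNIV} \<subseteq> {q. q permutes UNIV}"
      "(\<lambda>q. inv \<sigma> \<circ> q \<circ> \<sigma>) ` {q. q permutes UNIV} \<subseteq> {p. p permutes UNIV}"
      using assms by (auto simp: permutes_bij bij_imp_permutes intro!: bij_imp_permutes bij_comp)
  qed (auto simp: fun_eq_iff)
  have "det A = (\<Sum>q | q permutes UNIV. of_int (sign q) * (\<Prod>i\<in>UNIV. A $ i $ q i))"
    by (simp add: det_def)
  also have "\<dots> = (\<Sum>p | p permutes UNIV. of_int (sign (?c p)) * (\<Prod>i\<in>UNIV. A $ i $ ?c p i))"
    by (rule sum.reindex_bij_betw[OF bij, symmetric])
  also have "\<dots> = (\<Sum>p | p permutes UNIV. of_int (sign p) * (\<Prod>i\<in>UNIV. A $ \<sigma> i $ \<sigma> (p i)))"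
  proof (rule sum.cong[OF refl])
    fix p :: "'b \<Rightarrow> 'b" assume p: "p \<in> {p. p permutes UNIV}"
    have "(\<Prod>i\<in>UNIV. A $ i $ ?c p i) = (\<Prod>i\<in>UNIV. A $ \<sigma> i $ ?c p (\<sigma> i))"
      using assms by (rule prod.reindex_bij_betw[symmetric])
    then show "of_int (sign (?c p)) * (\<Prod>i\<in>UNIV. A $ i $ ?c p i)
        = of_int (sign p) * (\<Prod>i\<in>UNIV. A $ \<sigma> i $ \<sigma> (p i))"
      using p sign_conjugate[OF assms, of p] by simp
  qed
  also have "\<dots> = det (\<chi> i j. A $ \<sigma> i $ \<sigma> j)"
    by (simp add: det_def)
  finally show ?thesis ..
qed

text \<open>
  Translates the gauge-integral form of the change of variables into Bochner integrals with respect
  to \<open>lborel\<close>.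
\<close>

lemma absolutely_integrable_lborel_iff:
  fixes h :: "'a::euclidean_space \<Rightarrow> real"
  assumes "(\<lambda>x. indicator S x * h x) \<in> borel_measurable borel"
  shows "h absolutely_integrable_on S \<and> integral S h = b
     \<longleftrightarrow> has_bochner_integral lborel (\<lambda>x. indicator S x * h x) b"
proof -
  have eq: "h absolutely_integrable_on S \<longleftrightarrow> integrable lborel (\<lambda>x. indicator S x * h x)"
    unfolding set_integrable_def using assms by (simp add: integrable_completion)
  show ?thesis
  proof (cases "h absolutely_integrable_on S")
    case True
    have "integral S h = (LINT x:S | lebesgue. h x)"
      using set_lebesgue_integral_eq_integral(2)[OF True] by simp
    also have "\<dots> = (\<integral>x. indicator S x * h x \<partial>lborel)"
      unfolding set_lebesgue_integral_def using assms by (simp add: integral_completion)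
    finally show ?thesis using True eq by (simp add: has_bochner_integral_iff)
  qed (use eq in \<open>auto simp: has_bochner_integral_iff\<close>)
qed

lemma change_of_variables_wellorder:
  fixes g :: "real ^ 'm::{finite,wellorder} \<Rightarrow> real ^ 'm::_" and f :: "real ^ 'm::_ \<Rightarrow> real"
  assumes S: "open S" and der: "\<And>x. x \<in> S \<Longrightarrow> (g has_derivative g' x) (at x)"
    and inj: "inj_on g S"
    and ml: "(\<lambda>x. indicator S x * (\<bar>det (matrix (g' x))\<bar> * f (g x))) \<in> borel_measurable borel"
    and mr: "(\<lambda>y. indicator (g ` S) y * f y) \<in> borel_measurable borel"
  shows "has_bochner_integral lborel (\<lambda>x. indicator S x * (\<bar>det (matrix (g' x))\<bar> * f (g x))) b
     \<longleftrightarrow> has_bochner_integral lborel (\<lambda>y. indicator (g ` S) y * f y) b"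
proof -
  have S': "S \<in> sets lebesgue" using S by auto
  have "(\<lambda>x. \<bar>det (matrix (g' x))\<bar> *\<^sub>R (vec (f (g x)) :: real ^ 1)) absolutely_integrable_on S \<and>
      integral S (\<lambda>x. \<bar>det (matrix (g' x))\<bar> *\<^sub>R (vec (f (g x)) :: real ^ 1)) = vec b
    \<longleftrightarrow> (\<lambda>y. vec (f y) :: real ^ 1) absolutely_integrable_on (g ` S) \<and>
      integral (g ` S) (\<lambda>y. vec (f y) :: real ^ 1) = vec b"
    using has_derivative_at_withinI[OF der]
    by (intro has_absolute_integral_change_of_variables[OF S' _ inj]) auto
  then have "(\<lambda>x. \<bar>det (matrix (g' x))\<bar> * f (g x)) absolutely_integrable_on S \<and>
      integral S (\<lambda>x. \<bar>det (matrix (g' x))\<bar> * f (g x)) = b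
    \<longleftrightarrow> f absolutely_integrable_on (g ` S) \<and> integral (g ` S) f = b"
    unfolding absolutely_integrable_on_1_iff integral_on_1_eq integrable_on_1_iff
      absolutely_integrable_on_def set_lebesgue_integral_def
    by (auto simp: integral_on_1_eq absolutely_integrable_on_1_iff vec_eq_iff)
  then show ?thesis
    unfolding absolutely_integrable_lborel_iff[OF ml] absolutely_integrable_lborel_iff[OF mr] .
qed

lemma has_bochner_integral_reindex:
  fixes \<sigma> :: "'b::finite \<Rightarrow> 'a::finite" and f :: "real ^ 'b \<Rightarrow> real"
  assumes "bij \<sigma>" and [measurable]: "f \<in> borel_measurable borel"
  shows "has_bochner_integral lborel (\<lambda>x. f (reindex \<sigma> x)) b \<longleftrightarrow> has_bochner_integral lborel f b"
proof -
  have "has_bochner_integral (distr lborel borel (reindex \<sigma>)) f b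
      \<longleftrightarrow> has_bochner_integral lborel (\<lambda>x. f (reindex \<sigma> x)) b"
    unfolding has_bochner_integral_iff by (simp add: integrable_distr_eq integral_distr)
  then show ?thesis by (simp add: lborel_distr_reindex[OF assms(1)])
qed

text \<open>
  Conjugating \<open>g\<close> with the reindexing \<open>r\<close> reduces to the well-ordered case, since \<open>r\<close> preserves both
  Lebesgue measure and determinants.
\<close>

theorem change_of_variables:
  fixes g :: "real ^ 'n::finite \<Rightarrow> real ^ 'n" and f :: "real ^ 'n \<Rightarrow> real"
  assumes S: "open S" and der: "\<And>x. x \<in> S \<Longrightarrow> (g has_derivative g' x) (at x)"
    and inj: "inj_on g S"
    and ml: "(\<lambda>x. indicator S x * (\<bar>det (matrix (g' x))\<bar> * f (g x))) \<in> borel_measurable borel"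
    and mr: "(\<lambda>y. indicator (g ` S) y * f y) \<in> borel_measurable borel"
  shows "has_bochner_integral lborel (\<lambda>x. indicator S x * (\<bar>det (matrix (g' x))\<bar> * f (g x))) b
     \<longleftrightarrow> has_bochner_integral lborel (\<lambda>y. indicator (g ` S) y * f y) b"
proof -
  let ?\<sigma> = "Rep_ranked :: 'n ranked \<Rightarrow> 'n"
  have \<sigma>: "bij ?\<sigma>"
    by (rule bij_betw_byWitness[of _ Abs_ranked]) (auto simp: Abs_ranked_inverse Rep_ranked_inverse)
  then have \<sigma>': "bij (inv ?\<sigma>)" by (rule bij_imp_bij_inv)
  have inv [simp]: "inv ?\<sigma> (?\<sigma> i) = i" "?\<sigma> (inv ?\<sigma> j) = j" for i j
    using \<sigma> by (simp_all add: bij_is_inj bij_is_surj surj_f_inv_f)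
  define r where "r = (reindex ?\<sigma> :: real ^ 'n \<Rightarrow> real ^ ('n ranked))"
  define r' where "r' = (reindex (inv ?\<sigma>) :: real ^ ('n ranked) \<Rightarrow> real ^ 'n)"
  have [simp]: "r' (r x) = x" "r (r' y) = y" for x y
    unfolding r_def r'_def reindex_reindex by (simp_all add: comp_def)
  have r: "bounded_linear r" "bounded_linear r'"
    by (simp_all add: r_def r'_def bounded_linear_reindex)
  have r_ax: "r' (axis j 1) = axis (?\<sigma> j) 1" for j
  proof -
    have "i = ?\<sigma> j \<longleftrightarrow> inv ?\<sigma> i = j" for i by (metis inv)
    then show ?thesis by (auto simp: r'_def vec_eq_iff axis_def)
  qed
  let ?g = "r \<circ> g \<circ> r'" and ?g' = "\<lambda>y. r \<circ> g' (r' y) \<circ> r'"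
  have img: "r ` A = r' -` A" for A
    by (auto simp: image_iff) (metis \<open>\<And>y. r (r' y) = y\<close>)
  have mat: "det (matrix (?g' y)) = det (matrix (g' (r' y)))" for y
  proof -
    have "matrix (?g' y) = (\<chi> i j. matrix (g' (r' y)) $ ?\<sigma> i $ ?\<sigma> j)"
      by (simp add: vec_eq_iff matrix_def r_ax) (simp add: r_def)
    then show ?thesis by (simp add: det_reindex[OF \<sigma>])
  qed
  have gimg: "?g ` (r ` S) = r ` (g ` S)"
    by (simp add: image_comp[symmetric] image_image)
  have eq1: "(\<lambda>y. indicator (r ` S) y * (\<bar>det (matrix (?g' y))\<bar> * (f \<circ> r') (?g y)))
     = (\<lambda>y. (\<lambda>x. indicator S x * (\<bar>det (matrix (g' x))\<bar> * f (g x))) (r' y))"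
    unfolding mat by (simp add: fun_eq_iff img indicator_def)
  have eq2: "(\<lambda>y. indicator (?g ` (r ` S)) y * (f \<circ> r') y)
     = (\<lambda>y. (\<lambda>x. indicator (g ` S) x * f x) (r' y))"
    unfolding gimg by (simp add: fun_eq_iff img[of "g ` S"] indicator_def)
  have mr': "r' \<in> borel_measurable borel" unfolding r'_def by measurable
  have "has_bochner_integral lborel (\<lambda>y. indicator (r ` S) y * (\<bar>det (matrix (?g' y))\<bar> * (f \<circ> r') (?g y))) b
     \<longleftrightarrow> has_bochner_integral lborel (\<lambda>y. indicator (?g ` (r ` S)) y * (f \<circ> r') y) b"
  proof (rule change_of_variables_wellorder)
    have "continuous_on UNIV r'" using r(2) by (rule linear_continuous_on)
    then show "open (r ` S)"
      unfolding img using S by (simp add: continuous_on_open_vimage)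
    show "(?g has_derivative ?g' y) (at y)" if "y \<in> r ` S" for y
    proof -
      have "r' y \<in> S" using that by auto
      then have "(g has_derivative g' (r' y)) (at (r' y))" by (rule der)
      then have "(g \<circ> r' has_derivative g' (r' y) \<circ> r') (at y)"
        using bounded_linear_imp_has_derivative[OF r(2)] by (rule diff_chain_at[rotated])
      then have "(r \<circ> (g \<circ> r') has_derivative r \<circ> (g' (r' y) \<circ> r')) (at y)"
        using bounded_linear_imp_has_derivative[OF r(1)] by (rule diff_chain_at)
      then show ?thesis by (simp add: comp_assoc)
    qed
    show "inj_on ?g (r ` S)"
    proof (rule inj_onI)
      fix x y assume "x \<in> r ` S" "y \<in> r ` S" "?g x = ?g y"
      then obtain a b where "x = r a" "y = r b" "a \<in> S" "b \<in> S" "r (g a) = r (g b)" by auto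
      moreover from this have "g a = g b" by (metis \<open>\<And>x. r' (r x) = x\<close>)
      ultimately show "x = y" using inj by (auto dest: inj_onD)
    qed
    show "(\<lambda>y. indicator (r ` S) y * (\<bar>det (matrix (?g' y))\<bar> * (f \<circ> r') (?g y))) \<in> borel_measurable borel"
      unfolding eq1 by (rule measurable_compose[OF mr' ml])
    show "(\<lambda>y. indicator (?g ` (r ` S)) y * (f \<circ> r') y) \<in> borel_measurable borel"
      unfolding eq2 by (rule measurable_compose[OF mr' mr])
  qed
  then show ?thesis
    unfolding eq1 eq2 unfolding r'_def
    by (subst (asm) has_bochner_integral_reindex[OF \<sigma>' ml], subst (asm) has_bochner_integral_reindex[OF \<sigma>' mr])
qed

corollary nn_integral_linear_image:
  fixes T :: "real ^ 'n::finite \<Rightarrow> real ^ 'n" and f :: "real ^ 'n \<Rightarrow> real"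
  assumes T: "linear T" "inj T" and f: "\<And>x. 0 \<le> f x" "f \<in> borel_measurable borel"
    and int: "integrable lborel f"
  shows "ennreal \<bar>det (matrix T)\<bar> * (\<integral>\<^sup>+x. ennreal (f (T x)) \<partial>lborel) = (\<integral>\<^sup>+x. ennreal (f x) \<partial>lborel)"
proof -
  have bl: "bounded_linear T" using T(1) by (simp add: linear_conv_bounded_linear)
  have Tm [measurable]: "T \<in> borel_measurable borel"
    using linear_continuous_on[OF bl] by (rule borel_measurable_continuous_onI)
  note f(2) [measurable]
  have "surj T" using T by (simp add: linear_injective_imp_surjective)
  have "has_bochner_integral lborel (\<lambda>x. indicator UNIV x * (\<bar>det (matrix T)\<bar> * f (T x))) (integral\<^sup>L lborel f)
     \<longleftrightarrow> has_bochner_integral lborel (\<lambda>y. indicator (T ` UNIV) y * f y) (integral\<^sup>L lborel f)"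
    using bounded_linear_imp_has_derivative[OF bl] T(2) \<open>surj T\<close> by (intro change_of_variables) auto
  then have b: "has_bochner_integral lborel (\<lambda>x. \<bar>det (matrix T)\<bar> * f (T x)) (integral\<^sup>L lborel f)"
    using int \<open>surj T\<close> by (simp add: has_bochner_integral_integrable)
  have "ennreal \<bar>det (matrix T)\<bar> * (\<integral>\<^sup>+x. ennreal (f (T x)) \<partial>lborel)
      = (\<integral>\<^sup>+x. ennreal (\<bar>det (matrix T)\<bar> * f (T x)) \<partial>lborel)"
    using f by (subst nn_integral_cmult[symmetric]) (auto simp: ennreal_mult)
  also have "\<dots> = ennreal (integral\<^sup>L lborel f)"
    using b f by (subst nn_integral_eq_integral) (auto simp: has_bochner_integral_iff)
  also have "\<dots> = (\<integral>\<^sup>+x. ennreal (f x) \<partial>lborel)"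
    using int f by (subst nn_integral_eq_integral) auto
  finally show ?thesis .
qed

section \<open>Hausdorff measure on coordinate subspaces\<close>

lemma hausdorff_outer_mono: "A \<subseteq> B \<Longrightarrow> hausdorff_outer r A \<le> hausdorff_outer r B"
  unfolding hausdorff_outer_def by (auto intro!: SUP_mono' hausdorff_content_mono)

text \<open>
  A \<open>K\<close>-Lipschitz map multiplies the diameters in a cover by at most \<open>K\<close>, so the gauges by at most
  \<open>K ^ r\<close>. Applied to a near-isometry and its inverse, this compares Hausdorff measure on the zero set
  with Hausdorff measure on a subspace.
\<close>

lemma hausdorff_outer_Lipschitz_image:
  fixes f :: "'a::metric_space \<Rightarrow> 'b::metric_space"
  assumes K: "K > 0" and lip: "\<And>x y. x \<in> A \<Longrightarrow> y \<in> A \<Longrightarrow> dist (f x) (f y) \<le> K * dist x y"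
  shows "hausdorff_outer r (f ` A) \<le> ennreal (K ^ r) * hausdorff_outer r A"
proof -
  let ?q = "ennreal (1 / K ^ r)"
  have Kq: "ennreal (K ^ r) * ?q = 1"
    using K by (simp add: ennreal_mult[symmetric])
  have cont: "hausdorff_content \<delta> r (f ` A) \<le> ennreal (K ^ r) * hausdorff_content (\<delta> / K) r A"
    if "\<delta> > 0" for \<delta>
  proof -
    have "?q * hausdorff_content \<delta> r (f ` A) \<le> hausdorff_content (\<delta> / K) r A"
      unfolding hausdorff_content_def[of "\<delta> / K"]
    proof (rule INF_greatest)
      fix C :: "nat \<Rightarrow> 'a set"
      assume "C \<in> {C. A \<subseteq> (\<Union>i. C i) \<and> (\<forall>i. bounded (C i) \<and> diameter (C i) \<le> \<delta> / K)}"
      then have cov: "A \<subseteq> (\<Union>i. C i)" and C: "\<And>i. bounded (C i)" "\<And>i. diameter (C i) \<le> \<delta> / K"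
        by auto
      define C' where "C' i = f ` (C i \<inter> A)" for i
      have dst: "dist u v \<le> K * diameter (C i)" if uv: "u \<in> C' i" "v \<in> C' i" for u v i
      proof -
        obtain x y where xy: "x \<in> C i \<inter> A" "y \<in> C i \<inter> A" "u = f x" "v = f y"
          using uv unfolding C'_def by blast
        have "dist u v \<le> K * dist x y" using xy lip by simp
        also have "\<dots> \<le> K * diameter (C i)"
          using diameter_bounded_bound[OF C(1), of x i y] xy K by (intro mult_left_mono) auto
        finally show ?thesis .
      qed
      have bd: "bounded (C' i)" for i
        using dst[of _ i] by (auto simp: bounded_two_points)
      have diam: "diameter (C' i) \<le> K * diameter (C i)" for i
        using dst[of _ i] K diameter_ge_0[OF C(1), of i]
        by (auto simp: diameter_def[of "C' i"] intro!: cSUP_least)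
      have gauge: "hausdorff_gauge r (C' i) \<le> ennreal (K ^ r) * hausdorff_gauge r (C i)" for i
      proof (cases "C' i = {}")
        case False
        then have ne: "C i \<noteq> {}" by (auto simp: C'_def)
        have "unit_ball_vol (real r) * (diameter (C' i) / 2) ^ r
            \<le> unit_ball_vol (real r) * (K * diameter (C i) / 2) ^ r"
          using diam[of i] diameter_ge_0[OF bd, of i]
          by (intro mult_left_mono power_mono) auto
        also have "\<dots> = K ^ r * (unit_ball_vol (real r) * (diameter (C i) / 2) ^ r)"
          by (simp add: power_mult_distrib power_divide)
        finally show ?thesis
          using False ne K diameter_ge_0[OF C(1), of i]
          by (simp add: hausdorff_gauge_def ennreal_mult[symmetric] ennreal_leI)
      qed (simp add: hausdorff_gauge_def)
      have "hausdorff_content \<delta> r (f ` A) \<le> (\<Sum>i. hausdorff_gauge r (C' i))"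
        unfolding hausdorff_content_def
      proof (rule INF_lower, rule CollectI, intro conjI allI)
        show "f ` A \<subseteq> (\<Union>i. C' i)" using cov by (fastforce simp: C'_def)
        show "diameter (C' i) \<le> \<delta>" for i
          using diam[of i] C(2)[of i] K by (auto simp: field_simps intro: order_trans)
      qed (rule bd)
      also have "\<dots> \<le> (\<Sum>i. ennreal (K ^ r) * hausdorff_gauge r (C i))"
        by (intro suminf_le gauge summableI)
      also have "\<dots> = ennreal (K ^ r) * (\<Sum>i. hausdorff_gauge r (C i))" by simp
      finally have "?q * hausdorff_content \<delta> r (f ` A)
          \<le> ?q * (ennreal (K ^ r) * (\<Sum>i. hausdorff_gauge r (C i)))"
        by (rule mult_left_mono) simp
      then show "?q * hausdorff_content \<delta> r (f ` A) \<le> (\<Sum>i. hausdorff_gauge r (C i))"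
        using Kq by (simp add: mult.assoc[symmetric] mult.commute[of ?q])
    qed
    then have "ennreal (K ^ r) * (?q * hausdorff_content \<delta> r (f ` A))
        \<le> ennreal (K ^ r) * hausdorff_content (\<delta> / K) r A"
      by (rule mult_left_mono) simp
    then show ?thesis by (simp add: mult.assoc[symmetric] Kq)
  qed
  show ?thesis
    unfolding hausdorff_outer_def[of r "f ` A"]
  proof (rule SUP_least)
    fix \<delta> :: real assume "\<delta> \<in> {0<..}"
    then have "hausdorff_content (\<delta> / K) r A \<le> hausdorff_outer r A"
      using K by (intro hausdorff_content_le_outer) auto
    then show "hausdorff_content \<delta> r (f ` A) \<le> ennreal (K ^ r) * hausdorff_outer r A"
      using cont[of \<delta>] \<open>\<delta> \<in> {0<..}\<close> by (intro order_trans[OF cont mult_left_mono]) auto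
  qed
qed

lemma hausdorff_content_finite_cover:
  fixes Q :: "'i \<Rightarrow> 'a::metric_space set"
  assumes "finite I" "A \<subseteq> (\<Union>i\<in>I. Q i)" "\<delta> > 0"
    and "\<And>i. i \<in> I \<Longrightarrow> bounded (Q i)" "\<And>i. i \<in> I \<Longrightarrow> diameter (Q i) \<le> \<delta>"
  shows "hausdorff_content \<delta> r A \<le> (\<Sum>i\<in>I. hausdorff_gauge r (Q i))"
proof -
  obtain e where e: "bij_betw e {0..<card I} I"
    using ex_bij_betw_nat_finite[OF assms(1)] by auto
  define C where "C j = (if j < card I then Q (e j) else {})" for j
  have "hausdorff_content \<delta> r A \<le> (\<Sum>j. hausdorff_gauge r (C j))"
    unfolding hausdorff_content_def
  proof (rule INF_lower, rule CollectI, intro conjI allI)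
    show "A \<subseteq> (\<Union>j. C j)"
    proof
      fix x assume "x \<in> A"
      then obtain i where "i \<in> I" "x \<in> Q i" using assms(2) by auto
      moreover from this obtain j where "j < card I" "e j = i"
        using e unfolding bij_betw_def by (metis atLeastLessThan_iff imageE)
      ultimately show "x \<in> (\<Union>j. C j)" by (auto simp: C_def)
    qed
    show "bounded (C j)" "diameter (C j) \<le> \<delta>" for j
      using assms bij_betwE[OF e] by (auto simp: C_def)
  qed
  also have "\<dots> = (\<Sum>j\<in>{0..<card I}. hausdorff_gauge r (C j))"
    by (intro suminf_finite) (auto simp: C_def hausdorff_gauge_def)
  also have "\<dots> = (\<Sum>j\<in>{0..<card I}. hausdorff_gauge r (Q (e j)))"
    by (intro sum.cong) (auto simp: C_def)
  also have "\<dots> = (\<Sum>i\<in>I. hausdorff_gauge r (Q i))"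
    using e by (rule sum.reindex_bij_betw)
  finally show ?thesis .
qed

text \<open>
  An injection \<open>\<iota>\<close> selects the transverse coordinates: \<open>coord_embed \<iota>\<close> places a vector there,
  \<open>coord_part \<iota>\<close> reads them off, and \<open>flat \<iota>\<close> is the orthogonal complement of the range of the
  embedding.
\<close>

definition coord_embed :: "('p::finite \<Rightarrow> 'd::finite) \<Rightarrow> real ^ 'p \<Rightarrow> real ^ 'd" where
  "coord_embed \<iota> w = (\<chi> i. if i \<in> range \<iota> then w $ inv \<iota> i else 0)"

definition coord_part :: "('p::finite \<Rightarrow> 'd::finite) \<Rightarrow> real ^ 'd \<Rightarrow> real ^ 'p" where
  "coord_part \<iota> x = (\<chi> j. x $ \<iota> j)"

definition flat :: "('p::finite \<Rightarrow> 'd::finite) \<Rightarrow> (real ^ 'd) set" where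
  "flat \<iota> = {x. coord_part \<iota> x = 0}"

lemma coord_part_nth [simp]: "coord_part \<iota> x $ j = x $ \<iota> j"
  by (simp add: coord_part_def)

lemma linear_coord_part: "linear (coord_part \<iota>)"
  by (rule linearI) (auto simp: vec_eq_iff)

lemma linear_coord_embed: "linear (coord_embed \<iota>)"
  by (rule linearI) (auto simp: vec_eq_iff coord_embed_def)

lemma bounded_linear_coord [simp]:
  "bounded_linear (coord_part \<iota> :: real ^ 'd \<Rightarrow> real ^ 'p)"
  "bounded_linear (coord_embed \<iota> :: real ^ 'p \<Rightarrow> real ^ 'd)"
  by (simp_all add: linear_conv_bounded_linear[symmetric] linear_coord_part linear_coord_embed)

lemma measurable_coord [measurable]:
  "(coord_part \<iota> :: real ^ 'd \<Rightarrow> real ^ 'p) \<in> borel_measurable borel"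
  "(coord_embed \<iota> :: real ^ 'p \<Rightarrow> real ^ 'd) \<in> borel_measurable borel"
  by (intro borel_measurable_continuous_onI linear_continuous_on bounded_linear_coord)+

lemmas coord_linear_simps =
  linear_add[OF linear_coord_part] linear_diff[OF linear_coord_part] linear_0[OF linear_coord_part]
  linear_add[OF linear_coord_embed] linear_diff[OF linear_coord_embed] linear_0[OF linear_coord_embed]

lemma coord_part_embed [simp]: "inj \<iota> \<Longrightarrow> coord_part \<iota> (coord_embed \<iota> w) = w"
  by (simp add: vec_eq_iff coord_embed_def)

lemma flat_decompose: "inj \<iota> \<Longrightarrow> x - coord_embed \<iota> (coord_part \<iota> x) \<in> flat \<iota>"
  by (simp add: flat_def coord_linear_simps)

lemma coord_part_add_embed: "inj \<iota> \<Longrightarrow> t \<in> flat \<iota> \<Longrightarrow> coord_part \<iota> (t + coord_embed \<iota> w) = w"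
  by (simp add: flat_def coord_linear_simps)

lemma inner_coord_embed:
  assumes "inj \<iota>"
  shows "inner x (coord_embed \<iota> w) = inner (coord_part \<iota> x) w"
proof -
  have "inner x (coord_embed \<iota> w) = (\<Sum>i\<in>range \<iota>. x $ i * w $ inv \<iota> i)"
    unfolding inner_vec_def coord_embed_def
    by (intro sum.mono_neutral_cong_right) auto
  also have "\<dots> = (\<Sum>j\<in>UNIV. x $ \<iota> j * w $ j)"
    using assms by (subst sum.reindex) auto
  finally show ?thesis by (simp add: inner_vec_def)
qed

lemma norm_coord_embed [simp]: "inj \<iota> \<Longrightarrow> norm (coord_embed \<iota> w) = norm w"
  by (simp add: norm_eq_sqrt_inner inner_coord_embed)

lemma norm_flat_add_embed:
  assumes "inj \<iota>" "t \<in> flat \<iota>"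
  shows "(norm (t + coord_embed \<iota> w))\<^sup>2 = (norm t)\<^sup>2 + (norm w)\<^sup>2"
proof -
  have "inner t (coord_embed \<iota> w) = 0"
    using assms by (simp add: inner_coord_embed flat_def)
  then have "(norm (t + coord_embed \<iota> w))\<^sup>2 = (norm t)\<^sup>2 + (norm (coord_embed \<iota> w))\<^sup>2"
    by (simp add: norm_add_Pythagorean orthogonal_def)
  then show ?thesis using assms(1) by simp
qed

lemma closed_flat: "closed (flat \<iota> :: (real ^ 'd) set)"
  unfolding flat_def by (intro closed_Collect_eq linear_continuous_on bounded_linear_coord) auto

lemma flat_borel [measurable]: "(flat \<iota> :: (real ^ 'd) set) \<in> sets borel"
  by (intro borel_closed closed_flat)

lemma flat_add: "s \<in> flat \<iota> \<Longrightarrow> t \<in> flat \<iota> \<Longrightarrow> s + t \<in> flat \<iota>"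
  and flat_diff: "s \<in> flat \<iota> \<Longrightarrow> t \<in> flat \<iota> \<Longrightarrow> s - t \<in> flat \<iota>"
  by (simp_all add: flat_def coord_linear_simps)

lemma card_complement_range:
  assumes "inj (\<iota> :: 'p::finite \<Rightarrow> 'd::finite)"
  shows "card (- range \<iota>) = CARD('d) - CARD('p)"
  using assms by (simp add: Compl_eq_Diff_UNIV card_Diff_subset card_image)

text \<open>
  Cutting the cube into \<open>m ^ n\<close> cells of side \<open>2 * N / m\<close> gives arbitrarily fine covers whose total
  gauge is bounded independently of \<open>m\<close>.
\<close>

lemma hausdorff_outer_flat_cbox_finite:
  fixes \<iota> :: "'p::finite \<Rightarrow> 'd::finite"
  assumes \<iota>: "inj \<iota>" and n: "n = CARD('d) - CARD('p)" and "N > 0"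
  shows "hausdorff_outer n (flat \<iota> \<inter> cbox (\<chi> i. - N) (\<chi> i. N)) < \<infinity>"
proof -
  let ?B = "flat \<iota> \<inter> cbox (\<chi> i. - N) (\<chi> i. N)"
  let ?K = "unit_ball_vol (real n) * (real CARD('d) * N) ^ n"
  have "hausdorff_content \<delta> n ?B \<le> ennreal ?K" if "\<delta> > 0" for \<delta>
  proof -
    obtain m :: nat where m: "real CARD('d) * (2 * N) / \<delta> < real m" using reals_Archimedean2 by blast
    have m0: "m > 0" using m that \<open>N > 0\<close>
      by (metis gr0I less_eq_real_def not_less of_nat_0 of_nat_0_le_iff zero_le_divide_iff zero_le_mult_iff zero_le_numeral)
    define s where "s = 2 * N / real m"
    have s: "s > 0" "real CARD('d) * s \<le> \<delta>"
      using m that m0 \<open>N > 0\<close> by (auto simp: s_def field_simps)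
    let ?I = "PiE (- range \<iota>) (\<lambda>_. {..<m})"
    define Q where "Q f = {x \<in> flat \<iota>. \<forall>i\<in>- range \<iota>. - N + s * real (f i) \<le> x $ i \<and> x $ i \<le> - N + s * real (f i) + s}"
      for f :: "'d \<Rightarrow> nat"
    have dQ: "dist x y \<le> real CARD('d) * s" if "x \<in> Q f" "y \<in> Q f" for x y f
    proof -
      have "norm (x - y) \<le> (\<Sum>i\<in>UNIV. \<bar>(x - y) $ i\<bar>)" by (rule norm_le_l1_cart)
      also have "\<dots> \<le> (\<Sum>i\<in>(UNIV :: 'd set). s)"
      proof (rule sum_mono)
        fix i show "\<bar>(x - y) $ i\<bar> \<le> s"
        proof (cases "i \<in> range \<iota>")
          case True
          then obtain j where "i = \<iota> j" by auto
          then have "x $ i = 0" "y $ i = 0"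
            using that by (auto simp: Q_def flat_def vec_eq_iff)
          then show ?thesis using s by simp
        next
          case False
          then have "- N + s * real (f i) \<le> x $ i" "x $ i \<le> - N + s * real (f i) + s"
            "- N + s * real (f i) \<le> y $ i" "y $ i \<le> - N + s * real (f i) + s"
            using that by (auto simp: Q_def)
          then show ?thesis by (simp add: abs_le_iff)
        qed
      qed
      finally show ?thesis by (simp add: dist_norm)
    qed
    have bQ: "bounded (Q f)" for f
      using dQ[of _ f] by (auto simp: bounded_two_points)
    have diam: "diameter (Q f) \<le> real CARD('d) * s" for f
      using dQ[of _ f] s by (intro diameter_le) (auto simp: dist_norm)
    have "?B \<subseteq> (\<Union>f\<in>?I. Q f)"
    proof
      fix x assume x: "x \<in> ?B"
      then have xN: "- N \<le> x $ i" "x $ i \<le> N" for i by (auto simp: mem_box_cart)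
      \<comment> \<open>the cell index; the minimum puts the right end point into the last cell\<close>
      define f where "f = restrict (\<lambda>i. min (m - 1) (nat \<lfloor>(x $ i + N) / s\<rfloor>)) (- range \<iota>)"
      have "f \<in> ?I" using m0 by (auto simp: f_def)
      moreover have "x \<in> Q f"
        unfolding Q_def
      proof (rule CollectI, intro conjI ballI)
        show "x \<in> flat \<iota>" using x by simp
        fix i assume i: "i \<in> - range \<iota>"
        let ?y = "(x $ i + N) / s"
        have "x $ i + N \<le> s * real m" using xN[of i] m0 by (simp add: s_def)
        then have y: "0 \<le> ?y" "?y \<le> real m"
          using xN[of i] s by (simp_all add: pos_divide_le_eq mult.commute)
        have fi: "f i = min (m - 1) (nat \<lfloor>?y\<rfloor>)" using i by (simp add: f_def)
        have fl: "real (nat \<lfloor>?y\<rfloor>) \<le> ?y" "?y \<le> real (nat \<lfloor>?y\<rfloor>) + 1" 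
          using y(1) of_int_floor_le[of ?y] real_of_int_floor_add_one_ge[of ?y] by (simp_all only: of_nat_nat zero_le_floor)
        have "real (f i) \<le> ?y"
          by (rule order_trans[OF _ fl(1)]) (simp add: fi)
        moreover have "?y \<le> real (f i) + 1"
        proof (cases "nat \<lfloor>?y\<rfloor> \<le> m - 1")
          case True
          then show ?thesis using fl(2) by (simp add: fi min_absorb2)
        next
          case False
          then have "real (f i) + 1 = real m" using m0 by (simp add: fi)
          then show ?thesis using y(2) by simp
        qed
        ultimately show "- N + s * real (f i) \<le> x $ i" "x $ i \<le> - N + s * real (f i) + s"
          using s by (simp_all add: field_simps)
      qed
      ultimately show "x \<in> (\<Union>f\<in>?I. Q f)" by blast
    qed
    then have "hausdorff_content \<delta> n ?B \<le> (\<Sum>f\<in>?I. hausdorff_gauge n (Q f))"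
      by (intro hausdorff_content_finite_cover[OF _ _ that bQ order_trans[OF diam s(2)]] finite_PiE) simp_all
    also have "\<dots> \<le> (\<Sum>f\<in>?I. ennreal (unit_ball_vol (real n) * (real CARD('d) * s / 2) ^ n))"
      using diam diameter_ge_0[OF bQ]
      by (intro sum_mono) (auto simp: hausdorff_gauge_def intro!: ennreal_leI mult_left_mono power_mono)
    also have "\<dots> = of_nat (m ^ n) * ennreal (unit_ball_vol (real n) * (real CARD('d) * s / 2) ^ n)"
      by (simp add: card_PiE card_complement_range[OF \<iota>] n)
    also have "\<dots> = ennreal (real (m ^ n) * (unit_ball_vol (real n) * (real CARD('d) * s / 2) ^ n))"
      using s by (subst ennreal_mult) (auto simp: ennreal_of_nat_eq_real_of_nat)
    also have "real (m ^ n) * (unit_ball_vol (real n) * (real CARD('d) * s / 2) ^ n) = ?K"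
      using m0 by (simp add: s_def power_mult_distrib power_divide)
    finally show ?thesis .
  qed
  then have "hausdorff_outer n ?B \<le> ennreal ?K"
    unfolding hausdorff_outer_def by (intro SUP_least) auto
  then show ?thesis by (simp add: le_less_trans)
qed

lemma emeasure_lborel_cbox_content:
  "emeasure lborel (cbox a b) = ennreal (measure lborel (cbox a b))"
  using emeasure_lborel_cbox_finite[of a b] by (intro emeasure_eq_ennreal_measure) auto

lemma emeasure_lborel_unit_cbox: "emeasure lborel (cbox 0 1 :: (real ^ 'd) set) = 1"
  unfolding emeasure_lborel_cbox_content
  by (subst content_cbox_cart) (auto simp: interval_eq_empty_cart)

text \<open>
  A cover of the flat unit cube by sets of small gauge would, after thickening each set to a box with
  unit sides in the transverse directions, cover the full unit cube by boxes of small volume. The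
  boxes have volume \<open>(2 * diameter) ^ n\<close>, a fixed multiple \<open>?c\<close> of the gauge, so the total gauge of
  every cover is at least \<open>1 / ?c\<close>.
\<close>

lemma hausdorff_outer_flat_unit_pos:
  fixes \<iota> :: "'p::finite \<Rightarrow> 'd::finite"
  assumes \<iota>: "inj \<iota>" and n: "n = CARD('d) - CARD('p)"
  shows "hausdorff_outer n (flat \<iota> \<inter> cbox 0 1) > 0"
proof -
  let ?B = "flat \<iota> \<inter> cbox 0 1"
  \<comment> \<open>ratio of the box volume \<open>(2 * diameter) ^ n\<close> to the gauge \<open>unit_ball_vol n * (diameter / 2) ^ n\<close>\<close>
  let ?c = "4 ^ n / unit_ball_vol (real n)"
  have u: "unit_ball_vol (real n) \<noteq> 0" using unit_ball_vol_pos[of "real n"] by linarith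
  have c: "?c > 0" by simp
  have cc: "ennreal (1 / ?c) * ennreal ?c = 1"
    using c u by (simp add: ennreal_mult[symmetric])
  have "1 \<le> ennreal ?c * hausdorff_content 1 n ?B"
  proof -
    have "ennreal (1 / ?c) \<le> hausdorff_content 1 n ?B"
      unfolding hausdorff_content_def
    proof (rule INF_greatest)
      fix C :: "nat \<Rightarrow> (real ^ 'd) set"
      assume "C \<in> {C. ?B \<subseteq> (\<Union>i. C i) \<and> (\<forall>i. bounded (C i) \<and> diameter (C i) \<le> 1)}"
      then have cov: "?B \<subseteq> (\<Union>i. C i)" and C: "\<And>i. bounded (C i)" by auto
      define x where "x k = (SOME y. y \<in> C k)" for k
      define b where "b k = (if C k = {} then {} else
         cbox (\<chi> i. if i \<in> range \<iota> then 0 else x k $ i - diameter (C k))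
              (\<chi> i. if i \<in> range \<iota> then 1 else x k $ i + diameter (C k)))" for k
      have bC: "emeasure lborel (b k) \<le> ennreal ?c * hausdorff_gauge n (C k)" for k
      proof (cases "C k = {}")
        case False
        note d0 = diameter_ge_0[OF C, of k]
        have "emeasure lborel (b k) = ennreal (measure lborel (b k))"
          unfolding b_def if_not_P[OF False] by (rule emeasure_lborel_cbox_content)
        also have "measure lborel (b k) = (\<Prod>i\<in>UNIV. if i \<in> range \<iota> then 1 else 2 * diameter (C k))"
        proof -
          have ne: "b k \<noteq> {}" using False d0 by (auto simp: b_def interval_eq_empty_cart not_less split: if_splits) 
          have "measure lborel (b k) = (\<Prod>i\<in>UNIV.
              (\<chi> i. if i \<in> range \<iota> then 1 else x k $ i + diameter (C k)) $ i
            - (\<chi> i. if i \<in> range \<iota> then 0 else x k $ i - diameter (C k)) $ i)"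
            using ne unfolding b_def if_not_P[OF False] by (rule content_cbox_cart)
          also have "\<dots> = (\<Prod>i\<in>UNIV. if i \<in> range \<iota> then 1 else 2 * diameter (C k))"
            by (intro prod.cong) auto
          finally show ?thesis .
        qed
        also have "\<dots> = (2 * diameter (C k)) ^ n"
          by (subst prod.If_cases) (simp_all add: card_complement_range[OF \<iota>] n[symmetric] Compl_eq[symmetric])
        also have "\<dots> = (4 * (diameter (C k) / 2)) ^ n" by simp
        also have "\<dots> = ?c * (unit_ball_vol (real n) * (diameter (C k) / 2) ^ n)"
          unfolding power_mult_distrib[of 4] using u by simp
        finally show ?thesis
          using False d0 c by (simp add: hausdorff_gauge_def ennreal_mult[symmetric])
      qed (simp add: b_def)
      have "cbox 0 1 \<subseteq> (\<Union>k. b k)"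
      proof
        fix y :: "real ^ 'd" assume y: "y \<in> cbox 0 1"
        \<comment> \<open>the set covering the projection of \<open>y\<close> to the flat yields the box containing \<open>y\<close>\<close>
        define t where "t = y - coord_embed \<iota> (coord_part \<iota> y)"
        have tf: "t \<in> flat \<iota>" unfolding t_def by (rule flat_decompose[OF \<iota>])
        have ti: "t $ i = (if i \<in> range \<iota> then 0 else y $ i)" for i
          using \<iota> by (auto simp: t_def coord_embed_def)
        have "t \<in> ?B" using tf y by (auto simp: mem_box_cart ti)
        then obtain k where k: "t \<in> C k" using cov by auto
        then have xk: "x k \<in> C k" unfolding x_def by (rule someI)
        have "\<bar>t $ i - x k $ i\<bar> \<le> diameter (C k)" for i
          using component_le_norm_cart[of "t - x k" i] diameter_bounded_bound[OF C k xk]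
          by (simp add: dist_norm)
        then have "y \<in> b k"
          using k y ti by (auto simp: b_def mem_box_cart abs_le_iff) (smt (verit))+
        then show "y \<in> (\<Union>k. b k)" by blast
      qed
      moreover have "b k \<in> sets lborel" for k by (simp add: b_def)
      ultimately have "emeasure lborel (cbox 0 1 :: (real ^ 'd) set) \<le> (\<Sum>k. emeasure lborel (b k))"
        by (intro order_trans[OF emeasure_mono emeasure_subadditive_countably]) auto
      also have "\<dots> \<le> (\<Sum>k. ennreal ?c * hausdorff_gauge n (C k))"
        by (intro suminf_le bC summableI)
      also have "\<dots> = ennreal ?c * (\<Sum>k. hausdorff_gauge n (C k))" by simp
      also have "emeasure lborel (cbox 0 1 :: (real ^ 'd) set) = 1"
        by (rule emeasure_lborel_unit_cbox)
      finally have "ennreal (1 / ?c) * 1 \<le> ennreal (1 / ?c) * (ennreal ?c * (\<Sum>k. hausdorff_gauge n (C k)))"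
        by (rule mult_left_mono) simp
      also have "\<dots> = (\<Sum>k. hausdorff_gauge n (C k))"
        by (simp only: mult.assoc[symmetric] cc mult_1_left)
      finally show "ennreal (1 / ?c) \<le> (\<Sum>k. hausdorff_gauge n (C k))" by (simp only: mult_1_right)
    qed
    then have "ennreal ?c * ennreal (1 / ?c) \<le> ennreal ?c * hausdorff_content 1 n ?B"
      by (rule mult_left_mono) simp
    then show ?thesis by (simp only: cc mult.commute[of "ennreal ?c" "ennreal (1 / ?c)"])
  qed
  then have "hausdorff_content 1 n ?B \<noteq> 0" by auto
  then show ?thesis
    using hausdorff_content_le_outer[of 1 n ?B] by (auto simp: zero_less_iff_neq_zero)
qed

section \<open>Lebesgue measure as a product over a coordinate subspace\<close>

text \<open>
  Hausdorff measure on the flat, as a measure on the ambient space.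
\<close>

definition flat_measure :: "('p::finite \<Rightarrow> 'd::finite) \<Rightarrow> (real ^ 'd) measure" where
  "flat_measure \<iota> = density (hausdorff_measure (CARD('d) - CARD('p))) (indicator (flat \<iota>))"

lemma sets_flat_measure [simp, measurable_cong]: "sets (flat_measure \<iota>) = sets borel"
  by (simp add: flat_measure_def)

lemma space_flat_measure [simp]: "space (flat_measure \<iota>) = UNIV"
  by (simp add: flat_measure_def)

lemma AE_flat_measure: "AE t in flat_measure \<iota>. t \<in> flat \<iota>"
  unfolding flat_measure_def by (subst AE_density) (auto simp: indicator_def intro!: AE_I2)

lemma emeasure_flat_measure:
  fixes \<iota> :: "'p::finite \<Rightarrow> 'd::finite"
  assumes "A \<in> sets borel"
  shows "emeasure (flat_measure \<iota>) A = hausdorff_outer (CARD('d) - CARD('p)) (flat \<iota> \<inter> A)"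
  using assms unfolding flat_measure_def
  by (subst emeasure_density)
     (auto simp: indicator_inter_arith[symmetric] nn_integral_indicator emeasure_hausdorff_measure)

lemma distr_flat_measure_translate:
  fixes \<iota> :: "'p::finite \<Rightarrow> 'd::finite"
  assumes s: "s \<in> flat \<iota>"
  shows "distr (flat_measure \<iota>) borel ((+) s) = flat_measure \<iota>"
proof (rule measure_eqI)
  fix A assume "A \<in> sets (distr (flat_measure \<iota>) borel ((+) s))"
  then have A [measurable]: "A \<in> sets borel" by simp
  let ?n = "CARD('d) - CARD('p)"
  let ?A' = "(+) s -` A"
  have A' [measurable]: "?A' \<in> sets borel"
    using measurable_sets[of "(+) s" borel borel A] by simp
  have img: "(+) s ` (flat \<iota> \<inter> ?A') = flat \<iota> \<inter> A"
  proof (intro equalityI subsetI)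
    fix y assume "y \<in> flat \<iota> \<inter> A"
    then show "y \<in> (+) s ` (flat \<iota> \<inter> ?A')"
      using s by (intro image_eqI[of _ _ "y - s"]) (auto intro: flat_diff)
  qed (use s in \<open>auto intro: flat_add\<close>)
  have img': "(\<lambda>x. x - s) ` (flat \<iota> \<inter> A) = flat \<iota> \<inter> ?A'"
    unfolding img[symmetric] by (auto simp: image_image)
  have "hausdorff_outer ?n (flat \<iota> \<inter> A) \<le> hausdorff_outer ?n (flat \<iota> \<inter> ?A')"
    using hausdorff_outer_Lipschitz_image[of 1 "flat \<iota> \<inter> ?A'" "(+) s" ?n] by (simp add: img)
  moreover have "hausdorff_outer ?n (flat \<iota> \<inter> ?A') \<le> hausdorff_outer ?n (flat \<iota> \<inter> A)"
    using hausdorff_outer_Lipschitz_image[of 1 "flat \<iota> \<inter> A" "\<lambda>x. x - s" ?n]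
    by (simp only: img') (simp add: dist_norm)
  ultimately show "emeasure (distr (flat_measure \<iota>) borel ((+) s)) A = emeasure (flat_measure \<iota>) A"
    by (simp add: emeasure_distr emeasure_flat_measure)
qed simp

lemma nn_integral_flat_translate:
  assumes "s \<in> flat \<iota>" "f \<in> borel_measurable borel"
  shows "(\<integral>\<^sup>+t. f (s + t) \<partial>flat_measure \<iota>) = (\<integral>\<^sup>+t. f t \<partial>flat_measure \<iota>)"
  using assms(2) by (subst (2) distr_flat_measure_translate[OF assms(1), symmetric]) (simp add: nn_integral_distr)

lemma nn_integral_lborel_affine:
  fixes f :: "'a::euclidean_space \<Rightarrow> ennreal"
  assumes [measurable]: "f \<in> borel_measurable borel" and "c \<noteq> 0"
  shows "(\<integral>\<^sup>+x. f x \<partial>lborel) = ennreal (\<bar>c\<bar> ^ DIM('a)) * (\<integral>\<^sup>+x. f (a + c *\<^sub>R x) \<partial>lborel)"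
  by (subst lborel_affine[OF assms(2), of a])
     (simp add: nn_integral_density nn_integral_distr nn_integral_cmult)

lemma flat_measure_bounded_finite:
  fixes \<iota> :: "'p::finite \<Rightarrow> 'd::finite"
  assumes "inj \<iota>" "bounded A" "A \<in> sets borel"
  shows "emeasure (flat_measure \<iota>) A < \<infinity>"
proof -
  obtain N where N: "\<And>x. x \<in> A \<Longrightarrow> norm x \<le> N" "N > 0" using assms(2) bounded_pos by blast
  have "A \<subseteq> cbox (\<chi> i. - N) (\<chi> i. N)"
  proof
    fix x assume "x \<in> A"
    then have "\<bar>x $ i\<bar> \<le> N" for i
      using component_le_norm_cart[of x i] N(1) by (meson order_trans)
    then show "x \<in> cbox (\<chi> i. - N) (\<chi> i. N)" by (simp add: mem_box_cart abs_le_iff) (smt (verit))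
  qed
  then have "flat \<iota> \<inter> A \<subseteq> flat \<iota> \<inter> cbox (\<chi> i. - N) (\<chi> i. N)" by blast
  then have "hausdorff_outer (CARD('d) - CARD('p)) (flat \<iota> \<inter> A) < \<infinity>"
    using hausdorff_outer_flat_cbox_finite[OF assms(1) refl N(2)]
    by (rule le_less_trans[OF hausdorff_outer_mono])
  then show ?thesis by (simp add: emeasure_flat_measure assms(3))
qed

lemma sigma_finite_flat_measure:
  assumes "inj \<iota>"
  shows "sigma_finite_measure (flat_measure \<iota>)"
proof
  show "\<exists>A. countable A \<and> A \<subseteq> sets (flat_measure \<iota>) \<and> \<Union> A = space (flat_measure \<iota>) \<and>
      (\<forall>a\<in>A. emeasure (flat_measure \<iota>) a \<noteq> \<infinity>)"
  proof (intro exI[of _ "range (\<lambda>k::nat. ball 0 (real k))"] conjI ballI)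
    show "\<Union> (range (\<lambda>k::nat. ball 0 (real k))) = space (flat_measure \<iota>)"
      using reals_Archimedean2 by auto
    fix a assume "a \<in> range (\<lambda>k::nat. ball (0::real ^ 'b) (real k))"
    then have "emeasure (flat_measure \<iota>) a < \<infinity>"
      by (intro flat_measure_bounded_finite[OF assms]) auto
    then show "emeasure (flat_measure \<iota>) a \<noteq> \<infinity>" by simp
  qed auto
qed

text \<open>
  The constant relating Hausdorff measure on the flat to Lebesgue measure. It enters the constant \<open>c\<close> of
  the Laplace expansion and cancels from the normalised integrals.
\<close>

definition flat_unit :: "('p::finite \<Rightarrow> 'd::finite) \<Rightarrow> ennreal" where
  "flat_unit \<iota> = emeasure (flat_measure \<iota>) (cbox 0 1)"

lemma flat_unit_pos: "inj \<iota> \<Longrightarrow> 0 < flat_unit \<iota>"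
  and flat_unit_finite: "inj \<iota> \<Longrightarrow> flat_unit \<iota> < \<infinity>"
  unfolding flat_unit_def
  using hausdorff_outer_flat_unit_pos[of \<iota>, OF _ refl] flat_measure_bounded_finite[of \<iota> "cbox 0 1"]
  by (simp_all add: emeasure_flat_measure bounded_cbox)

text \<open>
  Both sides are integrals against translation-invariant measures on \<open>real ^ 'd\<close>, and such measures are
  proportional. The proportionality is the usual Fubini argument: integrate
  \<open>f y * indicator B (x + y)\<close> in both orders over \<open>x\<close> (Lebesgue) and \<open>y\<close> (the product measure), using
  translation invariance of the product measure and then invariance of Lebesgue measure under
  \<open>x \<mapsto> y - x\<close>. Here \<open>B\<close> is the unit cube, whose product mass is \<open>flat_unit \<iota>\<close>.
\<close>

lemma nn_integral_flat_decompose: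
  fixes \<iota> :: "'p::finite \<Rightarrow> 'd::finite" and f :: "real ^ 'd \<Rightarrow> ennreal"
  assumes \<iota>: "inj \<iota>" and f [measurable]: "f \<in> borel_measurable borel"
  shows "(\<integral>\<^sup>+w. \<integral>\<^sup>+t. f (t + coord_embed \<iota> w) \<partial>flat_measure \<iota> \<partial>lborel) = flat_unit \<iota> * (\<integral>\<^sup>+x. f x \<partial>lborel)"
proof -
  interpret F: sigma_finite_measure "flat_measure \<iota>" by (rule sigma_finite_flat_measure[OF \<iota>])
  interpret FL: pair_sigma_finite "flat_measure \<iota>" "lborel :: (real ^ 'p) measure" ..
  let ?P = "flat_measure \<iota> \<Otimes>\<^sub>M (lborel :: (real ^ 'p) measure)"
  interpret P: sigma_finite_measure ?P by (rule sigma_finite_pair_measure) unfold_locales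
  interpret PL: pair_sigma_finite ?P "lborel :: (real ^ 'd) measure" ..
  define s where "s q = fst q + coord_embed \<iota> (snd q)" for q
  have s [measurable]: "s \<in> borel_measurable ?P"
    unfolding s_def by measurable
  have iter: "(\<integral>\<^sup>+w. \<integral>\<^sup>+t. h (t + coord_embed \<iota> w) \<partial>flat_measure \<iota> \<partial>lborel) = (\<integral>\<^sup>+q. h (s q) \<partial>?P)"
    if [measurable]: "h \<in> borel_measurable borel" for h :: "real ^ 'd \<Rightarrow> ennreal"
    using FL.nn_integral_snd[of "\<lambda>q. h (s q)"] by (simp add: s_def)
  have inv: "(\<integral>\<^sup>+q. h (s q + x) \<partial>?P) = (\<integral>\<^sup>+q. h (s q) \<partial>?P)"
    if [measurable]: "h \<in> borel_measurable borel" for h :: "real ^ 'd \<Rightarrow> ennreal" and x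
  proof -
    let ?xT = "x - coord_embed \<iota> (coord_part \<iota> x)" and ?xw = "coord_part \<iota> x"
    have "(\<integral>\<^sup>+q. h (s q + x) \<partial>?P) = (\<integral>\<^sup>+w. \<integral>\<^sup>+t. h (t + coord_embed \<iota> w + x) \<partial>flat_measure \<iota> \<partial>lborel)"
      by (subst iter[symmetric]) simp_all
    also have "\<dots> = (\<integral>\<^sup>+w. \<integral>\<^sup>+t. h (t + coord_embed \<iota> (?xw + w)) \<partial>flat_measure \<iota> \<partial>lborel)"
    proof (rule nn_integral_cong)
      fix w :: "real ^ 'p"
      have "(\<integral>\<^sup>+t. h (t + coord_embed \<iota> w + x) \<partial>flat_measure \<iota>)
          = (\<integral>\<^sup>+t. h ((?xT + t) + coord_embed \<iota> (?xw + w)) \<partial>flat_measure \<iota>)"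
        by (simp add: coord_linear_simps algebra_simps)
      also have "\<dots> = (\<integral>\<^sup>+t. h (t + coord_embed \<iota> (?xw + w)) \<partial>flat_measure \<iota>)"
        by (rule nn_integral_flat_translate[OF flat_decompose[OF \<iota>]]) measurable
      finally show "(\<integral>\<^sup>+t. h (t + coord_embed \<iota> w + x) \<partial>flat_measure \<iota>)
          = (\<integral>\<^sup>+t. h (t + coord_embed \<iota> (?xw + w)) \<partial>flat_measure \<iota>)" .
    qed
    also have "\<dots> = (\<integral>\<^sup>+w. \<integral>\<^sup>+t. h (t + coord_embed \<iota> w) \<partial>flat_measure \<iota> \<partial>lborel)"
    proof -
      let ?k = "\<lambda>w. \<integral>\<^sup>+t. h (t + coord_embed \<iota> w) \<partial>flat_measure \<iota>"
      have "?k \<in> borel_measurable borel"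
        by (rule F.borel_measurable_nn_integral) measurable
      then show ?thesis using nn_integral_lborel_affine[of ?k 1 ?xw] by simp
    qed
    finally show ?thesis by (simp add: iter)
  qed
  let ?B = "cbox 0 1 :: (real ^ 'd) set"
  have B1: "emeasure lborel ?B = 1"
    by (rule emeasure_lborel_unit_cbox)
  have shift: "(\<integral>\<^sup>+x. h (a - x) \<partial>lborel) = (\<integral>\<^sup>+x. h x \<partial>lborel)" "(\<integral>\<^sup>+x. h (x + a) \<partial>lborel) = (\<integral>\<^sup>+x. h x \<partial>lborel)"
    if "h \<in> borel_measurable borel" for h :: "real ^ 'd \<Rightarrow> ennreal" and a
    using nn_integral_lborel_affine[OF that, of "-1" a] nn_integral_lborel_affine[OF that, of 1 a]
    by (simp_all add: add.commute)
  have "(\<integral>\<^sup>+q. f (s q) \<partial>?P) = (\<integral>\<^sup>+q. f (s q) * emeasure lborel ?B \<partial>?P)"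
    by (simp add: B1)
  also have "\<dots> = (\<integral>\<^sup>+q. \<integral>\<^sup>+x. f (s q) * indicator ?B (x + s q) \<partial>lborel \<partial>?P)"
    by (simp add: nn_integral_cmult shift(2)[of "indicator ?B"])
  also have "\<dots> = (\<integral>\<^sup>+x. \<integral>\<^sup>+q. f (s q) * indicator ?B (x + s q) \<partial>?P \<partial>lborel)"
    by (rule PL.Fubini'[symmetric]) measurable
  also have "\<dots> = (\<integral>\<^sup>+x. \<integral>\<^sup>+q. f (s q - x) * indicator ?B (s q) \<partial>?P \<partial>lborel)"
  proof (rule nn_integral_cong)
    fix x :: "real ^ 'd"
    show "(\<integral>\<^sup>+q. f (s q) * indicator ?B (x + s q) \<partial>?P) = (\<integral>\<^sup>+q. f (s q - x) * indicator ?B (s q) \<partial>?P)"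
      using inv[of "\<lambda>y. f (y - x) * indicator ?B y" x] by (simp add: add.commute)
  qed
  also have "\<dots> = (\<integral>\<^sup>+q. \<integral>\<^sup>+x. f (s q - x) * indicator ?B (s q) \<partial>lborel \<partial>?P)"
    by (rule PL.Fubini') measurable
  also have "\<dots> = (\<integral>\<^sup>+q. (\<integral>\<^sup>+x. f x \<partial>lborel) * indicator ?B (s q) \<partial>?P)"
    by (simp add: nn_integral_multc shift(1)[OF f])
  also have "\<dots> = (\<integral>\<^sup>+x. f x \<partial>lborel) * (\<integral>\<^sup>+q. indicator ?B (s q) \<partial>?P)"
    by (simp add: nn_integral_cmult)
  also have "(\<integral>\<^sup>+q. indicator ?B (s q) \<partial>?P) = flat_unit \<iota>"
  proof -
    \<comment> \<open>the unit cube is the product of the unit cubes of the two factors\<close>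
    have *: "indicator ?B (t + coord_embed \<iota> w) = (indicator ?B t * indicator (cbox 0 1) w :: ennreal)"
      if t: "t \<in> flat \<iota>" for t w
    proof -
      have c: "(t + coord_embed \<iota> w) $ i = (if i \<in> range \<iota> then w $ inv \<iota> i else t $ i)"
        and t0: "i \<in> range \<iota> \<Longrightarrow> t $ i = 0" for i
        using t by (auto simp: coord_embed_def flat_def vec_eq_iff)
      have "t + coord_embed \<iota> w \<in> ?B \<longleftrightarrow> t \<in> ?B \<and> w \<in> cbox 0 1"
      proof
        assume L: "t + coord_embed \<iota> w \<in> ?B"
        have "0 \<le> w $ j \<and> w $ j \<le> 1" for j
          using L c[of "\<iota> j"] \<iota> by (auto simp: mem_box_cart dest!: spec[of _ "\<iota> j"])
        moreover have "0 \<le> t $ i \<and> t $ i \<le> 1" for i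
          using L c[of i] t0[of i] by (cases "i \<in> range \<iota>") (auto simp: mem_box_cart dest!: spec[of _ i])
        ultimately show "t \<in> ?B \<and> w \<in> cbox 0 1" by (simp add: mem_box_cart)
      next
        assume "t \<in> ?B \<and> w \<in> cbox 0 1"
        then show "t + coord_embed \<iota> w \<in> ?B" by (simp add: mem_box_cart c del: vector_add_component)
      qed
      then show ?thesis by (auto simp: indicator_def)
    qed
    note AE = AE_flat_measure[of \<iota>]
    have "(\<integral>\<^sup>+q. indicator ?B (s q) \<partial>?P)
        = (\<integral>\<^sup>+w. \<integral>\<^sup>+t. indicator ?B (t + coord_embed \<iota> w) \<partial>flat_measure \<iota> \<partial>lborel)"
      by (rule iter[symmetric]) measurable
    also have "\<dots> = (\<integral>\<^sup>+w. \<integral>\<^sup>+t. indicator ?B t * indicator (cbox 0 1) (w :: real ^ 'p) \<partial>flat_measure \<iota> \<partial>lborel)"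
      using AE * by (intro nn_integral_cong nn_integral_cong_AE) auto
    also have "\<dots> = flat_unit \<iota> * emeasure lborel (cbox 0 1 :: (real ^ 'p) set)"
      by (simp add: nn_integral_multc nn_integral_cmult flat_unit_def)
    also have "emeasure lborel (cbox 0 1 :: (real ^ 'p) set) = 1"
      by (rule emeasure_lborel_unit_cbox)
    finally show ?thesis by simp
  qed
  finally show ?thesis by (simp add: iter mult.commute)
qed

text \<open>
  If a flat ball were null, so would be its product with the transverse space, which contains a ball of
  \<open>real ^ 'd\<close>.
\<close>

lemma flat_measure_ball_pos:
  fixes \<iota> :: "'p::finite \<Rightarrow> 'd::finite"
  assumes \<iota>: "inj \<iota>" and a: "a \<in> flat \<iota>" and "\<rho> > 0"
  shows "0 < emeasure (flat_measure \<iota>) (ball a \<rho>)"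
proof (rule ccontr)
  assume "\<not> ?thesis"
  then have 0: "emeasure (flat_measure \<iota>) (ball a \<rho>) = 0" by simp
  note AE = AE_flat_measure[of \<iota>]
  have sub: "dist t a \<le> dist (t + coord_embed \<iota> w) a" if "t \<in> flat \<iota>" for t w
  proof -
    have "(norm (t - a + coord_embed \<iota> w))\<^sup>2 = (norm (t - a))\<^sup>2 + (norm w)\<^sup>2"
      using that a by (intro norm_flat_add_embed[OF \<iota>] flat_diff)
    then have "(norm (t - a))\<^sup>2 \<le> (norm (t - a + coord_embed \<iota> w))\<^sup>2" by simp
    then show ?thesis by (simp add: dist_norm algebra_simps abs_le_square_iff[symmetric])
  qed
  have "flat_unit \<iota> * emeasure lborel (ball a \<rho>)
      = (\<integral>\<^sup>+w. \<integral>\<^sup>+t. indicator (ball a \<rho>) (t + coord_embed \<iota> w) \<partial>flat_measure \<iota> \<partial>lborel)"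
    using nn_integral_flat_decompose[OF \<iota> borel_measurable_indicator[OF borel_open[OF open_ball]], of a \<rho>]
    by simp
  also have "\<dots> \<le> (\<integral>\<^sup>+(w::real ^ 'p). \<integral>\<^sup>+t. indicator (ball a \<rho>) t \<partial>flat_measure \<iota> \<partial>lborel)"
  proof (rule nn_integral_mono)
    fix w :: "real ^ 'p"
    have "AE t in flat_measure \<iota>. indicator (ball a \<rho>) (t + coord_embed \<iota> w) \<le> (indicator (ball a \<rho>) t :: ennreal)"
      using AE
    proof eventually_elim
      case (elim t)
      then show ?case using sub[OF elim, of w] by (auto simp: indicator_def dist_commute)
    qed
    then show "(\<integral>\<^sup>+t. indicator (ball a \<rho>) (t + coord_embed \<iota> w) \<partial>flat_measure \<iota>)
        \<le> (\<integral>\<^sup>+t. indicator (ball a \<rho>) t \<partial>flat_measure \<iota>)"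
      by (rule nn_integral_mono_AE)
  qed
  also have "\<dots> = 0" using 0 by simp
  finally have "emeasure lborel (ball a \<rho>) = 0" using flat_unit_pos[OF \<iota>] by auto
  moreover have "unit_ball_vol (real CARD('d)) * \<rho> ^ CARD('d) > 0"
    using \<open>\<rho> > 0\<close> by (intro mult_pos_pos) auto
  ultimately show False
    using \<open>\<rho> > 0\<close> by (simp add: emeasure_ball)
qed

section \<open>Bounded Lipschitz functions and smooth maps\<close>

text \<open>
  Bounded Lipschitz functions form an algebra, closed under inverses of functions bounded below by a
  positive constant. Determinants of derivatives, being polynomial in the entries, therefore inherit
  Lipschitz bounds from these.
\<close>

definition bdd_lip :: "'a::metric_space set \<Rightarrow> ('a \<Rightarrow> real) \<Rightarrow> bool" where
  "bdd_lip S f \<longleftrightarrow> (\<exists>b L. 0 \<le> b \<and> 0 \<le> L \<and> (\<forall>x\<in>S. \<bar>f x\<bar> \<le> b) \<and> (\<forall>x\<in>S. \<forall>y\<in>S. \<bar>f x - f y\<bar> \<le> L * dist x y))"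

lemma bdd_lipI:
  assumes "\<And>x. x \<in> S \<Longrightarrow> \<bar>f x\<bar> \<le> b" "\<And>x y. x \<in> S \<Longrightarrow> y \<in> S \<Longrightarrow> \<bar>f x - f y\<bar> \<le> L * dist x y"
  shows "bdd_lip S f"
proof -
  have "\<bar>f x\<bar> \<le> max b 0" if "x \<in> S" for x using assms(1)[OF that] by simp
  moreover have "\<bar>f x - f y\<bar> \<le> max L 0 * dist x y" if "x \<in> S" "y \<in> S" for x y
    using assms(2)[OF that] by (rule order_trans) (simp add: mult_right_mono)
  ultimately show ?thesis unfolding bdd_lip_def by (meson max.cobounded2)
qed

lemma bdd_lipE:
  assumes "bdd_lip S f"
  obtains b L where "0 \<le> b" "0 \<le> L" "\<And>x. x \<in> S \<Longrightarrow> \<bar>f x\<bar> \<le> b"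
    "\<And>x y. x \<in> S \<Longrightarrow> y \<in> S \<Longrightarrow> \<bar>f x - f y\<bar> \<le> L * dist x y"
  using assms unfolding bdd_lip_def by blast

lemma bdd_lip_subset: "bdd_lip S f \<Longrightarrow> T \<subseteq> S \<Longrightarrow> bdd_lip T f"
  unfolding bdd_lip_def by (meson subsetD)

lemma bdd_lip_const [intro, simp]: "bdd_lip S (\<lambda>x. c)"
  by (rule bdd_lipI[of _ _ "\<bar>c\<bar>" 0]) auto

lemma bdd_lip_add:
  assumes "bdd_lip S f" "bdd_lip S g"
  shows "bdd_lip S (\<lambda>x. f x + g x)"
proof -
  obtain b L where 1: "0 \<le> b" "0 \<le> L" "\<And>x. x \<in> S \<Longrightarrow> \<bar>f x\<bar> \<le> b"
    "\<And>x y. x \<in> S \<Longrightarrow> y \<in> S \<Longrightarrow> \<bar>f x - f y\<bar> \<le> L * dist x y" using assms(1) by (rule bdd_lipE) (rule that)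
  obtain b' L' where 2: "0 \<le> b'" "0 \<le> L'" "\<And>x. x \<in> S \<Longrightarrow> \<bar>g x\<bar> \<le> b'"
    "\<And>x y. x \<in> S \<Longrightarrow> y \<in> S \<Longrightarrow> \<bar>g x - g y\<bar> \<le> L' * dist x y" using assms(2) by (rule bdd_lipE) (rule that)
  show ?thesis
  proof (rule bdd_lipI[of _ _ "b + b'" "L + L'"])
    show "\<bar>f x + g x\<bar> \<le> b + b'" if "x \<in> S" for x using 1(3) 2(3) that by (smt (verit))
    show "\<bar>(f x + g x) - (f y + g y)\<bar> \<le> (L + L') * dist x y" if "x \<in> S" "y \<in> S" for x y
      using 1(4)[OF that] 2(4)[OF that] by (simp add: algebra_simps)
  qed
qed

lemma abs_mult_diff_le:
  fixes a b c d :: real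
  assumes "\<bar>a\<bar> \<le> B" "\<bar>d\<bar> \<le> B'"
  shows "\<bar>a * c - b * d\<bar> \<le> B * \<bar>c - d\<bar> + B' * \<bar>a - b\<bar>"
proof -
  have "a * c - b * d = a * (c - d) + d * (a - b)" by (simp add: algebra_simps)
  then have "\<bar>a * c - b * d\<bar> \<le> \<bar>a\<bar> * \<bar>c - d\<bar> + \<bar>d\<bar> * \<bar>a - b\<bar>"
    by (metis abs_mult abs_triangle_ineq)
  also have "\<dots> \<le> B * \<bar>c - d\<bar> + B' * \<bar>a - b\<bar>"
    using assms by (intro add_mono mult_right_mono) auto
  finally show ?thesis .
qed

lemma bdd_lip_mult:
  assumes "bdd_lip S f" "bdd_lip S g"
  shows "bdd_lip S (\<lambda>x. f x * g x)"
proof -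
  obtain b L where 1: "0 \<le> b" "0 \<le> L" "\<And>x. x \<in> S \<Longrightarrow> \<bar>f x\<bar> \<le> b"
    "\<And>x y. x \<in> S \<Longrightarrow> y \<in> S \<Longrightarrow> \<bar>f x - f y\<bar> \<le> L * dist x y" using assms(1) by (rule bdd_lipE) (rule that)
  obtain b' L' where 2: "0 \<le> b'" "0 \<le> L'" "\<And>x. x \<in> S \<Longrightarrow> \<bar>g x\<bar> \<le> b'"
    "\<And>x y. x \<in> S \<Longrightarrow> y \<in> S \<Longrightarrow> \<bar>g x - g y\<bar> \<le> L' * dist x y" using assms(2) by (rule bdd_lipE) (rule that)
  show ?thesis
  proof (rule bdd_lipI[of _ _ "b * b'" "b * L' + b' * L"])
    show "\<bar>f x * g x\<bar> \<le> b * b'" if "x \<in> S" for x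
      using 1(1) 1(3)[OF that] 2(3)[OF that] by (simp add: abs_mult mult_mono)
    show "\<bar>f x * g x - f y * g y\<bar> \<le> (b * L' + b' * L) * dist x y" if "x \<in> S" "y \<in> S" for x y
    proof -
      have "\<bar>f x * g x - f y * g y\<bar> \<le> b * \<bar>g x - g y\<bar> + b' * \<bar>f x - f y\<bar>"
        by (rule abs_mult_diff_le[OF 1(3)[OF that(1)] 2(3)[OF that(2)]])
      also have "\<dots> \<le> b * (L' * dist x y) + b' * (L * dist x y)"
        using 1 2 that by (intro add_mono mult_left_mono) auto
      finally show ?thesis by (simp add: algebra_simps)
    qed
  qed
qed

lemma bdd_lip_sum:
  assumes "\<And>i. i \<in> I \<Longrightarrow> bdd_lip S (f i)"
  shows "bdd_lip S (\<lambda>x. \<Sum>i\<in>I. f i x)"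
  using assms by (induction I rule: infinite_finite_induct) (auto intro: bdd_lip_add)

lemma bdd_lip_prod:
  assumes "\<And>i. i \<in> I \<Longrightarrow> bdd_lip S (f i)"
  shows "bdd_lip S (\<lambda>x. \<Prod>i\<in>I. f i x)"
  using assms by (induction I rule: infinite_finite_induct) (auto intro: bdd_lip_mult)

lemma bdd_lip_abs: "bdd_lip S f \<Longrightarrow> bdd_lip S (\<lambda>x. \<bar>f x\<bar>)"
proof (elim bdd_lipE)
  fix b L assume "\<And>x. x \<in> S \<Longrightarrow> \<bar>f x\<bar> \<le> b" "\<And>x y. x \<in> S \<Longrightarrow> y \<in> S \<Longrightarrow> \<bar>f x - f y\<bar> \<le> L * dist x y"
  then show "bdd_lip S (\<lambda>x. \<bar>f x\<bar>)"
    by (intro bdd_lipI[of _ _ b L]) (auto intro: order_trans[OF abs_triangle_ineq3])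
qed

lemma bdd_lip_inverse:
  assumes f: "bdd_lip S f" and \<delta>: "0 < \<delta>" "\<And>x. x \<in> S \<Longrightarrow> \<delta> \<le> f x"
  shows "bdd_lip S (\<lambda>x. 1 / f x)"
proof -
  obtain b L where 1: "0 \<le> b" "0 \<le> L" "\<And>x. x \<in> S \<Longrightarrow> \<bar>f x\<bar> \<le> b"
    "\<And>x y. x \<in> S \<Longrightarrow> y \<in> S \<Longrightarrow> \<bar>f x - f y\<bar> \<le> L * dist x y" using f by (rule bdd_lipE) (rule that)
  show ?thesis
  proof (rule bdd_lipI[of _ _ "1 / \<delta>" "L / (\<delta> * \<delta>)"])
    show "\<bar>1 / f x\<bar> \<le> 1 / \<delta>" if "x \<in> S" for x
      using \<delta>(1) \<delta>(2)[OF that] by (simp add: frac_le)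
    show "\<bar>1 / f x - 1 / f y\<bar> \<le> L / (\<delta> * \<delta>) * dist x y" if "x \<in> S" "y \<in> S" for x y
    proof -
      have p: "\<delta> \<le> f x" "\<delta> \<le> f y" using \<delta>(2) that by auto
      then have "1 / f x - 1 / f y = (f y - f x) / (f x * f y)"
        using \<delta>(1) by (simp add: diff_frac_eq)
      then have "\<bar>1 / f x - 1 / f y\<bar> = \<bar>f x - f y\<bar> / (f x * f y)"
        using p \<delta>(1) by (simp add: abs_divide abs_mult abs_minus_commute)
      also have "\<dots> \<le> L * dist x y / (\<delta> * \<delta>)"
        using 1(4)[OF that] p \<delta>(1) by (intro frac_le mult_mono) auto
      finally show ?thesis by simp
    qed
  qed
qed

lemma bdd_lip_det:
  fixes A :: "'a::metric_space \<Rightarrow> real ^ 'n ^ 'n"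
  assumes "\<And>i j. bdd_lip S (\<lambda>x. A x $ i $ j)"
  shows "bdd_lip S (\<lambda>x. det (A x))"
  unfolding det_def by (intro bdd_lip_sum bdd_lip_mult bdd_lip_prod bdd_lip_const assms)

lemma continuous_on_det:
  fixes A :: "'a::topological_space \<Rightarrow> real ^ 'n ^ 'n"
  assumes "\<And>i j. continuous_on S (\<lambda>x. A x $ i $ j)"
  shows "continuous_on S (\<lambda>x. det (A x))"
  unfolding det_def by (intro continuous_intros assms)

lemma bdd_lip_bounded_linear:
  fixes f :: "'a::real_normed_vector \<Rightarrow> real"
  assumes "bounded S" "bounded_linear f"
  shows "bdd_lip S f"
proof -
  interpret f: bounded_linear f by fact
  obtain K where K: "K \<ge> 0" "\<And>x. norm (f x) \<le> norm x * K" using f.nonneg_bounded by blast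
  obtain N where N: "\<And>x. x \<in> S \<Longrightarrow> norm x \<le> N" using assms(1) unfolding bounded_iff by blast
  show ?thesis
  proof (rule bdd_lipI[of _ _ "N * K" K])
    show "\<bar>f x\<bar> \<le> N * K" if "x \<in> S" for x
      using K(2)[of x] mult_right_mono[OF N[OF that] K(1)] by simp
    show "\<bar>f x - f y\<bar> \<le> K * dist x y" for x y
      using K(2)[of "x - y"] by (simp add: f.diff dist_norm mult.commute)
  qed
qed

lemma bdd_lip_polynomial:
  fixes f :: "'a::real_normed_vector \<Rightarrow> real"
  assumes "real_polynomial_function f" "bounded S"
  shows "bdd_lip S f"
  using assms(1)
  by induction (auto intro: bdd_lip_bounded_linear assms(2) bdd_lip_add bdd_lip_mult)

lemma smooth_has_derivative:
  assumes "smooth f"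
  shows "(f has_derivative frechet_derivative f (at x)) (at x)"
proof -
  have "cont_diff (Suc 0) f" using assms unfolding smooth_def by (rule spec)
  then have "f differentiable (at x)" unfolding cont_diff.simps(2) by blast
  then show ?thesis by (simp add: frechet_derivative_works)
qed

lemma smooth_directional_derivative:
  assumes "smooth f"
  shows "smooth (\<lambda>x. frechet_derivative f (at x) v)"
  unfolding smooth_def
proof
  fix n
  have "cont_diff (Suc n) f" using assms unfolding smooth_def by (rule spec)
  then show "cont_diff n (\<lambda>x. frechet_derivative f (at x) v)" unfolding cont_diff.simps(2) by blast
qed

lemma smooth_continuous_on:
  assumes "smooth f"
  shows "continuous_on S f"
proof -
  have "cont_diff 0 f" using assms unfolding smooth_def by (rule spec)
  then show ?thesis unfolding cont_diff.simps(1) by (rule continuous_on_subset) simp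
qed

lemma bounded_linear_derivative: "smooth f \<Longrightarrow> bounded_linear (frechet_derivative f (at x))"
  by (rule has_derivative_bounded_linear[OF smooth_has_derivative])

lemma smooth_locally_Lipschitz:
  fixes f :: "'a::euclidean_space \<Rightarrow> 'b::real_normed_vector"
  assumes f: "smooth f"
  shows "\<exists>L\<ge>0. \<forall>x\<in>cball z r. \<forall>y\<in>cball z r. norm (f x - f y) \<le> L * norm (x - y)"
proof -
  let ?n = "\<lambda>x. \<Sum>i\<in>Basis. norm (frechet_derivative f (at x) i)"
  have "continuous_on (cball z r) ?n"
    by (intro continuous_intros smooth_continuous_on smooth_directional_derivative f)
  then have "bounded (?n ` cball z r)"
    by (intro compact_imp_bounded compact_continuous_image compact_cball)
  then obtain L where "\<forall>y\<in>?n ` cball z r. norm y \<le> L"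
    unfolding bounded_iff by blast
  then have L: "\<bar>?n x\<bar> \<le> L" if "x \<in> cball z r" for x using that by (auto simp del: mem_cball)
  have on: "onorm (frechet_derivative f (at x)) \<le> max L 0" if "x \<in> cball z r" for x
    using onorm_componentwise[OF bounded_linear_derivative[OF f], of x] L[OF that] by linarith
  show ?thesis
  proof (intro exI[of _ "max L 0"] conjI ballI)
    show "norm (f x - f y) \<le> max L 0 * norm (x - y)" if "x \<in> cball z r" "y \<in> cball z r" for x y
      using on that
      by (intro differentiable_bound[OF convex_cball has_derivative_at_withinI[OF smooth_has_derivative[OF f]]]) auto
  qed simp
qed

text \<open>
  Each directional derivative is again smooth, hence locally Lipschitz, and the operator norm is at
  most the sum of the norms on a basis.
\<close>

lemma smooth_derivative_locally_Lipschitz: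
  fixes f :: "'a::euclidean_space \<Rightarrow> 'b::real_normed_vector"
  assumes f: "smooth f"
  shows "\<exists>L\<ge>0. \<forall>x\<in>cball z r. \<forall>y\<in>cball z r.
    onorm (\<lambda>v. frechet_derivative f (at x) v - frechet_derivative f (at y) v) \<le> L * norm (x - y)"
proof -
  have "\<exists>L\<ge>0. \<forall>x\<in>cball z r. \<forall>y\<in>cball z r.
      norm (frechet_derivative f (at x) i - frechet_derivative f (at y) i) \<le> L * norm (x - y)" for i
    by (rule smooth_locally_Lipschitz[OF smooth_directional_derivative[OF f]])
  then obtain L where L: "\<And>i. L i \<ge> 0" "\<And>i x y. x \<in> cball z r \<Longrightarrow> y \<in> cball z r \<Longrightarrow>
      norm (frechet_derivative f (at x) i - frechet_derivative f (at y) i) \<le> L i * norm (x - y)"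
    by metis
  show ?thesis
  proof (intro exI[of _ "\<Sum>i\<in>Basis. L i"] conjI ballI)
    fix x y assume xy: "x \<in> cball z r" "y \<in> cball z r"
    have "onorm (\<lambda>v. frechet_derivative f (at x) v - frechet_derivative f (at y) v)
        \<le> (\<Sum>i\<in>Basis. norm (frechet_derivative f (at x) i - frechet_derivative f (at y) i))"
      by (intro onorm_componentwise bounded_linear_sub bounded_linear_derivative f)
    also have "\<dots> \<le> (\<Sum>i\<in>Basis. L i * norm (x - y))"
      using L xy by (intro sum_mono) auto
    finally show "onorm (\<lambda>v. frechet_derivative f (at x) v - frechet_derivative f (at y) v)
        \<le> (\<Sum>i\<in>Basis. L i) * norm (x - y)"
      by (simp add: sum_distrib_right)
  qed (use L in \<open>auto intro: sum_nonneg\<close>)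
qed

lemma jacobian_nth:
  "jacobian F (at x) $ i $ j = frechet_derivative F (at x) (axis j 1) $ i"
  by (simp add: jacobian_def matrix_def)

lemma jacobian_mult: "smooth F \<Longrightarrow> jacobian F (at x) *v v = frechet_derivative F (at x) v"
  for F :: "real ^ 'd \<Rightarrow> real ^ 'p"
  unfolding jacobian_def
  by (simp add: bounded_linear.linear bounded_linear_derivative)

lemma continuous_on_gen_jacobian:
  fixes F :: "real ^ 'd \<Rightarrow> real ^ 'p"
  assumes "smooth F"
  shows "continuous_on S (gen_jacobian F)"
proof -
  have e: "continuous_on S (\<lambda>x. jacobian F (at x) $ i $ j)" for i j
    unfolding jacobian_nth
    by (intro continuous_intros smooth_continuous_on smooth_directional_derivative assms)
  show ?thesis
    unfolding gen_jacobian_def Let_def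
    by (cases "CARD('p) \<le> CARD('d)")
      (simp_all, (intro continuous_intros continuous_on_det; simp add: matrix_matrix_mult_def transpose_def; intro continuous_intros e)+)
qed

section \<open>Normal forms of the derivative\<close>

lemma norm_preserving_inner:
  fixes f :: "'a::real_inner \<Rightarrow> 'b::real_inner" and g :: "'a \<Rightarrow> 'c::real_inner"
  assumes "linear f" "linear g" "\<And>x. norm (f x) = norm (g x)"
  shows "inner (f x) (f y) = inner (g x) (g y)"
proof -
  have "(norm (f (x + y)))\<^sup>2 = (norm (g (x + y)))\<^sup>2" using assms(3) by simp
  moreover have "(norm (f x))\<^sup>2 = (norm (g x))\<^sup>2" "(norm (f y))\<^sup>2 = (norm (g y))\<^sup>2" using assms(3) by simp_all
  ultimately show ?thesis
    by (simp add: linear_add[OF assms(1)] linear_add[OF assms(2)] power2_norm_eq_inner inner_add inner_commute)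
qed

text \<open>
  Rotating the \<open>d\<close>-dimensional range of \<open>A\<close> isometrically onto \<open>real ^ 'd\<close> replaces the tall matrix by a
  square one with the same Gram matrix, so that the generalized Jacobian becomes an ordinary
  determinant.
\<close>

lemma injective_matrix_isometry:
  fixes A :: "real ^ 'd ^ 'p"
  assumes "det (transpose A ** A) \<noteq> 0"
  obtains T :: "real ^ 'd \<Rightarrow> real ^ 'd" where "linear T" "inj T" "\<And>v. norm (T v) = norm (A *v v)"
    "\<bar>det (matrix T)\<bar> = sqrt (det (transpose A ** A))" "det (transpose A ** A) > 0"
proof -
  have injA: "inj ((*v) A)"
  proof -
    have "inj ((*v) (transpose A ** A))"
      using assms by (simp add: inj_matrix_vector_mult invertible_det_nz)
    then show ?thesis
      by (metis (no_types, lifting) inj_def matrix_vector_mul_assoc)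
  qed
  have "subspace (range ((*v) A))"
    by (simp add: linear_subspace_image[OF _ subspace_UNIV])
  moreover have "dim (range ((*v) A)) = dim (UNIV :: (real ^ 'd) set)"
    using injA by (intro dim_image_eq) auto
  ultimately obtain f where f: "linear f" "f ` range ((*v) A) = (UNIV :: (real ^ 'd) set)"
    "\<And>x. x \<in> range ((*v) A) \<Longrightarrow> norm (f x) = norm x"
    using isometries_subspaces[OF _ subspace_UNIV] by metis
  define T where "T = f \<circ> (*v) A"
  have T: "linear T" unfolding T_def using f(1) by (intro linear_compose) auto
  have nT: "norm (T v) = norm (A *v v)" for v using f(3) by (simp add: T_def)
  have injT: "inj T"
  proof (rule injI)
    fix x y assume "T x = T y"
    then have "norm (T (x - y)) = 0" by (simp add: linear_diff[OF T])
    then have "A *v (x - y) = A *v 0" by (simp add: nT)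
    then have "x - y = 0" using injA by (rule injD[rotated])
    then show "x = y" by simp
  qed
  have inner: "inner (T x) (T y) = inner (A *v x) (A *v y)" for x y
    by (rule norm_preserving_inner[OF T _ nT]) simp
  have "transpose (matrix T) ** matrix T = transpose A ** A"
  proof -
    have "(transpose (matrix T) ** matrix T) $ i $ j = inner (T (axis i 1)) (T (axis j 1))" for i j
      by (simp add: matrix_matrix_mult_def transpose_def matrix_def inner_vec_def)
    moreover have "(transpose A ** A) $ i $ j = inner (A *v axis i 1) (A *v axis j 1)" for i j
      by (simp add: matrix_matrix_mult_def transpose_def inner_vec_def matrix_vector_mult_basis column_def)
    ultimately show ?thesis by (simp add: vec_eq_iff inner)
  qed
  then have d: "det (transpose A ** A) = (det (matrix T))\<^sup>2"
    by (metis det_mul det_transpose power2_eq_square)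
  show ?thesis
    using assms d by (intro that[OF T injT nT]) auto
qed

text \<open>
  An orthogonal \<open>B\<close> maps the kernel of \<open>A\<close> onto the flat and its orthogonal complement, the row space,
  onto the transverse coordinate space; on the latter \<open>A\<close> is invertible, with inverse \<open>E\<close>, and
  transporting that inverse by \<open>B\<close> gives \<open>M\<close>. Since \<open>coord_part\<close> has orthonormal rows, so has \<open>M A\<close>;
  hence \<open>M (A A\<^sup>T) M\<^sup>T = 1\<close>, and taking determinants gives the last two claims.
\<close>

lemma full_row_rank_normal_form:
  fixes A :: "real ^ 'd ^ 'p" and \<iota> :: "'p \<Rightarrow> 'd"
  assumes \<iota>: "inj \<iota>" and det: "det (A ** transpose A) \<noteq> 0"
  obtains B :: "real ^ 'd \<Rightarrow> real ^ 'd" and M :: "real ^ 'p \<Rightarrow> real ^ 'p"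
  where "orthogonal_transformation B" "linear M" "inj M"
    "\<And>x. coord_part \<iota> (B x) = M (A *v x)"
    "\<bar>det (matrix M)\<bar> * sqrt (det (A ** transpose A)) = 1" "det (A ** transpose A) > 0"
proof -
  let ?G = "A ** transpose A"
  have "invertible ?G" using det by (simp add: invertible_det_nz)
  then obtain Gi where Gi: "?G ** Gi = mat 1" "Gi ** ?G = mat 1" unfolding invertible_def by blast
  define E where "E y = transpose A *v (Gi *v y)" for y
  have AE: "A *v E y = y" for y
    unfolding E_def by (metis Gi(1) matrix_vector_mul_assoc matrix_vector_mul_lid)
  have linE: "linear E" unfolding E_def
    by (rule linearI) (simp_all add: matrix_vector_right_distrib matrix_vector_mult_scaleR)
  let ?S = "range ((*v) (transpose A))" and ?K = "{x. A *v x = 0}"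
  let ?J = "range (coord_embed \<iota>)"
  have subS: "subspace ?S" by (rule linear_subspace_image[OF matrix_vector_mul_linear subspace_UNIV])
  have subS0: "subspace ?J"
    by (rule linear_subspace_image[OF linear_coord_embed subspace_UNIV])
  have subK: "subspace ?K"
    by (auto simp: subspace_def matrix_vector_right_distrib matrix_vector_mult_scaleR)
  have subF: "subspace (flat \<iota>)"
    by (auto simp: subspace_def flat_def coord_linear_simps linear_cmul[OF linear_coord_part])
  have injAt: "inj ((*v) (transpose A))"
  proof (rule injI)
    fix x y assume "transpose A *v x = transpose A *v y"
    then have "?G *v x = ?G *v y" by (metis matrix_vector_mul_assoc)
    then show "x = y" by (metis Gi(2) matrix_vector_mul_assoc matrix_vector_mul_lid)
  qed
  have dimS: "dim ?S = CARD('p)" using injAt by (subst dim_image_eq) auto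
  have dimS0: "dim ?J = CARD('p)"
  proof -
    have "inj (coord_embed \<iota> :: real ^ 'p \<Rightarrow> real ^ 'd)" using \<iota> by (metis coord_part_embed injI)
    then show ?thesis by (subst dim_image_eq) (auto simp: linear_coord_embed)
  qed
  have perpK: "?K = {x \<in> UNIV. \<forall>s\<in>?S. orthogonal s x}"
    by (auto simp: orthogonal_def dot_lmul_matrix) (metis inner_eq_zero_iff)
  have perpF: "flat \<iota> = {x \<in> UNIV. \<forall>s\<in>?J. orthogonal s x}"
    using \<iota> by (auto simp: orthogonal_def inner_commute[of "coord_embed \<iota> _"] inner_coord_embed flat_def)
  have "dim ?K + dim ?S = dim (UNIV :: (real ^ 'd) set)"
    unfolding perpK by (rule dim_subspace_orthogonal_to_vectors[OF subS subspace_UNIV]) auto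
  moreover have "dim (flat \<iota>) + dim ?J = dim (UNIV :: (real ^ 'd) set)"
    unfolding perpF by (rule dim_subspace_orthogonal_to_vectors[OF subS0 subspace_UNIV]) auto
  ultimately have dimK: "dim ?K = dim (flat \<iota>)" using dimS dimS0 by simp
  \<comment> \<open>the two isometries are glued to \<open>B\<close> along the orthogonal decomposition \<open>x = P x + (x - P x)\<close>\<close>
  obtain f1 where f1: "linear f1" "f1 ` ?S = ?J" "\<And>x. x \<in> ?S \<Longrightarrow> norm (f1 x) = norm x"
    using isometries_subspaces[OF subS subS0] dimS dimS0 by metis
  obtain f2 where f2: "linear f2" "f2 ` ?K = flat \<iota>" "\<And>x. x \<in> ?K \<Longrightarrow> norm (f2 x) = norm x"
    using isometries_subspaces[OF subK subF] dimK by metis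
  define P where "P x = E (A *v x)" for x
  have linP: "linear P" unfolding P_def
    by (rule linearI) (simp_all add: matrix_vector_right_distrib linear_add[OF linE] matrix_vector_mult_scaleR linear_cmul[OF linE])
  have PS: "P x \<in> ?S" for x by (simp add: P_def E_def)
  have PK: "x - P x \<in> ?K" for x by (simp add: P_def AE matrix_vector_mult_diff_distrib)
  define B where "B x = f1 (P x) + f2 (x - P x)" for x
  define M where "M y = coord_part \<iota> (f1 (E y))" for y
  have linB: "linear B" unfolding B_def
    by (rule linearI) (simp_all add: linear_add[OF linP] linear_cmul[OF linP] linear_add[OF f1(1)] linear_cmul[OF f1(1)]
        linear_add[OF f2(1)] linear_diff[OF f2(1)] linear_cmul[OF f2(1)] algebra_simps)
  have linM: "linear M" unfolding M_def
    by (rule linearI) (simp_all add: linear_add[OF linE] linear_cmul[OF linE] linear_add[OF f1(1)] linear_cmul[OF f1(1)]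
        linear_add[OF linear_coord_part] linear_cmul[OF linear_coord_part])
  have nB: "norm (B x) = norm x" for x
  proof -
    have "f1 (P x) \<in> ?J" "f2 (x - P x) \<in> flat \<iota>" using f1(2) f2(2) PS PK by blast+
    then have "orthogonal (f1 (P x)) (f2 (x - P x))" unfolding perpF by auto
    then have "(norm (B x))\<^sup>2 = (norm (f1 (P x)))\<^sup>2 + (norm (f2 (x - P x)))\<^sup>2"
      unfolding B_def by (rule norm_add_Pythagorean)
    also have "\<dots> = (norm (P x))\<^sup>2 + (norm (x - P x))\<^sup>2"
      using f1(3)[OF PS] f2(3)[OF PK] by simp
    also have "\<dots> = (norm (P x + (x - P x)))\<^sup>2"
    proof (rule norm_add_Pythagorean[symmetric])
      show "orthogonal (P x) (x - P x)" using PS[of x] PK[of x] unfolding perpK by blast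
    qed
    finally show ?thesis by simp
  qed
  have B: "orthogonal_transformation B" by (simp add: orthogonal_transformation linB nB)
  have BM: "coord_part \<iota> (B x) = M (A *v x)" for x
  proof -
    have "f2 (x - P x) \<in> flat \<iota>" using f2(2) PK by blast
    then show ?thesis by (simp add: B_def M_def P_def flat_def linear_add[OF linear_coord_part])
  qed
  let ?C = "matrix (coord_part \<iota> :: real ^ 'd \<Rightarrow> real ^ 'p)"
  have CB: "?C ** matrix B = matrix M ** A"
  proof -
    have "matrix (coord_part \<iota> \<circ> B) = ?C ** matrix B"
      by (rule matrix_compose) (simp_all add: linear_coord_part linB)
    moreover have "matrix (M \<circ> (*v) A) = matrix M ** A"
      by (subst matrix_compose) (simp_all add: linM)
    moreover have "coord_part \<iota> \<circ> B = M \<circ> (*v) A" by (simp add: fun_eq_iff BM)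
    ultimately show ?thesis by simp
  qed
  have CC: "?C ** transpose ?C = mat 1"
  proof -
    have "(\<Sum>k\<in>UNIV. (if \<iota> i = k then 1 else 0) * (if \<iota> j = k then 1 else 0)) = (if i = j then 1 else (0::real))" for i j
      using \<iota> by (simp add: if_distrib[of "\<lambda>x. x * _"] inj_eq cong: if_cong)
    then show ?thesis
      by (simp add: vec_eq_iff matrix_matrix_mult_def transpose_def matrix_def mat_def axis_def)
  qed
  have "matrix M ** ?G ** transpose (matrix M) = (matrix M ** A) ** transpose (matrix M ** A)"
    by (simp add: matrix_transpose_mul matrix_mul_assoc)
  also have "\<dots> = ?C ** (matrix B ** transpose (matrix B)) ** transpose ?C"
    by (simp add: CB[symmetric] matrix_transpose_mul matrix_mul_assoc)
  also have "matrix B ** transpose (matrix B) = mat 1"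
    using B by (simp add: orthogonal_transformation_matrix orthogonal_matrix_def)
  finally have "matrix M ** ?G ** transpose (matrix M) = mat 1" by (simp add: CC)
  then have "det (matrix M ** ?G ** transpose (matrix M)) = 1" by simp
  then have d1: "(det (matrix M))\<^sup>2 * det ?G = 1"
    by (simp add: det_mul power2_eq_square algebra_simps)
  then have pos: "det ?G > 0"
    by (metis mult_zero_left not_less_iff_gr_or_eq power_zero_numeral zero_less_mult_iff zero_less_one zero_less_power2 not_square_less_zero power2_eq_square)
  have "(\<bar>det (matrix M)\<bar> * sqrt (det ?G))\<^sup>2 = 1"
    using d1 pos by (simp add: power_mult_distrib)
  then have d: "\<bar>det (matrix M)\<bar> * sqrt (det ?G) = 1"
    using pos by (simp add: power2_eq_1_iff) (smt (verit) mult_nonneg_nonneg real_sqrt_ge_zero)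
  have "det (matrix M) \<noteq> 0" using d by auto
  then have "inj ((*v) (matrix M))" by (simp add: inj_matrix_vector_mult invertible_det_nz)
  then have "inj M" using linM by (simp add: inj_def matrix_works)
  then show ?thesis using that B linM BM d pos by blast
qed

section \<open>Radial integrals\<close>

text \<open>
  From \<open>y / N \<le> exp (y / N)\<close>, raised to the power \<open>N\<close>.
\<close>

lemma exp_minus_le_power:
  fixes y :: real and N :: nat
  assumes "y > 0" "N \<ge> 1"
  shows "exp (- y) \<le> (real N / y) ^ N"
proof -
  have "y / real N \<le> exp (y / real N)" using exp_ge_add_one_self[of "y / real N"] by linarith
  then have "(y / real N) ^ N \<le> exp (y / real N) ^ N"
    using assms by (intro power_mono) auto
  also have "\<dots> = exp y" using assms by (simp add: exp_of_nat_mult[symmetric])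
  finally have "1 / exp y \<le> 1 / (y / real N) ^ N"
    using assms by (intro divide_left_mono) auto
  also have "\<dots> = (real N / y) ^ N" by (simp add: power_divide)
  finally show ?thesis by (simp add: exp_minus inverse_eq_divide)
qed

lemma summable_power_exp_powr:
  fixes c a :: real
  assumes "c > 0" "a > 0"
  shows "summable (\<lambda>n. real (n + 1) ^ m * exp (- (c * real n powr a)))"
proof -
  obtain N :: nat where N: "(real m + 2) / a \<le> real N" "N \<ge> 1"
  proof -
    obtain N where "(real m + 2) / a \<le> real N" using real_arch_simple by blast
    then show ?thesis using that[of "max N 1"] by simp
  qed
  \<comment> \<open>\<open>N\<close> is chosen so that \<open>exp (- (c * n powr a))\<close> is at most a multiple of \<open>1 / n powr (m + 2)\<close>\<close>
  let ?K = "2 ^ m * (real N / c) ^ N"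
  have bound: "norm (real (n + 1) ^ m * exp (- (c * real n powr a))) \<le> ?K * (1 / real n ^ 2)" if n: "n \<ge> 1" for n
  proof -
    have n0: "real n \<ge> 1" using n by simp
    have "exp (- (c * real n powr a)) \<le> (real N / (c * real n powr a)) ^ N"
      using n0 assms N by (intro exp_minus_le_power) auto
    also have "\<dots> = (real N / c) ^ N / real n powr (a * real N)"
      using n0 by (simp add: power_divide power_mult_distrib powr_powr[symmetric] powr_realpow)
    also have "\<dots> \<le> (real N / c) ^ N / real n powr (real m + 2)"
    proof (intro divide_left_mono powr_mono mult_pos_pos)
      show "real m + 2 \<le> a * real N" using N(1) assms by (simp add: field_simps)
    qed (use n0 assms in auto)
    also have "real n powr (real m + 2) = real n ^ m * real n ^ 2"
      using n0 by (simp add: powr_add powr_realpow)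
    finally have e: "exp (- (c * real n powr a)) \<le> (real N / c) ^ N / (real n ^ m * real n ^ 2)" .
    have "real (n + 1) ^ m \<le> (2 * real n) ^ m" using n0 by (intro power_mono) auto
    then have "real (n + 1) ^ m * exp (- (c * real n powr a))
        \<le> (2 * real n) ^ m * ((real N / c) ^ N / (real n ^ m * real n ^ 2))"
      using e by (intro mult_mono) auto
    also have "\<dots> = ?K * (1 / real n ^ 2)" using n0 by (simp add: power_mult_distrib)
    finally show ?thesis by simp
  qed
  have "summable (\<lambda>n. ?K * (1 / real n ^ 2))"
    using inverse_power_summable[of 2, where 'a = real]
    by (intro summable_mult) (simp add: inverse_eq_divide power_divide)
  then show ?thesis
    using bound by (rule summable_comparison_test'[where N = 1])
qed

lemma ennreal_le_suminf: "f n \<le> (\<Sum>n. f n)" for f :: "nat \<Rightarrow> ennreal"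
  using sum_le_suminf[OF summableI, of "{n}" f] by simp

text \<open>
  Bounding the integrand on the shell \<open>n \<le> norm x < n + 1\<close> by its worst case over the ball of radius
  \<open>n + 1\<close> leaves a convergent series.
\<close>

lemma nn_integral_power_exp_powr_finite:
  fixes c a :: real
  assumes c: "c > 0" and a: "a > 0"
  shows "(\<integral>\<^sup>+(x::'a::euclidean_space). ennreal (norm x ^ j * exp (- (c * norm x powr a))) \<partial>lborel) < \<infinity>"
proof -
  let ?b = "\<lambda>n. real (n + 1) ^ j * exp (- (c * real n powr a))"
  have pw: "ennreal (norm x ^ j * exp (- (c * norm x powr a)))
      \<le> (\<Sum>n. ennreal (?b n) * indicator (ball 0 (real (n + 1))) x)" for x :: 'a
  proof -
    define n where "n = nat \<lfloor>norm x\<rfloor>"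
    have n: "real n \<le> norm x" "norm x < real n + 1" unfolding n_def using norm_ge_zero[of x] by linarith+
    have "norm x ^ j * exp (- (c * norm x powr a)) \<le> ?b n"
      using n c a by (intro mult_mono power_mono) (auto intro!: mult_left_mono powr_mono2)
    then have "ennreal (norm x ^ j * exp (- (c * norm x powr a))) \<le> ennreal (?b n) * indicator (ball 0 (real (n + 1))) x"
      using n by (simp add: ennreal_leI)
    also have "\<dots> \<le> (\<Sum>n. ennreal (?b n) * indicator (ball 0 (real (n + 1))) x)"
      by (rule ennreal_le_suminf)
    finally show ?thesis .
  qed
  have "(\<integral>\<^sup>+(x::'a). ennreal (norm x ^ j * exp (- (c * norm x powr a))) \<partial>lborel)
      \<le> (\<integral>\<^sup>+(x::'a). (\<Sum>n. ennreal (?b n) * indicator (ball 0 (real (n + 1))) x) \<partial>lborel)"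
    by (intro nn_integral_mono pw)
  also have "\<dots> = (\<Sum>n. \<integral>\<^sup>+(x::'a). ennreal (?b n) * indicator (ball 0 (real (n + 1))) x \<partial>lborel)"
    by (rule nn_integral_suminf[where f = "\<lambda>n (x::'a). ennreal (?b n) * indicator (ball 0 (real (n + 1))) x"])
      (intro borel_measurable_times_ennreal borel_measurable_const borel_measurable_indicator; simp)
  also have "\<dots> = (\<Sum>n. ennreal (unit_ball_vol (real DIM('a)) * (real (n + 1) ^ (j + DIM('a)) * exp (- (c * real n powr a)))))"
  proof (rule suminf_cong)
    fix n
    have "(\<integral>\<^sup>+(x::'a). ennreal (?b n) * indicator (ball 0 (real (n + 1))) x \<partial>lborel)
        = ennreal (?b n) * emeasure lborel (ball (0::'a) (real (n + 1)))"
      by (rule nn_integral_cmult_indicator) simp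
    also have "\<dots> = ennreal (?b n) * ennreal (unit_ball_vol (real DIM('a)) * real (n + 1) ^ DIM('a))"
      by (subst emeasure_ball) auto
    also have "\<dots> = ennreal (?b n * (unit_ball_vol (real DIM('a)) * real (n + 1) ^ DIM('a)))"
      by (rule ennreal_mult[symmetric]) auto
    also have "?b n * (unit_ball_vol (real DIM('a)) * real (n + 1) ^ DIM('a))
        = unit_ball_vol (real DIM('a)) * (real (n + 1) ^ (j + DIM('a)) * exp (- (c * real n powr a)))"
      by (simp add: power_add)
    finally show "(\<integral>\<^sup>+(x::'a). ennreal (?b n) * indicator (ball 0 (real (n + 1))) x \<partial>lborel)
        = ennreal (unit_ball_vol (real DIM('a)) * (real (n + 1) ^ (j + DIM('a)) * exp (- (c * real n powr a))))" .
  qed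
  also have "\<dots> < \<infinity>"
    using summable_power_exp_powr[OF c a, of "j + DIM('a)"]
    by (subst suminf_ennreal2) (auto intro: summable_mult)
  finally show ?thesis .
qed

lemma integrable_power_exp_powr:
  fixes c a :: real
  assumes "c > 0" "a > 0"
  shows "integrable lborel (\<lambda>x::'a::euclidean_space. norm x ^ j * exp (- (c * norm x powr a)))"
  using nn_integral_power_exp_powr_finite[OF assms, of j, where 'a = 'a]
  by (intro integrableI_nonneg) auto

lemma powr_nat_norm: "k \<ge> 1 \<Longrightarrow> norm x powr real k = norm x ^ k"
  by (cases "norm x = 0") (auto simp: powr_realpow)

lemma integrable_power_exp_power:
  fixes c :: real
  assumes "c > 0" "k \<ge> (1::nat)"
  shows "integrable lborel (\<lambda>x::'a::euclidean_space. norm x ^ j * exp (- (c * norm x ^ k)))"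
  using integrable_power_exp_powr[OF assms(1), of "real k" j, where 'a = 'a] assms(2)
  by (simp add: powr_nat_norm)

text \<open>
  The transverse integral at unit scale. It is the constant \<open>c\<close> of the Laplace expansion, up to division
  by \<open>flat_unit\<close> if \<open>p \<le> d\<close>.
\<close>

definition radial_mass :: "nat \<Rightarrow> 'a::euclidean_space itself \<Rightarrow> real" where
  "radial_mass k _ = (\<integral>(v::'a). exp (- (norm v ^ k)) \<partial>lborel)"

lemma nn_integral_radial:
  assumes "k \<ge> 1"
  shows "(\<integral>\<^sup>+(v::'a::euclidean_space). ennreal (exp (- (norm v ^ k))) \<partial>lborel) = ennreal (radial_mass k TYPE('a))"
  unfolding radial_mass_def
  using integrable_power_exp_power[of 1 k 0, where 'a = 'a] assms
  by (intro nn_integral_eq_integral) auto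

lemma nn_integral_lborel_pos:
  fixes f :: "'a::euclidean_space \<Rightarrow> real"
  assumes [measurable]: "f \<in> borel_measurable borel" and "\<And>x. f x > 0"
  shows "(\<integral>\<^sup>+x. ennreal (f x) \<partial>lborel) > 0"
proof -
  have "\<not> (AE x in lborel. ennreal (f x) = 0)"
  proof
    assume "AE x in lborel. ennreal (f x) = 0"
    moreover have "ennreal (f x) \<noteq> 0" for x using assms(2)[of x] by simp
    ultimately have "AE x in (lborel :: 'a measure). False" by simp
    then have "emeasure (lborel :: 'a measure) UNIV = 0"
      by (simp add: AE_iff_measurable[OF _ refl])
    then show False by simp
  qed
  then have "(\<integral>\<^sup>+x. ennreal (f x) \<partial>lborel) \<noteq> 0"
    by (subst nn_integral_0_iff_AE) auto
  then show ?thesis by (simp add: zero_less_iff_neq_zero)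
qed

lemma radial_mass_pos: "k \<ge> 1 \<Longrightarrow> radial_mass k TYPE('a::euclidean_space) > 0"
  using nn_integral_lborel_pos[of "\<lambda>v::'a. exp (- (norm v ^ k))"] nn_integral_radial[of k, where 'a = 'a]
  by simp

lemma powr_inverse_power: "\<epsilon> > 0 \<Longrightarrow> k \<ge> 1 \<Longrightarrow> (\<epsilon> powr (1 / real k)) ^ k = \<epsilon>"
  by (simp add: powr_realpow[symmetric] powr_powr)

lemma scaled_norm_power:
  fixes v :: "'a::real_normed_vector"
  assumes "\<epsilon> > 0" "k \<ge> 1"
  shows "norm ((\<epsilon> powr (1 / real k)) *\<^sub>R v) ^ k / \<epsilon> = norm v ^ k"
  using assms by (simp add: power_mult_distrib powr_inverse_power)

text \<open>
  The substitution \<open>x = \<epsilon> powr (1/k) * v\<close>, under which \<open>norm x ^ k / \<epsilon>\<close> becomes \<open>norm v ^ k\<close>.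
\<close>

lemma nn_integral_exp_scaled:
  fixes f :: "'a::euclidean_space \<Rightarrow> real"
  assumes k: "k \<ge> 1" and \<epsilon>: "\<epsilon> > 0" and meas: "f \<in> borel_measurable borel"
  shows "(\<integral>\<^sup>+x. ennreal (f x) \<partial>lborel)
    = ennreal (\<epsilon> powr (DIM('a) / real k)) * (\<integral>\<^sup>+v. ennreal (f ((\<epsilon> powr (1 / real k)) *\<^sub>R v)) \<partial>lborel)"
proof -
  have "\<bar>\<epsilon> powr (1 / real k)\<bar> ^ DIM('a) = \<epsilon> powr (DIM('a) / real k)"
    using \<epsilon> by (simp add: powr_realpow[symmetric] powr_powr)
  then show ?thesis
    using nn_integral_lborel_affine[of "\<lambda>x. ennreal (f x)" "\<epsilon> powr (1 / real k)" 0] \<epsilon> meas by simp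
qed

text \<open>
  Substituting \<open>w = M v\<close> and then rescaling \<open>v\<close>. One additional factor \<open>norm w\<close> gains one factor
  \<open>\<epsilon> powr (1/k)\<close>: this is the origin of the rate.
\<close>

lemma radial_weight_integrals:
  fixes M N :: "real ^ 'p \<Rightarrow> real ^ 'p"
  assumes M: "linear M" and N: "linear N" and NM: "\<And>y. N (M y) = y" and k: "k \<ge> 1"
  shows "\<epsilon> > 0 \<Longrightarrow> (\<integral>\<^sup>+w. ennreal (exp (- (norm (N w) ^ k / \<epsilon>))) \<partial>lborel)
      = ennreal (\<epsilon> powr (CARD('p) / real k) * (\<bar>det (matrix M)\<bar> * radial_mass k TYPE(real ^ 'p)))"
    and "\<exists>K\<ge>0. \<forall>\<epsilon>>0. (\<integral>\<^sup>+w. ennreal (norm w * exp (- (norm (N w) ^ k / \<epsilon>))) \<partial>lborel)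
      \<le> ennreal (K * \<epsilon> powr ((CARD('p) + 1) / real k))"
proof -
  have injM: "inj M" using NM by (metis injI)
  obtain K where K: "K > 0" "\<And>v. norm (M v) \<le> K * norm v"
    using linear_bounded_pos[OF M] by auto
  have low: "norm w / K \<le> norm (N w)" for w
  proof -
    have "surj M" using M injM by (simp add: linear_injective_imp_surjective)
    then obtain v where "w = M v" by (metis surjD)
    then show ?thesis using K by (simp add: NM field_simps)
  qed
  have Nm [measurable]: "N \<in> borel_measurable borel"
    using N by (intro borel_measurable_continuous_onI linear_continuous_on) (simp add: linear_conv_bounded_linear)
  have Mm [measurable]: "M \<in> borel_measurable borel"
    using M by (intro borel_measurable_continuous_onI linear_continuous_on) (simp add: linear_conv_bounded_linear)
  have int: "integrable lborel (\<lambda>w. norm w ^ j * exp (- (norm (N w) ^ k / \<epsilon>)))" if "\<epsilon> > 0" for \<epsilon> j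
  proof (rule Bochner_Integration.integrable_bound)
    let ?c = "(1 / K) ^ k / \<epsilon>"
    show "integrable lborel (\<lambda>w::real ^ 'p. norm w ^ j * exp (- (?c * norm w ^ k)))"
      using that K k by (intro integrable_power_exp_power) auto
    have "?c * norm w ^ k \<le> norm (N w) ^ k / \<epsilon>" for w
    proof -
      have "(norm w / K) ^ k \<le> norm (N w) ^ k" using low K by (intro power_mono) auto
      then have "(norm w / K) ^ k / \<epsilon> \<le> norm (N w) ^ k / \<epsilon>"
        using that by (intro divide_right_mono) auto
      then show ?thesis by (simp add: power_divide)
    qed
    then show "AE w in lborel. norm (norm w ^ j * exp (- (norm (N w) ^ k / \<epsilon>))) \<le> norm (norm w ^ j * exp (- (?c * norm w ^ k)))"
      by (intro AE_I2) (simp add: mult_left_mono)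
  qed measurable
  have scale: "(\<integral>\<^sup>+w. ennreal (norm w ^ j * exp (- (norm (N w) ^ k / \<epsilon>))) \<partial>lborel)
     = ennreal \<bar>det (matrix M)\<bar> * (ennreal (\<epsilon> powr (CARD('p) / real k)) *
        (\<integral>\<^sup>+v. ennreal (norm (M ((\<epsilon> powr (1 / real k)) *\<^sub>R v)) ^ j * exp (- (norm v ^ k))) \<partial>lborel))"
    if "\<epsilon> > 0" for \<epsilon> j
  proof -
    have "(\<integral>\<^sup>+w. ennreal (norm w ^ j * exp (- (norm (N w) ^ k / \<epsilon>))) \<partial>lborel)
      = ennreal \<bar>det (matrix M)\<bar> * (\<integral>\<^sup>+v. ennreal (norm (M v) ^ j * exp (- (norm v ^ k / \<epsilon>))) \<partial>lborel)"
      by (subst nn_integral_linear_image[OF M injM _ _ int[OF that], symmetric]) (simp_all add: NM)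
    also have "(\<integral>\<^sup>+v. ennreal (norm (M v) ^ j * exp (- (norm v ^ k / \<epsilon>))) \<partial>lborel)
      = ennreal (\<epsilon> powr (DIM(real ^ 'p) / real k)) * (\<integral>\<^sup>+v. ennreal (norm (M ((\<epsilon> powr (1 / real k)) *\<^sub>R v)) ^ j
          * exp (- (norm ((\<epsilon> powr (1 / real k)) *\<^sub>R v) ^ k / \<epsilon>))) \<partial>lborel)"
      by (rule nn_integral_exp_scaled[OF k that]) measurable
    finally show ?thesis by (simp only: scaled_norm_power[OF that k]) simp
  qed
  show "(\<integral>\<^sup>+w. ennreal (exp (- (norm (N w) ^ k / \<epsilon>))) \<partial>lborel)
      = ennreal (\<epsilon> powr (CARD('p) / real k) * (\<bar>det (matrix M)\<bar> * radial_mass k TYPE(real ^ 'p)))" if "\<epsilon> > 0"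
    using scale[OF that, of 0] radial_mass_pos[OF k, where 'a = "real ^ 'p"]
    by (simp add: nn_integral_radial[OF k] ennreal_mult[symmetric] mult.left_commute)
  let ?I = "\<integral>(v::real ^ 'p). norm v ^ 1 * exp (- (1 * norm v ^ k)) \<partial>lborel"
  have I: "(\<integral>\<^sup>+(v::real ^ 'p). ennreal (norm v ^ 1 * exp (- (1 * norm v ^ k))) \<partial>lborel) = ennreal ?I"
    using integrable_power_exp_power[of 1 k 1, where 'a = "real ^ 'p"] k
    by (intro nn_integral_eq_integral) auto
  have I0: "?I \<ge> 0" by (rule Bochner_Integration.integral_nonneg) simp
  show "\<exists>K\<ge>0. \<forall>\<epsilon>>0. (\<integral>\<^sup>+w. ennreal (norm w * exp (- (norm (N w) ^ k / \<epsilon>))) \<partial>lborel)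
      \<le> ennreal (K * \<epsilon> powr ((CARD('p) + 1) / real k))"
  proof (intro exI[of _ "\<bar>det (matrix M)\<bar> * (K * ?I)"] conjI allI impI)
    show "0 \<le> \<bar>det (matrix M)\<bar> * (K * ?I)" using K I0 by (intro mult_nonneg_nonneg) auto
    fix \<epsilon> :: real assume \<epsilon>: "\<epsilon> > 0"
    let ?s = "\<epsilon> powr (1 / real k)"
    have "(\<integral>\<^sup>+v. ennreal (norm (M (?s *\<^sub>R v)) ^ 1 * exp (- (norm v ^ k))) \<partial>lborel)
        \<le> (\<integral>\<^sup>+v. ennreal (?s * K) * ennreal (norm (v::real ^ 'p) ^ 1 * exp (- (1 * norm v ^ k))) \<partial>lborel)"
    proof (rule nn_integral_mono)
      fix v :: "real ^ 'p"
      have "norm (M (?s *\<^sub>R v)) \<le> ?s * (K * norm v)"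
        using K(2)[of "?s *\<^sub>R v"] by (simp add: mult.left_commute)
      then show "ennreal (norm (M (?s *\<^sub>R v)) ^ 1 * exp (- (norm v ^ k)))
          \<le> ennreal (?s * K) * ennreal (norm v ^ 1 * exp (- (1 * norm v ^ k)))"
        using K by (simp add: ennreal_mult[symmetric] ennreal_leI mult_right_mono mult.assoc[symmetric])
    qed
    also have "\<dots> = ennreal (?s * K * ?I)"
      using K I0 by (subst nn_integral_cmult) (simp_all only: I, auto simp: ennreal_mult)
    finally have "(\<integral>\<^sup>+w. ennreal (norm w ^ 1 * exp (- (norm (N w) ^ k / \<epsilon>))) \<partial>lborel)
        \<le> ennreal \<bar>det (matrix M)\<bar> * (ennreal (\<epsilon> powr (CARD('p) / real k)) * ennreal (?s * K * ?I))"
      unfolding scale[OF \<epsilon>] by (intro mult_left_mono) auto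
    also have "\<dots> = ennreal (\<bar>det (matrix M)\<bar> * (\<epsilon> powr (CARD('p) / real k) * (?s * K * ?I)))"
      using K I0 by (simp add: ennreal_mult)
    also have "\<bar>det (matrix M)\<bar> * (\<epsilon> powr (CARD('p) / real k) * (?s * K * ?I))
        = \<bar>det (matrix M)\<bar> * (K * ?I) * \<epsilon> powr ((CARD('p) + 1) / real k)"
      using \<epsilon> by (simp add: add_divide_distrib powr_add)
    finally show "(\<integral>\<^sup>+w. ennreal (norm w * exp (- (norm (N w) ^ k / \<epsilon>))) \<partial>lborel)
      \<le> ennreal (\<bar>det (matrix M)\<bar> * (K * ?I) * \<epsilon> powr ((CARD('p) + 1) / real k))" by simp
  qed
qed

section \<open>Local expansion in straightened coordinates\<close>

text \<open>
  Integral against the weight, rescaled so as to have a finite nonzero limit: only the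
  \<open>min d p\<close> directions transverse to the zero set concentrate.
\<close>

definition laplace_mean :: "(real ^ 'd \<Rightarrow> real ^ 'p) \<Rightarrow> nat \<Rightarrow> real \<Rightarrow> (real ^ 'd \<Rightarrow> real) \<Rightarrow> real" where
  "laplace_mean F k \<epsilon> h = \<epsilon> powr (- (real (min CARD('d) CARD('p)) / real k)) *
     (\<integral>x. h x * exp (- (norm (F x) ^ k / \<epsilon>)) \<partial>lborel)"

definition zero_set_integral :: "(real ^ 'd \<Rightarrow> real ^ 'p) \<Rightarrow> (real ^ 'd \<Rightarrow> real) \<Rightarrow> ennreal" where
  "zero_set_integral F h = (\<integral>\<^sup>+x. ennreal (h x / gen_jacobian F x) * indicator (F -` {0}) x \<partial>zero_set_hausdorff F)"

text \<open>
  Laplace expansion near \<open>z\<close> for Lipschitz \<open>h\<close> supported in a ball. The limit \<open>\<Lambda>\<close> is only required to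
  agree with \<open>c * zero_set_integral F h\<close> up to a factor \<open>\<theta>\<close> on either side, which is what a chart with
  distortion close to \<open>1\<close> can give. Over all \<open>z\<close> and \<open>\<theta>\<close> the constant \<open>c\<close> will be the same, whereas \<open>r\<close> and
  \<open>K\<close> depend on them. Finiteness of the
  local mass of the zero set is recorded since it comes from the same chart.
\<close>

definition local_laplace ::
  "(real ^ 'd \<Rightarrow> real ^ 'p) \<Rightarrow> nat \<Rightarrow> real \<Rightarrow> real \<Rightarrow> real ^ 'd \<Rightarrow> real \<Rightarrow> real \<Rightarrow> bool" where
  "local_laplace F k c \<theta> z r K \<longleftrightarrow>
     emeasure (zero_set_hausdorff F) (F -` {0} \<inter> ball z r) < \<infinity> \<and>
     (\<forall>h L b. (\<forall>x. 0 \<le> h x \<and> h x \<le> b) \<and> L-lipschitz_on UNIV h \<and> (\<forall>x. x \<notin> ball z r \<longrightarrow> h x = 0) \<longrightarrow>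
       (\<exists>\<Lambda>\<ge>0. (\<forall>\<epsilon>. 0 < \<epsilon> \<and> \<epsilon> \<le> 1 \<longrightarrow> \<bar>laplace_mean F k \<epsilon> h - \<Lambda>\<bar> \<le> K * (b + L) * \<epsilon> powr (1 / real k)) \<and>
         ennreal \<Lambda> \<le> ennreal (\<theta> * c) * zero_set_integral F h \<and>
         ennreal c * zero_set_integral F h \<le> ennreal (\<theta> * \<Lambda>)))"

lemma sets_zero_set_hausdorff [simp, measurable_cong]: "sets (zero_set_hausdorff F) = sets borel"
  by (simp add: zero_set_hausdorff_def)

lemma space_zero_set_hausdorff [simp]: "space (zero_set_hausdorff F) = UNIV"
  by (simp add: zero_set_hausdorff_def)

text \<open>
  A chart \<open>G\<close> on \<open>ball z R\<close> in which \<open>M \<circ> F\<close> becomes the transverse coordinate projection and all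
  geometric distortions are bounded by \<open>\<theta>\<close>. The image of the chart contains \<open>ball (G z) \<rho>\<close>, and
  functions supported in \<open>ball z r\<close> are carried to functions supported well inside that ball, namely at
  half its radius.
\<close>

locale straightening =
  fixes F :: "real ^ 'd \<Rightarrow> real ^ 'p" and \<iota> :: "'p \<Rightarrow> 'd" and k :: nat
    and G :: "real ^ 'd \<Rightarrow> real ^ 'd" and G' :: "real ^ 'd \<Rightarrow> real ^ 'd \<Rightarrow> real ^ 'd"
    and M N :: "real ^ 'p \<Rightarrow> real ^ 'p" and z :: "real ^ 'd" and R \<rho> r \<theta> :: real
  assumes inj_\<iota>: "inj \<iota>" and k: "k \<ge> 1" and smooth_F: "smooth F" and Fz: "F z = 0"
    and pos: "0 < R" "0 < \<rho>" "0 < r" "r \<le> R" "1 < \<theta>"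
    and M: "linear M" and N: "linear N" and NM: "\<And>y. N (M y) = y"
    and G_part: "\<And>x. coord_part \<iota> (G x) = M (F x)"
    and G_der: "\<And>x. x \<in> ball z R \<Longrightarrow> (G has_derivative G' x) (at x)"
    and G_up: "\<And>x y. x \<in> ball z R \<Longrightarrow> y \<in> ball z R \<Longrightarrow> dist (G x) (G y) \<le> \<theta> * dist x y"
    and G_low: "\<And>x y. x \<in> ball z R \<Longrightarrow> y \<in> ball z R \<Longrightarrow> dist x y \<le> \<theta> * dist (G x) (G y)"
    and G_det: "\<And>x. x \<in> ball z R \<Longrightarrow> 1 / \<theta> \<le> \<bar>det (matrix (G' x))\<bar> \<and> \<bar>det (matrix (G' x))\<bar> \<le> \<theta>"
    and G_detlip: "bdd_lip (ball z R) (\<lambda>x. \<bar>det (matrix (G' x))\<bar>)"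
    and jac_pos: "\<And>x. x \<in> ball z R \<Longrightarrow> 0 < gen_jacobian F x"
    and jac: "\<And>x. x \<in> ball z R \<Longrightarrow> gen_jacobian F x \<le> \<theta> * gen_jacobian F z \<and> gen_jacobian F z \<le> \<theta> * gen_jacobian F x"
    and detM: "\<bar>det (matrix M)\<bar> * gen_jacobian F z = 1"
    and cover: "ball (G z) \<rho> \<subseteq> G ` ball z R"
    and inner: "G ` ball z r \<subseteq> ball (G z) (\<rho> / 2)"
begin

abbreviation "W \<equiv> ball (G z) \<rho>"
abbreviation "Z \<equiv> F -` {0}"

definition g :: "real ^ 'd \<Rightarrow> real ^ 'd" where
  "g y = (if y \<in> W then inv_into (ball z R) G y else z)"

lemma card_le: "CARD('p) \<le> CARD('d)"
  using inj_\<iota> by (metis card_inj_on_le finite_class.finite_UNIV subset_UNIV)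

lemma inj_G: "inj_on G (ball z R)"
proof (rule inj_onI)
  fix x y assume "x \<in> ball z R" "y \<in> ball z R" "G x = G y"
  then show "x = y" using G_low[of x y] by simp
qed

lemma g_in: "y \<in> W \<Longrightarrow> g y \<in> ball z R" and G_g: "y \<in> W \<Longrightarrow> G (g y) = y"
  using cover inv_into_into[of y G "ball z R"] f_inv_into_f[of y G "ball z R"]
  by (auto simp: g_def simp del: mem_ball)

lemma g_G: "x \<in> ball z R \<Longrightarrow> G x \<in> W \<Longrightarrow> g (G x) = x"
  using inv_into_f_f[OF inj_G] by (simp add: g_def del: mem_ball)

lemma g_lip: "y \<in> W \<Longrightarrow> y' \<in> W \<Longrightarrow> dist (g y) (g y') \<le> \<theta> * dist y y'"
  using G_low[OF g_in g_in, of y y'] by (simp add: G_g del: mem_ball)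

lemma g_measurable [measurable]: "g \<in> borel_measurable borel"
proof -
  have "continuous_on W g"
    by (rule lipschitz_on_continuous_on[of \<theta>], rule lipschitz_onI) (use g_lip pos in auto)
  then have "(\<lambda>y. if y \<in> W then g y else z) \<in> borel_measurable borel"
    by (intro borel_measurable_continuous_on_if) auto
  moreover have "(\<lambda>y. if y \<in> W then g y else z) = g" by (auto simp: g_def fun_eq_iff)
  ultimately show ?thesis by simp
qed

lemma ball_subset: "ball z r \<subseteq> ball z R" using pos by (auto simp: subset_ball)

lemma G_in_W: "x \<in> ball z r \<Longrightarrow> G x \<in> W"
  using inner pos by (force simp: subset_iff)

lemma G_flat: "G x \<in> flat \<iota> \<longleftrightarrow> F x = 0"
  using NM[of "F x"] linear_0[OF M] linear_0[OF N] by (auto simp: flat_def G_part)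

lemma measurable_F [measurable]: "F \<in> borel_measurable borel"
  using smooth_continuous_on[OF smooth_F] by (rule borel_measurable_continuous_onI)

lemma measurable_jac [measurable]: "gen_jacobian F \<in> borel_measurable borel"
  using continuous_on_gen_jacobian[OF smooth_F] by (rule borel_measurable_continuous_onI)

lemma Z_borel [measurable]: "Z \<in> sets borel"
  using measurable_sets[OF measurable_F, of "{0}"] by simp

lemma zsh: "zero_set_hausdorff F = hausdorff_measure (CARD('d) - CARD('p))"
  using card_le by (simp add: zero_set_hausdorff_def min_absorb2)

text \<open>
  The zero set and the flat correspond under \<open>G\<close>, which is \<open>\<theta>\<close>-Lipschitz in both directions; this and
  the next lemma compare their Hausdorff measures.
\<close>

lemma flat_image_up:
  "hausdorff_outer (CARD('d) - CARD('p)) (flat \<iota> \<inter> (W \<inter> g -` A)) \<le> ennreal (\<theta> ^ (CARD('d) - CARD('p))) * hausdorff_outer (CARD('d) - CARD('p)) (A \<inter> Z)"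
proof -
  have "flat \<iota> \<inter> (W \<inter> g -` A) \<subseteq> G ` (A \<inter> Z \<inter> ball z R)"
  proof
    fix y assume y: "y \<in> flat \<iota> \<inter> (W \<inter> g -` A)"
    then have "F (g y) = 0" using G_flat[of "g y"] by (simp add: G_g del: mem_ball)
    then show "y \<in> G ` (A \<inter> Z \<inter> ball z R)"
      using y G_g[of y] g_in[of y] by (intro image_eqI[of _ _ "g y"]) (auto simp del: mem_ball)
  qed
  then have "hausdorff_outer (CARD('d) - CARD('p)) (flat \<iota> \<inter> (W \<inter> g -` A)) \<le> hausdorff_outer (CARD('d) - CARD('p)) (G ` (A \<inter> Z \<inter> ball z R))"
    by (rule hausdorff_outer_mono)
  also have "\<dots> \<le> ennreal (\<theta> ^ (CARD('d) - CARD('p))) * hausdorff_outer (CARD('d) - CARD('p)) (A \<inter> Z \<inter> ball z R)"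
    using pos G_up by (intro hausdorff_outer_Lipschitz_image) auto
  also have "\<dots> \<le> ennreal (\<theta> ^ (CARD('d) - CARD('p))) * hausdorff_outer (CARD('d) - CARD('p)) (A \<inter> Z)"
    by (intro mult_left_mono hausdorff_outer_mono) auto
  finally show ?thesis .
qed

lemma flat_image_low:
  "hausdorff_outer (CARD('d) - CARD('p)) (A \<inter> (Z \<inter> ball z r)) \<le> ennreal (\<theta> ^ (CARD('d) - CARD('p))) * hausdorff_outer (CARD('d) - CARD('p)) (flat \<iota> \<inter> (W \<inter> g -` A))"
proof -
  have "A \<inter> (Z \<inter> ball z r) \<subseteq> g ` (flat \<iota> \<inter> (W \<inter> g -` A))"
  proof
    fix x assume x: "x \<in> A \<inter> (Z \<inter> ball z r)"
    then have "g (G x) = x" using G_in_W ball_subset by (intro g_G) auto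
    then show "x \<in> g ` (flat \<iota> \<inter> (W \<inter> g -` A))"
      using x G_in_W[of x] G_flat[of x] by (intro image_eqI[of _ _ "G x"]) (auto simp del: mem_ball)
  qed
  then have "hausdorff_outer (CARD('d) - CARD('p)) (A \<inter> (Z \<inter> ball z r)) \<le> hausdorff_outer (CARD('d) - CARD('p)) (g ` (flat \<iota> \<inter> (W \<inter> g -` A)))"
    by (rule hausdorff_outer_mono)
  also have "\<dots> \<le> ennreal (\<theta> ^ (CARD('d) - CARD('p))) * hausdorff_outer (CARD('d) - CARD('p)) (flat \<iota> \<inter> (W \<inter> g -` A))"
    using pos g_lip by (intro hausdorff_outer_Lipschitz_image) auto
  finally show ?thesis .
qed

text \<open>
  Flat Hausdorff measure transported to the zero set by the inverse chart. By the preceding lemmas it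
  agrees with Hausdorff measure on the zero set near \<open>z\<close> up to the factor \<open>\<theta> ^ n\<close>.
\<close>

definition pulled :: "(real ^ 'd) measure" where
  "pulled = distr (density (flat_measure \<iota>) (indicator W)) borel g"

lemma sets_pulled [simp, measurable_cong]: "sets pulled = sets borel"
  by (simp add: pulled_def)

lemma g_measurable_density: "g \<in> measurable (density (flat_measure \<iota>) (indicator W)) borel"
  using g_measurable by (subst measurable_cong_sets[of _ borel _ borel]) auto

lemma emeasure_pulled: "A \<in> sets borel \<Longrightarrow> emeasure pulled A = hausdorff_outer (CARD('d) - CARD('p)) (flat \<iota> \<inter> (W \<inter> g -` A))"
proof -
  assume A [measurable]: "A \<in> sets borel"
  have gA [measurable]: "g -` A \<in> sets borel"
    using measurable_sets[OF g_measurable A] by simp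
  have "emeasure pulled A = emeasure (density (flat_measure \<iota>) (indicator W)) (g -` A)"
    unfolding pulled_def using g_measurable_density A by (subst emeasure_distr) auto
  also have "\<dots> = emeasure (flat_measure \<iota>) (W \<inter> g -` A)"
    using gA by (subst emeasure_restricted) auto
  finally show ?thesis by (simp add: emeasure_flat_measure)
qed

lemma nn_integral_pulled:
  assumes [measurable]: "f \<in> borel_measurable borel"
  shows "(\<integral>\<^sup>+x. f x \<partial>pulled) = (\<integral>\<^sup>+t. f (g t) * indicator W t \<partial>flat_measure \<iota>)"
proof -
  have "(\<integral>\<^sup>+x. f x \<partial>pulled) = (\<integral>\<^sup>+t. f (g t) \<partial>density (flat_measure \<iota>) (indicator W))"
    unfolding pulled_def by (rule nn_integral_distr[OF g_measurable_density]) simp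
  also have "\<dots> = (\<integral>\<^sup>+t. indicator W t * f (g t) \<partial>flat_measure \<iota>)"
  proof (rule nn_integral_density)
    show "indicator W \<in> borel_measurable (flat_measure \<iota>)" by (rule borel_measurable_indicator) simp
    have "(\<lambda>t. f (g t)) \<in> borel_measurable borel" by measurable
    then show "(\<lambda>t. f (g t)) \<in> borel_measurable (flat_measure \<iota>)"
      by (subst measurable_cong_sets[of _ borel _ borel]) auto
  qed
  finally show ?thesis by (simp add: mult.commute)
qed

lemma pulled_le:
  assumes [measurable]: "f \<in> borel_measurable borel"
  shows "(\<integral>\<^sup>+x. f x \<partial>pulled) \<le> ennreal (\<theta> ^ (CARD('d) - CARD('p))) * (\<integral>\<^sup>+x. f x * indicator Z x \<partial>zero_set_hausdorff F)"
proof -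
  let ?H = "scale_measure (ennreal (\<theta> ^ (CARD('d) - CARD('p)))) (density (zero_set_hausdorff F) (indicator Z))"
  have "emeasure pulled A \<le> emeasure ?H A" if A [measurable]: "A \<in> sets borel" for A
  proof -
    have "emeasure (density (zero_set_hausdorff F) (indicator Z)) A = emeasure (zero_set_hausdorff F) (A \<inter> Z)"
      by (subst emeasure_restricted) (auto simp: Int_commute)
    also have "\<dots> = hausdorff_outer (CARD('d) - CARD('p)) (A \<inter> Z)" by (simp add: zsh emeasure_hausdorff_measure)
    finally show ?thesis using flat_image_up[of A] by (simp add: emeasure_pulled)
  qed
  then have "pulled \<le> ?H" by (subst le_measure) auto
  then have "(\<integral>\<^sup>+x. f x \<partial>pulled) \<le> (\<integral>\<^sup>+x. f x \<partial>?H)"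
    by (intro nn_integral_mono_measure) simp
  then show ?thesis
    by (simp add: nn_integral_scale_measure nn_integral_density mult.commute)
qed

lemma pulled_ge:
  assumes [measurable]: "f \<in> borel_measurable borel"
  shows "(\<integral>\<^sup>+x. f x * indicator (Z \<inter> ball z r) x \<partial>zero_set_hausdorff F) \<le> ennreal (\<theta> ^ (CARD('d) - CARD('p))) * (\<integral>\<^sup>+x. f x \<partial>pulled)"
proof -
  let ?H = "density (zero_set_hausdorff F) (indicator (Z \<inter> ball z r))"
  have [measurable]: "Z \<inter> ball z r \<in> sets borel" by (intro sets.Int Z_borel) simp
  have "emeasure ?H A \<le> emeasure (scale_measure (ennreal (\<theta> ^ (CARD('d) - CARD('p)))) pulled) A" if A [measurable]: "A \<in> sets borel" for A
  proof -
    have "emeasure ?H A = emeasure (zero_set_hausdorff F) (A \<inter> (Z \<inter> ball z r))"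
      by (subst emeasure_restricted) (auto simp: Int_commute)
    also have "\<dots> = hausdorff_outer (CARD('d) - CARD('p)) (A \<inter> (Z \<inter> ball z r))" by (simp add: zsh emeasure_hausdorff_measure)
    finally show ?thesis using flat_image_low[of A] by (simp add: emeasure_pulled)
  qed
  then have "?H \<le> scale_measure (ennreal (\<theta> ^ (CARD('d) - CARD('p)))) pulled" by (subst le_measure) auto
  then have "(\<integral>\<^sup>+x. f x \<partial>?H) \<le> (\<integral>\<^sup>+x. f x \<partial>scale_measure (ennreal (\<theta> ^ (CARD('d) - CARD('p)))) pulled)"
    by (intro nn_integral_mono_measure) simp
  then show ?thesis
    by (simp add: nn_integral_scale_measure nn_integral_density mult.commute)
qed

lemma flat_W_finite: "emeasure (flat_measure \<iota>) W < \<infinity>"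
  by (rule flat_measure_bounded_finite[OF inj_\<iota>]) auto

lemma Gz_flat: "G z \<in> flat \<iota>" using G_flat[of z] Fz by simp

lemma zero_set_finite: "emeasure (zero_set_hausdorff F) (Z \<inter> ball z r) < \<infinity>"
proof -
  have "emeasure (zero_set_hausdorff F) (Z \<inter> ball z r) = hausdorff_outer (CARD('d) - CARD('p)) (UNIV \<inter> (Z \<inter> ball z r))"
    by (simp add: zsh emeasure_hausdorff_measure)
  also have "\<dots> \<le> ennreal (\<theta> ^ (CARD('d) - CARD('p))) * hausdorff_outer (CARD('d) - CARD('p)) (flat \<iota> \<inter> (W \<inter> g -` UNIV))"
    by (rule flat_image_low)
  also have "\<dots> = ennreal (\<theta> ^ (CARD('d) - CARD('p))) * emeasure (flat_measure \<iota>) W"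
    by (simp add: emeasure_flat_measure)
  also have "\<dots> < \<infinity>" using flat_W_finite by (simp add: ennreal_mult_less_top)
  finally show ?thesis .
qed

lemma zero_set_pos: "0 < emeasure (zero_set_hausdorff F) Z"
proof -
  have "0 < emeasure (flat_measure \<iota>) W"
    by (rule flat_measure_ball_pos[OF inj_\<iota> Gz_flat pos(2)])
  also have "\<dots> = hausdorff_outer (CARD('d) - CARD('p)) (flat \<iota> \<inter> (W \<inter> g -` UNIV))" by (simp add: emeasure_flat_measure)
  also have "\<dots> \<le> ennreal (\<theta> ^ (CARD('d) - CARD('p))) * hausdorff_outer (CARD('d) - CARD('p)) (UNIV \<inter> Z)" by (rule flat_image_up)
  also have "\<dots> = ennreal (\<theta> ^ (CARD('d) - CARD('p))) * emeasure (zero_set_hausdorff F) Z"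
    by (simp add: zsh emeasure_hausdorff_measure)
  finally show ?thesis by (auto simp: zero_less_iff_neq_zero)
qed

text \<open>
  The density of the image under \<open>G\<close> of the measure with density \<open>h\<close>.
\<close>

definition u :: "(real ^ 'd \<Rightarrow> real) \<Rightarrow> real ^ 'd \<Rightarrow> real" where
  "u h y = (if y \<in> W then h (g y) / \<bar>det (matrix (G' (g y)))\<bar> else 0)"

lemma u_nonneg: "(\<And>x. 0 \<le> h x) \<Longrightarrow> 0 \<le> u h y"
  by (simp add: u_def)

lemma det_pos: "x \<in> ball z R \<Longrightarrow> 0 < \<bar>det (matrix (G' x))\<bar>"
  using G_det[of x] pos by (smt (verit) divide_pos_pos)

lemma u_le:
  assumes h: "\<And>x. 0 \<le> h x" "\<And>x. h x \<le> b"
  shows "u h y \<le> b * \<theta>"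
proof (cases "y \<in> W")
  case True
  let ?J = "\<bar>det (matrix (G' (g y)))\<bar>"
  have J: "1 / \<theta> \<le> ?J" "0 < ?J" using G_det[OF g_in[OF True]] det_pos[OF g_in[OF True]] by auto
  have "h (g y) / ?J \<le> b / (1 / \<theta>)"
    using h J pos order_trans[OF h(1) h(2)] by (intro frac_le) auto
  then show ?thesis using True by (simp add: u_def)
next
  case False
  have "0 \<le> b" using h order_trans by blast
  then show ?thesis using False pos by (simp add: u_def)
qed

text \<open>
  For two points of \<open>W\<close> this is the product rule for Lipschitz functions. If only one of them lies in
  \<open>W\<close>, the function vanishes at the other and, where it is nonzero, the two points are at distance at
  least \<open>\<rho> / 2\<close> by the choice of \<open>r\<close>, so boundedness suffices.
\<close>

lemma u_lipschitz:
  "\<exists>C\<ge>0. \<forall>h L b. (\<forall>x. 0 \<le> h x \<and> h x \<le> b) \<and> L-lipschitz_on UNIV h \<and> (\<forall>x. x \<notin> ball z r \<longrightarrow> h x = 0) \<longrightarrow>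
     (\<forall>y y'. \<bar>u h y - u h y'\<bar> \<le> C * (b + L) * dist y y')"
proof -
  have "bdd_lip (ball z R) (\<lambda>x. 1 / \<bar>det (matrix (G' x))\<bar>)"
    using G_det pos by (intro bdd_lip_inverse[OF G_detlip, of "1 / \<theta>"]) auto
  then obtain B L' where B: "0 \<le> B" "0 \<le> L'"
      "\<And>x. x \<in> ball z R \<Longrightarrow> \<bar>1 / \<bar>det (matrix (G' x))\<bar>\<bar> \<le> B"
      "\<And>x y. x \<in> ball z R \<Longrightarrow> y \<in> ball z R \<Longrightarrow>
        \<bar>1 / \<bar>det (matrix (G' x))\<bar> - 1 / \<bar>det (matrix (G' y))\<bar>\<bar> \<le> L' * dist x y"
    by (rule bdd_lipE) (rule that)
  define C where "C = \<theta> * (B + L') + 2 * \<theta> / \<rho>"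
  have C: "C \<ge> 0" "C \<ge> \<theta> * (B + L')" "C \<ge> 2 * \<theta> / \<rho>" using B pos by (simp_all add: C_def)
  show ?thesis
  proof (intro exI[of _ C] conjI allI impI C(1))
    fix h :: "real ^ 'd \<Rightarrow> real" and L b :: real and y y' :: "real ^ 'd"
    assume H: "(\<forall>x. 0 \<le> h x \<and> h x \<le> b) \<and> L-lipschitz_on UNIV h \<and> (\<forall>x. x \<notin> ball z r \<longrightarrow> h x = 0)"
    then have h: "\<And>x. 0 \<le> h x" "\<And>x. h x \<le> b" "\<And>x y. \<bar>h x - h y\<bar> \<le> L * dist x y" "L \<ge> 0"
      "\<And>x. x \<notin> ball z r \<Longrightarrow> h x = 0"
      by (auto simp: lipschitz_on_def dist_real_def)
    have b: "b \<ge> 0" using h(1,2) order_trans by blast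
    have both: "\<bar>u h y - u h y'\<bar> \<le> C * (b + L) * dist y y'" if "y \<in> W" "y' \<in> W" for y y'
    proof -
      let ?J = "\<lambda>x. 1 / \<bar>det (matrix (G' x))\<bar>"
      have gy: "g y \<in> ball z R" "g y' \<in> ball z R" using that g_in by auto
      have "\<bar>h (g y) * ?J (g y) - h (g y') * ?J (g y')\<bar>
          \<le> b * \<bar>?J (g y) - ?J (g y')\<bar> + B * \<bar>h (g y) - h (g y')\<bar>"
        using h(1,2)[of "g y"] B(3)[OF gy(2)] by (intro abs_mult_diff_le) auto
      also have "\<dots> \<le> b * (L' * dist (g y) (g y')) + B * (L * dist (g y) (g y'))"
        using B(4)[OF gy] h(3)[of "g y" "g y'"] B(1) b by (intro add_mono mult_left_mono) auto
      also have "\<dots> = (b * L' + B * L) * dist (g y) (g y')" by (simp add: algebra_simps)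
      also have "\<dots> \<le> ((B + L') * (b + L)) * (\<theta> * dist y y')"
      proof (rule mult_mono)
        have "0 \<le> B * b" "0 \<le> L' * L" using B b h(4) by auto
        then show "b * L' + B * L \<le> (B + L') * (b + L)" by (simp add: algebra_simps)
      qed (use g_lip[OF that] B b h(4) in auto)
      also have "\<dots> = (\<theta> * (B + L')) * ((b + L) * dist y y')" by (simp add: algebra_simps)
      also have "\<dots> \<le> C * ((b + L) * dist y y')"
        using C b h(4) by (intro mult_right_mono) auto
      finally show ?thesis using that by (simp add: u_def mult.assoc)
    qed
    have one: "\<bar>u h y - u h y'\<bar> \<le> C * (b + L) * dist y y'" if y: "y \<in> W" "y' \<notin> W" for y y'
    proof (cases "u h y = 0")
      case True
      moreover have "u h y' = 0" using y by (simp add: u_def)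
      ultimately show ?thesis using C b h(4) by simp
    next
      case False
      then have "h (g y) \<noteq> 0" using y by (auto simp: u_def)
      then have "g y \<in> ball z r" using h(5) by blast
      then have "G (g y) \<in> G ` ball z r" by (rule imageI)
      then have "y \<in> ball (G z) (\<rho> / 2)" unfolding G_g[OF y(1)] by (rule subsetD[OF inner])
      then have "\<rho> / 2 \<le> dist y y'"
        using y(2) dist_triangle[of "G z" y' y] by auto
      then have "1 \<le> 2 / \<rho> * dist y y'" using pos by (simp add: field_simps)
      then have "b * \<theta> * 1 \<le> b * \<theta> * (2 / \<rho> * dist y y')" using b pos by (intro mult_left_mono) auto
      also have "\<dots> = 2 * \<theta> / \<rho> * (b * dist y y')" by simp
      also have "\<dots> \<le> C * ((b + L) * dist y y')"
        using C b h(4) by (intro mult_mono) (auto intro!: mult_right_mono)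
      finally have "b * \<theta> \<le> C * (b + L) * dist y y'" by (simp add: mult.assoc)
      moreover have "u h y' = 0" using y by (simp add: u_def)
      ultimately show ?thesis using u_le[of h b y] u_nonneg[of h y] h by simp
    qed
    show "\<bar>u h y - u h y'\<bar> \<le> C * (b + L) * dist y y'"
    proof (cases "y \<in> W"; cases "y' \<in> W")
      assume "y \<notin> W" "y' \<in> W"
      then show ?thesis using one[of y' y] by (simp add: abs_minus_commute dist_commute)
    next
      assume "y \<notin> W" "y' \<notin> W"
      then show ?thesis using C b h(4) by (simp add: u_def)
    qed (use both one in auto)
  qed
qed

text \<open>
  In the new coordinates the weight depends on the transverse part only.
\<close>

lemma straightened_integral:
  assumes h: "\<And>x. 0 \<le> h x" "\<And>x. h x \<le> b" "L-lipschitz_on UNIV h" "\<And>x. x \<notin> ball z r \<Longrightarrow> h x = 0"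
    and um: "u h \<in> borel_measurable borel" and \<epsilon>: "\<epsilon> > 0"
  shows "integrable lborel (\<lambda>x. h x * exp (- (norm (F x) ^ k / \<epsilon>)))"
    and "(\<integral>\<^sup>+y. ennreal (u h y * exp (- (norm (N (coord_part \<iota> y)) ^ k / \<epsilon>))) \<partial>lborel)
      = ennreal (\<integral>x. h x * exp (- (norm (F x) ^ k / \<epsilon>)) \<partial>lborel)"
proof -
  have hm [measurable]: "h \<in> borel_measurable borel"
    using lipschitz_on_continuous_on[OF h(3)] by (rule borel_measurable_continuous_onI)
  note um [measurable]
  have Nm [measurable]: "N \<in> borel_measurable borel"
    using N by (intro borel_measurable_continuous_onI linear_continuous_on) (simp add: linear_conv_bounded_linear)
  show int: "integrable lborel (\<lambda>x. h x * exp (- (norm (F x) ^ k / \<epsilon>)))"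
  proof (rule Bochner_Integration.integrable_bound)
    show "integrable lborel (\<lambda>x. b * indicator (ball z r) x :: real)"
      using emeasure_lborel_ball_finite[of z r] by (intro integrable_mult_right integrable_real_indicator) auto
    show "AE x in lborel. norm (h x * exp (- (norm (F x) ^ k / \<epsilon>))) \<le> norm (b * indicator (ball z r) x :: real)"
    proof (rule AE_I2)
      fix x
      have e: "exp (- (norm (F x) ^ k / \<epsilon>)) \<le> 1" using \<epsilon> by simp
      show "norm (h x * exp (- (norm (F x) ^ k / \<epsilon>))) \<le> norm (b * indicator (ball z r) x :: real)"
      proof (cases "x \<in> ball z r")
        case True
        have "h x * exp (- (norm (F x) ^ k / \<epsilon>)) \<le> b * 1"
          using h(1)[of x] h(2)[of x] e by (intro mult_mono) auto
        then show ?thesis using True h(1)[of x] h(2)[of x] by (simp add: abs_mult)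
      qed (use h(4) in auto)
    qed
  qed measurable
  let ?S = "ball z R \<inter> G -` W"
  have contG: "continuous_on (ball z R) G"
    using G_der by (intro has_derivative_continuous_on) (auto intro: has_derivative_at_withinI)
  have S: "open ?S" using contG by (intro continuous_open_preimage) auto
  have GS: "G ` ?S = W" using cover by blast
  let ?f = "\<lambda>y. u h y * exp (- (norm (N (coord_part \<iota> y)) ^ k / \<epsilon>))"
  have left: "(\<lambda>x. indicator ?S x * (\<bar>det (matrix (G' x))\<bar> * ?f (G x))) = (\<lambda>x. h x * exp (- (norm (F x) ^ k / \<epsilon>)))"
  proof
    fix x
    show "indicator ?S x * (\<bar>det (matrix (G' x))\<bar> * ?f (G x)) = h x * exp (- (norm (F x) ^ k / \<epsilon>))"
    proof (cases "x \<in> ?S")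
      case True
      then have x: "x \<in> ball z R" "G x \<in> W" by auto
      then show ?thesis
        using True det_pos[OF x(1)] by (simp add: u_def g_G[OF x] G_part NM del: mem_ball)
    next
      case False
      then have "x \<notin> ball z r" using G_in_W[of x] ball_subset by blast
      then show ?thesis using False h(4) by (simp del: mem_ball)
    qed
  qed
  have right: "(\<lambda>y. indicator (G ` ?S) y * ?f y) = ?f"
    unfolding GS by (auto simp: fun_eq_iff indicator_def u_def)
  have "has_bochner_integral lborel (\<lambda>x. indicator ?S x * (\<bar>det (matrix (G' x))\<bar> * ?f (G x)))
        (\<integral>x. h x * exp (- (norm (F x) ^ k / \<epsilon>)) \<partial>lborel)
     \<longleftrightarrow> has_bochner_integral lborel (\<lambda>y. indicator (G ` ?S) y * ?f y)
        (\<integral>x. h x * exp (- (norm (F x) ^ k / \<epsilon>)) \<partial>lborel)"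
  proof (rule change_of_variables[OF S])
    show "inj_on G ?S" using inj_G by (rule inj_on_subset) auto
    show "(\<lambda>x. indicator ?S x * (\<bar>det (matrix (G' x))\<bar> * ?f (G x))) \<in> borel_measurable borel"
      unfolding left by measurable
    show "(\<lambda>y. indicator (G ` ?S) y * ?f y) \<in> borel_measurable borel"
      unfolding right by measurable
  qed (use G_der in auto)
  then have "has_bochner_integral lborel ?f (\<integral>x. h x * exp (- (norm (F x) ^ k / \<epsilon>)) \<partial>lborel)"
    unfolding left right using int by (simp add: has_bochner_integral_integrable)
  then show "(\<integral>\<^sup>+y. ennreal (?f y) \<partial>lborel) = ennreal (\<integral>x. h x * exp (- (norm (F x) ^ k / \<epsilon>)) \<partial>lborel)"
    using u_nonneg[of h] h(1) by (subst nn_integral_eq_integral) (auto simp: has_bochner_integral_iff)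
qed

text \<open>
  Write \<open>\<Psi> w\<close> for the integral of \<open>u h\<close> over the flat shifted by \<open>w\<close>. Then \<open>\<Psi>\<close> differs from its value at
  \<open>0\<close> by at most a multiple of \<open>norm w\<close>, so integrating it against the transverse weight leaves
  \<open>\<Psi> 0\<close> times the radial integral, with an error smaller by \<open>\<epsilon> powr (1/k)\<close>. The value \<open>\<Psi> 0\<close> is an
  integral over the zero set via the measure \<open>pulled\<close>. The exponent of \<open>\<theta>\<close> counts the distortions:
  \<open>n\<close> from Hausdorff measure, one from \<open>det G'\<close> and one from the variation of \<open>JF\<close>.
\<close>

theorem local_laplace_straightened:
  "\<exists>K\<ge>0. local_laplace F k (radial_mass k TYPE(real ^ 'p) / enn2real (flat_unit \<iota>))
     (\<theta> ^ (CARD('d) - CARD('p) + 2)) z r K"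
proof -
  let ?n = "CARD('d) - CARD('p)" and ?a = "radial_mass k TYPE(real ^ 'p)"
  define \<kappa> where "\<kappa> = enn2real (flat_unit \<iota>)"
  have \<kappa>: "flat_unit \<iota> = ennreal \<kappa>" "\<kappa> > 0"
    using flat_unit_pos[OF inj_\<iota>] flat_unit_finite[OF inj_\<iota>]
    by (auto simp: \<kappa>_def enn2real_positive_iff)
  have a: "?a > 0" by (rule radial_mass_pos[OF k])
  define D where "D = \<bar>det (matrix M)\<bar>"
  have Jz: "gen_jacobian F z > 0" using jac_pos pos by simp
  have D: "D > 0" "1 / gen_jacobian F z = D"
    using detM Jz by (auto simp: D_def field_simps zero_less_mult_iff)
  define m where "m = enn2real (emeasure (flat_measure \<iota>) W)"
  have m: "emeasure (flat_measure \<iota>) W = ennreal m" "m \<ge> 0"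
    using flat_W_finite by (auto simp: m_def)
  obtain C where C: "C \<ge> 0" "\<And>h L b y y'. (\<forall>x. 0 \<le> h x \<and> h x \<le> b) \<Longrightarrow> L-lipschitz_on UNIV h \<Longrightarrow>
      (\<forall>x. x \<notin> ball z r \<longrightarrow> h x = 0) \<Longrightarrow> \<bar>u h y - u h y'\<bar> \<le> C * (b + L) * dist y y'"
    using u_lipschitz by blast
  obtain K2 where K2: "K2 \<ge> 0" "\<And>\<epsilon>. \<epsilon> > 0 \<Longrightarrow>
      (\<integral>\<^sup>+w. ennreal (norm w * exp (- (norm (N w) ^ k / \<epsilon>))) \<partial>lborel) \<le> ennreal (K2 * \<epsilon> powr ((CARD('p) + 1) / real k))"
    using radial_weight_integrals(2)[OF M N NM k] by blast
  note I0 = radial_weight_integrals(1)[OF M N NM k]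
  have Nm [measurable]: "N \<in> borel_measurable borel"
    using N by (intro borel_measurable_continuous_onI linear_continuous_on) (simp add: linear_conv_bounded_linear)
  define K where "K = m * K2 * C / \<kappa>"
  have main: "\<exists>\<Lambda>\<ge>0. (\<forall>\<epsilon>. 0 < \<epsilon> \<and> \<epsilon> \<le> 1 \<longrightarrow> \<bar>laplace_mean F k \<epsilon> h - \<Lambda>\<bar> \<le> K * (b + L) * \<epsilon> powr (1 / real k)) \<and>
      ennreal \<Lambda> \<le> ennreal (\<theta> ^ (?n + 2) * (?a / \<kappa>)) * zero_set_integral F h \<and>
      ennreal (?a / \<kappa>) * zero_set_integral F h \<le> ennreal (\<theta> ^ (?n + 2) * \<Lambda>)"
    if H: "\<forall>x. 0 \<le> h x \<and> h x \<le> b" "L-lipschitz_on UNIV h" "\<forall>x. x \<notin> ball z r \<longrightarrow> h x = 0" for h L b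
  proof -
    have h: "\<And>x. 0 \<le> h x" "\<And>x. h x \<le> b" "\<And>x. x \<notin> ball z r \<Longrightarrow> h x = 0" "L \<ge> 0"
      using H by (auto simp: lipschitz_on_def)
    have b: "b \<ge> 0" using h(1,2) order_trans by blast
    have hm [measurable]: "h \<in> borel_measurable borel"
      using lipschitz_on_continuous_on[OF H(2)] by (rule borel_measurable_continuous_onI)
    define K1 where "K1 = C * (b + L)"
    have K1: "K1 \<ge> 0" using C b h by (simp add: K1_def)
    have ulip: "\<bar>u h y - u h y'\<bar> \<le> K1 * dist y y'" for y y' unfolding K1_def by (rule C(2)[OF H])
    have um [measurable]: "u h \<in> borel_measurable borel"
    proof (rule borel_measurable_continuous_onI, rule lipschitz_on_continuous_on)
      show "K1-lipschitz_on UNIV (u h)"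
        using ulip K1 by (intro lipschitz_onI) (auto simp: dist_real_def)
    qed
    have u0: "u h y \<ge> 0" for y by (rule u_nonneg[OF h(1)])
    define \<Psi> where "\<Psi> w = (\<integral>\<^sup>+t. ennreal (u h (t + coord_embed \<iota> w)) \<partial>flat_measure \<iota>)" for w :: "real ^ 'p"
    interpret FM: sigma_finite_measure "flat_measure \<iota>" by (rule sigma_finite_flat_measure[OF inj_\<iota>])
    have \<Psi>m [measurable]: "\<Psi> \<in> borel_measurable borel"
      unfolding \<Psi>_def by (rule FM.borel_measurable_nn_integral) measurable
    \<comment> \<open>shifting orthogonally to the flat does not bring a point closer to \<open>G z\<close>\<close>
    have far: "u h (t + coord_embed \<iota> w) = 0" if t: "t \<in> flat \<iota>" "t \<notin> W" for t w
    proof -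
      have "(norm (t - G z + coord_embed \<iota> w))\<^sup>2 = (norm (t - G z))\<^sup>2 + (norm w)\<^sup>2"
        using t Gz_flat by (intro norm_flat_add_embed[OF inj_\<iota>] flat_diff)
      then have "(norm (t - G z))\<^sup>2 \<le> (norm (t - G z + coord_embed \<iota> w))\<^sup>2" by simp
      then have "dist t (G z) \<le> dist (t + coord_embed \<iota> w) (G z)"
        by (simp add: dist_norm algebra_simps abs_le_square_iff[symmetric])
      then show ?thesis using t(2) by (simp add: u_def dist_commute)
    qed
    have near: "\<bar>u h (t + coord_embed \<iota> w) - u h t\<bar> \<le> K1 * norm w" for t w
      using ulip[of "t + coord_embed \<iota> w" t] inj_\<iota> by (simp add: dist_norm)
    define \<Psi>0 where "\<Psi>0 = (\<integral>\<^sup>+t. ennreal (u h t) \<partial>flat_measure \<iota>)"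
    have indW: "(\<integral>\<^sup>+t. ennreal c * indicator W t \<partial>flat_measure \<iota>) = ennreal (c * m)" if "c \<ge> 0" for c
      using m that by (subst nn_integral_cmult_indicator) (auto simp: ennreal_mult)
    have Wm [measurable]: "W \<in> sets borel" by simp
    have up: "\<Psi> w \<le> \<Psi>0 + ennreal (K1 * norm w * m)" for w
    proof -
      have "\<Psi> w \<le> (\<integral>\<^sup>+t. ennreal (u h t) + ennreal (K1 * norm w) * indicator W t \<partial>flat_measure \<iota>)"
        unfolding \<Psi>_def
      proof (rule nn_integral_mono_AE)
        show "AE t in flat_measure \<iota>. ennreal (u h (t + coord_embed \<iota> w)) \<le> ennreal (u h t) + ennreal (K1 * norm w) * indicator W t"
          using AE_flat_measure[of \<iota>]
        proof eventually_elim
          case (elim t)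
          show ?case
          proof (cases "t \<in> W")
            case True
            have "ennreal (u h (t + coord_embed \<iota> w)) \<le> ennreal (u h t + K1 * norm w)"
              using near[of t w] by (intro ennreal_leI) linarith
            also have "\<dots> = ennreal (u h t) + ennreal (K1 * norm w)" using u0 K1 by (intro ennreal_plus) auto
            finally show ?thesis using True by (simp del: mem_ball)
          qed (use far[OF elim] in simp)
        qed
      qed
      also have "\<dots> = \<Psi>0 + ennreal (K1 * norm w * m)"
        using K1 unfolding \<Psi>0_def by (subst nn_integral_add) (auto simp: indW[simplified])
      finally show ?thesis .
    qed
    have low: "\<Psi>0 \<le> \<Psi> w + ennreal (K1 * norm w * m)" for w
    proof -
      have "\<Psi>0 \<le> (\<integral>\<^sup>+t. ennreal (u h (t + coord_embed \<iota> w)) + ennreal (K1 * norm w) * indicator W t \<partial>flat_measure \<iota>)"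
        unfolding \<Psi>0_def
      proof (rule nn_integral_mono)
        fix t
        show "ennreal (u h t) \<le> ennreal (u h (t + coord_embed \<iota> w)) + ennreal (K1 * norm w) * indicator W t"
        proof (cases "t \<in> W")
          case True
          have "ennreal (u h t) \<le> ennreal (u h (t + coord_embed \<iota> w) + K1 * norm w)"
            using near[of t w] by (intro ennreal_leI) linarith
          also have "\<dots> = ennreal (u h (t + coord_embed \<iota> w)) + ennreal (K1 * norm w)" using u0 K1 by (intro ennreal_plus) auto
          finally show ?thesis using True by (simp del: mem_ball)
        qed (simp add: u_def)
      qed
      also have "\<dots> = \<Psi> w + ennreal (K1 * norm w * m)"
        using K1 unfolding \<Psi>_def by (subst nn_integral_add) (auto simp: indW[simplified])
      finally show ?thesis .
    qed
    have \<Psi>0_fin: "\<Psi>0 < \<infinity>"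
    proof -
      have "\<Psi>0 \<le> (\<integral>\<^sup>+t. ennreal (b * \<theta>) * indicator W t \<partial>flat_measure \<iota>)"
        unfolding \<Psi>0_def
      proof (rule nn_integral_mono)
        fix t show "ennreal (u h t) \<le> ennreal (b * \<theta>) * indicator W t"
          using u_le[of h b t, OF h(1,2)] by (cases "t \<in> W") (simp_all add: ennreal_leI u_def)
      qed
      also have "\<dots> = ennreal (b * \<theta> * m)" using b pos by (intro indW) auto
      finally show ?thesis by (simp add: le_less_trans)
    qed
    define \<psi> where "\<psi> = enn2real \<Psi>0"
    have \<psi>: "\<Psi>0 = ennreal \<psi>" "\<psi> \<ge> 0" using \<Psi>0_fin by (auto simp: \<psi>_def)
    define \<Lambda> where "\<Lambda> = ?a * D * \<psi> / \<kappa>"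
    have \<Lambda>0: "\<Lambda> \<ge> 0" using a D \<psi> \<kappa> by (simp add: \<Lambda>_def)
    have rate: "\<bar>laplace_mean F k \<epsilon> h - \<Lambda>\<bar> \<le> K * (b + L) * \<epsilon> powr (1 / real k)" if \<epsilon>: "\<epsilon> > 0" for \<epsilon>
    proof -
      let ?e = "\<lambda>w. exp (- (norm (N w) ^ k / \<epsilon>))"
      define X where "X = (\<integral>x. h x * exp (- (norm (F x) ^ k / \<epsilon>)) \<partial>lborel)"
      have X0: "X \<ge> 0" unfolding X_def using h(1) by (intro Bochner_Integration.integral_nonneg) auto
      define P where "P = \<epsilon> powr (CARD('p) / real k)"
      have P: "P > 0" using \<epsilon> by (simp add: P_def)
      define Q where "Q = K1 * m * (K2 * \<epsilon> powr ((CARD('p) + 1) / real k))"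
      have Q0: "Q \<ge> 0" using K1 m K2 by (simp add: Q_def)
      have k1: "(\<integral>\<^sup>+w. ennreal (?e w) * ennreal (K1 * norm w * m) \<partial>lborel) \<le> ennreal Q"
      proof -
        have "(\<integral>\<^sup>+w. ennreal (?e w) * ennreal (K1 * norm w * m) \<partial>lborel)
            = (\<integral>\<^sup>+w. ennreal (K1 * m) * ennreal (norm w * ?e w) \<partial>lborel)"
          using K1 m by (intro nn_integral_cong) (simp add: ennreal_mult[symmetric] ac_simps)
        also have "\<dots> = ennreal (K1 * m) * (\<integral>\<^sup>+w. ennreal (norm w * ?e w) \<partial>lborel)"
          by (rule nn_integral_cmult) measurable
        also have "\<dots> \<le> ennreal (K1 * m) * ennreal (K2 * \<epsilon> powr ((CARD('p) + 1) / real k))"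
          by (intro mult_left_mono K2 \<epsilon>) auto
        also have "\<dots> = ennreal Q" using K1 m K2 by (simp add: Q_def ennreal_mult)
        finally show ?thesis .
      qed
      have k0: "(\<integral>\<^sup>+w. ennreal (?e w) * \<Psi>0 \<partial>lborel) = ennreal (P * (D * ?a) * \<psi>)"
      proof -
        have "(\<integral>\<^sup>+w. ennreal (?e w) * \<Psi>0 \<partial>lborel) = (\<integral>\<^sup>+w. ennreal (?e w) \<partial>lborel) * \<Psi>0"
          by (rule nn_integral_multc) measurable
        then show ?thesis
          using P D a \<psi> by (simp add: I0[OF \<epsilon>] P_def D_def ennreal_mult)
      qed
      \<comment> \<open>the substitution by \<open>G\<close>, followed by slicing along the flat\<close>
      have \<kappa>X: "(\<integral>\<^sup>+w. ennreal (?e w) * \<Psi> w \<partial>lborel) = ennreal (\<kappa> * X)"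
      proof -
        let ?f = "\<lambda>y. ennreal (u h y * exp (- (norm (N (coord_part \<iota> y)) ^ k / \<epsilon>)))"
        have "(\<integral>\<^sup>+w. ennreal (?e w) * \<Psi> w \<partial>lborel)
            = (\<integral>\<^sup>+w. \<integral>\<^sup>+t. ?f (t + coord_embed \<iota> w) \<partial>flat_measure \<iota> \<partial>lborel)"
        proof (rule nn_integral_cong)
          fix w :: "real ^ 'p"
          have "ennreal (?e w) * \<Psi> w = (\<integral>\<^sup>+t. ennreal (?e w) * ennreal (u h (t + coord_embed \<iota> w)) \<partial>flat_measure \<iota>)"
            unfolding \<Psi>_def by (rule nn_integral_cmult[symmetric]) measurable
          also have "\<dots> = (\<integral>\<^sup>+t. ?f (t + coord_embed \<iota> w) \<partial>flat_measure \<iota>)"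
            using AE_flat_measure[of \<iota>]
            by (intro nn_integral_cong_AE, eventually_elim)
              (simp add: coord_part_add_embed[OF inj_\<iota>] ennreal_mult[symmetric] u0 mult.commute)
          finally show "ennreal (?e w) * \<Psi> w = (\<integral>\<^sup>+t. ?f (t + coord_embed \<iota> w) \<partial>flat_measure \<iota>)" .
        qed
        also have "\<dots> = flat_unit \<iota> * (\<integral>\<^sup>+y. ?f y \<partial>lborel)"
          by (rule nn_integral_flat_decompose[OF inj_\<iota>]) measurable
        also have "\<dots> = ennreal \<kappa> * ennreal X"
          unfolding X_def \<kappa>(1) by (subst straightened_integral(2)[OF h(1,2) H(2) h(3) um \<epsilon>]) simp_all
        finally show ?thesis using \<kappa> X0 by (simp add: ennreal_mult)
      qed
      have "ennreal (\<kappa> * X) \<le> (\<integral>\<^sup>+w. ennreal (?e w) * \<Psi>0 + ennreal (?e w) * ennreal (K1 * norm w * m) \<partial>lborel)"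
        unfolding \<kappa>X[symmetric]
        by (intro nn_integral_mono) (simp only: distrib_left[symmetric], intro mult_left_mono up, simp)
      also have "\<dots> = (\<integral>\<^sup>+w. ennreal (?e w) * \<Psi>0 \<partial>lborel) + (\<integral>\<^sup>+w. ennreal (?e w) * ennreal (K1 * norm w * m) \<partial>lborel)"
        by (rule nn_integral_add) measurable
      also have "\<dots> \<le> ennreal (P * (D * ?a) * \<psi>) + ennreal Q"
        unfolding k0 by (intro add_left_mono k1)
      also have "\<dots> = ennreal (P * (D * ?a) * \<psi> + Q)"
        using P D a \<psi> Q0 by (intro ennreal_plus[symmetric]) auto
      finally have r1: "\<kappa> * X \<le> P * (D * ?a) * \<psi> + Q"
        using P D a \<psi> Q0 by (subst (asm) ennreal_le_iff) auto
      have "ennreal (P * (D * ?a) * \<psi>) \<le> (\<integral>\<^sup>+w. ennreal (?e w) * \<Psi> w + ennreal (?e w) * ennreal (K1 * norm w * m) \<partial>lborel)"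
        unfolding k0[symmetric]
        by (intro nn_integral_mono) (simp only: distrib_left[symmetric], intro mult_left_mono low, simp)
      also have "\<dots> = (\<integral>\<^sup>+w. ennreal (?e w) * \<Psi> w \<partial>lborel) + (\<integral>\<^sup>+w. ennreal (?e w) * ennreal (K1 * norm w * m) \<partial>lborel)"
        by (rule nn_integral_add) measurable
      also have "\<dots> \<le> ennreal (\<kappa> * X) + ennreal Q"
        unfolding \<kappa>X by (intro add_left_mono k1)
      also have "\<dots> = ennreal (\<kappa> * X + Q)"
        using \<kappa> X0 Q0 by (intro ennreal_plus[symmetric]) auto
      finally have r2: "P * (D * ?a) * \<psi> \<le> \<kappa> * X + Q"
        using \<kappa> X0 Q0 by (subst (asm) ennreal_le_iff) auto
      have lm: "laplace_mean F k \<epsilon> h = X / P"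
        using card_le by (simp add: laplace_mean_def X_def P_def min_absorb2 powr_minus_divide)
      have "X / P - \<Lambda> = (\<kappa> * X - P * (D * ?a) * \<psi>) / (\<kappa> * P)"
        using P \<kappa> by (simp add: \<Lambda>_def field_simps)
      then have "\<bar>X / P - \<Lambda>\<bar> = \<bar>\<kappa> * X - P * (D * ?a) * \<psi>\<bar> / (\<kappa> * P)"
        using P \<kappa> by (simp add: abs_divide)
      also have "\<dots> \<le> Q / (\<kappa> * P)" using r1 r2 P \<kappa> by (intro divide_right_mono) auto
      also have "\<dots> = K1 * m * K2 / \<kappa> * (\<epsilon> powr ((CARD('p) + 1) / real k) / P)"
        using P \<kappa> by (simp add: Q_def)
      also have "\<epsilon> powr ((CARD('p) + 1) / real k) / P = \<epsilon> powr (1 / real k)"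
        using \<epsilon> by (simp add: P_def powr_diff[symmetric] diff_divide_distrib[symmetric])
      finally show ?thesis by (simp add: lm K_def K1_def ac_simps)
    qed
    let ?n2 = "?n + 2"
    let ?f = "\<lambda>x. ennreal (h x / gen_jacobian F x)"
    have fm: "?f \<in> borel_measurable borel" by measurable
    have zi: "zero_set_integral F h = (\<integral>\<^sup>+x. ?f x * indicator Z x \<partial>zero_set_hausdorff F)"
      by (simp add: zero_set_integral_def)
    \<comment> \<open>compares \<open>D * u h\<close>, where \<open>D = 1 / JF z\<close>, with \<open>h / JF\<close> at the corresponding point of the zero set\<close>
    have cmp: "ennreal D * ennreal (u h t) \<le> ennreal (\<theta>\<^sup>2) * (?f (g t) * indicator W t)"
      "?f (g t) * indicator W t \<le> ennreal (\<theta>\<^sup>2) * (ennreal D * ennreal (u h t))" for t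
    proof -
      have "D * (h (g t) / \<bar>det (matrix (G' (g t)))\<bar>) \<le> \<theta>\<^sup>2 * (h (g t) / gen_jacobian F (g t))
          \<and> h (g t) / gen_jacobian F (g t) \<le> \<theta>\<^sup>2 * (D * (h (g t) / \<bar>det (matrix (G' (g t)))\<bar>))" if t: "t \<in> W"
      proof -
        let ?x = "g t" and ?d = "\<bar>det (matrix (G' (g t)))\<bar>"
        note x = g_in[OF t]
        have d: "0 < ?d" "1 / ?d \<le> \<theta>" "1 / \<theta> \<le> 1 / ?d"
          using det_pos[OF x] G_det[OF x] pos by (auto simp: field_simps)
        have j: "0 < gen_jacobian F ?x" "D \<le> \<theta> * (1 / gen_jacobian F ?x)" "1 / gen_jacobian F ?x \<le> \<theta> * D"
          using jac_pos[OF x] jac[OF x] Jz unfolding D(2)[symmetric] by (auto simp: field_simps)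
        have "D * (1 / ?d) \<le> (\<theta> * (1 / gen_jacobian F ?x)) * \<theta>"
          using d j D pos by (intro mult_mono) auto
        then have "h ?x * (D * (1 / ?d)) \<le> h ?x * ((\<theta> * (1 / gen_jacobian F ?x)) * \<theta>)"
          using h(1) by (intro mult_left_mono) auto
        moreover have "1 / gen_jacobian F ?x * (1 / \<theta>) \<le> \<theta> * D * (1 / ?d)"
          using d j D pos by (intro mult_mono) auto
        then have "\<theta> * (1 / gen_jacobian F ?x * (1 / \<theta>)) \<le> \<theta> * (\<theta> * D * (1 / ?d))"
          using pos by (intro mult_left_mono) auto
        then have "1 / gen_jacobian F ?x \<le> \<theta> * (\<theta> * D * (1 / ?d))"
          using pos by simp
        then have "h ?x * (1 / gen_jacobian F ?x) \<le> h ?x * (\<theta> * (\<theta> * D * (1 / ?d)))"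
          using h(1) by (intro mult_left_mono) auto
        ultimately show ?thesis by (simp add: power2_eq_square ac_simps)
      qed
      then show "ennreal D * ennreal (u h t) \<le> ennreal (\<theta>\<^sup>2) * (?f (g t) * indicator W t)"
        "?f (g t) * indicator W t \<le> ennreal (\<theta>\<^sup>2) * (ennreal D * ennreal (u h t))"
        using D pos by (auto simp: u_def ennreal_mult'[symmetric] ennreal_leI indicator_def)
    qed
    have fgm: "(\<lambda>t. ?f (g t) * indicator W t) \<in> borel_measurable (flat_measure \<iota>)"
    proof -
      have "(\<lambda>t. ?f (g t) * indicator W t) \<in> borel_measurable borel" by measurable
      then show ?thesis by (subst measurable_cong_sets[of _ borel _ borel]) auto
    qed
    have um': "(\<lambda>t. ennreal (u h t)) \<in> borel_measurable (flat_measure \<iota>)"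
      by measurable
    have \<Lambda>e: "ennreal \<Lambda> = ennreal (?a / \<kappa>) * (\<integral>\<^sup>+t. ennreal D * ennreal (u h t) \<partial>flat_measure \<iota>)"
    proof -
      have "(\<integral>\<^sup>+t. ennreal D * ennreal (u h t) \<partial>flat_measure \<iota>) = ennreal D * \<Psi>0"
        unfolding \<Psi>0_def by (rule nn_integral_cmult[OF um'])
      then show ?thesis
        using a \<kappa> D \<psi> by (simp add: \<Lambda>_def ennreal_mult[symmetric])
    qed
    have th: "ennreal (\<theta>\<^sup>2) * ennreal (\<theta> ^ ?n) = ennreal (\<theta> ^ ?n2)"
      using pos by (simp add: ennreal_mult[symmetric] power_add power2_eq_square mult.commute)
    have tc: "ennreal (\<theta> ^ ?n2 * (?a / \<kappa>)) = ennreal (\<theta> ^ ?n2) * ennreal (?a / \<kappa>)"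
      using pos a \<kappa> by (intro ennreal_mult) auto
    have "(\<integral>\<^sup>+t. ennreal D * ennreal (u h t) \<partial>flat_measure \<iota>)
        \<le> (\<integral>\<^sup>+t. ennreal (\<theta>\<^sup>2) * (?f (g t) * indicator W t) \<partial>flat_measure \<iota>)"
      by (intro nn_integral_mono cmp)
    also have "\<dots> = ennreal (\<theta>\<^sup>2) * (\<integral>\<^sup>+x. ?f x \<partial>pulled)"
      by (simp add: nn_integral_cmult[OF fgm] nn_integral_pulled[OF fm])
    also have "\<dots> \<le> ennreal (\<theta>\<^sup>2) * (ennreal (\<theta> ^ ?n) * zero_set_integral F h)"
      unfolding zi by (intro mult_left_mono pulled_le fm) auto
    finally have "ennreal \<Lambda> \<le> ennreal (?a / \<kappa>) * (ennreal (\<theta>\<^sup>2) * (ennreal (\<theta> ^ ?n) * zero_set_integral F h))"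
      unfolding \<Lambda>e by (intro mult_left_mono) auto
    also have "\<dots> = ennreal (\<theta> ^ ?n2 * (?a / \<kappa>)) * zero_set_integral F h"
      unfolding tc th[symmetric] by (simp only: ac_simps)
    finally have up1: "ennreal \<Lambda> \<le> ennreal (\<theta> ^ ?n2 * (?a / \<kappa>)) * zero_set_integral F h" .
    have "(\<integral>\<^sup>+x. ?f x \<partial>pulled) = (\<integral>\<^sup>+t. ?f (g t) * indicator W t \<partial>flat_measure \<iota>)"
      by (rule nn_integral_pulled[OF fm])
    also have "\<dots> \<le> (\<integral>\<^sup>+t. ennreal (\<theta>\<^sup>2) * (ennreal D * ennreal (u h t)) \<partial>flat_measure \<iota>)"
      by (intro nn_integral_mono cmp)
    also have "\<dots> = ennreal (\<theta>\<^sup>2) * (\<integral>\<^sup>+t. ennreal D * ennreal (u h t) \<partial>flat_measure \<iota>)"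
      by (rule nn_integral_cmult) measurable
    finally have pulled_up: "(\<integral>\<^sup>+x. ?f x \<partial>pulled)
        \<le> ennreal (\<theta>\<^sup>2) * (\<integral>\<^sup>+t. ennreal D * ennreal (u h t) \<partial>flat_measure \<iota>)" .
    have "zero_set_integral F h = (\<integral>\<^sup>+x. ?f x * indicator (Z \<inter> ball z r) x \<partial>zero_set_hausdorff F)"
      unfolding zi by (intro nn_integral_cong) (use h(3) in \<open>auto simp: indicator_def\<close>)
    also have "\<dots> \<le> ennreal (\<theta> ^ ?n) * (\<integral>\<^sup>+x. ?f x \<partial>pulled)" by (rule pulled_ge[OF fm])
    also have "\<dots> \<le> ennreal (\<theta> ^ ?n) *
        (ennreal (\<theta>\<^sup>2) * (\<integral>\<^sup>+t. ennreal D * ennreal (u h t) \<partial>flat_measure \<iota>))"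
      by (rule mult_left_mono[OF pulled_up]) simp
    finally have "ennreal (?a / \<kappa>) * zero_set_integral F h \<le> ennreal (?a / \<kappa>) * (ennreal (\<theta> ^ ?n) *
        (ennreal (\<theta>\<^sup>2) * (\<integral>\<^sup>+t. ennreal D * ennreal (u h t) \<partial>flat_measure \<iota>)))"
      by (rule mult_left_mono) simp
    also have "\<dots> = ennreal (\<theta> ^ ?n2) * ennreal \<Lambda>"
      unfolding \<Lambda>e th[symmetric] by (simp only: ac_simps)
    also have "\<dots> = ennreal (\<theta> ^ ?n2 * \<Lambda>)" using pos \<Lambda>0 by (simp add: ennreal_mult)
    finally have "ennreal (?a / \<kappa>) * zero_set_integral F h \<le> ennreal (\<theta> ^ ?n2 * \<Lambda>)" .
    then show ?thesis using \<Lambda>0 rate up1 by blast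
  qed
  have "K \<ge> 0" using m K2 C \<kappa> by (simp add: K_def)
  moreover have "local_laplace F k (?a / \<kappa>) (\<theta> ^ (?n + 2)) z r K"
    unfolding local_laplace_def using zero_set_finite main by blast
  ultimately show ?thesis unfolding \<kappa>_def by blast
qed

end

section \<open>Local expansion where the derivative is surjective\<close>

lemma local_laplace_antimono:
  assumes loc: "local_laplace F k c \<theta> z r K" and "r' \<le> r" and F: "smooth F"
  shows "local_laplace F k c \<theta> z r' K"
proof -
  have sub: "ball z r' \<subseteq> ball z r" using assms(2) by (rule subset_ball)
  have [measurable]: "F \<in> borel_measurable borel"
    using smooth_continuous_on[OF F] by (rule borel_measurable_continuous_onI)
  have "F -` {0} \<inter> ball z r \<in> sets borel"
    using measurable_sets[of F borel borel "{0}"] by (intro sets.Int) auto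
  then have "emeasure (zero_set_hausdorff F) (F -` {0} \<inter> ball z r')
      \<le> emeasure (zero_set_hausdorff F) (F -` {0} \<inter> ball z r)"
    using sub by (intro emeasure_mono) auto
  then have "emeasure (zero_set_hausdorff F) (F -` {0} \<inter> ball z r') < \<infinity>"
    using loc[unfolded local_laplace_def, THEN conjunct1] by (rule le_less_trans)
  then show ?thesis
    unfolding local_laplace_def
  proof (intro conjI allI impI)
    fix h :: "real ^ 'a \<Rightarrow> real" and L b
    assume "(\<forall>x. 0 \<le> h x \<and> h x \<le> b) \<and> L-lipschitz_on UNIV h \<and> (\<forall>x. x \<notin> ball z r' \<longrightarrow> h x = 0)"
    then have "(\<forall>x. 0 \<le> h x \<and> h x \<le> b) \<and> L-lipschitz_on UNIV h \<and> (\<forall>x. x \<notin> ball z r \<longrightarrow> h x = 0)"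
      using sub by blast
    then show "\<exists>\<Lambda>\<ge>0. (\<forall>\<epsilon>. 0 < \<epsilon> \<and> \<epsilon> \<le> 1 \<longrightarrow> \<bar>laplace_mean F k \<epsilon> h - \<Lambda>\<bar> \<le> K * (b + L) * \<epsilon> powr (1 / real k)) \<and>
         ennreal \<Lambda> \<le> ennreal (\<theta> * c) * zero_set_integral F h \<and>
         ennreal c * zero_set_integral F h \<le> ennreal (\<theta> * \<Lambda>)"
      by (rule loc[unfolded local_laplace_def, THEN conjunct2, THEN spec, THEN spec, THEN spec, THEN mp])
  qed
qed

lemma bdd_lip_linear_smooth:
  fixes f :: "'a::euclidean_space \<Rightarrow> 'b::real_normed_vector" and l :: "'b \<Rightarrow> real"
  assumes f: "smooth f" and l: "bounded_linear l"
  shows "bdd_lip (cball z r) (\<lambda>x. l (f x))"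
proof -
  interpret l: bounded_linear l by fact
  obtain K where K: "K \<ge> 0" "\<And>x. norm (l x) \<le> norm x * K" using l.nonneg_bounded by blast
  obtain L where L: "L \<ge> 0" "\<forall>x\<in>cball z r. \<forall>y\<in>cball z r. norm (f x - f y) \<le> L * norm (x - y)"
    using smooth_locally_Lipschitz[OF f] by blast
  have "bounded (f ` cball z r)"
    by (intro compact_imp_bounded compact_continuous_image compact_cball smooth_continuous_on f)
  then obtain b where "\<forall>y\<in>f ` cball z r. norm y \<le> b" unfolding bounded_iff by blast
  then have b: "norm (f x) \<le> b" if "x \<in> cball z r" for x using that by (auto simp del: mem_cball)
  show ?thesis
  proof (rule bdd_lipI[of _ _ "b * K" "L * K"])
    show "\<bar>l (f x)\<bar> \<le> b * K" if "x \<in> cball z r" for x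
      using K(2)[of "f x"] mult_right_mono[OF b[OF that] K(1)] by simp
    show "\<bar>l (f x) - l (f y)\<bar> \<le> L * K * dist x y" if "x \<in> cball z r" "y \<in> cball z r" for x y
    proof -
      have "\<bar>l (f x) - l (f y)\<bar> \<le> norm (f x - f y) * K"
        using K(2)[of "f x - f y"] by (simp add: l.diff)
      also have "\<dots> \<le> (L * norm (x - y)) * K"
        using L(2) that K(1) by (intro mult_right_mono) auto
      finally show ?thesis by (simp add: dist_norm ac_simps)
    qed
  qed
qed

text \<open>
  The chart is \<open>G x = B x - J J\<^sup>T B x + J M (F x)\<close>, with \<open>J\<close> the coordinate embedding and \<open>B\<close>, \<open>M\<close> from the
  normal form of \<open>DF z\<close>: the transverse part of the rotation \<open>B\<close> is replaced by \<open>M \<circ> F\<close>. The two have the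
  same derivative at \<open>z\<close>, so \<open>G\<close> is a small perturbation of an isometry on a small ball, and every
  distortion tends to \<open>1\<close> with the radius. That the image contains a ball is invariance of domain.
\<close>

theorem local_laplace_submersion:
  fixes F :: "real ^ 'd \<Rightarrow> real ^ 'p" and \<iota> :: "'p \<Rightarrow> 'd"
  assumes \<iota>: "inj \<iota>" and k: "k \<ge> 1" and F: "smooth F" and Fz: "F z = 0" and Jz: "gen_jacobian F z \<noteq> 0"
    and \<theta>: "\<theta> > 1"
  shows "\<exists>r>0. \<exists>K\<ge>0. local_laplace F k (radial_mass k TYPE(real ^ 'p) / enn2real (flat_unit \<iota>))
     (\<theta> ^ (CARD('d) - CARD('p) + 2)) z r K"
    and "0 < emeasure (zero_set_hausdorff F) (F -` {0})"
proof -
  have card: "CARD('p) \<le> CARD('d)"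
    using \<iota> by (metis card_inj_on_le finite_class.finite_UNIV subset_UNIV)
  define A where "A = jacobian F (at z)"
  have JA: "gen_jacobian F z = sqrt (det (A ** transpose A))"
    using card by (simp add: gen_jacobian_def A_def Let_def)
  then have "det (A ** transpose A) \<noteq> 0" using Jz by auto
  from full_row_rank_normal_form[OF \<iota> this]
  obtain B :: "real ^ 'd \<Rightarrow> real ^ 'd" and M :: "real ^ 'p \<Rightarrow> real ^ 'p"
    where B: "orthogonal_transformation B" and M: "linear M" "inj M"
      and BM: "\<And>x. coord_part \<iota> (B x) = M (A *v x)"
      and detM: "\<bar>det (matrix M)\<bar> * gen_jacobian F z = 1" and detA: "det (A ** transpose A) > 0"
    unfolding JA by blast
  have Jpos: "gen_jacobian F z > 0" using detA by (simp add: JA)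
  obtain N where N: "linear N" "N \<circ> M = id" using linear_injective_left_inverse[OF M] by blast
  have NM: "N (M y) = y" for y using N(2) by (metis comp_apply id_apply)
  have linB: "linear B" using B by (rule orthogonal_transformation_linear)
  have bl: "bounded_linear B" "bounded_linear M"
    using linB M(1) by (simp_all add: linear_conv_bounded_linear)
  let ?F' = "\<lambda>x. frechet_derivative F (at x)"
  have F'z: "?F' z v = A *v v" for v by (simp add: A_def jacobian_mult[OF F])
  define G where "G x = B x - coord_embed \<iota> (coord_part \<iota> (B x)) + coord_embed \<iota> (M (F x))" for x
  define G' where "G' x v = B v - coord_embed \<iota> (coord_part \<iota> (B v)) + coord_embed \<iota> (M (?F' x v))" for x v
  have G_part: "coord_part \<iota> (G x) = M (F x)" for x
    using \<iota> by (simp add: G_def coord_linear_simps)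
  have G_der: "(G has_derivative G' x) (at x)" for x
    unfolding G_def[abs_def] G'_def[abs_def]
    by (intro has_derivative_add has_derivative_diff bounded_linear.has_derivative[OF bounded_linear_coord(1)]
        bounded_linear.has_derivative[OF bounded_linear_coord(2)] bounded_linear.has_derivative[OF bl(1)]
        bounded_linear.has_derivative[OF bl(2)] has_derivative_ident smooth_has_derivative[OF F])
  have G'B: "G' x v - B v = coord_embed \<iota> (M (?F' x v - ?F' z v))" for x v
    by (simp add: G'_def BM F'z coord_linear_simps linear_diff[OF M(1)])
  have G'z: "G' z = B" using G'B[of z] by (simp add: fun_eq_iff coord_linear_simps linear_0[OF M(1)])
  \<comment> \<open>a perturbation of an isometry by \<open>\<eta>\<close> distorts by factors between \<open>1 - \<eta> = 1 / \<theta>\<close> and \<open>1 + \<eta> \<le> \<theta>\<close>\<close>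
  define \<eta> where "\<eta> = 1 - 1 / \<theta>"
  have \<eta>: "\<eta> > 0" "1 + \<eta> \<le> \<theta>" "1 - \<eta> = 1 / \<theta>"
  proof -
    have "0 \<le> (\<theta> - 1)\<^sup>2 / \<theta>" using \<theta> by simp
    also have "(\<theta> - 1)\<^sup>2 / \<theta> = \<theta> - (1 + \<eta>)" using \<theta> by (simp add: \<eta>_def field_simps power2_eq_square)
    finally show "1 + \<eta> \<le> \<theta>" by simp
  qed (use \<theta> in \<open>auto simp: \<eta>_def\<close>)
  obtain KM where KM: "KM > 0" "\<And>v. norm (M v) \<le> KM * norm v" using linear_bounded_pos[OF M(1)] by auto
  obtain L where L: "L \<ge> 0" "\<And>x y. x \<in> cball z 1 \<Longrightarrow> y \<in> cball z 1 \<Longrightarrow>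
      onorm (\<lambda>v. ?F' x v - ?F' y v) \<le> L * norm (x - y)"
    using smooth_derivative_locally_Lipschitz[OF F, of z 1] by blast
  have entries: "bdd_lip (cball z 1) (\<lambda>x. matrix (G' x) $ i $ j)" for i j
  proof -
    have "bounded_linear (\<lambda>y. coord_embed \<iota> (M y) $ i)"
      by (intro bounded_linear_compose[OF bounded_linear_vec_nth] bounded_linear_compose[OF bounded_linear_coord(2)] bl)
    from bdd_lip_add[OF bdd_lip_const[of _ "(B (axis j 1) - coord_embed \<iota> (coord_part \<iota> (B (axis j 1)))) $ i"]
        bdd_lip_linear_smooth[OF smooth_directional_derivative[OF F] this, of z 1 "axis j 1"]]
    show ?thesis by (simp add: matrix_def G'_def)
  qed
  have detlip: "bdd_lip (cball z 1) (\<lambda>x. \<bar>det (matrix (G' x))\<bar>)"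
    by (intro bdd_lip_abs bdd_lip_det entries)
  obtain bd Ld where Ld: "0 \<le> Ld" "\<And>x y. x \<in> cball z 1 \<Longrightarrow> y \<in> cball z 1 \<Longrightarrow>
      \<bar>\<bar>det (matrix (G' x))\<bar> - \<bar>det (matrix (G' y))\<bar>\<bar> \<le> Ld * dist x y"
    using detlip by (rule bdd_lipE) (rule that)
  have detz: "\<bar>det (matrix (G' z))\<bar> = 1"
    using B unfolding G'z by (metis abs_1 abs_minus_cancel det_orthogonal_matrix orthogonal_transformation_matrix)
  have "isCont (gen_jacobian F) z"
    using continuous_on_gen_jacobian[OF F, of UNIV] by (simp add: continuous_on_eq_continuous_at)
  then obtain R3 where R3: "R3 > 0" "\<And>x. dist x z < R3 \<Longrightarrow> dist (gen_jacobian F x) (gen_jacobian F z) < \<eta> * gen_jacobian F z"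
    using \<eta> Jpos unfolding continuous_at_eps_delta by (metis mult_pos_pos dist_norm)
  \<comment> \<open>makes \<open>G - B\<close> an \<open>\<eta>\<close>-Lipschitz map and \<open>det G'\<close>, \<open>JF\<close> vary by at most the relative amount \<open>\<eta>\<close>\<close>
  define R where "R = min (min 1 R3) (min (\<eta> / (KM * L + 1)) (\<eta> / (Ld + 1)))"
  have den: "KM * L + 1 > 0" "Ld + 1 > 0" using KM L Ld by (auto intro: add_nonneg_pos)
  have R: "R > 0" "R \<le> 1" "R \<le> R3" "R \<le> \<eta> / (KM * L + 1)" "R \<le> \<eta> / (Ld + 1)"
    using R3 \<eta> den by (auto simp: R_def)
  have R': "KM * L * R \<le> \<eta>" "Ld * R \<le> \<eta>"
    using R den by (auto simp: field_simps)
  have in1: "x \<in> cball z 1" if "x \<in> ball z R" for x using that R by auto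
  have G'near: "onorm (\<lambda>v. G' x v - B v) \<le> \<eta>" if x: "x \<in> ball z R" for x
  proof (rule onorm_le)
    fix v
    have bl': "bounded_linear (\<lambda>v. ?F' x v - ?F' z v)" by (intro bounded_linear_sub bounded_linear_derivative F)
    have "norm (G' x v - B v) \<le> KM * norm (?F' x v - ?F' z v)"
      unfolding G'B using \<iota> KM(2) by simp
    also have "\<dots> \<le> KM * (onorm (\<lambda>v. ?F' x v - ?F' z v) * norm v)"
      using onorm[OF bl'] KM by (intro mult_left_mono) auto
    also have "\<dots> \<le> KM * ((L * R) * norm v)"
    proof (intro mult_left_mono mult_right_mono)
      have "norm (x - z) \<le> R" using x by (simp add: dist_norm norm_minus_commute)
      then have "L * norm (x - z) \<le> L * R" using L(1) by (rule mult_left_mono)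
      then show "onorm (\<lambda>v. ?F' x v - ?F' z v) \<le> L * R"
        using L(2)[OF in1[OF x], of z] by simp
    qed (use KM in auto)
    also have "\<dots> \<le> \<eta> * norm v" using mult_right_mono[OF R'(1) norm_ge_zero[of v]] by (simp add: ac_simps)
    finally show "norm (G' x v - B v) \<le> \<eta> * norm v" .
  qed
  \<comment> \<open>mean value inequality for \<open>G - B\<close>\<close>
  have near: "norm ((G x - B x) - (G y - B y)) \<le> \<eta> * norm (x - y)" if "x \<in> ball z R" "y \<in> ball z R" for x y
  proof (rule differentiable_bound[OF convex_ball _ _ that])
    fix x
    have "((\<lambda>x. G x - B x) has_derivative (\<lambda>v. G' x v - B v)) (at x)"
      by (intro has_derivative_diff G_der bounded_linear_imp_has_derivative bl)
    then show "((\<lambda>x. G x - B x) has_derivative (\<lambda>v. G' x v - B v)) (at x within ball z R)"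
      by (rule has_derivative_at_withinI)
  qed (rule G'near)
  have nB: "norm (B x - B y) = norm (x - y)" for x y
    using B by (simp add: linear_diff[OF linB, symmetric] orthogonal_transformation_norm)
  have G_up: "dist (G x) (G y) \<le> \<theta> * dist x y" and G_low: "dist x y \<le> \<theta> * dist (G x) (G y)"
    if xy: "x \<in> ball z R" "y \<in> ball z R" for x y
  proof -
    have "norm (G x - G y) \<le> norm (B x - B y) + norm ((G x - B x) - (G y - B y))"
      using norm_triangle_ineq[of "B x - B y" "(G x - B x) - (G y - B y)"] by simp
    also have "\<dots> \<le> (1 + \<eta>) * norm (x - y)" using near[OF xy] by (simp add: nB algebra_simps)
    also have "\<dots> \<le> \<theta> * norm (x - y)" using \<eta> by (intro mult_right_mono) auto
    finally show "dist (G x) (G y) \<le> \<theta> * dist x y" by (simp add: dist_norm)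
    have "norm (B x - B y) \<le> norm (G x - G y) + norm ((G x - B x) - (G y - B y))"
      using norm_triangle_ineq4[of "G x - G y" "(G x - B x) - (G y - B y)"] by simp
    then have "(1 - \<eta>) * norm (x - y) \<le> norm (G x - G y)" using near[OF xy] by (simp add: nB algebra_simps)
    then have "\<theta> * ((1 - \<eta>) * norm (x - y)) \<le> \<theta> * norm (G x - G y)" using \<theta> by (intro mult_left_mono) auto
    then show "dist x y \<le> \<theta> * dist (G x) (G y)" using \<theta> by (simp add: \<eta>(3) dist_norm)
  qed
  have G_det: "1 / \<theta> \<le> \<bar>det (matrix (G' x))\<bar> \<and> \<bar>det (matrix (G' x))\<bar> \<le> \<theta>" if x: "x \<in> ball z R" for x
  proof -
    have "\<bar>\<bar>det (matrix (G' x))\<bar> - \<bar>det (matrix (G' z))\<bar>\<bar> \<le> Ld * dist x z"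
      using in1[OF x] by (intro Ld(2)) auto
    also have "\<dots> \<le> Ld * R" using x Ld(1) by (intro mult_left_mono) (auto simp: dist_commute)
    finally show ?thesis using R'(2) \<eta> unfolding detz by linarith
  qed
  have jac: "0 < gen_jacobian F x" "gen_jacobian F x \<le> \<theta> * gen_jacobian F z" "gen_jacobian F z \<le> \<theta> * gen_jacobian F x"
    if x: "x \<in> ball z R" for x
  proof -
    have d: "\<bar>gen_jacobian F x - gen_jacobian F z\<bar> < \<eta> * gen_jacobian F z"
      using R3(2)[of x] x R by (simp add: dist_real_def dist_commute)
    have "gen_jacobian F x \<le> (1 + \<eta>) * gen_jacobian F z" using d by (simp add: algebra_simps)
    also have "\<dots> \<le> \<theta> * gen_jacobian F z" using \<eta> Jpos by (intro mult_right_mono) auto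
    finally show "gen_jacobian F x \<le> \<theta> * gen_jacobian F z" .
    have l: "(1 - \<eta>) * gen_jacobian F z < gen_jacobian F x" using d by (simp add: algebra_simps)
    have "0 < (1 - \<eta>) * gen_jacobian F z" using \<eta>(3) \<theta> Jpos by simp
    then show "0 < gen_jacobian F x" using l by linarith
    have "\<theta> * ((1 - \<eta>) * gen_jacobian F z) \<le> \<theta> * gen_jacobian F x" using l \<theta> by (intro mult_left_mono) auto
    then show "gen_jacobian F z \<le> \<theta> * gen_jacobian F x" using \<theta> by (simp add: \<eta>(3))
  qed
  have injG: "inj_on G (ball z R)"
  proof (rule inj_onI)
    fix x y assume "x \<in> ball z R" "y \<in> ball z R" "G x = G y"
    then show "x = y" using G_low[of x y] by simp
  qed
  have contG: "continuous_on (ball z R) G"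
    by (rule has_derivative_continuous_on[OF has_derivative_at_withinI[OF G_der]])
  have "open (G ` ball z R)" by (rule invariance_of_domain[OF contG open_ball injG])
  moreover have "G z \<in> G ` ball z R" using R by simp
  ultimately obtain \<rho> where \<rho>: "\<rho> > 0" "ball (G z) \<rho> \<subseteq> G ` ball z R"
    unfolding open_contains_ball by blast
  define r where "r = min R (\<rho> / (2 * \<theta>))"
  have r: "0 < r" "r \<le> R" "\<theta> * r \<le> \<rho> / 2" using R \<rho> \<theta> by (auto simp: r_def min_def field_simps)
  have inner: "G ` ball z r \<subseteq> ball (G z) (\<rho> / 2)"
  proof
    fix y assume "y \<in> G ` ball z r"
    then obtain x where x: "y = G x" "dist z x < r" by auto
    have "dist (G z) (G x) \<le> \<theta> * dist z x" using x r R by (intro G_up) auto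
    also have "\<dots> < \<theta> * r" using x \<theta> by simp
    finally show "y \<in> ball (G z) (\<rho> / 2)" using x r by simp
  qed
  interpret straightening F \<iota> k G G' M N z R \<rho> r \<theta>
  proof (rule straightening.intro)
    show "bdd_lip (ball z R) (\<lambda>x. \<bar>det (matrix (G' x))\<bar>)"
      by (rule bdd_lip_subset[OF detlip]) (use in1 in blast)
  qed (use \<iota> k F Fz R \<rho> r \<theta> M(1) N(1) NM G_part G_der G_up G_low G_det jac detM inner in auto)
  show "\<exists>r>0. \<exists>K\<ge>0. local_laplace F k (radial_mass k TYPE(real ^ 'p) / enn2real (flat_unit \<iota>))
     (\<theta> ^ (CARD('d) - CARD('p) + 2)) z r K"
    using local_laplace_straightened r by blast
  show "0 < emeasure (zero_set_hausdorff F) (F -` {0})" by (rule zero_set_pos)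
qed

section \<open>Local expansion where the derivative is injective\<close>

lemma hausdorff_outer_0_singleton: "hausdorff_outer 0 {z :: 'a::metric_space} = 1"
proof -
  have g: "hausdorff_gauge 0 S = 1" if "S \<noteq> {}" for S :: "'a set"
    using that by (simp add: hausdorff_gauge_def)
  have "hausdorff_content \<delta> 0 {z} = 1" if "\<delta> > 0" for \<delta>
  proof (rule antisym)
    show "hausdorff_content \<delta> 0 {z} \<le> 1"
      using hausdorff_content_finite_cover[of "{()}" "{z}" "\<lambda>_. {z}" \<delta> 0] that by (simp add: g)
    show "1 \<le> hausdorff_content \<delta> 0 {z}"
      unfolding hausdorff_content_def
    proof (rule INF_greatest)
      fix C :: "nat \<Rightarrow> 'a set"
      assume "C \<in> {C. {z} \<subseteq> (\<Union>i. C i) \<and> (\<forall>i. bounded (C i) \<and> diameter (C i) \<le> \<delta>)}"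
      then obtain i where "z \<in> C i" by auto
      then have "1 = hausdorff_gauge 0 (C i)" by (subst g) auto
      also have "\<dots> \<le> (\<Sum>i. hausdorff_gauge 0 (C i))" by (rule ennreal_le_suminf)
      finally show "1 \<le> (\<Sum>i. hausdorff_gauge 0 (C i))" .
    qed
  qed
  then have "hausdorff_outer 0 {z} = (SUP \<delta>\<in>{0::real<..}. 1)"
    unfolding hausdorff_outer_def by (intro SUP_cong) auto
  also have "\<dots> = 1" by (rule cSUP_const) (auto intro: exI[of _ 1])
  finally show ?thesis .
qed

lemma abs_power_diff_le:
  fixes a b :: real
  assumes "0 \<le> a" "a \<le> M" "0 \<le> b" "b \<le> M"
  shows "\<bar>a ^ k - b ^ k\<bar> \<le> real k * M ^ (k - 1) * \<bar>a - b\<bar>"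
proof (cases k)
  case (Suc j)
  have "\<bar>a ^ Suc j - b ^ Suc j\<bar> = \<bar>a - b\<bar> * \<bar>\<Sum>i<Suc j. a ^ i * b ^ (j - i)\<bar>"
  proof -
    have "(\<Sum>i<Suc j. b ^ (Suc j - Suc i) * a ^ i) = (\<Sum>i<Suc j. a ^ i * b ^ (j - i))"
      by (intro sum.cong) (simp_all add: mult.commute)
    then show ?thesis by (simp only: power_diff_sumr2 abs_mult)
  qed
  also have "\<dots> \<le> \<bar>a - b\<bar> * (\<Sum>i<Suc j. M ^ j)"
  proof (intro mult_left_mono order_trans[OF sum_abs] sum_mono)
    fix i assume i: "i \<in> {..<Suc j}"
    have "a ^ i * b ^ (j - i) \<le> M ^ i * M ^ (j - i)"
      using assms by (intro mult_mono power_mono) auto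
    also have "\<dots> = M ^ j" using i by (simp add: power_add[symmetric])
    finally show "\<bar>a ^ i * b ^ (j - i)\<bar> \<le> M ^ j" using assms by simp
  qed simp
  finally show ?thesis using Suc by (simp add: ac_simps)
qed simp

text \<open>
  Mean value bound for \<open>exp\<close> on a half-line.
\<close>

lemma abs_exp_minus_diff_le:
  fixes x y m :: real
  assumes "m \<le> x" "m \<le> y"
  shows "\<bar>exp (- x) - exp (- y)\<bar> \<le> exp (- m) * \<bar>x - y\<bar>"
proof -
  have *: "exp (- x) - exp (- y) \<le> exp (- m) * (y - x)" if "m \<le> x" "x \<le> y" for x y
  proof -
    have "exp (- x) - exp (- y) = exp (- x) * (1 - exp (x - y))"
      by (simp add: algebra_simps mult_exp_exp)
    also have "1 - exp (x - y) \<le> y - x" using exp_ge_add_one_self[of "x - y"] by linarith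
    then have "exp (- x) * (1 - exp (x - y)) \<le> exp (- x) * (y - x)" by (rule mult_left_mono) simp
    also have "\<dots> \<le> exp (- m) * (y - x)" using that by (intro mult_right_mono) auto
    finally show ?thesis .
  qed
  show ?thesis
  proof (cases "x \<le> y")
    case True
    then show ?thesis using *[of x y] assms by (simp add: abs_if)
  next
    case False
    then show ?thesis using *[of y x] assms by (simp add: abs_if)
  qed
qed

text \<open>
  The isometry \<open>T\<close> replaces the derivative, so that \<open>norm (T v) = norm (DF z v)\<close> and \<open>|det T| = JF z\<close>. With
  \<open>w = norm (x - z) / \<epsilon> powr (1/k)\<close>, the exponents for \<open>F x\<close> and for its linearisation differ near \<open>z\<close> by
  \<open>O(\<epsilon> powr (1/k) * w ^ (k + 1))\<close>, and both are at least \<open>c * w ^ k\<close>. Hence the integrands differ by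
  \<open>\<epsilon> powr (1/k)\<close> times a rescaled integrable profile \<open>\<Phi>\<close>. Near \<open>z\<close> the zero set is the single point
  \<open>z\<close>, so the limit is exact and any \<open>\<theta> \<ge> 1\<close> is allowed.
\<close>

theorem local_laplace_immersion:
  fixes F :: "real ^ 'd \<Rightarrow> real ^ 'p"
  assumes card: "CARD('d) < CARD('p)" and k: "k \<ge> 1" and F: "smooth F" and Fz: "F z = 0" and Jz: "gen_jacobian F z \<noteq> 0"
    and \<theta>: "\<theta> \<ge> 1"
  shows "\<exists>r>0. \<exists>K\<ge>0. local_laplace F k (radial_mass k TYPE(real ^ 'd)) \<theta> z r K"
    and "0 < emeasure (zero_set_hausdorff F) (F -` {0})"
proof -
  let ?a = "radial_mass k TYPE(real ^ 'd)"
  have a: "?a > 0" by (rule radial_mass_pos[OF k])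
  have zsh: "zero_set_hausdorff F = hausdorff_measure 0"
    using card by (simp add: zero_set_hausdorff_def min_absorb1)
  define A where "A = jacobian F (at z)"
  have JA: "gen_jacobian F z = sqrt (det (transpose A ** A))"
    using card by (simp add: gen_jacobian_def A_def Let_def)
  then have "det (transpose A ** A) \<noteq> 0" using Jz by auto
  from injective_matrix_isometry[OF this] obtain T :: "real ^ 'd \<Rightarrow> real ^ 'd"
    where T: "linear T" "inj T" and nT: "\<And>v. norm (T v) = norm (A *v v)"
      and detT: "\<bar>det (matrix T)\<bar> = gen_jacobian F z" and dA: "det (transpose A ** A) > 0"
    unfolding JA by blast
  have Jpos: "gen_jacobian F z > 0" using dA by (simp add: JA)
  have Fm [measurable]: "F \<in> borel_measurable borel"
    using smooth_continuous_on[OF F] by (rule borel_measurable_continuous_onI)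
  have Tm [measurable]: "T \<in> borel_measurable borel"
    using T(1) by (intro borel_measurable_continuous_onI linear_continuous_on) (simp add: linear_conv_bounded_linear)
  let ?F' = "\<lambda>x. frechet_derivative F (at x)"
  have F'z: "?F' z v = A *v v" for v by (simp add: A_def jacobian_mult[OF F])
  obtain c0 where c0: "c0 > 0" "\<And>v. c0 * norm v \<le> norm (T v)"
    using linear_inj_bounded_below_pos[OF T] by (auto simp: mult.commute)
  obtain C0 where C0: "C0 > 0" "\<And>v. norm (T v) \<le> C0 * norm v" using linear_bounded_pos[OF T(1)] by auto
  obtain C2 where C2: "C2 \<ge> 0" "\<And>x y. x \<in> cball z 1 \<Longrightarrow> y \<in> cball z 1 \<Longrightarrow>
      onorm (\<lambda>v. ?F' x v - ?F' y v) \<le> C2 * norm (x - y)"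
    using smooth_derivative_locally_Lipschitz[OF F, of z 1] by blast
  have quad: "norm (F x - A *v (x - z)) \<le> C2 * (norm (x - z))\<^sup>2" if x: "norm (x - z) \<le> 1" for x
  proof -
    let ?\<rho> = "norm (x - z)"
    have "norm ((F x - A *v x) - (F z - A *v z)) \<le> (C2 * ?\<rho>) * norm (x - z)"
    proof (rule differentiable_bound[OF convex_cball[of z ?\<rho>]])
      fix y assume y: "y \<in> cball z ?\<rho>"
      have "((\<lambda>x. F x - A *v x) has_derivative (\<lambda>v. ?F' y v - A *v v)) (at y)"
        by (intro has_derivative_diff smooth_has_derivative[OF F] bounded_linear_imp_has_derivative matrix_vector_mul_bounded_linear)
      then show "((\<lambda>x. F x - A *v x) has_derivative (\<lambda>v. ?F' y v - A *v v)) (at y within cball z ?\<rho>)"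
        by (rule has_derivative_at_withinI)
      have "onorm (\<lambda>v. ?F' y v - A *v v) \<le> C2 * norm (y - z)"
        using C2(2)[of y z] y x by (simp add: F'z dist_norm norm_minus_commute)
      also have "\<dots> \<le> C2 * ?\<rho>" using y C2(1) by (intro mult_left_mono) (auto simp: dist_norm norm_minus_commute)
      finally show "onorm (\<lambda>v. ?F' y v - A *v v) \<le> C2 * ?\<rho>" .
    qed (auto simp: dist_norm norm_minus_commute)
    then show ?thesis by (simp add: Fz matrix_vector_mult_diff_distrib power2_eq_square algebra_simps)
  qed
  \<comment> \<open>so small that the Taylor remainder is at most half of \<open>norm (T (x - z))\<close>\<close>
  define r where "r = min 1 (c0 / (2 * (C2 + 1)))"
  have r: "r > 0" "r \<le> 1" "C2 * r \<le> c0 / 2"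
  proof -
    show "r > 0" "r \<le> 1" using c0 C2 by (auto simp: r_def)
    have "C2 * r \<le> (C2 + 1) * (c0 / (2 * (C2 + 1)))" using C2 c0 by (intro mult_mono) (auto simp: r_def)
    also have "\<dots> = c0 / 2" using C2 by (simp add: field_simps)
    finally show "C2 * r \<le> c0 / 2" .
  qed
  define C3 where "C3 = C0 + C2"
  have C3: "C3 \<ge> 0" "C0 \<le> C3" using C0 C2 by (simp_all add: C3_def)
  have inner: "\<bar>norm (F x) - norm (T (x - z))\<bar> \<le> C2 * (norm (x - z))\<^sup>2"
      "c0 / 2 * norm (x - z) \<le> norm (F x)" "norm (F x) \<le> C3 * norm (x - z)"
    if x: "norm (x - z) < r" for x
  proof -
    have "norm (x - z) \<le> 1" using x r by simp
    then show 1: "\<bar>norm (F x) - norm (T (x - z))\<bar> \<le> C2 * (norm (x - z))\<^sup>2"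
      using norm_triangle_ineq3[of "F x" "A *v (x - z)"] quad[of x] by (simp add: nT)
    have "C2 * norm (x - z) \<le> C2 * r" using x C2 by (intro mult_left_mono) auto
    then have "C2 * norm (x - z) \<le> c0 / 2" using r by simp
    then have "(C2 * norm (x - z)) * norm (x - z) \<le> c0 / 2 * norm (x - z)" by (intro mult_right_mono) auto
    then show "c0 / 2 * norm (x - z) \<le> norm (F x)"
      using 1 c0(2)[of "x - z"] by (simp add: power2_eq_square)
    have "C2 * (norm (x - z))\<^sup>2 \<le> C2 * norm (x - z)"
    proof (intro mult_left_mono)
      show "(norm (x - z))\<^sup>2 \<le> norm (x - z)"
        using x r mult_right_mono[of "norm (x - z)" 1 "norm (x - z)"] by (simp add: power2_eq_square)
    qed (use C2 in auto)
    then show "norm (F x) \<le> C3 * norm (x - z)"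
      using 1 C0(2)[of "x - z"] by (simp add: C3_def algebra_simps)
  qed
  have Z: "F -` {0} \<inter> ball z r = {z}"
  proof (intro equalityI subsetI)
    fix x assume x: "x \<in> F -` {0} \<inter> ball z r"
    then have "c0 / 2 * norm (x - z) \<le> 0" using inner(2)[of x] by (simp add: dist_norm norm_minus_commute)
    then show "x \<in> {z}" using c0 by (simp add: mult_le_0_iff)
  qed (use Fz r in auto)
  have sing: "emeasure (zero_set_hausdorff F) {z} = 1"
    by (simp add: zsh emeasure_hausdorff_measure hausdorff_outer_0_singleton)
  have ZB: "F -` {0} \<in> sets borel" using measurable_sets[OF Fm, of "{0}"] by simp
  have "emeasure (zero_set_hausdorff F) {z} \<le> emeasure (zero_set_hausdorff F) (F -` {0})"
    using ZB Fz by (intro emeasure_mono) auto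
  then show "0 < emeasure (zero_set_hausdorff F) (F -` {0})" unfolding sing by (rule less_le_trans[rotated]) simp
  define c where "c = (c0 / 2) ^ k"
  have c: "c > 0" using c0 by (simp add: c_def)
  define \<Phi> where "\<Phi> v = (norm v + norm v ^ (k + 1)) * exp (- (c * norm v ^ k))" for v :: "real ^ 'd"
  have \<Phi>int: "integrable lborel \<Phi>"
    unfolding \<Phi>_def[abs_def] distrib_right
    using integrable_power_exp_power[OF c k, of 1, where 'a = "real ^ 'd"] integrable_power_exp_power[OF c k, of "k + 1", where 'a = "real ^ 'd"]
    by (intro Bochner_Integration.integrable_add) simp_all
  have \<Phi>0: "\<Phi> v \<ge> 0" for v by (simp add: \<Phi>_def)
  have \<Phi>m [measurable]: "\<Phi> \<in> borel_measurable borel" using \<Phi>int by (simp add: borel_measurable_integrable[where M = lborel, simplified])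
  define I where "I = (\<integral>v. \<Phi> v \<partial>lborel)"
  have I0: "I \<ge> 0" unfolding I_def using \<Phi>0 by (intro Bochner_Integration.integral_nonneg) auto
  \<comment> \<open>the three terms account for the variation of \<open>h\<close>, for points off the ball, and for the variation of the exponent\<close>
  define C4 where "C4 = 1 + 1 / r + real k * C3 ^ (k - 1) * C2"
  have C4: "C4 \<ge> 0" "1 \<le> C4" "1 / r \<le> C4" "real k * C3 ^ (k - 1) * C2 \<le> C4"
    using r C3 C2 by (auto simp: C4_def)
  have main: "\<exists>\<Lambda>\<ge>0. (\<forall>\<epsilon>. 0 < \<epsilon> \<and> \<epsilon> \<le> 1 \<longrightarrow> \<bar>laplace_mean F k \<epsilon> h - \<Lambda>\<bar> \<le> (C4 * I) * (b + L) * \<epsilon> powr (1 / real k)) \<and>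
      ennreal \<Lambda> \<le> ennreal (\<theta> * ?a) * zero_set_integral F h \<and>
      ennreal ?a * zero_set_integral F h \<le> ennreal (\<theta> * \<Lambda>)"
    if H: "\<forall>x. 0 \<le> h x \<and> h x \<le> b" "L-lipschitz_on UNIV h" "\<forall>x. x \<notin> ball z r \<longrightarrow> h x = 0" for h L b
  proof -
    have h: "\<And>x. 0 \<le> h x" "\<And>x. h x \<le> b" "\<And>x. x \<notin> ball z r \<Longrightarrow> h x = 0" "L \<ge> 0" "\<And>x y. \<bar>h x - h y\<bar> \<le> L * norm (x - y)"
      using H by (auto simp: lipschitz_on_def dist_norm)
    have b: "b \<ge> 0" using h(1,2) order_trans by blast
    have hm [measurable]: "h \<in> borel_measurable borel"
      using lipschitz_on_continuous_on[OF H(2)] by (rule borel_measurable_continuous_onI)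
    define \<Lambda> where "\<Lambda> = ?a * (h z / gen_jacobian F z)"
    have \<Lambda>0: "\<Lambda> \<ge> 0" using a h(1) Jpos by (simp add: \<Lambda>_def)
    have "zero_set_integral F h = (\<integral>\<^sup>+x. ennreal (h z / gen_jacobian F z) * indicator {z} x \<partial>zero_set_hausdorff F)"
      unfolding zero_set_integral_def
    proof (rule nn_integral_cong)
      fix x
      show "ennreal (h x / gen_jacobian F x) * indicator (F -` {0}) x = ennreal (h z / gen_jacobian F z) * indicator {z} x"
      proof (cases "x \<in> ball z r")
        case True
        then have "x \<in> F -` {0} \<longleftrightarrow> x \<in> F -` {0} \<inter> ball z r" by blast
        then have "x \<in> F -` {0} \<longleftrightarrow> x = z" unfolding Z by (simp only: singleton_iff)
        then show ?thesis by (auto simp: indicator_def)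
      qed (use h(3) r in \<open>auto simp: indicator_def\<close>)
    qed
    also have "\<dots> = ennreal (h z / gen_jacobian F z)"
      by (subst nn_integral_cmult_indicator) (auto simp: sing)
    finally have zi: "ennreal ?a * zero_set_integral F h = ennreal \<Lambda>"
      using a h(1) Jpos by (simp add: \<Lambda>_def ennreal_mult[symmetric])
    have rate: "\<bar>laplace_mean F k \<epsilon> h - \<Lambda>\<bar> \<le> (C4 * I) * (b + L) * \<epsilon> powr (1 / real k)" if \<epsilon>: "\<epsilon> > 0" for \<epsilon>
    proof -
      define s where "s = \<epsilon> powr (1 / real k)"
      have s: "s > 0" "s ^ k = \<epsilon>" using \<epsilon> powr_inverse_power[OF \<epsilon> k] by (simp_all add: s_def)
      have sd: "s ^ CARD('d) = \<epsilon> powr (CARD('d) / real k)"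
        using \<epsilon> by (simp add: s_def powr_realpow[symmetric] powr_powr)
      let ?e1 = "\<lambda>x. exp (- (norm (F x) ^ k / \<epsilon>))" and ?e0 = "\<lambda>x. exp (- (norm (T (x - z)) ^ k / \<epsilon>))"
      have pw: "\<bar>h x * ?e1 x - h z * ?e0 x\<bar> \<le> (C4 * (b + L) * s) * \<Phi> ((1 / s) *\<^sub>R (x - z))" for x
      proof -
        let ?y = "norm (x - z)"
        define w where "w = norm (x - z) / s"
        have yw: "norm (x - z) = s * w" using s by (simp add: w_def)
        have w0: "w \<ge> 0" using s by (simp add: w_def)
        have \<Phi>w: "\<Phi> ((1 / s) *\<^sub>R (x - z)) = (w + w ^ (k + 1)) * exp (- (c * w ^ k))"
          using s by (simp add: \<Phi>_def w_def)
        have div: "t ^ k / \<epsilon> = (t / s) ^ k" for t :: real using s by (simp add: power_divide)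
        let ?E = "exp (- (c * w ^ k))"
        have low0: "c * w ^ k \<le> (norm (T (x - z)) / s) ^ k"
        proof -
          have "c0 / 2 * norm (x - z) \<le> norm (T (x - z))"
            by (rule order_trans[OF mult_right_mono c0(2)]) (use c0(1) in auto)
          then have "c0 / 2 * w \<le> norm (T (x - z)) / s" using s by (simp add: yw pos_le_divide_eq ac_simps)
          then have "(c0 / 2 * w) ^ k \<le> (norm (T (x - z)) / s) ^ k" by (rule power_mono) (rule mult_nonneg_nonneg[OF _ w0], use c0 in simp)
          then show ?thesis by (simp only: c_def power_mult_distrib)
        qed
        show ?thesis
        proof (cases "x \<in> ball z r")
          case True
          then have x: "?y < r" by (simp add: dist_norm norm_minus_commute)
          have low1: "c * w ^ k \<le> (norm (F x) / s) ^ k"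
          proof -
            have "c0 / 2 * w \<le> norm (F x) / s" using inner(2)[OF x] s by (simp add: yw pos_le_divide_eq ac_simps)
            then have "(c0 / 2 * w) ^ k \<le> (norm (F x) / s) ^ k" by (rule power_mono) (rule mult_nonneg_nonneg[OF _ w0], use c0 in simp)
            then show ?thesis by (simp only: c_def power_mult_distrib)
          qed
          have "\<bar>(norm (F x) / s) ^ k - (norm (T (x - z)) / s) ^ k\<bar>
              \<le> real k * (C3 * w) ^ (k - 1) * \<bar>norm (F x) / s - norm (T (x - z)) / s\<bar>"
          proof (rule abs_power_diff_le)
            show "norm (F x) / s \<le> C3 * w" using inner(3)[OF x] s by (simp add: yw pos_divide_le_eq ac_simps)
            have "norm (T (x - z)) \<le> C3 * norm (x - z)"
              using C0(2)[of "x - z"] mult_right_mono[OF C3(2) norm_ge_zero[of "x - z"]] by simp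
            then show "norm (T (x - z)) / s \<le> C3 * w" using s by (simp add: yw pos_divide_le_eq ac_simps)
          qed (use s in auto)
          also have "\<dots> \<le> real k * (C3 * w) ^ (k - 1) * (C2 * s * w\<^sup>2)"
          proof (intro mult_left_mono)
            have "\<bar>norm (F x) / s - norm (T (x - z)) / s\<bar> = \<bar>norm (F x) - norm (T (x - z))\<bar> / s"
              using s by (simp add: diff_divide_distrib[symmetric])
            also have "\<dots> \<le> C2 * (norm (x - z))\<^sup>2 / s" using inner(1)[OF x] s by (intro divide_right_mono) auto
            also have "\<dots> = C2 * s * w\<^sup>2" using s by (simp add: yw power2_eq_square)
            finally show "\<bar>norm (F x) / s - norm (T (x - z)) / s\<bar> \<le> C2 * s * w\<^sup>2" .
          qed (use C3 w0 in auto)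
          also have "\<dots> = (real k * C3 ^ (k - 1) * C2) * (s * w ^ (k + 1))"
          proof -
            have "w ^ (k - 1) * w\<^sup>2 = w ^ (k + 1)" using k by (simp only: power_add[symmetric]) simp
            then show ?thesis by (simp only: power_mult_distrib) (simp add: ac_simps)
          qed
          also have "\<dots> \<le> C4 * (s * w ^ (k + 1))" using C4 s w0 by (intro mult_right_mono) auto
          finally have pd: "\<bar>(norm (F x) / s) ^ k - (norm (T (x - z)) / s) ^ k\<bar> \<le> C4 * (s * w ^ (k + 1))" .
          have e: "\<bar>?e1 x - ?e0 x\<bar> \<le> ?E * (C4 * (s * w ^ (k + 1)))"
            unfolding div by (rule order_trans[OF abs_exp_minus_diff_le[OF low1 low0] mult_left_mono[OF pd]]) simp
          have e1: "?e1 x \<le> ?E" unfolding div using low1 by simp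
          have "\<bar>h x * ?e1 x - h z * ?e0 x\<bar> \<le> b * \<bar>?e1 x - ?e0 x\<bar> + ?E * \<bar>h x - h z\<bar>"
          proof -
            have "h x * ?e1 x - h z * ?e0 x = h z * (?e1 x - ?e0 x) + ?e1 x * (h x - h z)" by (simp add: algebra_simps)
            then have "\<bar>h x * ?e1 x - h z * ?e0 x\<bar> \<le> h z * \<bar>?e1 x - ?e0 x\<bar> + ?e1 x * \<bar>h x - h z\<bar>"
              using abs_triangle_ineq[of "h z * (?e1 x - ?e0 x)" "?e1 x * (h x - h z)"] h(1)[of z] by (simp add: abs_mult)
            also have "\<dots> \<le> b * \<bar>?e1 x - ?e0 x\<bar> + ?E * \<bar>h x - h z\<bar>"
              using h(2)[of z] e1 by (intro add_mono mult_right_mono) auto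
            finally show ?thesis .
          qed
          also have "\<dots> \<le> b * (?E * (C4 * (s * w ^ (k + 1)))) + ?E * (L * (s * w))"
            using e b h(5)[of x z] yw by (intro add_mono mult_left_mono) auto
          also have "\<dots> \<le> (C4 * (b + L) * s) * ((w + w ^ (k + 1)) * ?E)"
          proof -
            have "L * w \<le> C4 * (L * w)" using C4 h(4) w0 mult_right_mono[OF C4(2), of "L * w"] by simp
            moreover have "0 \<le> C4 * (b * w)" "0 \<le> C4 * (L * w ^ (k + 1))" using C4 b h(4) w0 by auto
            ultimately have "b * (C4 * w ^ (k + 1)) + L * w \<le> C4 * (b + L) * (w + w ^ (k + 1))"
              by (simp add: algebra_simps)
            then have "(?E * s) * (b * (C4 * w ^ (k + 1)) + L * w) \<le> (?E * s) * (C4 * (b + L) * (w + w ^ (k + 1)))"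
              using s by (intro mult_left_mono) auto
            then show ?thesis by (simp only: distrib_left distrib_right ac_simps)
          qed
          finally show ?thesis unfolding \<Phi>w .
        next
          case False
          then have x: "r \<le> ?y" by (simp add: dist_norm norm_minus_commute)
          \<comment> \<open>off the ball only the linearised term survives, and \<open>1 \<le> norm (x - z) / r\<close> supplies the factor \<open>\<epsilon> powr (1/k)\<close>\<close>
          have "\<bar>h x * ?e1 x - h z * ?e0 x\<bar> = h z * ?e0 x" using h(3)[OF False] h(1)[of z] by simp
          also have "\<dots> \<le> b * ?E" unfolding div using low0 h(1,2)[of z] by (intro mult_mono) auto
          also have "\<dots> \<le> b * ?E * (1 / r * ?y)"
          proof -
            have "1 \<le> 1 / r * ?y" using x r by (simp add: field_simps)
            then show ?thesis using mult_left_mono[of 1 "1 / r * ?y" "b * ?E"] b by (simp only: mult_1_right zero_le_mult_iff exp_ge_zero) simp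
          qed
          also have "\<dots> \<le> b * ?E * (C4 * ?y)" using C4 b by (intro mult_left_mono mult_right_mono) auto
          also have "\<dots> = (C4 * s) * (b * w * ?E)" unfolding yw by simp
          also have "\<dots> \<le> (C4 * s) * ((b + L) * (w + w ^ (k + 1)) * ?E)"
            using C4 s b h(4) w0 by (intro mult_left_mono mult_right_mono mult_mono) auto
          finally show ?thesis unfolding \<Phi>w by (simp only: ac_simps)
        qed
      qed
      have nnP: "(\<integral>\<^sup>+x. ennreal (\<Phi> ((1 / s) *\<^sub>R (x - z))) \<partial>lborel) = ennreal (s ^ CARD('d) * I)"
      proof -
        have "(\<integral>\<^sup>+x. ennreal (\<Phi> ((1 / s) *\<^sub>R (x - z))) \<partial>lborel) = ennreal (s ^ CARD('d)) * (\<integral>\<^sup>+v. ennreal (\<Phi> v) \<partial>lborel)"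
          using s nn_integral_lborel_affine[of "\<lambda>x. ennreal (\<Phi> ((1 / s) *\<^sub>R (x - z)))" s z] by simp
        also have "(\<integral>\<^sup>+v. ennreal (\<Phi> v) \<partial>lborel) = ennreal I"
          unfolding I_def using \<Phi>int \<Phi>0 by (intro nn_integral_eq_integral) auto
        finally show ?thesis using s I0 by (simp add: ennreal_mult)
      qed
      have Pint: "integrable lborel (\<lambda>x. \<Phi> ((1 / s) *\<^sub>R (x - z)))"
        using nnP \<Phi>0 by (intro integrableI_nonneg) auto
      have Pval: "(\<integral>x. \<Phi> ((1 / s) *\<^sub>R (x - z)) \<partial>lborel) = s ^ CARD('d) * I"
        using nnP \<Phi>0 s I0 by (subst integral_eq_nn_integral) auto
      have e0nn: "(\<integral>\<^sup>+x. ennreal (?e0 x) \<partial>lborel) = ennreal (s ^ CARD('d) * (?a / gen_jacobian F z))"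
      proof -
        let ?f = "\<lambda>v::real ^ 'd. exp (- (norm v ^ k / \<epsilon>))"
        have fint: "integrable lborel ?f"
          using integrable_power_exp_power[of "1 / \<epsilon>" k 0, where 'a = "real ^ 'd"] \<epsilon> k by simp
        have "(\<integral>\<^sup>+v. ennreal (?f v) \<partial>lborel) = ennreal (\<epsilon> powr (DIM(real ^ 'd) / real k)) *
            (\<integral>\<^sup>+v. ennreal (?f ((\<epsilon> powr (1 / real k)) *\<^sub>R v)) \<partial>lborel)"
          by (rule nn_integral_exp_scaled[OF k \<epsilon>]) measurable
        then have f1: "(\<integral>\<^sup>+v. ennreal (?f v) \<partial>lborel) = ennreal (s ^ CARD('d) * ?a)"
          using a s by (simp only: scaled_norm_power[OF \<epsilon> k] nn_integral_radial[OF k]) (simp add: sd ennreal_mult)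
        have "ennreal (gen_jacobian F z) * (\<integral>\<^sup>+x. ennreal (?f (T x)) \<partial>lborel) = ennreal (s ^ CARD('d) * ?a)"
          unfolding f1[symmetric] detT[symmetric] by (rule nn_integral_linear_image[OF T _ _ fint]) auto
        then have "ennreal (1 / gen_jacobian F z) * (ennreal (gen_jacobian F z) * (\<integral>\<^sup>+x. ennreal (?f (T x)) \<partial>lborel))
            = ennreal (1 / gen_jacobian F z) * ennreal (s ^ CARD('d) * ?a)" by simp
        then have "(\<integral>\<^sup>+x. ennreal (?f (T x)) \<partial>lborel) = ennreal (s ^ CARD('d) * (?a / gen_jacobian F z))"
          using Jpos a s by (simp add: mult.assoc[symmetric] ennreal_mult[symmetric])
        moreover have "(\<integral>\<^sup>+x. ennreal (?e0 x) \<partial>lborel) = (\<integral>\<^sup>+x. ennreal (?f (T x)) \<partial>lborel)"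
          using nn_integral_lborel_affine[of "\<lambda>x. ennreal (?e0 x)" 1 z] by simp
        ultimately show ?thesis by simp
      qed
      have e0int: "integrable lborel ?e0" using e0nn by (intro integrableI_nonneg) auto
      have e0val: "(\<integral>x. ?e0 x \<partial>lborel) = s ^ CARD('d) * (?a / gen_jacobian F z)"
        using e0nn a s Jpos by (subst integral_eq_nn_integral) auto
      have dint: "integrable lborel (\<lambda>x. h x * ?e1 x - h z * ?e0 x)"
      proof (rule Bochner_Integration.integrable_bound)
        show "integrable lborel (\<lambda>x. (C4 * (b + L) * s) * \<Phi> ((1 / s) *\<^sub>R (x - z)))" using Pint by simp
        show "AE x in lborel. norm (h x * ?e1 x - h z * ?e0 x) \<le> norm ((C4 * (b + L) * s) * \<Phi> ((1 / s) *\<^sub>R (x - z)))"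
          using order_trans[OF pw abs_ge_self] by (intro AE_I2) simp
      qed measurable
      have "integrable lborel (\<lambda>x. (h x * ?e1 x - h z * ?e0 x) + h z * ?e0 x)"
        using dint e0int by (intro Bochner_Integration.integrable_add) simp_all
      then have h1int: "integrable lborel (\<lambda>x. h x * ?e1 x)" by simp
      have "(\<integral>x. h x * ?e1 x \<partial>lborel) - h z * (\<integral>x. ?e0 x \<partial>lborel) = (\<integral>x. h x * ?e1 x - h z * ?e0 x \<partial>lborel)"
        using h1int e0int by simp
      then have "\<bar>(\<integral>x. h x * ?e1 x \<partial>lborel) - h z * (\<integral>x. ?e0 x \<partial>lborel)\<bar> \<le> (\<integral>x. \<bar>h x * ?e1 x - h z * ?e0 x\<bar> \<partial>lborel)"
        using integral_abs_bound[of lborel "\<lambda>x. h x * ?e1 x - h z * ?e0 x"] by simp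
      also have "\<dots> \<le> (\<integral>x. (C4 * (b + L) * s) * \<Phi> ((1 / s) *\<^sub>R (x - z)) \<partial>lborel)"
        using dint Pint pw by (intro integral_mono) auto
      also have "\<dots> = (C4 * (b + L) * s) * (s ^ CARD('d) * I)" by (simp add: Pval)
      finally have diff: "\<bar>(\<integral>x. h x * ?e1 x \<partial>lborel) - s ^ CARD('d) * \<Lambda>\<bar> \<le> (C4 * (b + L) * s) * (s ^ CARD('d) * I)"
        by (simp add: e0val \<Lambda>_def ac_simps)
      have lm: "laplace_mean F k \<epsilon> h = (\<integral>x. h x * ?e1 x \<partial>lborel) / s ^ CARD('d)"
        using card by (simp add: laplace_mean_def min_absorb1 powr_minus_divide sd)
      have "laplace_mean F k \<epsilon> h - \<Lambda> = ((\<integral>x. h x * ?e1 x \<partial>lborel) - s ^ CARD('d) * \<Lambda>) / s ^ CARD('d)"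
        unfolding lm using s by (simp add: field_simps)
      then have "\<bar>laplace_mean F k \<epsilon> h - \<Lambda>\<bar> = \<bar>(\<integral>x. h x * ?e1 x \<partial>lborel) - s ^ CARD('d) * \<Lambda>\<bar> / s ^ CARD('d)"
        using s by (simp add: abs_divide)
      also have "\<dots> \<le> (C4 * (b + L) * s) * (s ^ CARD('d) * I) / s ^ CARD('d)"
        using diff s by (intro divide_right_mono) auto
      also have "\<dots> = (C4 * I) * (b + L) * s" using s by simp
      finally show ?thesis by (simp add: s_def)
    qed
    have "ennreal \<Lambda> \<le> ennreal (\<theta> * ?a) * zero_set_integral F h"
    proof -
      have "ennreal ?a * zero_set_integral F h \<le> ennreal (\<theta> * ?a) * zero_set_integral F h"
        using \<theta> a by (intro mult_right_mono ennreal_leI) auto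
      then show ?thesis by (simp add: zi)
    qed
    moreover have "ennreal ?a * zero_set_integral F h \<le> ennreal (\<theta> * \<Lambda>)"
      unfolding zi using \<theta> \<Lambda>0 mult_right_mono[of 1 \<theta> \<Lambda>] by (intro ennreal_leI) simp
    ultimately show ?thesis using \<Lambda>0 rate by blast
  qed
  have "local_laplace F k ?a \<theta> z r (C4 * I)"
    unfolding local_laplace_def using main by (auto simp: Z sing)
  moreover have "C4 * I \<ge> 0" using C4 I0 by simp
  ultimately show "\<exists>r>0. \<exists>K\<ge>0. local_laplace F k ?a \<theta> z r K" using r by blast
qed

section \<open>Partitions of unity and quotients\<close>

text \<open>
  The tent functions \<open>max 0 (r z - dist x z)\<close> of a finite subcover, divided by their sum. Cutting the
  denominator off below at half its minimum over \<open>Z\<close> keeps the quotients Lipschitz on the whole space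
  without changing them near \<open>Z\<close>.
\<close>

lemma Lipschitz_partition_of_unity:
  fixes Z :: "'a::metric_space set" and r :: "'a \<Rightarrow> real"
  assumes Z: "compact Z" "Z \<noteq> {}" and r: "\<And>z. z \<in> Z \<Longrightarrow> r z > 0"
  obtains K \<eta> L W where "finite K" "K \<subseteq> Z" "0 \<le> L" "open W" "Z \<subseteq> W"
    "\<And>z x. z \<in> K \<Longrightarrow> 0 \<le> \<eta> z x \<and> \<eta> z x \<le> (1::real)"
    "\<And>z x y. z \<in> K \<Longrightarrow> \<bar>\<eta> z x - \<eta> z y\<bar> \<le> L * dist x y"
    "\<And>z x. z \<in> K \<Longrightarrow> x \<notin> ball z (r z) \<Longrightarrow> \<eta> z x = 0"
    "\<And>x. x \<in> W \<Longrightarrow> (\<Sum>z\<in>K. \<eta> z x) = 1" "\<And>x. (\<Sum>z\<in>K. \<eta> z x) \<le> 1"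
proof -
  have "Z \<subseteq> (\<Union>z\<in>Z. ball z (r z))" using r by auto
  then obtain K where K: "K \<subseteq> Z" "finite K" "Z \<subseteq> (\<Union>z\<in>K. ball z (r z))"
    using compactE_image[OF Z(1), of Z "\<lambda>z. ball z (r z)"] by auto
  define \<psi> where "\<psi> z x = max 0 (r z - dist x z)" for z x
  have \<psi>0: "\<psi> z x \<ge> 0" for z x by (simp add: \<psi>_def)
  have \<psi>lip: "\<bar>\<psi> z x - \<psi> z y\<bar> \<le> dist x y" for z x y
    using dist_triangle[of x z y] dist_triangle[of y z x] by (simp add: \<psi>_def dist_commute max_def) linarith
  define S where "S x = (\<Sum>z\<in>K. \<psi> z x)" for x
  have \<psi>S: "\<psi> z x \<le> S x" if "z \<in> K" for z x
    unfolding S_def using that K \<psi>0 by (intro member_le_sum) auto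
  have Slip: "\<bar>S x - S y\<bar> \<le> real (card K) * dist x y" for x y
  proof -
    have "\<bar>S x - S y\<bar> = \<bar>\<Sum>z\<in>K. \<psi> z x - \<psi> z y\<bar>" by (simp add: S_def sum_subtractf)
    also have "\<dots> \<le> (\<Sum>z\<in>K. dist x y)" by (intro order_trans[OF sum_abs] sum_mono \<psi>lip)
    finally show ?thesis by simp
  qed
  have "(real (card K))-lipschitz_on UNIV S"
    using Slip by (intro lipschitz_onI) (auto simp: dist_real_def)
  then have Scont: "continuous_on UNIV S" by (rule lipschitz_on_continuous_on)
  have Spos: "S x > 0" if x: "x \<in> Z" for x
  proof -
    obtain z where z: "z \<in> K" "x \<in> ball z (r z)" using K(3) x by blast
    then have "\<psi> z x > 0" by (simp add: \<psi>_def dist_commute)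
    then show ?thesis using \<psi>S[OF z(1), of x] by linarith
  qed
  obtain x0 where x0: "x0 \<in> Z" "\<And>x. x \<in> Z \<Longrightarrow> S x0 \<le> S x"
    using continuous_attains_inf[OF Z continuous_on_subset[OF Scont]] by blast
  define s where "s = S x0 / 2"
  have s: "s > 0" using Spos[OF x0(1)] by (simp add: s_def)
  define W where "W = {x. s < S x}"
  have W: "open W" "Z \<subseteq> W"
  proof -
    show "open W" unfolding W_def by (intro open_Collect_less continuous_on_const Scont)
    show "Z \<subseteq> W" using x0 s by (force simp: W_def s_def)
  qed
  define M where "M x = max (S x) s" for x
  have M: "M x \<ge> s" "S x \<le> M x" "M x > 0" for x using s by (auto simp: M_def)
  have Mlip: "\<bar>M x - M y\<bar> \<le> real (card K) * dist x y" for x y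
    using Slip[of x y] by (simp add: M_def max_def) linarith
  define \<eta> where "\<eta> z x = \<psi> z x / M x" for z x
  define L where "L = (1 + real (card K)) / s"
  show ?thesis
  proof
    show "0 \<le> L" using s by (simp add: L_def)
    fix z x y assume z: "z \<in> K"
    show b: "0 \<le> \<eta> z x \<and> \<eta> z x \<le> 1" for x
      using \<psi>0[of z x] \<psi>S[OF z, of x] M[of x] by (simp add: \<eta>_def)
    have "\<eta> z x - \<eta> z y = (\<psi> z x - \<psi> z y) / M x + \<eta> z y * ((M y - M x) / M x)"
      using M(3)[of x] M(3)[of y] by (simp add: \<eta>_def field_simps)
    then have "\<bar>\<eta> z x - \<eta> z y\<bar> \<le> \<bar>\<psi> z x - \<psi> z y\<bar> / M x + \<eta> z y * (\<bar>M y - M x\<bar> / M x)"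
      using M(3)[of x] b[of y]
        abs_triangle_ineq[of "(\<psi> z x - \<psi> z y) / M x" "\<eta> z y * ((M y - M x) / M x)"]
      by (simp add: abs_mult)
    also have "\<dots> \<le> dist x y / s + 1 * (real (card K) * dist x y / s)"
      using M[of x] s b[of y] \<psi>lip[of z x y] Mlip[of x y]
      by (intro add_mono mult_mono frac_le) (auto simp: abs_minus_commute)
    also have "\<dots> = L * dist x y" using s by (simp add: L_def field_simps)
    finally show "\<bar>\<eta> z x - \<eta> z y\<bar> \<le> L * dist x y" .
  next
    fix z x assume "z \<in> K" "x \<notin> ball z (r z)"
    then show "\<eta> z x = 0" by (simp add: \<eta>_def \<psi>_def dist_commute)
  next
    fix x
    have sum: "(\<Sum>z\<in>K. \<eta> z x) = S x / M x" by (simp add: \<eta>_def S_def sum_divide_distrib)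
    show "(\<Sum>z\<in>K. \<eta> z x) \<le> 1" unfolding sum using M(2,3)[of x] by simp
    show "(\<Sum>z\<in>K. \<eta> z x) = 1" if "x \<in> W" unfolding sum using that s by (simp add: W_def M_def)
  qed (use K W in auto)
qed

lemma le_if_le_all_multiples:
  fixes a b :: real
  assumes "b \<ge> 0" "\<And>\<theta>. \<theta> > 1 \<Longrightarrow> a \<le> \<theta> * b"
  shows "a \<le> b"
proof (rule field_le_epsilon)
  fix e :: real assume e: "e > 0"
  have "a \<le> (1 + e / (b + 1)) * b" using e assms(1) by (intro assms(2)) auto
  also have "\<dots> = b + e * (b / (b + 1))" by (simp add: algebra_simps)
  also have "\<dots> \<le> b + e * 1" using e assms(1) by (intro add_left_mono mult_left_mono) auto
  finally show "a \<le> b + e" by simp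
qed

text \<open>
  Error propagation for a quotient whose denominator stays away from zero; \<open>b\<close> bounds the limiting
  ratio \<open>y / n\<close>.
\<close>

lemma ratio_error:
  fixes x y w n b E0 E1 :: real
  assumes n: "n > 0" and w: "n / 2 \<le> w" and x: "\<bar>x - y\<bar> \<le> E1" and E: "\<bar>w - n\<bar> \<le> E0" and y: "\<bar>y\<bar> \<le> b * n"
  shows "\<bar>x / w - y / n\<bar> \<le> 2 / n * (E1 + b * E0)"
proof -
  have w0: "w > 0" using n w by linarith
  have b: "b \<ge> 0" using y n by (smt (verit) mult_neg_pos)
  have "x / w - y / n = (x - y) / w + (y / n) * ((n - w) / w)"
    using n w0 by (simp add: field_simps)
  then have "\<bar>x / w - y / n\<bar> \<le> \<bar>x - y\<bar> / w + \<bar>y\<bar> / n * (\<bar>w - n\<bar> / w)"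
    using abs_triangle_ineq[of "(x - y) / w" "(y / n) * ((n - w) / w)"] n w0
    by (simp add: abs_mult abs_minus_commute)
  also have "\<dots> \<le> E1 / (n / 2) + b * (E0 / (n / 2))"
  proof (intro add_mono mult_mono)
    show "\<bar>x - y\<bar> / w \<le> E1 / (n / 2)" using x n w by (intro frac_le) auto
    show "\<bar>w - n\<bar> / w \<le> E0 / (n / 2)" using E n w by (intro frac_le) auto
    show "\<bar>y\<bar> / n \<le> b" using y n by (simp add: pos_divide_le_eq)
  qed (use b w0 in auto)
  also have "\<dots> = 2 / n * (E1 + b * E0)" using n by (simp add: field_simps)
  finally show ?thesis .
qed

lemma tendsto_powr_inverse_at_right_0:
  "k \<ge> (1::nat) \<Longrightarrow> ((\<lambda>\<epsilon>::real. \<epsilon> powr (1 / real k)) \<longlongrightarrow> 0) (at_right 0)"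
proof -
  assume k: "k \<ge> 1"
  have "((\<lambda>\<epsilon>::real. \<epsilon> powr (1 / real k)) \<longlongrightarrow> 0 powr (1 / real k)) (at_right 0)"
    using k by (intro tendsto_powr2 tendsto_ident_at tendsto_const) (auto simp: eventually_at_right_less eventually_at_filter)
  then show ?thesis by simp
qed

section \<open>Growth at infinity and the zero set\<close>

text \<open>
  The hypotheses of the theorem together with the local expansions, which hide the distinction between
  submersions and immersions from the global argument.
\<close>

locale laplace_setting =
  fixes F :: "real ^ 'd \<Rightarrow> real ^ 'p" and k :: nat and m \<alpha> R c :: real
  assumes k: "k \<ge> 1" and F: "smooth F" and F0: "F 0 = 0"
    and m: "m > 0" and \<alpha>: "\<alpha> > 0" and R: "R \<ge> 0"
    and growth: "\<And>x. norm x \<ge> R \<Longrightarrow> norm (F x) \<ge> m * norm x powr \<alpha>"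
    and c: "c > 0"
    and jac_pos: "\<And>x. F x = 0 \<Longrightarrow> gen_jacobian F x > 0"
    and charts: "\<And>z \<theta>. F z = 0 \<Longrightarrow> \<theta> > 1 \<Longrightarrow> \<exists>r>0. \<exists>K\<ge>0. local_laplace F k c \<theta> z r K"
    and zero_set_pos: "0 < emeasure (zero_set_hausdorff F) (F -` {0})"
begin

abbreviation "Z \<equiv> F -` {0}"
abbreviation "a \<equiv> \<alpha> * real k"
abbreviation "weight \<equiv> \<lambda>\<epsilon> x. exp (- (norm (F x) ^ k / \<epsilon>))"

lemma measurable_F [measurable]: "F \<in> borel_measurable borel"
  using smooth_continuous_on[OF F] by (rule borel_measurable_continuous_onI)

lemma measurable_jac [measurable]: "gen_jacobian F \<in> borel_measurable borel"
  using continuous_on_gen_jacobian[OF F] by (rule borel_measurable_continuous_onI)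

lemma Z_borel [measurable]: "Z \<in> sets borel"
  using measurable_sets[OF measurable_F, of "{0}"] by simp

lemma a_pos: "a > 0" using \<alpha> k by simp

lemma norm_F_power: "norm x \<ge> R \<Longrightarrow> m ^ k * norm x powr a \<le> norm (F x) ^ k"
proof -
  assume x: "norm x \<ge> R"
  have "(m * norm x powr \<alpha>) ^ k \<le> norm (F x) ^ k"
    using growth[OF x] m by (intro power_mono) auto
  moreover have "(norm x powr \<alpha>) ^ k = norm x powr a"
    using k \<alpha> by (cases "norm x = 0") (simp_all add: powr_realpow[symmetric] powr_powr)
  ultimately show ?thesis by (simp only: power_mult_distrib)
qed

lemma compact_Z: "compact Z"
proof -
  have "norm x \<le> R" if x: "F x = 0" for x
  proof (rule ccontr)
    assume "\<not> norm x \<le> R"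
    then have "m * norm x powr \<alpha> \<le> 0" "norm x > 0" using growth[of x] x R by auto
    then show False using m by (simp add: mult_le_0_iff)
  qed
  then have "bounded Z" by (auto simp: bounded_iff)
  moreover have "closed Z"
    by (intro continuous_closed_vimage) (use smooth_continuous_on[OF F, of UNIV] in \<open>auto simp: continuous_on_eq_continuous_at\<close>)
  ultimately show ?thesis by (simp add: compact_eq_bounded_closed)
qed

lemma zero_in_Z: "0 \<in> Z" using F0 by simp

text \<open>
  Where the growth bound holds, the exponent \<open>norm (F x) ^ k / \<epsilon>\<close> is at least
  \<open>(C + 1) * norm x powr a\<close>; elsewhere \<open>norm x < R\<close>, which costs the constant factor.
\<close>

lemma weight_dominated:
  assumes "\<epsilon> > 0" "C \<ge> 0" "\<epsilon> * (C + 1) \<le> m ^ k"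
  shows "exp (C * norm x powr a) * weight \<epsilon> x \<le> exp ((C + 1) * R powr a) * exp (- (norm x powr a))"
proof (cases "norm x \<ge> R")
  case True
  have "(C + 1) * norm x powr a \<le> m ^ k / \<epsilon> * norm x powr a"
    using assms by (intro mult_right_mono) (auto simp: pos_le_divide_eq mult.commute)
  also have "\<dots> \<le> norm (F x) ^ k / \<epsilon>"
    using norm_F_power[OF True] assms(1) by (simp add: divide_right_mono)
  finally have "C * norm x powr a - norm (F x) ^ k / \<epsilon> \<le> (C + 1) * R powr a - norm x powr a"
    using assms(2) by (simp add: algebra_simps) (smt (verit) mult_nonneg_nonneg powr_ge_zero)
  then show ?thesis by (simp add: mult_exp_exp)
next
  case False
  have "norm x powr a \<le> R powr a" using False a_pos by (intro powr_mono2) auto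
  then have "(C + 1) * norm x powr a \<le> (C + 1) * R powr a" using assms(2) by (intro mult_left_mono) auto
  moreover have "0 \<le> norm (F x) ^ k / \<epsilon>" using assms(1) by simp
  ultimately have "C * norm x powr a - norm (F x) ^ k / \<epsilon> \<le> (C + 1) * R powr a - norm x powr a"
    by (simp add: algebra_simps)
  then show ?thesis by (simp add: mult_exp_exp)
qed

lemma integrable_tail: "integrable lborel (\<lambda>x::real ^ 'd. exp (- (norm x powr a)))"
  using integrable_power_exp_powr[of 1 a 0, where 'a = "real ^ 'd"] a_pos by simp

lemma integrable_weighted:
  assumes \<phi>m [measurable]: "\<phi> \<in> borel_measurable borel"
    and \<phi>: "\<And>x. \<bar>\<phi> x\<bar> \<le> C * exp (C * norm x powr a)" and C: "C \<ge> 0"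
    and \<epsilon>: "\<epsilon> > 0" "\<epsilon> * (C + 1) \<le> m ^ k"
  shows "integrable lborel (\<lambda>x. \<phi> x * weight \<epsilon> x)"
proof (rule Bochner_Integration.integrable_bound)
  show "integrable lborel (\<lambda>x::real ^ 'd. C * exp ((C + 1) * R powr a) * exp (- (norm x powr a)))"
    using integrable_tail by simp
  show "AE x in lborel. norm (\<phi> x * weight \<epsilon> x) \<le> norm (C * exp ((C + 1) * R powr a) * exp (- (norm x powr a)))"
  proof (rule AE_I2)
    fix x
    have "\<bar>\<phi> x * weight \<epsilon> x\<bar> \<le> C * exp (C * norm x powr a) * weight \<epsilon> x"
      using \<phi>[of x] by (simp add: abs_mult)
    also have "\<dots> = C * (exp (C * norm x powr a) * weight \<epsilon> x)" by simp
    also have "\<dots> \<le> C * (exp ((C + 1) * R powr a) * exp (- (norm x powr a)))"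
      by (intro mult_left_mono weight_dominated \<epsilon> C)
    finally show "norm (\<phi> x * weight \<epsilon> x) \<le> norm (C * exp ((C + 1) * R powr a) * exp (- (norm x powr a)))"
      using C by simp
  qed
qed measurable

lemma integrable_weight:
  assumes "\<epsilon> > 0"
  shows "integrable lborel (weight \<epsilon>)"
proof (rule Bochner_Integration.integrable_bound)
  let ?\<beta> = "m ^ k / \<epsilon>"
  have \<beta>: "?\<beta> > 0" using m assms by simp
  show "integrable lborel (\<lambda>x::real ^ 'd. exp (?\<beta> * R powr a) * exp (- (?\<beta> * norm x powr a)))"
    using integrable_power_exp_powr[OF \<beta> a_pos, of 0, where 'a = "real ^ 'd"] by simp
  show "AE x in lborel. norm (weight \<epsilon> x) \<le> norm (exp (?\<beta> * R powr a) * exp (- (?\<beta> * norm x powr a)))"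
  proof (rule AE_I2)
    fix x
    have "?\<beta> * norm x powr a - ?\<beta> * R powr a \<le> norm (F x) ^ k / \<epsilon>"
    proof (cases "norm x \<ge> R")
      case True
      have "?\<beta> * norm x powr a \<le> norm (F x) ^ k / \<epsilon>"
        using norm_F_power[OF True] assms(1) by (simp add: divide_right_mono)
      moreover have "0 \<le> ?\<beta> * R powr a" using \<beta> by (intro mult_nonneg_nonneg) auto
      ultimately show ?thesis by linarith
    next
      case False
      have "norm x powr a \<le> R powr a" using False a_pos by (intro powr_mono2) auto
      then have "?\<beta> * norm x powr a \<le> ?\<beta> * R powr a" using \<beta> by (intro mult_left_mono) auto
      moreover have "0 \<le> norm (F x) ^ k / \<epsilon>" using assms(1) by simp
      ultimately show ?thesis by linarith
    qed
    then show "norm (weight \<epsilon> x) \<le> norm (exp (?\<beta> * R powr a) * exp (- (?\<beta> * norm x powr a)))"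
      by (simp add: mult_exp_exp)
  qed
qed measurable

text \<open>
  Compactness inside a large ball, the growth condition outside.
\<close>

lemma bounded_away_from_zero_set:
  assumes W: "open W" "Z \<subseteq> W"
  obtains \<delta> where "\<delta> > 0" "\<And>x. x \<notin> W \<Longrightarrow> \<delta> \<le> norm (F x)"
proof -
  define R1 where "R1 = max R 1"
  let ?S = "cball 0 R1 - W"
  have "\<exists>\<delta>>0. \<forall>x\<in>?S. \<delta> \<le> norm (F x)"
  proof (cases "?S = {}")
    case False
    have "compact ?S" using W by (intro compact_diff) auto
    moreover have "continuous_on ?S (\<lambda>x. norm (F x))" by (intro continuous_intros smooth_continuous_on F)
    ultimately obtain x0 where x0: "x0 \<in> ?S" "\<forall>x\<in>?S. norm (F x0) \<le> norm (F x)"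
      using continuous_attains_inf False by blast
    moreover have "F x0 \<noteq> 0" using x0 W by auto
    ultimately show ?thesis by (intro exI[of _ "norm (F x0)"]) auto
  qed (auto intro: exI[of _ 1])
  then obtain \<delta> where \<delta>: "\<delta> > 0" "\<And>x. x \<in> ?S \<Longrightarrow> \<delta> \<le> norm (F x)" by blast
  show ?thesis
  proof (rule that[of "min \<delta> m"])
    show "min \<delta> m > 0" using \<delta> m by simp
    fix x assume x: "x \<notin> W"
    show "min \<delta> m \<le> norm (F x)"
    proof (cases "norm x \<le> R1")
      case True
      then show ?thesis using \<delta>(2)[of x] x by auto
    next
      case False
      then have n: "norm x \<ge> R" "norm x \<ge> 1" by (auto simp: R1_def)
      then have "1 \<le> norm x powr \<alpha>" using \<alpha> by (intro ge_one_powr_ge_zero) auto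
      then have "m * 1 \<le> m * norm x powr \<alpha>" using m by (intro mult_left_mono) auto
      then show ?thesis using growth[OF n(1)] by simp
    qed
  qed
qed

text \<open>
  The weight is the square of the weight at \<open>2 * \<epsilon>\<close>. One factor is at most \<open>exp (- \<delta> ^ k / (2 * \<epsilon>))\<close>
  off \<open>W\<close>, which is smaller than any power of \<open>\<epsilon>\<close>; the other one compensates the growth of \<open>\<phi>\<close>. The
  constant does not depend on \<open>\<phi>\<close> and \<open>C\<close>.
\<close>

lemma tail_estimate:
  assumes W: "open W" "Z \<subseteq> W"
  shows "\<exists>K\<ge>0. \<forall>\<phi> C \<epsilon>. \<phi> \<in> borel_measurable borel \<longrightarrow> C \<ge> 0 \<longrightarrow> (\<forall>x. \<bar>\<phi> x\<bar> \<le> C * exp (C * norm x powr a)) \<longrightarrow>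
     0 < \<epsilon> \<longrightarrow> \<epsilon> \<le> 1 \<longrightarrow> 2 * \<epsilon> * (C + 1) \<le> m ^ k \<longrightarrow> (\<forall>x\<in>W. \<phi> x = 0) \<longrightarrow>
     \<bar>laplace_mean F k \<epsilon> \<phi>\<bar> \<le> K * (C * exp ((C + 1) * R powr a)) * \<epsilon> powr (1 / real k)"
proof -
  obtain \<delta> where \<delta>: "\<delta> > 0" "\<And>x. x \<notin> W \<Longrightarrow> \<delta> \<le> norm (F x)"
    using bounded_away_from_zero_set[OF W] by blast
  \<comment> \<open>\<open>\<epsilon> ^ N\<close> beats the rescaling factor \<open>\<epsilon> powr (- q / k)\<close> with \<open>\<epsilon> powr (1 / k)\<close> to spare\<close>
  define N where "N = min CARD('d) CARD('p) + 1"
  define I where "I = (\<integral>(x::real ^ 'd). exp (- (norm x powr a)) \<partial>lborel)"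
  have I: "I \<ge> 0" unfolding I_def by (intro Bochner_Integration.integral_nonneg) auto
  define K0 where "K0 = (real N * 2 / \<delta> ^ k) ^ N"
  have K0: "K0 \<ge> 0" using \<delta> by (simp add: K0_def)
  show ?thesis
  proof (intro exI[of _ "K0 * I"] conjI allI impI)
    show "0 \<le> K0 * I" using K0 I by simp
    fix \<phi> :: "real ^ 'd \<Rightarrow> real" and C \<epsilon> :: real
    assume \<phi>m [measurable]: "\<phi> \<in> borel_measurable borel" and C: "C \<ge> 0"
      and \<phi>: "\<forall>x. \<bar>\<phi> x\<bar> \<le> C * exp (C * norm x powr a)"
      and \<epsilon>: "0 < \<epsilon>" "\<epsilon> \<le> 1" "2 * \<epsilon> * (C + 1) \<le> m ^ k" and \<phi>W: "\<forall>x\<in>W. \<phi> x = 0"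
    let ?D = "C * exp ((C + 1) * R powr a)"
    have D: "?D \<ge> 0" using C by simp
    have small: "exp (- (\<delta> ^ k / (2 * \<epsilon>))) \<le> K0 * \<epsilon> powr ((real (min CARD('d) CARD('p)) + 1) / real k)"
    proof -
      have "exp (- (\<delta> ^ k / (2 * \<epsilon>))) \<le> (real N / (\<delta> ^ k / (2 * \<epsilon>))) ^ N"
        using \<delta> \<epsilon> by (intro exp_minus_le_power) (auto simp: N_def)
      also have "\<dots> = K0 * \<epsilon> ^ N"
        unfolding K0_def power_mult_distrib[symmetric] by (simp add: mult.assoc)
      also have "\<epsilon> ^ N = \<epsilon> powr real N" using \<epsilon> by (simp add: powr_realpow)
      also have "\<epsilon> powr real N \<le> \<epsilon> powr ((real (min CARD('d) CARD('p)) + 1) / real k)"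
      proof (rule powr_mono')
        have "(real (min CARD('d) CARD('p)) + 1) / real k \<le> (real (min CARD('d) CARD('p)) + 1) / 1"
          using k by (intro divide_left_mono) auto
        then show "(real (min CARD('d) CARD('p)) + 1) / real k \<le> real N" by (simp add: N_def)
      qed (use \<epsilon> in auto)
      finally show ?thesis using K0 by (simp add: mult_left_mono)
    qed
    have pw: "\<bar>\<phi> x * weight \<epsilon> x\<bar> \<le> (K0 * \<epsilon> powr ((real (min CARD('d) CARD('p)) + 1) / real k) * ?D) * exp (- (norm x powr a))" for x
    proof (cases "x \<in> W")
      case True
      then show ?thesis using \<phi>W K0 D by simp
    next
      case False
      have split: "weight \<epsilon> x = weight (2 * \<epsilon>) x * weight (2 * \<epsilon>) x"
        using \<epsilon> by (simp add: mult_exp_exp)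
      have "\<delta> ^ k \<le> norm (F x) ^ k" using \<delta> False by (intro power_mono) auto
      then have "weight (2 * \<epsilon>) x \<le> exp (- (\<delta> ^ k / (2 * \<epsilon>)))" using \<epsilon> by (simp add: divide_right_mono)
      then have w1: "weight (2 * \<epsilon>) x \<le> K0 * \<epsilon> powr ((real (min CARD('d) CARD('p)) + 1) / real k)" using small by linarith
      have "\<bar>\<phi> x * weight \<epsilon> x\<bar> = \<bar>\<phi> x\<bar> * weight (2 * \<epsilon>) x * weight (2 * \<epsilon>) x"
        by (simp add: split abs_mult)
      also have "\<dots> \<le> (C * exp (C * norm x powr a)) * weight (2 * \<epsilon>) x * (K0 * \<epsilon> powr ((real (min CARD('d) CARD('p)) + 1) / real k))"
        using \<phi> w1 C K0 by (intro mult_mono mult_nonneg_nonneg) auto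
      also have "\<dots> = C * (K0 * \<epsilon> powr ((real (min CARD('d) CARD('p)) + 1) / real k)) * (exp (C * norm x powr a) * weight (2 * \<epsilon>) x)" by simp
      also have "\<dots> \<le> C * (K0 * \<epsilon> powr ((real (min CARD('d) CARD('p)) + 1) / real k)) * (exp ((C + 1) * R powr a) * exp (- (norm x powr a)))"
        using \<epsilon> C K0 by (intro mult_left_mono weight_dominated) auto
      finally show ?thesis by (simp add: ac_simps)
    qed
    have int: "integrable lborel (\<lambda>x. (K0 * \<epsilon> powr ((real (min CARD('d) CARD('p)) + 1) / real k) * ?D) * exp (- (norm (x::real ^ 'd) powr a)))"
      using integrable_tail by simp
    have "\<bar>\<integral>x. \<phi> x * weight \<epsilon> x \<partial>lborel\<bar> \<le> (\<integral>x. \<bar>\<phi> x * weight \<epsilon> x\<bar> \<partial>lborel)"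
      by (rule integral_abs_bound)
    also have "\<dots> \<le> (\<integral>x. (K0 * \<epsilon> powr ((real (min CARD('d) CARD('p)) + 1) / real k) * ?D) * exp (- (norm (x::real ^ 'd) powr a)) \<partial>lborel)"
    proof (intro integral_mono)
      show "integrable lborel (\<lambda>x. \<bar>\<phi> x * weight \<epsilon> x\<bar>)"
      proof (rule Bochner_Integration.integrable_bound[OF int])
        show "AE x in lborel. norm \<bar>\<phi> x * weight \<epsilon> x\<bar> \<le> norm ((K0 * \<epsilon> powr ((real (min CARD('d) CARD('p)) + 1) / real k) * ?D) * exp (- (norm x powr a)))"
          by (intro AE_I2) (simp only: real_norm_def abs_idempotent, rule order_trans[OF pw abs_ge_self])
      qed measurable
    qed (use int pw in auto)
    also have "\<dots> = K0 * \<epsilon> powr ((real (min CARD('d) CARD('p)) + 1) / real k) * ?D * I" by (simp add: I_def)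
    finally have b: "\<bar>\<integral>x. \<phi> x * weight \<epsilon> x \<partial>lborel\<bar> \<le> K0 * \<epsilon> powr ((real (min CARD('d) CARD('p)) + 1) / real k) * ?D * I" .
    have "\<bar>laplace_mean F k \<epsilon> \<phi>\<bar> = \<epsilon> powr (- (real (min CARD('d) CARD('p)) / real k)) * \<bar>\<integral>x. \<phi> x * weight \<epsilon> x \<partial>lborel\<bar>"
      by (simp add: laplace_mean_def abs_mult)
    also have "\<dots> \<le> \<epsilon> powr (- (real (min CARD('d) CARD('p)) / real k)) * (K0 * \<epsilon> powr ((real (min CARD('d) CARD('p)) + 1) / real k) * ?D * I)"
      using b by (intro mult_left_mono) auto
    also have "\<dots> = (\<epsilon> powr (- (real (min CARD('d) CARD('p)) / real k)) * \<epsilon> powr ((real (min CARD('d) CARD('p)) + 1) / real k)) * (K0 * ?D * I)" by (simp only: ac_simps)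
    also have "\<epsilon> powr (- (real (min CARD('d) CARD('p)) / real k)) * \<epsilon> powr ((real (min CARD('d) CARD('p)) + 1) / real k) = \<epsilon> powr (1 / real k)"
      using \<epsilon> by (simp only: powr_add[symmetric]) (simp add: add_divide_distrib)
    finally show "\<bar>laplace_mean F k \<epsilon> \<phi>\<bar> \<le> (K0 * I) * ?D * \<epsilon> powr (1 / real k)" by (simp only: ac_simps)
  qed
qed

lemma zero_set_finite: "emeasure (zero_set_hausdorff F) Z < \<infinity>"
proof -
  have "\<forall>z\<in>Z. \<exists>r>0. emeasure (zero_set_hausdorff F) (Z \<inter> ball z r) < \<infinity>"
  proof
    fix z assume "z \<in> Z"
    then obtain r K where "r > 0" "local_laplace F k c 2 z r K" using charts[of z 2] by auto
    then show "\<exists>r>0. emeasure (zero_set_hausdorff F) (Z \<inter> ball z r) < \<infinity>"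
      unfolding local_laplace_def by blast
  qed
  then obtain r where r: "\<And>z. z \<in> Z \<Longrightarrow> r z > 0 \<and> emeasure (zero_set_hausdorff F) (Z \<inter> ball z (r z)) < \<infinity>"
    by metis
  have "Z \<subseteq> (\<Union>z\<in>Z. ball z (r z))" using r by force
  then obtain K where K: "K \<subseteq> Z" "finite K" "Z \<subseteq> (\<Union>z\<in>K. ball z (r z))"
    using compactE_image[OF compact_Z, of Z "\<lambda>z. ball z (r z)"] by auto
  have "emeasure (zero_set_hausdorff F) Z \<le> emeasure (zero_set_hausdorff F) (\<Union>z\<in>K. Z \<inter> ball z (r z))"
    using K by (intro emeasure_mono) (auto intro!: sets.finite_UN sets.Int Z_borel)
  also have "\<dots> \<le> (\<Sum>z\<in>K. emeasure (zero_set_hausdorff F) (Z \<inter> ball z (r z)))"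
    using K(2) by (intro emeasure_subadditive_finite) (auto intro!: sets.Int Z_borel)
  also have "\<dots> < \<infinity>" using K r by (auto simp: ennreal_sum_less_top[unfolded infinity_ennreal_def[symmetric]])
  finally show ?thesis .
qed

lemma jac_lower_bound: obtains j where "j > 0" "\<And>x. x \<in> Z \<Longrightarrow> j \<le> gen_jacobian F x"
proof -
  obtain x0 where "x0 \<in> Z" "\<forall>x\<in>Z. gen_jacobian F x0 \<le> gen_jacobian F x"
    using continuous_attains_inf[OF compact_Z _ continuous_on_gen_jacobian[OF F]] zero_in_Z by blast
  then show ?thesis using jac_pos[of x0] by (intro that[of "gen_jacobian F x0"]) auto
qed

text \<open>
  The unnormalised \<open>\<pi>\<^sub>0\<close>-integral, as a real number for signed functions; \<open>zero_set_integral\<close> is the same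
  for nonnegative ones.
\<close>

definition limit_int :: "(real ^ 'd \<Rightarrow> real) \<Rightarrow> real" where
  "limit_int f = (\<integral>x. f x * (1 / gen_jacobian F x * indicator Z x) \<partial>zero_set_hausdorff F)"

lemma integrable_limit:
  assumes fm [measurable]: "f \<in> borel_measurable borel" and fb: "\<And>x. x \<in> Z \<Longrightarrow> \<bar>f x\<bar> \<le> b"
  shows "integrable (zero_set_hausdorff F) (\<lambda>x. f x * (1 / gen_jacobian F x * indicator Z x))"
proof -
  obtain j where j: "j > 0" "\<And>x. x \<in> Z \<Longrightarrow> j \<le> gen_jacobian F x" by (rule jac_lower_bound) (rule that)
  have b: "b \<ge> 0" using fb[OF zero_in_Z] by linarith
  show ?thesis
  proof (rule Bochner_Integration.integrable_bound)
    show "integrable (zero_set_hausdorff F) (\<lambda>x. b / j * indicator Z x :: real)"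
      using zero_set_finite by (intro integrable_mult_right integrable_real_indicator) auto
    show "AE x in zero_set_hausdorff F. norm (f x * (1 / gen_jacobian F x * indicator Z x)) \<le> norm (b / j * indicator Z x :: real)"
    proof (rule AE_I2)
      fix x
      have "\<bar>f x\<bar> / \<bar>gen_jacobian F x\<bar> \<le> b / j" if "x \<in> Z"
        using fb[OF that] j(1) j(2)[OF that] b by (intro frac_le) auto
      then show "norm (f x * (1 / gen_jacobian F x * indicator Z x)) \<le> norm (b / j * indicator Z x :: real)"
        using b j(1) by (auto simp: indicator_def abs_mult)
    qed
  qed measurable
qed

lemma zero_set_integral_eq:
  assumes [measurable]: "f \<in> borel_measurable borel" and f: "\<And>x. x \<in> Z \<Longrightarrow> 0 \<le> f x \<and> f x \<le> b"
  shows "zero_set_integral F f = ennreal (limit_int f)" "limit_int f \<ge> 0"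
proof -
  have nn: "f x * (1 / gen_jacobian F x * indicator Z x) \<ge> 0" for x
    using f[of x] jac_pos[of x] by (auto simp: indicator_def)
  have int: "integrable (zero_set_hausdorff F) (\<lambda>x. f x * (1 / gen_jacobian F x * indicator Z x))"
    using f by (intro integrable_limit[of f b]) auto
  have "zero_set_integral F f = (\<integral>\<^sup>+x. ennreal (f x * (1 / gen_jacobian F x * indicator Z x)) \<partial>zero_set_hausdorff F)"
    unfolding zero_set_integral_def by (intro nn_integral_cong) (auto simp: indicator_def)
  also have "\<dots> = ennreal (limit_int f)"
    unfolding limit_int_def using int nn by (intro nn_integral_eq_integral) auto
  finally show "zero_set_integral F f = ennreal (limit_int f)" .
  show "limit_int f \<ge> 0" unfolding limit_int_def using nn by (intro Bochner_Integration.integral_nonneg) auto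
qed

section \<open>Expansion near the zero set\<close>

lemma integrable_bounded_weight:
  assumes [measurable]: "f \<in> borel_measurable borel" and f: "\<And>x. \<bar>f x\<bar> \<le> b" and "\<epsilon> > 0"
  shows "integrable lborel (\<lambda>x. f x * weight \<epsilon> x)"
proof (rule Bochner_Integration.integrable_bound)
  show "integrable lborel (\<lambda>x. b * weight \<epsilon> x)" using integrable_weight[OF assms(3)] by simp
  show "AE x in lborel. norm (f x * weight \<epsilon> x) \<le> norm (b * weight \<epsilon> x)"
    using f order_trans[OF f abs_ge_self] by (intro AE_I2) (simp add: abs_mult)
qed measurable

lemma laplace_mean_add:
  assumes "integrable lborel (\<lambda>x. f x * weight \<epsilon> x)" "integrable lborel (\<lambda>x. g x * weight \<epsilon> x)"
  shows "laplace_mean F k \<epsilon> (\<lambda>x. f x + g x) = laplace_mean F k \<epsilon> f + laplace_mean F k \<epsilon> g"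
  using assms by (simp add: laplace_mean_def distrib_right distrib_left)

lemma laplace_mean_diff:
  assumes "integrable lborel (\<lambda>x. f x * weight \<epsilon> x)" "integrable lborel (\<lambda>x. g x * weight \<epsilon> x)"
  shows "laplace_mean F k \<epsilon> (\<lambda>x. f x - g x) = laplace_mean F k \<epsilon> f - laplace_mean F k \<epsilon> g"
  using assms by (simp add: laplace_mean_def left_diff_distrib right_diff_distrib)

lemma laplace_mean_cmult: "laplace_mean F k \<epsilon> (\<lambda>x. b * f x) = b * laplace_mean F k \<epsilon> f"
  by (simp add: laplace_mean_def mult.assoc)

lemma laplace_mean_sum:
  assumes "\<And>z. z \<in> K \<Longrightarrow> integrable lborel (\<lambda>x. h z x * weight \<epsilon> x)"
  shows "laplace_mean F k \<epsilon> (\<lambda>x. \<Sum>z\<in>K. h z x) = (\<Sum>z\<in>K. laplace_mean F k \<epsilon> (h z))"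
  using assms by (simp add: laplace_mean_def sum_distrib_right sum_distrib_left)

lemma cutoff_measurable:
  assumes "open U" "L-lipschitz_on U f"
  shows "(\<lambda>x. indicator U x * f x :: real) \<in> borel_measurable borel"
  using borel_measurable_continuous_on_indicator[OF borel_open[OF assms(1)] lipschitz_on_continuous_on[OF assms(2)]]
  by simp

text \<open>
  Sums the local expansions of \<open>\<eta> z * f\<close> over a partition of unity subordinate to charts that lie in
  \<open>U\<close>. The part of \<open>f\<close> not seen by the partition vanishes near \<open>Z\<close>, so it is covered by
  \<open>tail_estimate\<close>. Shrinking the charts into \<open>U\<close> makes \<open>\<eta> z * f\<close> Lipschitz on the whole space although
  \<open>f\<close> is controlled on \<open>U\<close> only.
\<close>

lemma neighbourhood_expansion_approx:
  assumes U: "open U" "Z \<subseteq> U" and \<theta>: "\<theta> > 1"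
  shows "\<exists>C\<ge>0. \<forall>f b L. (\<forall>x\<in>U. 0 \<le> f x \<and> f x \<le> b) \<and> L-lipschitz_on U f \<longrightarrow>
    (\<exists>\<Lambda>\<ge>0. (\<forall>\<epsilon>. 0 < \<epsilon> \<and> \<epsilon> \<le> 1 \<and> 4 * \<epsilon> \<le> m ^ k \<longrightarrow>
        \<bar>laplace_mean F k \<epsilon> (\<lambda>x. indicator U x * f x) - \<Lambda>\<bar> \<le> C * (b + L) * \<epsilon> powr (1 / real k)) \<and>
      ennreal \<Lambda> \<le> ennreal (\<theta> * c) * zero_set_integral F (\<lambda>x. indicator U x * f x) \<and>
      ennreal c * zero_set_integral F (\<lambda>x. indicator U x * f x) \<le> ennreal (\<theta> * \<Lambda>))"
proof -
  have "\<forall>z\<in>Z. \<exists>r>0. \<exists>K\<ge>0. local_laplace F k c \<theta> z r K \<and> ball z r \<subseteq> U"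
  proof
    fix z assume z: "z \<in> Z"
    obtain r K where r: "r > 0" "K \<ge> 0" "local_laplace F k c \<theta> z r K" using charts[of z \<theta>] z \<theta> by auto
    obtain e where e: "e > 0" "ball z e \<subseteq> U" using U z by (meson open_contains_ball subsetD)
    have "local_laplace F k c \<theta> z (min r e) K" by (rule local_laplace_antimono[OF r(3) _ F]) simp
    moreover have "min r e > 0" "ball z (min r e) \<subseteq> U" using r e by auto
    ultimately show "\<exists>r>0. \<exists>K\<ge>0. local_laplace F k c \<theta> z r K \<and> ball z r \<subseteq> U"
      using r(2) by blast
  qed
  then obtain r Kz where r: "\<And>z. z \<in> Z \<Longrightarrow> r z > 0" "\<And>z. z \<in> Z \<Longrightarrow> Kz z \<ge> (0::real)"
      "\<And>z. z \<in> Z \<Longrightarrow> local_laplace F k c \<theta> z (r z) (Kz z)" "\<And>z. z \<in> Z \<Longrightarrow> ball z (r z) \<subseteq> U"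
    by metis
  have Zne: "Z \<noteq> {}" using zero_in_Z by blast
  obtain K \<eta> H W where K: "finite K" "K \<subseteq> Z" "0 \<le> H" "open W" "Z \<subseteq> W"
    and \<eta>01: "\<And>z x. z \<in> K \<Longrightarrow> 0 \<le> \<eta> z x \<and> \<eta> z x \<le> (1::real)"
    and \<eta>lip: "\<And>z x y. z \<in> K \<Longrightarrow> \<bar>\<eta> z x - \<eta> z y\<bar> \<le> H * dist x y"
    and \<eta>supp: "\<And>z x. z \<in> K \<Longrightarrow> x \<notin> ball z (r z) \<Longrightarrow> \<eta> z x = 0"
    and \<eta>1: "\<And>x. x \<in> W \<Longrightarrow> (\<Sum>z\<in>K. \<eta> z x) = 1" and \<eta>le: "\<And>x. (\<Sum>z\<in>K. \<eta> z x) \<le> 1"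
    by (rule Lipschitz_partition_of_unity[OF compact_Z Zne r(1)]) (assumption, rule that)
  obtain Kt where Kt: "Kt \<ge> 0" "\<And>\<phi> C \<epsilon>. \<phi> \<in> borel_measurable borel \<Longrightarrow> C \<ge> 0 \<Longrightarrow> (\<forall>x. \<bar>\<phi> x\<bar> \<le> C * exp (C * norm x powr a)) \<Longrightarrow>
     0 < \<epsilon> \<Longrightarrow> \<epsilon> \<le> 1 \<Longrightarrow> 2 * \<epsilon> * (C + 1) \<le> m ^ k \<Longrightarrow> (\<forall>x\<in>W. \<phi> x = 0) \<Longrightarrow>
     \<bar>laplace_mean F k \<epsilon> \<phi>\<bar> \<le> Kt * (C * exp ((C + 1) * R powr a)) * \<epsilon> powr (1 / real k)"
    using tail_estimate[OF K(4,5)] by blast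
  define T where "T = Kt * exp (2 * R powr a)"
  have T: "T \<ge> 0" using Kt by (simp add: T_def)
  define C where "C = (\<Sum>z\<in>K. Kz z) * (1 + H) + T"
  have KK: "(\<Sum>z\<in>K. Kz z) \<ge> 0" using K(2) r(2) by (intro sum_nonneg) auto
  have C: "C \<ge> 0" using KK K(3) T by (simp add: C_def)
  show ?thesis
  proof (rule exI[of _ C], intro conjI C allI impI)
    fix f :: "real ^ 'd \<Rightarrow> real" and b L
    assume A: "(\<forall>x\<in>U. 0 \<le> f x \<and> f x \<le> b) \<and> L-lipschitz_on U f"
    then have f: "\<And>x. x \<in> U \<Longrightarrow> 0 \<le> f x" "\<And>x. x \<in> U \<Longrightarrow> f x \<le> b" and fL: "L-lipschitz_on U f"
      and flip: "\<And>x y. x \<in> U \<Longrightarrow> y \<in> U \<Longrightarrow> \<bar>f x - f y\<bar> \<le> L * dist x y" and L: "L \<ge> 0"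
      by (auto simp: lipschitz_on_def dist_real_def)
    have b: "b \<ge> 0" using f[of 0] U zero_in_Z by force
    define fU where "fU x = indicator U x * f x" for x
    have fUm [measurable]: "fU \<in> borel_measurable borel"
      unfolding fU_def[abs_def] by (rule cutoff_measurable[OF U(1) fL])
    have fU: "0 \<le> fU x" "fU x \<le> b" for x using f b by (auto simp: fU_def indicator_def)
    define h where "h z x = \<eta> z x * fU x" for z x
    have h01: "0 \<le> h z x" "h z x \<le> b" if "z \<in> K" for z x
    proof -
      show "0 \<le> h z x" using \<eta>01[OF that] fU by (simp add: h_def)
      have "\<eta> z x * fU x \<le> 1 * b" using \<eta>01[OF that, of x] fU[of x] by (intro mult_mono) auto
      then show "h z x \<le> b" by (simp add: h_def)
    qed
    have hsupp: "h z x = 0" if "z \<in> K" "x \<notin> ball z (r z)" for z x using \<eta>supp[OF that] by (simp add: h_def)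
    have hlip: "(L + b * H)-lipschitz_on UNIV (h z)" if z: "z \<in> K" for z
    proof (rule lipschitz_onI)
      have one: "\<bar>h z x - h z y\<bar> \<le> (L + b * H) * dist x y" if x: "x \<in> U" for x y
      proof (cases "y \<in> U")
        case True
        have "\<bar>h z x - h z y\<bar> \<le> 1 * \<bar>f x - f y\<bar> + b * \<bar>\<eta> z x - \<eta> z y\<bar>"
          unfolding h_def using x True f[OF True] \<eta>01[OF z, of x] by (simp add: fU_def) (intro abs_mult_diff_le[of _ 1, simplified]; simp)
        also have "\<dots> \<le> 1 * (L * dist x y) + b * (H * dist x y)"
          using flip[OF x True] \<eta>lip[OF z, of x y] b by (intro add_mono mult_left_mono) auto
        finally show ?thesis by (simp add: algebra_simps)
      next
        case False
        have y0: "\<eta> z y = 0" using \<eta>supp[OF z] False r(4)[of z] K(2) z by blast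
        have "\<bar>h z x - h z y\<bar> = fU x * \<bar>\<eta> z x - \<eta> z y\<bar>" using fU[of x] by (simp add: h_def y0 abs_mult)
        also have "\<dots> \<le> b * (H * dist x y)" using fU[of x] \<eta>lip[OF z, of x y] by (intro mult_mono) auto
        also have "\<dots> \<le> (L + b * H) * dist x y" using L by (simp add: algebra_simps)
        finally show ?thesis .
      qed
      show "dist (h z x) (h z y) \<le> (L + b * H) * dist x y" for x y
      proof (cases "x \<in> U \<or> y \<in> U")
        case True
        then show ?thesis using one[of x y] one[of y x] by (auto simp: dist_real_def abs_minus_commute dist_commute)
      next
        case False
        then show ?thesis using L b K(3) by (simp add: h_def fU_def)
      qed
      show "0 \<le> L + b * H" using L b K(3) by simp
    qed
    have hm [measurable]: "h z \<in> borel_measurable borel" if "z \<in> K" for z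
      using lipschitz_on_continuous_on[OF hlip[OF that]] by (rule borel_measurable_continuous_onI)
    have "\<exists>\<Lambda>\<ge>0. (\<forall>\<epsilon>. 0 < \<epsilon> \<and> \<epsilon> \<le> 1 \<longrightarrow> \<bar>laplace_mean F k \<epsilon> (h z) - \<Lambda>\<bar> \<le> Kz z * (b + (L + b * H)) * \<epsilon> powr (1 / real k)) \<and>
         ennreal \<Lambda> \<le> ennreal (\<theta> * c) * zero_set_integral F (h z) \<and>
         ennreal c * zero_set_integral F (h z) \<le> ennreal (\<theta> * \<Lambda>)" if z: "z \<in> K" for z
    proof -
      have "(\<forall>x. 0 \<le> h z x \<and> h z x \<le> b) \<and> (L + b * H)-lipschitz_on UNIV (h z) \<and> (\<forall>x. x \<notin> ball z (r z) \<longrightarrow> h z x = 0)"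
        using h01[OF z] hlip[OF z] hsupp[OF z] by blast
      moreover have "local_laplace F k c \<theta> z (r z) (Kz z)" using r(3) z K(2) by blast
      ultimately show ?thesis unfolding local_laplace_def by blast
    qed
    then obtain \<Lambda> where \<Lambda>: "\<And>z. z \<in> K \<Longrightarrow> \<Lambda> z \<ge> 0"
      "\<And>z \<epsilon>. z \<in> K \<Longrightarrow> 0 < \<epsilon> \<Longrightarrow> \<epsilon> \<le> 1 \<Longrightarrow> \<bar>laplace_mean F k \<epsilon> (h z) - \<Lambda> z\<bar> \<le> Kz z * (b + (L + b * H)) * \<epsilon> powr (1 / real k)"
      "\<And>z. z \<in> K \<Longrightarrow> ennreal (\<Lambda> z) \<le> ennreal (\<theta> * c) * zero_set_integral F (h z)"
      "\<And>z. z \<in> K \<Longrightarrow> ennreal c * zero_set_integral F (h z) \<le> ennreal (\<theta> * \<Lambda> z)"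
      by metis
    have zsum: "zero_set_integral F fU = (\<Sum>z\<in>K. zero_set_integral F (h z))"
    proof -
      have "zero_set_integral F fU = (\<integral>\<^sup>+x. (\<Sum>z\<in>K. ennreal (h z x / gen_jacobian F x) * indicator Z x) \<partial>zero_set_hausdorff F)"
        unfolding zero_set_integral_def
      proof (rule nn_integral_cong)
        fix x
        show "ennreal (fU x / gen_jacobian F x) * indicator Z x = (\<Sum>z\<in>K. ennreal (h z x / gen_jacobian F x) * indicator Z x)"
        proof (cases "x \<in> Z")
          case True
          then have J: "gen_jacobian F x > 0" using jac_pos by auto
          have "fU x = (\<Sum>z\<in>K. h z x)"
            using \<eta>1[of x] K(5) True by (auto simp: h_def sum_distrib_right[symmetric])
          then have "fU x / gen_jacobian F x = (\<Sum>z\<in>K. h z x / gen_jacobian F x)"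
            by (simp add: sum_divide_distrib)
          then show ?thesis using True h01 J by (simp add: sum_ennreal del: vimage_eq)
        qed simp
      qed
      also have "\<dots> = (\<Sum>z\<in>K. zero_set_integral F (h z))"
        unfolding zero_set_integral_def
      proof (rule nn_integral_sum)
        fix z assume "z \<in> K"
        then have [measurable]: "h z \<in> borel_measurable borel" by (rule hm)
        show "(\<lambda>x. ennreal (h z x / gen_jacobian F x) * indicator Z x) \<in> borel_measurable (zero_set_hausdorff F)"
          by measurable
      qed
      finally show ?thesis .
    qed
    show "\<exists>\<Lambda>\<ge>0. (\<forall>\<epsilon>. 0 < \<epsilon> \<and> \<epsilon> \<le> 1 \<and> 4 * \<epsilon> \<le> m ^ k \<longrightarrow>
        \<bar>laplace_mean F k \<epsilon> (\<lambda>x. indicator U x * f x) - \<Lambda>\<bar> \<le> C * (b + L) * \<epsilon> powr (1 / real k)) \<and>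
      ennreal \<Lambda> \<le> ennreal (\<theta> * c) * zero_set_integral F (\<lambda>x. indicator U x * f x) \<and>
      ennreal c * zero_set_integral F (\<lambda>x. indicator U x * f x) \<le> ennreal (\<theta> * \<Lambda>)"
      unfolding fU_def[symmetric]
    proof (intro exI[of _ "\<Sum>z\<in>K. \<Lambda> z"] conjI allI impI)
      show S0: "0 \<le> (\<Sum>z\<in>K. \<Lambda> z)" using \<Lambda>(1) by (rule sum_nonneg)
      show "ennreal (\<Sum>z\<in>K. \<Lambda> z) \<le> ennreal (\<theta> * c) * zero_set_integral F fU"
      proof -
        have "ennreal (\<Sum>z\<in>K. \<Lambda> z) = (\<Sum>z\<in>K. ennreal (\<Lambda> z))" using \<Lambda>(1) by (intro sum_ennreal[symmetric])
        also have "\<dots> \<le> ennreal (\<theta> * c) * zero_set_integral F fU"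
          unfolding zsum sum_distrib_left by (intro sum_mono \<Lambda>(3))
        finally show ?thesis .
      qed
      show "ennreal c * zero_set_integral F fU \<le> ennreal (\<theta> * (\<Sum>z\<in>K. \<Lambda> z))"
      proof -
        have "ennreal c * zero_set_integral F fU \<le> (\<Sum>z\<in>K. ennreal (\<theta> * \<Lambda> z))"
          unfolding zsum sum_distrib_left by (intro sum_mono \<Lambda>(4))
        also have "\<dots> = ennreal (\<Sum>z\<in>K. \<theta> * \<Lambda> z)" using \<Lambda>(1) \<theta> by (intro sum_ennreal) auto
        finally show ?thesis by (simp add: sum_distrib_left)
      qed
      fix \<epsilon> :: real assume e: "0 < \<epsilon> \<and> \<epsilon> \<le> 1 \<and> 4 * \<epsilon> \<le> m ^ k"
      then have \<epsilon>: "0 < \<epsilon>" "\<epsilon> \<le> 1" "2 * \<epsilon> * (1 + 1) \<le> m ^ k" by auto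
      let ?s = "\<epsilon> powr (1 / real k)"
      \<comment> \<open>the part of \<open>f\<close> missed by the partition of unity, which vanishes on \<open>W\<close>\<close>
      define \<rho> where "\<rho> x = (1 - (\<Sum>z\<in>K. \<eta> z x)) * fU x" for x
      have \<rho>eq: "\<rho> x = fU x - (\<Sum>z\<in>K. h z x)" for x
        by (simp add: \<rho>_def h_def sum_distrib_right[symmetric] left_diff_distrib)
      have \<rho>m [measurable]: "\<rho> \<in> borel_measurable borel"
        unfolding \<rho>eq[abs_def] by measurable
      have \<rho>b: "\<bar>\<rho> x\<bar> \<le> b" for x
      proof -
        have "0 \<le> (\<Sum>z\<in>K. \<eta> z x)" using \<eta>01 by (intro sum_nonneg) auto
        then have "\<bar>\<rho> x\<bar> \<le> 1 * b" unfolding \<rho>_def abs_mult using \<eta>le[of x] fU[of x] by (intro mult_mono) auto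
        then show ?thesis by simp
      qed
      have tail: "\<bar>laplace_mean F k \<epsilon> \<rho>\<bar> \<le> T * b * ?s"
      proof (cases "b = 0")
        case True
        then have "\<rho> = (\<lambda>x. 0)" using \<rho>b by (auto simp: fun_eq_iff)
        then show ?thesis using True by (simp add: laplace_mean_def)
      next
        case False
        then have b': "b > 0" using b by simp
        let ?\<phi> = "\<lambda>x. \<rho> x / b"
        have "\<bar>laplace_mean F k \<epsilon> ?\<phi>\<bar> \<le> Kt * (1 * exp ((1 + 1) * R powr a)) * ?s"
        proof (rule Kt(2))
          show "\<forall>x. \<bar>\<rho> x / b\<bar> \<le> 1 * exp (1 * norm x powr a)"
          proof
            fix x
            have "\<bar>\<rho> x / b\<bar> \<le> 1" using \<rho>b[of x] b' by simp
            also have "1 \<le> exp (1 * norm x powr a)" by simp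
            finally show "\<bar>\<rho> x / b\<bar> \<le> 1 * exp (1 * norm x powr a)" by simp
          qed
          show "\<forall>x\<in>W. \<rho> x / b = 0" using \<eta>1 by (simp add: \<rho>_def)
        qed (use \<epsilon> in \<open>auto\<close>)
        then have "b * \<bar>laplace_mean F k \<epsilon> ?\<phi>\<bar> \<le> b * (T * ?s)" using b by (intro mult_left_mono) (auto simp: T_def)
        moreover have "laplace_mean F k \<epsilon> \<rho> = b * laplace_mean F k \<epsilon> ?\<phi>"
          using b' by (simp add: laplace_mean_cmult[symmetric])
        ultimately show ?thesis using b by (simp add: abs_mult ac_simps)
      qed
      have hint: "integrable lborel (\<lambda>x. h z x * weight \<epsilon> x)" if "z \<in> K" for z
        using h01[OF that] by (intro integrable_bounded_weight[OF hm[OF that], of b] \<epsilon>) auto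
      have \<rho>int: "integrable lborel (\<lambda>x. \<rho> x * weight \<epsilon> x)"
        by (intro integrable_bounded_weight[OF \<rho>m \<rho>b] \<epsilon>)
      have "integrable lborel (\<lambda>x. (\<Sum>z\<in>K. h z x) * weight \<epsilon> x)"
        unfolding sum_distrib_right by (intro Bochner_Integration.integrable_sum hint)
      then have "laplace_mean F k \<epsilon> (\<lambda>x. (\<Sum>z\<in>K. h z x) + \<rho> x)
          = (\<Sum>z\<in>K. laplace_mean F k \<epsilon> (h z)) + laplace_mean F k \<epsilon> \<rho>"
        using \<rho>int by (subst laplace_mean_add) (simp_all add: laplace_mean_sum[OF hint])
      moreover have "(\<lambda>x. (\<Sum>z\<in>K. h z x) + \<rho> x) = fU" by (simp add: fun_eq_iff \<rho>eq)
      ultimately have "laplace_mean F k \<epsilon> fU - (\<Sum>z\<in>K. \<Lambda> z)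
          = (\<Sum>z\<in>K. laplace_mean F k \<epsilon> (h z) - \<Lambda> z) + laplace_mean F k \<epsilon> \<rho>"
        by (simp add: sum_subtractf)
      then have "\<bar>laplace_mean F k \<epsilon> fU - (\<Sum>z\<in>K. \<Lambda> z)\<bar>
          \<le> (\<Sum>z\<in>K. \<bar>laplace_mean F k \<epsilon> (h z) - \<Lambda> z\<bar>) + \<bar>laplace_mean F k \<epsilon> \<rho>\<bar>"
        using abs_triangle_ineq[of "\<Sum>z\<in>K. laplace_mean F k \<epsilon> (h z) - \<Lambda> z" "laplace_mean F k \<epsilon> \<rho>"]
          sum_abs[of "\<lambda>z. laplace_mean F k \<epsilon> (h z) - \<Lambda> z" K] by linarith
      also have "\<dots> \<le> (\<Sum>z\<in>K. Kz z * (b + (L + b * H)) * ?s) + T * b * ?s"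
        using \<Lambda>(2) \<epsilon> tail by (intro add_mono sum_mono) auto
      also have "\<dots> = ((\<Sum>z\<in>K. Kz z) * (b + (L + b * H)) + T * b) * ?s"
        by (simp add: sum_distrib_right distrib_right mult.assoc)
      also have "\<dots> \<le> (C * (b + L)) * ?s"
      proof (intro mult_right_mono)
        have "b + (L + b * H) \<le> (1 + H) * (b + L)" using L K(3) by (simp add: algebra_simps)
        then have "(\<Sum>z\<in>K. Kz z) * (b + (L + b * H)) \<le> (\<Sum>z\<in>K. Kz z) * ((1 + H) * (b + L))"
          using KK by (rule mult_left_mono)
        moreover have "T * b \<le> T * (b + L)" using T L by (intro mult_left_mono) auto
        ultimately show "(\<Sum>z\<in>K. Kz z) * (b + (L + b * H)) + T * b \<le> C * (b + L)"
          by (simp add: C_def distrib_right mult.assoc)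
      qed simp
      finally show "\<bar>laplace_mean F k \<epsilon> fU - (\<Sum>z\<in>K. \<Lambda> z)\<bar> \<le> C * (b + L) * ?s" .
    qed
  qed
qed

text \<open>
  The rate is taken from distortion \<open>\<theta> = 2\<close>. The limit \<open>\<Lambda>\<close> obtained there is also the limit obtained for
  any other \<open>\<theta> > 1\<close>, because limits are unique; so \<open>\<Lambda>\<close> and \<open>c * limit_int\<close> agree up to every factor
  \<open>\<theta> > 1\<close>, that is, they are equal.
\<close>

lemma neighbourhood_expansion_nonneg:
  assumes U: "open U" "Z \<subseteq> U"
  shows "\<exists>C\<ge>0. \<forall>f b L. (\<forall>x\<in>U. 0 \<le> f x \<and> f x \<le> b) \<longrightarrow> L-lipschitz_on U f \<longrightarrow>
    (\<forall>\<epsilon>. 0 < \<epsilon> \<longrightarrow> \<epsilon> \<le> 1 \<longrightarrow> 4 * \<epsilon> \<le> m ^ k \<longrightarrow>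
        \<bar>laplace_mean F k \<epsilon> (\<lambda>x. indicator U x * f x) - c * limit_int (\<lambda>x. indicator U x * f x)\<bar>
          \<le> C * (b + L) * \<epsilon> powr (1 / real k))"
proof -
  let ?approx = "\<lambda>\<theta> C. \<forall>f b L. (\<forall>x\<in>U. 0 \<le> f x \<and> f x \<le> b) \<and> L-lipschitz_on U f \<longrightarrow>
    (\<exists>\<Lambda>\<ge>0. (\<forall>\<epsilon>. 0 < \<epsilon> \<and> \<epsilon> \<le> 1 \<and> 4 * \<epsilon> \<le> m ^ k \<longrightarrow>
        \<bar>laplace_mean F k \<epsilon> (\<lambda>x. indicator U x * f x) - \<Lambda>\<bar> \<le> C * (b + L) * \<epsilon> powr (1 / real k)) \<and>
      ennreal \<Lambda> \<le> ennreal (\<theta> * c) * zero_set_integral F (\<lambda>x. indicator U x * f x) \<and>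
      ennreal c * zero_set_integral F (\<lambda>x. indicator U x * f x) \<le> ennreal (\<theta> * \<Lambda>))"
  obtain C where C: "C \<ge> 0" "?approx 2 C"
    using neighbourhood_expansion_approx[OF U, of 2] by auto
  show ?thesis
  proof (intro exI[of _ C] conjI allI impI C(1))
    fix f :: "real ^ 'd \<Rightarrow> real" and b L \<epsilon>
    assume fb: "\<forall>x\<in>U. 0 \<le> f x \<and> f x \<le> b" and fL: "L-lipschitz_on U f"
      and \<epsilon>: "0 < \<epsilon>" "\<epsilon> \<le> 1" "4 * \<epsilon> \<le> m ^ k"
    define fU where "fU x = indicator U x * f x" for x
    have fUm [measurable]: "fU \<in> borel_measurable borel"
      unfolding fU_def[abs_def] by (rule cutoff_measurable[OF U(1) fL])
    define I where "I = limit_int fU"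
    have zI: "zero_set_integral F fU = ennreal I" and I0: "I \<ge> 0"
      unfolding I_def using fb U(2) by (intro zero_set_integral_eq[OF fUm, of b]; auto simp: fU_def)+
    have ex: "\<exists>\<Lambda>\<ge>0. (\<forall>\<epsilon>. 0 < \<epsilon> \<and> \<epsilon> \<le> 1 \<and> 4 * \<epsilon> \<le> m ^ k \<longrightarrow>
        \<bar>laplace_mean F k \<epsilon> fU - \<Lambda>\<bar> \<le> K * (b + L) * \<epsilon> powr (1 / real k)) \<and>
        \<Lambda> \<le> \<theta> * (c * I) \<and> c * I \<le> \<theta> * \<Lambda>" if \<theta>: "\<theta> > 1" and K: "?approx \<theta> K" for \<theta> K
    proof -
      have "(\<forall>x\<in>U. 0 \<le> f x \<and> f x \<le> b) \<and> L-lipschitz_on U f" using fb fL by blast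
      from K[THEN spec, THEN spec, THEN spec, THEN mp, OF this]
      obtain \<Lambda> where \<Lambda>: "\<Lambda> \<ge> 0" "\<forall>\<epsilon>. 0 < \<epsilon> \<and> \<epsilon> \<le> 1 \<and> 4 * \<epsilon> \<le> m ^ k \<longrightarrow>
          \<bar>laplace_mean F k \<epsilon> fU - \<Lambda>\<bar> \<le> K * (b + L) * \<epsilon> powr (1 / real k)"
        "ennreal \<Lambda> \<le> ennreal (\<theta> * c) * ennreal I" "ennreal c * ennreal I \<le> ennreal (\<theta> * \<Lambda>)"
        unfolding fU_def[symmetric] zI by blast
      have "ennreal \<Lambda> \<le> ennreal (\<theta> * c * I)" using \<Lambda>(3) \<theta> c I0 by (simp add: ennreal_mult)
      then have "\<Lambda> \<le> \<theta> * (c * I)" using \<theta> c I0 by (simp add: mult.assoc)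
      moreover have "ennreal (c * I) \<le> ennreal (\<theta> * \<Lambda>)" using \<Lambda>(4) c I0 by (simp add: ennreal_mult)
      then have "c * I \<le> \<theta> * \<Lambda>" using \<theta> \<Lambda>(1) by simp
      ultimately show ?thesis using \<Lambda>(1,2) by blast
    qed
    have lim: "((\<lambda>\<epsilon>. laplace_mean F k \<epsilon> fU) \<longlongrightarrow> \<Lambda>) (at_right 0)"
      if "\<forall>\<epsilon>. 0 < \<epsilon> \<and> \<epsilon> \<le> 1 \<and> 4 * \<epsilon> \<le> m ^ k \<longrightarrow> \<bar>laplace_mean F k \<epsilon> fU - \<Lambda>\<bar> \<le> K * \<epsilon> powr (1 / real k)" for \<Lambda> K
    proof (rule LIM_zero_cancel, rule Lim_null_comparison)
      show "((\<lambda>\<epsilon>. K * \<epsilon> powr (1 / real k)) \<longlongrightarrow> 0) (at_right 0)"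
        using tendsto_mult_right_zero[OF tendsto_powr_inverse_at_right_0[OF k], of K] by simp
      have "\<forall>\<^sub>F \<epsilon> in at_right 0. 0 < \<epsilon> \<and> \<epsilon> < min 1 (m ^ k / 4)"
        using m by (auto simp: eventually_at_right_field intro!: exI[of _ "min 1 (m ^ k / 4)"])
      then show "\<forall>\<^sub>F \<epsilon> in at_right 0. norm (laplace_mean F k \<epsilon> fU - \<Lambda>) \<le> K * \<epsilon> powr (1 / real k)"
        by (rule eventually_mono) (use that in auto)
    qed
    obtain \<Lambda> where \<Lambda>: "\<Lambda> \<ge> 0" "\<forall>\<epsilon>. 0 < \<epsilon> \<and> \<epsilon> \<le> 1 \<and> 4 * \<epsilon> \<le> m ^ k \<longrightarrow>
        \<bar>laplace_mean F k \<epsilon> fU - \<Lambda>\<bar> \<le> C * (b + L) * \<epsilon> powr (1 / real k)"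
      using ex[OF _ C(2)] by auto
    have both: "\<Lambda> \<le> \<theta> * (c * I)" "c * I \<le> \<theta> * \<Lambda>" if \<theta>: "\<theta> > 1" for \<theta>
    proof -
      obtain K where "?approx \<theta> K" using neighbourhood_expansion_approx[OF U \<theta>] by blast
      from ex[OF \<theta> this] obtain \<Lambda>' where \<Lambda>': "\<forall>\<epsilon>. 0 < \<epsilon> \<and> \<epsilon> \<le> 1 \<and> 4 * \<epsilon> \<le> m ^ k \<longrightarrow>
          \<bar>laplace_mean F k \<epsilon> fU - \<Lambda>'\<bar> \<le> K * (b + L) * \<epsilon> powr (1 / real k)"
          "\<Lambda>' \<le> \<theta> * (c * I)" "c * I \<le> \<theta> * \<Lambda>'"
        by blast
      have "\<Lambda>' = \<Lambda>" using tendsto_unique[OF _ lim[OF \<Lambda>'(1)] lim[OF \<Lambda>(2)]] by simp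
      then show "\<Lambda> \<le> \<theta> * (c * I)" "c * I \<le> \<theta> * \<Lambda>" using \<Lambda>' by auto
    qed
    have "\<Lambda> = c * I"
    proof (rule antisym)
      show "\<Lambda> \<le> c * I" using c I0 by (intro le_if_le_all_multiples[OF _ both(1)]) auto
      show "c * I \<le> \<Lambda>" by (rule le_if_le_all_multiples[OF \<Lambda>(1) both(2)])
    qed
    moreover have "\<bar>laplace_mean F k \<epsilon> fU - \<Lambda>\<bar> \<le> C * (b + L) * \<epsilon> powr (1 / real k)"
      using \<epsilon> by (intro \<Lambda>(2)[rule_format]) auto
    ultimately show "\<bar>laplace_mean F k \<epsilon> (\<lambda>x. indicator U x * f x) - c * limit_int (\<lambda>x. indicator U x * f x)\<bar>
          \<le> C * (b + L) * \<epsilon> powr (1 / real k)"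
      by (simp only: I_def fU_def[abs_def])
  qed
qed

section \<open>The Gibbs measures and their limit\<close>

lemma limit_int_diff:
  assumes [measurable]: "f \<in> borel_measurable borel" "g \<in> borel_measurable borel"
    and "\<And>x. x \<in> Z \<Longrightarrow> \<bar>f x\<bar> \<le> b" "\<And>x. x \<in> Z \<Longrightarrow> \<bar>g x\<bar> \<le> b'"
  shows "limit_int (\<lambda>x. f x - g x) = limit_int f - limit_int g"
  unfolding limit_int_def left_diff_distrib
  using integrable_limit[of f b] integrable_limit[of g b'] assms by (intro Bochner_Integration.integral_diff) auto

lemma limit_int_cong: "(\<And>x. x \<in> Z \<Longrightarrow> f x = g x) \<Longrightarrow> limit_int f = limit_int g"
  unfolding limit_int_def by (intro Bochner_Integration.integral_cong) (auto simp: indicator_def)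

definition mass :: real where "mass = limit_int (\<lambda>_. 1)"

lemma limit_norm_eq: "limit_norm F = ennreal mass"
  using zero_set_integral_eq(1)[of "\<lambda>_. 1" 1] by (simp add: limit_norm_def zero_set_integral_def mass_def)

text \<open>
  A positive density on a set of positive measure; that measure is positive because the chart at \<open>0\<close>
  carries a flat ball into \<open>Z\<close> (or, for isolated zeros, because points have mass \<open>1\<close>).
\<close>

lemma mass_pos: "mass > 0"
proof -
  have "mass \<noteq> 0"
  proof
    assume "mass = 0"
    then have "(\<integral>\<^sup>+x. ennreal (1 / gen_jacobian F x) * indicator Z x \<partial>zero_set_hausdorff F) = 0"
      using limit_norm_eq by (simp add: limit_norm_def)
    then have "AE x in zero_set_hausdorff F. ennreal (1 / gen_jacobian F x) * indicator Z x = 0"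
      by (subst (asm) nn_integral_0_iff_AE) auto
    then have "AE x in zero_set_hausdorff F. x \<notin> Z"
    proof eventually_elim
      case (elim x)
      then show ?case using jac_pos[of x] by (auto simp: indicator_def)
    qed
    then have "emeasure (zero_set_hausdorff F) Z = 0"
      by (subst (asm) AE_iff_measurable[of Z]) auto
    then show False using zero_set_pos by simp
  qed
  moreover have "mass \<ge> 0" unfolding mass_def by (rule zero_set_integral_eq(2)[of _ 1]) auto
  ultimately show ?thesis by simp
qed

lemma limit_int_le:
  assumes [measurable]: "f \<in> borel_measurable borel" and f: "\<And>x. x \<in> Z \<Longrightarrow> \<bar>f x\<bar> \<le> b"
  shows "\<bar>limit_int f\<bar> \<le> b * mass"
proof -
  let ?w = "\<lambda>x. 1 / gen_jacobian F x * indicator Z x"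
  have int: "integrable (zero_set_hausdorff F) (\<lambda>x. f x * ?w x)" by (rule integrable_limit[OF assms])
  have int1: "integrable (zero_set_hausdorff F) (\<lambda>x. b * (1 * ?w x))"
    using integrable_limit[of "\<lambda>_. 1" 1] by (intro integrable_mult_right) auto
  have "\<bar>limit_int f\<bar> \<le> (\<integral>x. \<bar>f x * ?w x\<bar> \<partial>zero_set_hausdorff F)"
    unfolding limit_int_def by (rule integral_abs_bound)
  also have "\<dots> \<le> (\<integral>x. b * (1 * ?w x) \<partial>zero_set_hausdorff F)"
  proof (rule integral_mono[OF integrable_abs[OF int] int1])
    fix x show "\<bar>f x * ?w x\<bar> \<le> b * (1 * ?w x)"
    proof (cases "x \<in> Z")
      case True
      then show ?thesis using f[OF True] jac_pos[of x] by (simp add: abs_mult divide_right_mono)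
    qed simp
  qed
  also have "\<dots> = b * mass" unfolding mass_def limit_int_def by (rule integral_mult_right_zero)
  finally show ?thesis .
qed

lemma limit_measure_density: "limit_measure F = density (zero_set_hausdorff F) (\<lambda>x. ennreal ((1 / gen_jacobian F x * indicator Z x) / mass))"
  unfolding limit_measure_def limit_norm_eq
proof (rule density_cong)
  show "AE x in zero_set_hausdorff F. ennreal (1 / gen_jacobian F x) * indicator Z x / ennreal mass
      = ennreal ((1 / gen_jacobian F x * indicator Z x) / mass)"
  proof (rule AE_I2)
    fix x
    show "ennreal (1 / gen_jacobian F x) * indicator Z x / ennreal mass = ennreal ((1 / gen_jacobian F x * indicator Z x) / mass)"
      using mass_pos jac_pos[of x] by (cases "x \<in> Z") (auto simp: divide_ennreal)
  qed
qed measurable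

lemma limit_measure_integral:
  assumes [measurable]: "f \<in> borel_measurable borel" and f: "\<And>x. x \<in> Z \<Longrightarrow> \<bar>f x\<bar> \<le> b"
  shows "integrable (limit_measure F) f" "(\<integral>x. f x \<partial>limit_measure F) = limit_int f / mass"
proof -
  let ?w = "\<lambda>x. 1 / gen_jacobian F x * indicator Z x"
  have nn: "AE x in zero_set_hausdorff F. 0 \<le> ?w x / mass"
    using mass_pos jac_pos by (intro AE_I2) (auto simp: indicator_def less_imp_le)
  have eq: "(\<lambda>x. (?w x / mass) *\<^sub>R f x) = (\<lambda>x. f x * ?w x / mass)" by (simp add: fun_eq_iff)
  have int: "integrable (zero_set_hausdorff F) (\<lambda>x. f x * ?w x / mass)"
    by (intro integrable_divide_zero impI integrable_limit[OF assms])
  show "integrable (limit_measure F) f"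
    unfolding limit_measure_density by (subst integrable_density[OF _ _ nn]) (use int in \<open>simp_all only: eq, measurable\<close>)
  have "(\<integral>x. f x \<partial>limit_measure F) = (\<integral>x. f x * ?w x / mass \<partial>zero_set_hausdorff F)"
    unfolding limit_measure_density by (subst integral_density[OF _ _ nn]) (simp_all only: eq, measurable)
  then show "(\<integral>x. f x \<partial>limit_measure F) = limit_int f / mass"
    by (simp only: limit_int_def integral_divide_zero)
qed

lemma prob_space_limit: "prob_space (limit_measure F)"
proof
  have "emeasure (limit_measure F) (space (limit_measure F))
      = (\<integral>\<^sup>+x. ennreal ((1 / gen_jacobian F x * indicator Z x) / mass) \<partial>zero_set_hausdorff F)"
    unfolding limit_measure_density by (simp add: emeasure_density)
  also have "\<dots> = ennreal (\<integral>x. 1 * (1 / gen_jacobian F x * indicator Z x) / mass \<partial>zero_set_hausdorff F)"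
  proof (subst nn_integral_eq_integral[symmetric])
    show "integrable (zero_set_hausdorff F) (\<lambda>x. 1 * (1 / gen_jacobian F x * indicator Z x) / mass)"
      by (intro integrable_divide_zero impI integrable_limit[of "\<lambda>_. 1" 1]) auto
    show "AE x in zero_set_hausdorff F. 0 \<le> 1 * (1 / gen_jacobian F x * indicator Z x) / mass"
      using mass_pos jac_pos by (intro AE_I2) (auto simp: indicator_def less_imp_le)
  qed simp
  also have "(\<integral>x. 1 * (1 / gen_jacobian F x * indicator Z x) / mass \<partial>zero_set_hausdorff F) = limit_int (\<lambda>_. 1) / mass"
    unfolding limit_int_def by (rule integral_divide_zero)
  also have "\<dots> = 1" using mass_pos by (simp add: mass_def)
  finally show "emeasure (limit_measure F) (space (limit_measure F)) = 1" by simp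
qed

definition partition_fn :: "real \<Rightarrow> real" where
  "partition_fn \<epsilon> = (\<integral>x. weight \<epsilon> x \<partial>lborel)"

lemma gibbs_norm_eq: "\<epsilon> > 0 \<Longrightarrow> gibbs_norm F k \<epsilon> = ennreal (partition_fn \<epsilon>)"
  unfolding gibbs_norm_def partition_fn_def
  using integrable_weight[of \<epsilon>] by (intro nn_integral_eq_integral) auto

lemma partition_fn_pos: "\<epsilon> > 0 \<Longrightarrow> partition_fn \<epsilon> > 0"
  using nn_integral_lborel_pos[of "weight \<epsilon>"] gibbs_norm_eq[of \<epsilon>] by (simp add: gibbs_norm_def)

lemma gibbs_measure_density:
  assumes "\<epsilon> > 0"
  shows "gibbs_measure F k \<epsilon> = density lborel (\<lambda>x. ennreal (weight \<epsilon> x / partition_fn \<epsilon>))"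
  unfolding gibbs_measure_def gibbs_norm_eq[OF assms]
  using partition_fn_pos[OF assms] by (simp add: divide_ennreal)

lemma gibbs_integral:
  assumes [measurable]: "f \<in> borel_measurable borel" and \<epsilon>: "\<epsilon> > 0"
    and int: "integrable lborel (\<lambda>x. f x * weight \<epsilon> x)"
  shows "integrable (gibbs_measure F k \<epsilon>) f"
    "(\<integral>x. f x \<partial>gibbs_measure F k \<epsilon>) = laplace_mean F k \<epsilon> f / laplace_mean F k \<epsilon> (\<lambda>_. 1)"
proof -
  have nn: "AE x in lborel. 0 \<le> weight \<epsilon> x / partition_fn \<epsilon>"
    using partition_fn_pos[OF \<epsilon>] by (intro AE_I2) simp
  have eq: "(\<lambda>x. (weight \<epsilon> x / partition_fn \<epsilon>) *\<^sub>R f x) = (\<lambda>x. f x * weight \<epsilon> x / partition_fn \<epsilon>)"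
    by (simp add: fun_eq_iff)
  show "integrable (gibbs_measure F k \<epsilon>) f"
    unfolding gibbs_measure_density[OF \<epsilon>]
    by (subst integrable_density[OF _ _ nn]) (use int in \<open>simp_all only: eq, simp_all\<close>)
  have "(\<integral>x. f x \<partial>gibbs_measure F k \<epsilon>) = (\<integral>x. f x * weight \<epsilon> x / partition_fn \<epsilon> \<partial>lborel)"
    unfolding gibbs_measure_density[OF \<epsilon>]
    by (subst integral_density[OF _ _ nn]) (simp_all only: eq, simp_all)
  also have "\<dots> = (\<integral>x. f x * weight \<epsilon> x \<partial>lborel) / partition_fn \<epsilon>" by simp
  also have "\<dots> = laplace_mean F k \<epsilon> f / laplace_mean F k \<epsilon> (\<lambda>_. 1)"
    using \<epsilon> by (simp add: laplace_mean_def partition_fn_def)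
  finally show "(\<integral>x. f x \<partial>gibbs_measure F k \<epsilon>) = laplace_mean F k \<epsilon> f / laplace_mean F k \<epsilon> (\<lambda>_. 1)" .
qed

lemma prob_space_gibbs:
  assumes \<epsilon>: "\<epsilon> > 0"
  shows "prob_space (gibbs_measure F k \<epsilon>)"
proof
  have "emeasure (gibbs_measure F k \<epsilon>) (space (gibbs_measure F k \<epsilon>)) = (\<integral>\<^sup>+x. ennreal (weight \<epsilon> x / partition_fn \<epsilon>) \<partial>lborel)"
    unfolding gibbs_measure_density[OF \<epsilon>] by (simp add: emeasure_density)
  also have "\<dots> = ennreal (\<integral>x. weight \<epsilon> x / partition_fn \<epsilon> \<partial>lborel)"
    using integrable_weight[OF \<epsilon>] partition_fn_pos[OF \<epsilon>] by (intro nn_integral_eq_integral) auto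
  also have "(\<integral>x. weight \<epsilon> x / partition_fn \<epsilon> \<partial>lborel) = partition_fn \<epsilon> / partition_fn \<epsilon>"
    unfolding partition_fn_def by (rule integral_divide_zero)
  finally show "emeasure (gibbs_measure F k \<epsilon>) (space (gibbs_measure F k \<epsilon>)) = 1"
    using partition_fn_pos[OF \<epsilon>] by simp
qed

section \<open>Global expansion\<close>

text \<open>
  A signed \<open>f\<close> is the difference of the nonnegative functions \<open>f + b\<close> and \<open>b\<close>.
\<close>

lemma neighbourhood_expansion:
  assumes U: "open U" "Z \<subseteq> U"
  shows "\<exists>C\<ge>0. \<forall>f b L \<epsilon>. (\<forall>x\<in>U. \<bar>f x\<bar> \<le> b) \<longrightarrow> L-lipschitz_on U f \<longrightarrow> 0 < \<epsilon> \<longrightarrow> \<epsilon> \<le> 1 \<longrightarrow> 4 * \<epsilon> \<le> m ^ k \<longrightarrow>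
     \<bar>laplace_mean F k \<epsilon> (\<lambda>x. indicator U x * f x) - c * limit_int (\<lambda>x. indicator U x * f x)\<bar>
          \<le> C * (b + L) * \<epsilon> powr (1 / real k)"
proof -
  obtain C where C: "C \<ge> 0" and E: "\<And>f b L \<epsilon>. (\<forall>x\<in>U. 0 \<le> f x \<and> f x \<le> b) \<Longrightarrow> L-lipschitz_on U f \<Longrightarrow>
      0 < \<epsilon> \<Longrightarrow> \<epsilon> \<le> 1 \<Longrightarrow> 4 * \<epsilon> \<le> m ^ k \<Longrightarrow>
        \<bar>laplace_mean F k \<epsilon> (\<lambda>x. indicator U x * f x) - c * limit_int (\<lambda>x. indicator U x * f x)\<bar>
          \<le> C * (b + L) * \<epsilon> powr (1 / real k)"
    using neighbourhood_expansion_nonneg[OF U] by blast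
  show ?thesis
  proof (rule exI[of _ "3 * C"], intro conjI allI impI)
    show "0 \<le> 3 * C" using C by simp
    fix f :: "real ^ 'd \<Rightarrow> real" and b L \<epsilon>
    assume fb: "\<forall>x\<in>U. \<bar>f x\<bar> \<le> b" and fL: "L-lipschitz_on U f" and \<epsilon>: "0 < \<epsilon>" "\<epsilon> \<le> 1" "4 * \<epsilon> \<le> m ^ k"
    have b: "b \<ge> 0" using fb U(2) zero_in_Z by force
    have L: "L \<ge> 0" using fL by (rule lipschitz_on_nonneg)
    let ?s = "\<epsilon> powr (1 / real k)"
    have gL: "L-lipschitz_on U (\<lambda>x. f x + b)" using fL by (auto simp: lipschitz_on_def dist_real_def)
    have bL: "0-lipschitz_on U (\<lambda>x. b)" by (auto simp: lipschitz_on_def)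
    define g where "g x = indicator U x * (f x + b)" for x
    define h where "h x = indicator U x * b" for x
    have gm [measurable]: "g \<in> borel_measurable borel" unfolding g_def[abs_def] by (rule cutoff_measurable[OF U(1) gL])
    have hm [measurable]: "h \<in> borel_measurable borel" unfolding h_def[abs_def] by (rule cutoff_measurable[OF U(1) bL])
    have gb: "\<bar>g x\<bar> \<le> 2 * b" and hb: "\<bar>h x\<bar> \<le> b" for x
      using fb b by (force simp: g_def indicator_def abs_le_iff, auto simp: h_def indicator_def)
    have fgh: "(\<lambda>x. indicator U x * f x) = (\<lambda>x. g x - h x)" by (simp add: fun_eq_iff g_def h_def algebra_simps)
    have lm: "laplace_mean F k \<epsilon> (\<lambda>x. indicator U x * f x) = laplace_mean F k \<epsilon> g - laplace_mean F k \<epsilon> h"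
      unfolding fgh using integrable_bounded_weight[OF gm gb \<epsilon>(1)] integrable_bounded_weight[OF hm hb \<epsilon>(1)]
      by (rule laplace_mean_diff)
    have li: "limit_int (\<lambda>x. indicator U x * f x) = limit_int g - limit_int h"
      unfolding fgh by (rule limit_int_diff[OF gm hm gb hb])
    have "\<bar>laplace_mean F k \<epsilon> g - c * limit_int g\<bar> \<le> C * (2 * b + L) * ?s"
      unfolding g_def[abs_def]
    proof (rule E[OF _ gL \<epsilon>])
      show "\<forall>x\<in>U. 0 \<le> f x + b \<and> f x + b \<le> 2 * b" using fb by (auto simp: abs_le_iff)
    qed
    moreover have "\<bar>laplace_mean F k \<epsilon> h - c * limit_int h\<bar> \<le> C * (b + 0) * ?s"
      unfolding h_def[abs_def] using b bL \<epsilon> by (intro E) auto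
    ultimately have "\<bar>laplace_mean F k \<epsilon> (\<lambda>x. indicator U x * f x) - c * limit_int (\<lambda>x. indicator U x * f x)\<bar>
        \<le> C * (2 * b + L) * ?s + C * (b + 0) * ?s"
      unfolding lm li by (simp add: right_diff_distrib)
    also have "\<dots> \<le> 3 * C * (b + L) * ?s"
    proof -
      have "C * L * ?s \<ge> 0" using C L by simp
      then show ?thesis by (simp add: algebra_simps)
    qed
    finally show "\<bar>laplace_mean F k \<epsilon> (\<lambda>x. indicator U x * f x) - c * limit_int (\<lambda>x. indicator U x * f x)\<bar>
        \<le> 3 * C * (b + L) * ?s" .
  qed
qed

abbreviation "growth_factor \<equiv> \<lambda>C. C * exp ((C + 1) * R powr a)"

lemma outside_estimate:
  assumes U: "open U" "Z \<subseteq> U"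
  shows "\<exists>K\<ge>0. \<forall>\<phi> C \<epsilon>. continuous_on UNIV \<phi> \<longrightarrow> C \<ge> 0 \<longrightarrow> (\<forall>x. \<bar>\<phi> x\<bar> \<le> C * exp (C * norm x powr a)) \<longrightarrow>
     0 < \<epsilon> \<longrightarrow> \<epsilon> \<le> 1 \<longrightarrow> 2 * \<epsilon> * (C + 1) \<le> m ^ k \<longrightarrow>
     \<bar>laplace_mean F k \<epsilon> \<phi> - laplace_mean F k \<epsilon> (\<lambda>x. indicator U x * \<phi> x)\<bar> \<le> K * growth_factor C * \<epsilon> powr (1 / real k)"
proof -
  obtain K where K: "K \<ge> 0" "\<And>\<phi> C \<epsilon>. \<phi> \<in> borel_measurable borel \<Longrightarrow> C \<ge> 0 \<Longrightarrow> (\<forall>x. \<bar>\<phi> x\<bar> \<le> C * exp (C * norm x powr a)) \<Longrightarrow>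
     0 < \<epsilon> \<Longrightarrow> \<epsilon> \<le> 1 \<Longrightarrow> 2 * \<epsilon> * (C + 1) \<le> m ^ k \<Longrightarrow> (\<forall>x\<in>U. \<phi> x = 0) \<Longrightarrow>
     \<bar>laplace_mean F k \<epsilon> \<phi>\<bar> \<le> K * growth_factor C * \<epsilon> powr (1 / real k)"
    using tail_estimate[OF U] by blast
  show ?thesis
  proof (rule exI[of _ K], intro conjI allI impI K(1))
    fix \<phi> :: "real ^ 'd \<Rightarrow> real" and C \<epsilon> :: real
    assume cont: "continuous_on UNIV \<phi>" and C: "C \<ge> 0" and gr: "\<forall>x. \<bar>\<phi> x\<bar> \<le> C * exp (C * norm x powr a)"
      and \<epsilon>: "0 < \<epsilon>" "\<epsilon> \<le> 1" "2 * \<epsilon> * (C + 1) \<le> m ^ k"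
    have \<phi>m [measurable]: "\<phi> \<in> borel_measurable borel" using cont by (rule borel_measurable_continuous_onI)
    have Um [measurable]: "U \<in> sets borel" using U(1) by simp
    have \<epsilon>': "\<epsilon> * (C + 1) \<le> m ^ k"
    proof -
      have "0 \<le> \<epsilon> * (C + 1)" using \<epsilon>(1) C by simp
      then show ?thesis using \<epsilon>(3) by linarith
    qed
    have gr': "\<bar>indicator A x * \<phi> x\<bar> \<le> C * exp (C * norm x powr a)" for x and A :: "(real ^ 'd) set"
      using gr C by (auto simp: indicator_def)
    have "laplace_mean F k \<epsilon> \<phi> - laplace_mean F k \<epsilon> (\<lambda>x. indicator U x * \<phi> x) = laplace_mean F k \<epsilon> (\<lambda>x. \<phi> x - indicator U x * \<phi> x)"
      using gr gr' C \<epsilon> \<epsilon>' by (intro laplace_mean_diff[symmetric] integrable_weighted[where C = C]) auto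
    also have "(\<lambda>x. \<phi> x - indicator U x * \<phi> x) = (\<lambda>x. indicator (- U) x * \<phi> x)" by (auto simp: fun_eq_iff indicator_def)
    also have "\<bar>laplace_mean F k \<epsilon> (\<lambda>x. indicator (- U) x * \<phi> x)\<bar> \<le> K * growth_factor C * \<epsilon> powr (1 / real k)"
      using C gr' \<epsilon> by (intro K(2)) auto
    finally show "\<bar>laplace_mean F k \<epsilon> \<phi> - laplace_mean F k \<epsilon> (\<lambda>x. indicator U x * \<phi> x)\<bar> \<le> K * growth_factor C * \<epsilon> powr (1 / real k)" .
  qed
qed

lemma expansion:
  assumes U: "open U" "Z \<subseteq> U"
  shows "\<exists>D\<ge>0. \<forall>\<phi> C b L \<epsilon>. continuous_on UNIV \<phi> \<longrightarrow> C \<ge> 0 \<longrightarrow> (\<forall>x. \<bar>\<phi> x\<bar> \<le> C * exp (C * norm x powr a)) \<longrightarrow>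
     (\<forall>x\<in>U. \<bar>\<phi> x\<bar> \<le> b) \<longrightarrow> L-lipschitz_on U \<phi> \<longrightarrow> 0 < \<epsilon> \<longrightarrow> \<epsilon> \<le> 1 \<longrightarrow> 4 * \<epsilon> \<le> m ^ k \<longrightarrow> 2 * \<epsilon> * (C + 1) \<le> m ^ k \<longrightarrow>
     \<bar>laplace_mean F k \<epsilon> \<phi> - c * limit_int \<phi>\<bar> \<le> D * (b + L + growth_factor C) * \<epsilon> powr (1 / real k)"
proof -
  obtain D1 where D1: "D1 \<ge> 0" "\<And>f b L \<epsilon>. (\<forall>x\<in>U. \<bar>f x\<bar> \<le> b) \<Longrightarrow> L-lipschitz_on U f \<Longrightarrow> 0 < \<epsilon> \<Longrightarrow> \<epsilon> \<le> 1 \<Longrightarrow> 4 * \<epsilon> \<le> m ^ k \<Longrightarrow>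
     \<bar>laplace_mean F k \<epsilon> (\<lambda>x. indicator U x * f x) - c * limit_int (\<lambda>x. indicator U x * f x)\<bar>
          \<le> D1 * (b + L) * \<epsilon> powr (1 / real k)"
    using neighbourhood_expansion[OF U] by blast
  obtain D2 where D2: "D2 \<ge> 0" "\<And>\<phi> C \<epsilon>. continuous_on UNIV \<phi> \<Longrightarrow> C \<ge> 0 \<Longrightarrow> (\<forall>x. \<bar>\<phi> x\<bar> \<le> C * exp (C * norm x powr a)) \<Longrightarrow>
     0 < \<epsilon> \<Longrightarrow> \<epsilon> \<le> 1 \<Longrightarrow> 2 * \<epsilon> * (C + 1) \<le> m ^ k \<Longrightarrow>
     \<bar>laplace_mean F k \<epsilon> \<phi> - laplace_mean F k \<epsilon> (\<lambda>x. indicator U x * \<phi> x)\<bar> \<le> D2 * growth_factor C * \<epsilon> powr (1 / real k)"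
    using outside_estimate[OF U] by blast
  show ?thesis
  proof (rule exI[of _ "D1 + D2"], intro conjI allI impI)
    show "0 \<le> D1 + D2" using D1 D2 by simp
    fix \<phi> :: "real ^ 'd \<Rightarrow> real" and C b L \<epsilon> :: real
    assume cont: "continuous_on UNIV \<phi>" and C: "C \<ge> 0" and gr: "\<forall>x. \<bar>\<phi> x\<bar> \<le> C * exp (C * norm x powr a)"
      and b: "\<forall>x\<in>U. \<bar>\<phi> x\<bar> \<le> b" and L: "L-lipschitz_on U \<phi>"
      and \<epsilon>: "0 < \<epsilon>" "\<epsilon> \<le> 1" "4 * \<epsilon> \<le> m ^ k" "2 * \<epsilon> * (C + 1) \<le> m ^ k"
    let ?s = "\<epsilon> powr (1 / real k)" and ?T = "growth_factor C"
    have b0: "b \<ge> 0" using b U(2) zero_in_Z by force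
    have L0: "L \<ge> 0" using L by (rule lipschitz_on_nonneg)
    have T: "?T \<ge> 0" using C by simp
    have li: "limit_int (\<lambda>x. indicator U x * \<phi> x) = limit_int \<phi>"
      using U(2) by (intro limit_int_cong) (auto simp: indicator_def)
    have "\<bar>laplace_mean F k \<epsilon> \<phi> - c * limit_int \<phi>\<bar> \<le> D1 * (b + L) * ?s + D2 * ?T * ?s"
      using D1(2)[OF b L \<epsilon>(1-3)] D2(2)[OF cont C gr \<epsilon>(1,2,4)] unfolding li by linarith
    also have "\<dots> = (D1 * (b + L) + D2 * ?T) * ?s" by (simp only: distrib_right)
    also have "\<dots> \<le> ((D1 + D2) * (b + L + ?T)) * ?s"
    proof (rule mult_right_mono)
      have "0 \<le> D1 * ?T" "0 \<le> D2 * (b + L)" using D1 D2 T b0 L0 by (auto intro!: mult_nonneg_nonneg)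
      moreover have "(D1 + D2) * (b + L + ?T) = D1 * (b + L) + D2 * ?T + D1 * ?T + D2 * (b + L)"
        by (simp only: distrib_left distrib_right add_ac)
      ultimately show "D1 * (b + L) + D2 * ?T \<le> (D1 + D2) * (b + L + ?T)" by linarith
    qed simp
    finally show "\<bar>laplace_mean F k \<epsilon> \<phi> - c * limit_int \<phi>\<bar> \<le> (D1 + D2) * (b + L + ?T) * ?s" .
  qed
qed

lemma eventually_small: "\<delta> > 0 \<Longrightarrow> \<forall>\<^sub>F \<epsilon> in at_right (0::real). 0 < \<epsilon> \<and> \<epsilon> < \<delta>"
  by (auto simp: eventually_at_right_field intro!: exI[of _ \<delta>])

section \<open>Convergence with and without a rate\<close>

lemma growth_bounded_on_zero_set:
  assumes "continuous_on UNIV \<phi>"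
  shows "\<exists>b. \<forall>x\<in>Z. \<bar>\<phi> x :: real\<bar> \<le> b"
proof -
  have "bounded (\<phi> ` Z)"
    using assms by (intro compact_imp_bounded compact_continuous_image compact_Z) (rule continuous_on_subset, auto)
  then show ?thesis by (auto simp: bounded_iff)
qed

text \<open>
  The expansions of \<open>\<phi>\<close> and of \<open>1\<close> are divided by means of \<open>ratio_error\<close>. The bound on \<open>\<epsilon>\<close> splits into \<open>\<epsilon>0\<close>,
  below which the denominator is at least half its limit, and a bound that makes the growth of \<open>\<phi>\<close>
  harmless; only the second one depends on \<open>C\<close>.
\<close>

theorem Lipschitz_rate:
  assumes U: "open U" "bounded U" "Z \<subseteq> U"
  shows "\<exists>A \<epsilon>bar :: real \<Rightarrow> real.
          continuous_on {0..} A \<and> mono_on {0..} A \<and> (\<forall>c\<ge>0. A c \<ge> 0)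
        \<and> continuous_on {0..} \<epsilon>bar \<and> antimono_on {0..} \<epsilon>bar \<and> (\<forall>c\<ge>0. \<epsilon>bar c > 0)
        \<and> (\<forall>(\<phi>::real ^ 'd \<Rightarrow> real) C M1. continuous_on UNIV \<phi> \<longrightarrow> C \<ge> 0 \<longrightarrow>
            (\<forall>x. \<bar>\<phi> x\<bar> \<le> C * exp (C * norm x powr (\<alpha> * real k))) \<longrightarrow>
            M1 \<ge> 0 \<longrightarrow> M1-lipschitz_on U \<phi> \<longrightarrow>
            integrable (limit_measure F) \<phi>
          \<and> (\<forall>\<epsilon>\<in>{0<..<\<epsilon>bar C}.
              integrable (gibbs_measure F k \<epsilon>) \<phi>
            \<and> \<bar>(\<integral>x. \<phi> x \<partial>gibbs_measure F k \<epsilon>) - (\<integral>x. \<phi> x \<partial>limit_measure F)\<bar>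
                \<le> A C * (1 + (SUP x\<in>U. \<bar>\<phi> x\<bar>) + M1) * \<epsilon> powr (1 / real k)))"
proof -
  let ?T = growth_factor
  obtain D where D: "D \<ge> 0" and E: "\<And>\<phi> C b L \<epsilon>. continuous_on UNIV \<phi> \<Longrightarrow> C \<ge> 0 \<Longrightarrow> (\<forall>x. \<bar>\<phi> x\<bar> \<le> C * exp (C * norm x powr a)) \<Longrightarrow>
     (\<forall>x\<in>U. \<bar>\<phi> x\<bar> \<le> b) \<Longrightarrow> L-lipschitz_on U \<phi> \<Longrightarrow> 0 < \<epsilon> \<Longrightarrow> \<epsilon> \<le> 1 \<Longrightarrow> 4 * \<epsilon> \<le> m ^ k \<Longrightarrow> 2 * \<epsilon> * (C + 1) \<le> m ^ k \<Longrightarrow>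
     \<bar>laplace_mean F k \<epsilon> \<phi> - c * limit_int \<phi>\<bar> \<le> D * (b + L + ?T C) * \<epsilon> powr (1 / real k)"
    using expansion[OF U(1,3)] by blast
  define n where "n = c * mass"
  have n: "n > 0" using c mass_pos by (simp add: n_def)
  define D1 where "D1 = D * (1 + ?T 1)"
  have D1: "D1 \<ge> 0" using D by (simp add: D1_def)
  \<comment> \<open>the last entry keeps the error of the denominator below \<open>n / 2\<close>\<close>
  define \<epsilon>0 where "\<epsilon>0 = min (min 1 (m ^ k / 4)) ((n / (2 * (D1 + 1))) ^ k)"
  have \<epsilon>0: "\<epsilon>0 > 0" using m n D1 by (simp add: \<epsilon>0_def)
  have one: "\<bar>laplace_mean F k \<epsilon> (\<lambda>_. 1) - n\<bar> \<le> D1 * \<epsilon> powr (1 / real k)" "n / 2 \<le> laplace_mean F k \<epsilon> (\<lambda>_. 1)"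
    if \<epsilon>: "0 < \<epsilon>" "\<epsilon> < \<epsilon>0" for \<epsilon>
  proof -
    have "0-lipschitz_on U (\<lambda>_::real ^ 'd. 1::real)" by (auto simp: lipschitz_on_def)
    then have "\<bar>laplace_mean F k \<epsilon> (\<lambda>_. 1) - c * limit_int (\<lambda>_. 1)\<bar> \<le> D * (1 + 0 + ?T 1) * \<epsilon> powr (1 / real k)"
      using \<epsilon> by (intro E) (auto simp: \<epsilon>0_def)
    then show b: "\<bar>laplace_mean F k \<epsilon> (\<lambda>_. 1) - n\<bar> \<le> D1 * \<epsilon> powr (1 / real k)"
      by (simp add: n_def D1_def mass_def)
    have "\<epsilon> powr (1 / real k) \<le> ((n / (2 * (D1 + 1))) ^ k) powr (1 / real k)"
      using \<epsilon> by (intro powr_mono2) (auto simp: \<epsilon>0_def)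
    also have "\<dots> = n / (2 * (D1 + 1))"
      using k n D1 by (simp add: powr_realpow[symmetric] powr_powr)
    finally have "D1 * \<epsilon> powr (1 / real k) \<le> D1 * (n / (2 * (D1 + 1)))" using D1 by (rule mult_left_mono)
    also have "\<dots> = n / 2 * (D1 / (D1 + 1))" using D1 by simp
    also have "\<dots> \<le> n / 2 * 1" using n D1 by (intro mult_left_mono) auto
    finally show "n / 2 \<le> laplace_mean F k \<epsilon> (\<lambda>_. 1)" using b by linarith
  qed
  define A0 where "A0 = 2 / n * (D * (2 + ?T 1))"
  have A0: "A0 \<ge> 0" using n D by (simp add: A0_def)
  define A where "A C = A0 * (1 + ?T C)" for C
  define \<epsilon>bar where "\<epsilon>bar C = min \<epsilon>0 (m ^ k / (2 * (C + 1)))" for C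
  have 1: "continuous_on {0..} A" unfolding A_def by (intro continuous_intros)
  have 2: "mono_on {0..} A"
  proof (rule mono_onI)
    fix x y :: real assume xy: "x \<in> {0..}" "y \<in> {0..}" "x \<le> y"
    have "(x + 1) * R powr a \<le> (y + 1) * R powr a" using xy by (intro mult_right_mono) auto
    then have "?T x \<le> ?T y" using xy by (intro mult_mono) auto
    then show "A x \<le> A y" unfolding A_def using A0 by (intro mult_left_mono add_left_mono)
  qed
  have 3: "\<forall>c\<ge>0. A c \<ge> 0" using A0 by (simp add: A_def)
  have 4: "continuous_on {0..} \<epsilon>bar" unfolding \<epsilon>bar_def by (intro continuous_intros) auto
  have 5: "antimono_on {0..} \<epsilon>bar"
  proof (rule monotone_onI)
    fix x y :: real assume xy: "x \<in> {0..}" "y \<in> {0..}" "x \<le> y"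
    have "m ^ k / (2 * (y + 1)) \<le> m ^ k / (2 * (x + 1))"
      using xy m by (intro divide_left_mono) auto
    then show "\<epsilon>bar y \<le> \<epsilon>bar x" by (auto simp: \<epsilon>bar_def min_def)
  qed
  have 6: "\<forall>c\<ge>0. \<epsilon>bar c > 0" using \<epsilon>0 m by (simp add: \<epsilon>bar_def)
  have main: "integrable (limit_measure F) \<phi>
          \<and> (\<forall>\<epsilon>\<in>{0<..<\<epsilon>bar C}.
              integrable (gibbs_measure F k \<epsilon>) \<phi>
            \<and> \<bar>(\<integral>x. \<phi> x \<partial>gibbs_measure F k \<epsilon>) - (\<integral>x. \<phi> x \<partial>limit_measure F)\<bar>
                \<le> A C * (1 + (SUP x\<in>U. \<bar>\<phi> x\<bar>) + M1) * \<epsilon> powr (1 / real k))"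
    if cont: "continuous_on UNIV \<phi>" and C: "C \<ge> 0" and gr: "\<forall>x. \<bar>\<phi> x\<bar> \<le> C * exp (C * norm x powr a)"
      and M1: "M1 \<ge> 0" and L: "M1-lipschitz_on U \<phi>" for \<phi> :: "real ^ 'd \<Rightarrow> real" and C M1
  proof -
    have \<phi>m [measurable]: "\<phi> \<in> borel_measurable borel" using cont by (rule borel_measurable_continuous_onI)
    define M0 where "M0 = (SUP x\<in>U. \<bar>\<phi> x\<bar>)"
    have "bdd_above ((\<lambda>x. \<bar>\<phi> x\<bar>) ` U)"
    proof -
      have "compact (closure U)" using U(2) by simp
      then have "bounded ((\<lambda>x. \<bar>\<phi> x\<bar>) ` closure U)"
        by (intro compact_imp_bounded compact_continuous_image continuous_intros continuous_on_subset[OF cont]) auto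
      then have "bounded ((\<lambda>x. \<bar>\<phi> x\<bar>) ` U)" by (rule bounded_subset) (auto intro: subsetD[OF closure_subset])
      then show ?thesis by (rule bounded_imp_bdd_above)
    qed
    then have M0: "\<bar>\<phi> x\<bar> \<le> M0" if "x \<in> U" for x unfolding M0_def using that by (intro cSUP_upper)
    have M00: "M0 \<ge> 0" using M0[of 0] U(3) zero_in_Z by force
    have ZM0: "\<bar>\<phi> x\<bar> \<le> M0" if "x \<in> Z" for x using M0 that U(3) by blast
    have lim: "integrable (limit_measure F) \<phi>" "(\<integral>x. \<phi> x \<partial>limit_measure F) = limit_int \<phi> / mass"
    by (rule limit_measure_integral[OF \<phi>m ZM0]; assumption)+
    have T: "?T C \<ge> 0" "?T 1 \<ge> 0" using C by auto
    have "integrable (gibbs_measure F k \<epsilon>) \<phi>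
            \<and> \<bar>(\<integral>x. \<phi> x \<partial>gibbs_measure F k \<epsilon>) - (\<integral>x. \<phi> x \<partial>limit_measure F)\<bar>
                \<le> A C * (1 + M0 + M1) * \<epsilon> powr (1 / real k)"
      if "\<epsilon> \<in> {0<..<\<epsilon>bar C}" for \<epsilon>
    proof -
      let ?s = "\<epsilon> powr (1 / real k)"
      have \<epsilon>: "0 < \<epsilon>" "\<epsilon> < \<epsilon>0" "\<epsilon> < m ^ k / (2 * (C + 1))" using that by (auto simp: \<epsilon>bar_def)
      then have \<epsilon>': "\<epsilon> \<le> 1" "4 * \<epsilon> \<le> m ^ k" by (auto simp: \<epsilon>0_def)
      have \<epsilon>C: "2 * \<epsilon> * (C + 1) \<le> m ^ k" using \<epsilon>(3) C by (simp add: pos_less_divide_eq algebra_simps)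
      have "0 \<le> \<epsilon> * (C + 1)" using \<epsilon>(1) C by simp
      then have "\<epsilon> * (C + 1) \<le> m ^ k" using \<epsilon>C by linarith
      then have int: "integrable lborel (\<lambda>x. \<phi> x * weight \<epsilon> x)"
        using gr C \<epsilon> by (intro integrable_weighted[where C = C]) auto
      note gibbs = gibbs_integral[OF \<phi>m \<epsilon>(1) int]
      have limeq: "(\<integral>x. \<phi> x \<partial>limit_measure F) = c * limit_int \<phi> / n"
        unfolding lim(2) n_def using c by simp
      have "\<bar>laplace_mean F k \<epsilon> \<phi> / laplace_mean F k \<epsilon> (\<lambda>_. 1) - c * limit_int \<phi> / n\<bar>
          \<le> 2 / n * (D * (M0 + M1 + ?T C) * ?s + M0 * (D1 * ?s))"
      proof (rule ratio_error[OF n one(2)[OF \<epsilon>(1,2)] _ one(1)[OF \<epsilon>(1,2)]])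
        show "\<bar>laplace_mean F k \<epsilon> \<phi> - c * limit_int \<phi>\<bar> \<le> D * (M0 + M1 + ?T C) * ?s"
          using M0 by (intro E cont C gr L \<epsilon>(1) \<epsilon>' \<epsilon>C) auto
        have "\<bar>limit_int \<phi>\<bar> \<le> M0 * mass" by (rule limit_int_le[OF \<phi>m ZM0])
        then have "c * \<bar>limit_int \<phi>\<bar> \<le> c * (M0 * mass)" using c by (intro mult_left_mono) auto
        then show "\<bar>c * limit_int \<phi>\<bar> \<le> M0 * n" using c by (simp add: n_def abs_mult ac_simps)
      qed
      also have "\<dots> = 2 / n * (D * ((M0 + M1 + ?T C) + M0 * (1 + ?T 1))) * ?s"
        by (simp only: D1_def distrib_left distrib_right ac_simps)
      also have "\<dots> \<le> 2 / n * (D * ((2 + ?T 1) * (1 + ?T C) * (1 + M0 + M1))) * ?s"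
      proof (intro mult_right_mono mult_left_mono)
        define t where "t = ?T 1" define t' where "t' = ?T C"
        have t: "t \<ge> 0" "t' \<ge> 0" using T by (simp_all add: t_def t'_def)
        have "(M0 + M1 + t') + M0 * (1 + t) \<le> (2 + t) * (1 + t') * (1 + M0 + M1)"
        proof -
          have "(2 + t) * (1 + t') * (1 + M0 + M1) - ((M0 + M1 + t') + M0 * (1 + t))
              = 2 + M1 + t + t * M1 + t' + 2 * t' * M0 + 2 * t' * M1 + t * t' + t * t' * M0 + t * t' * M1"
            by (simp add: algebra_simps)
          also have "\<dots> \<ge> 0" using t M00 M1 by (intro add_nonneg_nonneg mult_nonneg_nonneg) auto
          finally show ?thesis by simp
        qed
        then show "(M0 + M1 + ?T C) + M0 * (1 + ?T 1) \<le> (2 + ?T 1) * (1 + ?T C) * (1 + M0 + M1)"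
          by (simp only: t_def t'_def)
      qed (use n D in auto)
      also have "\<dots> = A C * (1 + M0 + M1) * ?s" by (simp only: A_def A0_def ac_simps)
      finally show ?thesis using gibbs limeq by simp
    qed
    then show ?thesis using lim(1) unfolding M0_def by blast
  qed
  show ?thesis
  proof (rule exI[of _ A], rule exI[of _ \<epsilon>bar], intro conjI[OF 1] conjI[OF 2] conjI[OF 3] conjI[OF 4] conjI[OF 5] conjI[OF 6] allI)
    fix \<phi> :: "real ^ 'd \<Rightarrow> real" and C M1
    show "continuous_on UNIV \<phi> \<longrightarrow> C \<ge> 0 \<longrightarrow> (\<forall>x. \<bar>\<phi> x\<bar> \<le> C * exp (C * norm x powr a)) \<longrightarrow>
        M1 \<ge> 0 \<longrightarrow> M1-lipschitz_on U \<phi> \<longrightarrow> integrable (limit_measure F) \<phi>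
        \<and> (\<forall>\<epsilon>\<in>{0<..<\<epsilon>bar C}.
            integrable (gibbs_measure F k \<epsilon>) \<phi>
          \<and> \<bar>(\<integral>x. \<phi> x \<partial>gibbs_measure F k \<epsilon>) - (\<integral>x. \<phi> x \<partial>limit_measure F)\<bar>
              \<le> A C * (1 + (SUP x\<in>U. \<bar>\<phi> x\<bar>) + M1) * \<epsilon> powr (1 / real k))"
      using main[of \<phi> C M1] by (intro impI)
  qed
qed

text \<open>
  For a polynomial \<open>g\<close> with \<open>|\<phi> - g| \<le> \<eta>\<close> on \<open>U\<close>, replacing \<open>\<phi>\<close> by \<open>g\<close> on \<open>U\<close> changes the rescaled integral by at
  most \<open>\<eta>\<close> times that of \<open>1\<close>, which converges and hence is bounded, and changes the limit by at most
  \<open>\<eta>\<close> times its mass. The expansion applies to \<open>g\<close>, and \<open>\<phi>\<close> off \<open>U\<close> is negligible.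
\<close>

theorem weak_convergence:
  assumes U: "open U" "bounded U" "Z \<subseteq> U"
    and cont: "continuous_on UNIV \<phi>" and C: "C \<ge> 0" and gr: "\<forall>x. \<bar>\<phi> x\<bar> \<le> C * exp (C * norm x powr a)"
  shows "integrable (limit_measure F) \<phi>"
    and "\<forall>\<^sub>F \<epsilon> in at_right 0. integrable (gibbs_measure F k \<epsilon>) \<phi>"
    and "((\<lambda>\<epsilon>. \<bar>(\<integral>x. \<phi> x \<partial>gibbs_measure F k \<epsilon>) - (\<integral>x. \<phi> x \<partial>limit_measure F)\<bar>) \<longlongrightarrow> 0) (at_right 0)"
proof -
  have \<phi>m [measurable]: "\<phi> \<in> borel_measurable borel" using cont by (rule borel_measurable_continuous_onI)
  obtain b where b: "\<And>x. x \<in> Z \<Longrightarrow> \<bar>\<phi> x\<bar> \<le> b" using growth_bounded_on_zero_set[OF cont] by blast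
  have lim: "integrable (limit_measure F) \<phi>" "(\<integral>x. \<phi> x \<partial>limit_measure F) = limit_int \<phi> / mass"
    by (rule limit_measure_integral[OF \<phi>m b]; assumption)+
  show "integrable (limit_measure F) \<phi>" by (rule lim(1))
  have int: "integrable lborel (\<lambda>x. \<phi> x * weight \<epsilon> x)" if "0 < \<epsilon> \<and> \<epsilon> < m ^ k / (2 * (C + 1))" for \<epsilon>
  proof -
    have \<epsilon>C: "2 * \<epsilon> * (C + 1) \<le> m ^ k" using that C by (simp add: pos_less_divide_eq algebra_simps)
    moreover have "0 \<le> \<epsilon> * (C + 1)" using that C by simp
    ultimately have "\<epsilon> * (C + 1) \<le> m ^ k" by linarith
    then show ?thesis using gr C that by (intro integrable_weighted[where C = C]) auto
  qed
  have ev: "\<forall>\<^sub>F \<epsilon> in at_right 0. 0 < \<epsilon> \<and> \<epsilon> < min (min 1 (m ^ k / 4)) (m ^ k / (2 * (C + 1)))"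
    using m C by (intro eventually_small) auto
  show "\<forall>\<^sub>F \<epsilon> in at_right 0. integrable (gibbs_measure F k \<epsilon>) \<phi>"
    using ev by eventually_elim (auto intro!: gibbs_integral(1) int)
  obtain D1 where D1: "D1 \<ge> 0" "\<And>f b L \<epsilon>. (\<forall>x\<in>U. \<bar>f x\<bar> \<le> b) \<Longrightarrow> L-lipschitz_on U f \<Longrightarrow> 0 < \<epsilon> \<Longrightarrow> \<epsilon> \<le> 1 \<Longrightarrow> 4 * \<epsilon> \<le> m ^ k \<Longrightarrow>
     \<bar>laplace_mean F k \<epsilon> (\<lambda>x. indicator U x * f x) - c * limit_int (\<lambda>x. indicator U x * f x)\<bar>
          \<le> D1 * (b + L) * \<epsilon> powr (1 / real k)"
    using neighbourhood_expansion[OF U(1,3)] by blast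
  obtain D2 where D2: "D2 \<ge> 0" "\<And>\<phi> C \<epsilon>. continuous_on UNIV \<phi> \<Longrightarrow> C \<ge> 0 \<Longrightarrow> (\<forall>x. \<bar>\<phi> x\<bar> \<le> C * exp (C * norm x powr a)) \<Longrightarrow>
     0 < \<epsilon> \<Longrightarrow> \<epsilon> \<le> 1 \<Longrightarrow> 2 * \<epsilon> * (C + 1) \<le> m ^ k \<Longrightarrow>
     \<bar>laplace_mean F k \<epsilon> \<phi> - laplace_mean F k \<epsilon> (\<lambda>x. indicator U x * \<phi> x)\<bar> \<le> D2 * growth_factor C * \<epsilon> powr (1 / real k)"
    using outside_estimate[OF U(1,3)] by blast
  have s0: "((\<lambda>\<epsilon>. K * \<epsilon> powr (1 / real k)) \<longlongrightarrow> 0) (at_right 0)" for K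
    using tendsto_mult_right_zero[OF tendsto_powr_inverse_at_right_0[OF k], of K] by simp
  define n where "n = c * mass"
  have n: "n > 0" using c mass_pos by (simp add: n_def)
  have one: "((\<lambda>\<epsilon>. laplace_mean F k \<epsilon> (\<lambda>_. 1)) \<longlongrightarrow> n) (at_right 0)"
  proof (rule LIM_zero_cancel, rule Lim_null_comparison)
    show "((\<lambda>\<epsilon>. (D1 * (1 + 0) + D2 * growth_factor 1) * \<epsilon> powr (1 / real k)) \<longlongrightarrow> 0) (at_right 0)" by (rule s0)
    have "\<forall>\<^sub>F \<epsilon> in at_right 0. 0 < \<epsilon> \<and> \<epsilon> < min 1 (m ^ k / 4)" using m by (intro eventually_small) auto
    then show "\<forall>\<^sub>F \<epsilon> in at_right 0. norm (laplace_mean F k \<epsilon> (\<lambda>_. 1) - n)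
        \<le> (D1 * (1 + 0) + D2 * growth_factor 1) * \<epsilon> powr (1 / real k)"
    proof eventually_elim
      case (elim \<epsilon>)
      have li: "limit_int (\<lambda>x. indicator U x * 1) = mass"
        unfolding mass_def using U(3) by (intro limit_int_cong) (auto simp: indicator_def)
      have "\<bar>laplace_mean F k \<epsilon> (\<lambda>x. indicator U x * 1) - c * limit_int (\<lambda>x. indicator U x * 1)\<bar>
          \<le> D1 * (1 + 0) * \<epsilon> powr (1 / real k)"
        using elim by (intro D1(2)[of "\<lambda>_. 1" 1 0]) (auto simp: lipschitz_on_def)
      then have "\<bar>laplace_mean F k \<epsilon> (\<lambda>x. indicator U x * 1) - n\<bar> \<le> D1 * (1 + 0) * \<epsilon> powr (1 / real k)"
        by (simp only: li n_def)
      moreover have "\<bar>laplace_mean F k \<epsilon> (\<lambda>_. 1) - laplace_mean F k \<epsilon> (\<lambda>x. indicator U x * 1)\<bar>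
          \<le> D2 * growth_factor 1 * \<epsilon> powr (1 / real k)"
        using elim by (intro D2(2)) auto
      moreover have "(D1 * (1 + 0) + D2 * growth_factor 1) * \<epsilon> powr (1 / real k)
          = D1 * (1 + 0) * \<epsilon> powr (1 / real k) + D2 * growth_factor 1 * \<epsilon> powr (1 / real k)"
        by (rule distrib_right)
      ultimately show ?case unfolding real_norm_def by linarith
    qed
  qed
  have main: "((\<lambda>\<epsilon>. laplace_mean F k \<epsilon> \<phi>) \<longlongrightarrow> c * limit_int \<phi>) (at_right 0)"
  proof (rule tendstoI)
    fix e :: real assume e: "e > 0"
    \<comment> \<open>the two errors caused by the approximation are \<open>2 * n * \<eta>\<close> and \<open>n * \<eta>\<close>, together \<open>e / 2\<close>\<close>
    define \<eta> where "\<eta> = e / (6 * n)"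
    have \<eta>: "\<eta> > 0" using e n by (simp add: \<eta>_def)
    have "compact (closure U)" using U(2) by simp
    then obtain g where g: "real_polynomial_function g" "\<And>x. x \<in> closure U \<Longrightarrow> \<bar>\<phi> x - g x\<bar> < \<eta>"
      using Stone_Weierstrass_real_polynomial_function[OF _ continuous_on_subset[OF cont] \<eta>] by blast
    have gU: "\<bar>\<phi> x - g x\<bar> \<le> \<eta>" if "x \<in> U" for x using g(2)[of x] closure_subset that by force
    have gcont: "continuous_on UNIV g" using g(1) by (simp add: continuous_on_polymonial_function real_polynomial_function_eq)
    have gm [measurable]: "g \<in> borel_measurable borel" using gcont by (rule borel_measurable_continuous_onI)
    have Um [measurable]: "U \<in> sets borel" using U(1) by simp
    obtain bg Lg where gb: "0 \<le> bg" "0 \<le> Lg" "\<And>x. x \<in> U \<Longrightarrow> \<bar>g x\<bar> \<le> bg"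
      "\<And>x y. x \<in> U \<Longrightarrow> y \<in> U \<Longrightarrow> \<bar>g x - g y\<bar> \<le> Lg * dist x y"
      using bdd_lip_polynomial[OF g(1) U(2)] by (rule bdd_lipE) (rule that)
    have gL: "Lg-lipschitz_on U g" using gb by (auto simp: lipschitz_on_def dist_real_def)
    have gZ: "\<bar>g x\<bar> \<le> bg" if "x \<in> Z" for x using gb(3) that U(3) by blast
    have lc: "\<bar>limit_int g - limit_int \<phi>\<bar> \<le> \<eta> * mass"
    proof -
      have "\<bar>limit_int (\<lambda>x. g x - \<phi> x)\<bar> \<le> \<eta> * mass"
        using gU U(3) by (intro limit_int_le) (auto simp: abs_minus_commute)
      then show ?thesis using limit_int_diff[OF gm \<phi>m gZ b] by simp
    qed
    then have "c * \<bar>limit_int g - limit_int \<phi>\<bar> \<le> c * (\<eta> * mass)" using c by (intro mult_left_mono) auto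
    then have lc': "\<bar>c * limit_int g - c * limit_int \<phi>\<bar> \<le> \<eta> * n"
      using c by (simp add: n_def right_diff_distrib[symmetric] abs_mult ac_simps)
    have lg: "limit_int (\<lambda>x. indicator U x * g x) = limit_int g"
      using U(3) by (intro limit_int_cong) (auto simp: indicator_def)
    let ?K = "D1 * (bg + Lg) + D2 * growth_factor C"
    have ev1: "\<forall>\<^sub>F \<epsilon> in at_right 0. laplace_mean F k \<epsilon> (\<lambda>_. 1) < 2 * n"
      using order_tendstoD(2)[OF one, of "2 * n"] n by simp
    have ev2: "\<forall>\<^sub>F \<epsilon> in at_right 0. ?K * \<epsilon> powr (1 / real k) < e / 2"
      using order_tendstoD(2)[OF s0, of "e / 2" ?K] e by simp
    show "\<forall>\<^sub>F \<epsilon> in at_right 0. dist (laplace_mean F k \<epsilon> \<phi>) (c * limit_int \<phi>) < e"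
      using ev ev1 ev2
    proof eventually_elim
      case (elim \<epsilon>)
      let ?s = "\<epsilon> powr (1 / real k)"
      have \<epsilon>: "0 < \<epsilon>" "\<epsilon> \<le> 1" "4 * \<epsilon> \<le> m ^ k" and \<epsilon>C: "2 * \<epsilon> * (C + 1) \<le> m ^ k"
        using elim C by (auto simp: pos_less_divide_eq algebra_simps)
      have i1: "\<bar>laplace_mean F k \<epsilon> \<phi> - laplace_mean F k \<epsilon> (\<lambda>x. indicator U x * \<phi> x)\<bar> \<le> D2 * growth_factor C * ?s"
        by (rule D2(2)[OF cont C gr \<epsilon>(1,2) \<epsilon>C])
      have i2: "\<bar>laplace_mean F k \<epsilon> (\<lambda>x. indicator U x * g x) - c * limit_int g\<bar> \<le> D1 * (bg + Lg) * ?s"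
        using D1(2)[of g bg Lg \<epsilon>] gb(3) gL \<epsilon> unfolding lg by blast
      have i3: "\<bar>laplace_mean F k \<epsilon> (\<lambda>x. indicator U x * \<phi> x) - laplace_mean F k \<epsilon> (\<lambda>x. indicator U x * g x)\<bar>
          \<le> \<eta> * laplace_mean F k \<epsilon> (\<lambda>_. 1)"
      proof -
        obtain b\<phi> where b\<phi>: "\<And>x. x \<in> U \<Longrightarrow> \<bar>\<phi> x\<bar> \<le> b\<phi>"
        proof (rule that[of "\<eta> + bg"])
          fix x assume "x \<in> U"
          then show "\<bar>\<phi> x\<bar> \<le> \<eta> + bg" using gU[of x] gb(3)[of x] by linarith
        qed
        have bounds: "\<bar>indicator U x * \<phi> x\<bar> \<le> max b\<phi> 0" "\<bar>indicator U x * g x\<bar> \<le> max bg 0" for x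
          using b\<phi>[of x] gb(3)[of x] by (auto simp: indicator_def)
        have m1: "(\<lambda>x. indicator U x * \<phi> x) \<in> borel_measurable borel" "(\<lambda>x. indicator U x * g x) \<in> borel_measurable borel"
          by measurable
        note ints = integrable_bounded_weight[OF m1(1) bounds(1) \<epsilon>(1)] integrable_bounded_weight[OF m1(2) bounds(2) \<epsilon>(1)]
        have "laplace_mean F k \<epsilon> (\<lambda>x. indicator U x * \<phi> x) - laplace_mean F k \<epsilon> (\<lambda>x. indicator U x * g x)
            = \<epsilon> powr (- (real (min CARD('d) CARD('p)) / real k)) *
              (\<integral>x. (indicator U x * \<phi> x - indicator U x * g x) * weight \<epsilon> x \<partial>lborel)"
          by (subst laplace_mean_diff[OF ints, symmetric]) (simp add: laplace_mean_def)
        also have "\<bar>\<dots>\<bar> \<le> \<epsilon> powr (- (real (min CARD('d) CARD('p)) / real k)) * (\<integral>x. \<eta> * (1 * weight \<epsilon> x) \<partial>lborel)"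
          unfolding abs_mult
        proof (intro mult_mono)
          have di: "integrable lborel (\<lambda>x. (indicator U x * \<phi> x - indicator U x * g x) * weight \<epsilon> x)"
            unfolding left_diff_distrib by (intro Bochner_Integration.integrable_diff ints)
          have "\<bar>\<integral>x. (indicator U x * \<phi> x - indicator U x * g x) * weight \<epsilon> x \<partial>lborel\<bar>
              \<le> (\<integral>x. \<bar>(indicator U x * \<phi> x - indicator U x * g x) * weight \<epsilon> x\<bar> \<partial>lborel)"
            by (rule integral_abs_bound)
          also have "\<dots> \<le> (\<integral>x. \<eta> * (1 * weight \<epsilon> x) \<partial>lborel)"
          proof (rule integral_mono[OF integrable_abs[OF di]])
            show "integrable lborel (\<lambda>x. \<eta> * (1 * weight \<epsilon> x))" using integrable_weight[OF \<epsilon>(1)] by simp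
            fix x
            have "\<bar>indicator U x * \<phi> x - indicator U x * g x\<bar> \<le> \<eta>" using gU[of x] \<eta> by (auto simp: indicator_def)
            then show "\<bar>(indicator U x * \<phi> x - indicator U x * g x) * weight \<epsilon> x\<bar> \<le> \<eta> * (1 * weight \<epsilon> x)"
              unfolding abs_mult by (simp add: mult_right_mono)
          qed
          finally show "\<bar>\<integral>x. (indicator U x * \<phi> x - indicator U x * g x) * weight \<epsilon> x \<partial>lborel\<bar> \<le> (\<integral>x. \<eta> * (1 * weight \<epsilon> x) \<partial>lborel)" .
        qed auto
        also have "\<dots> = \<eta> * laplace_mean F k \<epsilon> (\<lambda>_. 1)" by (simp add: laplace_mean_def)
        finally show ?thesis .
      qed
      have "\<eta> * laplace_mean F k \<epsilon> (\<lambda>_. 1) \<le> \<eta> * (2 * n)" using elim \<eta> by (intro mult_left_mono) auto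
      then have "\<bar>laplace_mean F k \<epsilon> \<phi> - c * limit_int \<phi>\<bar> \<le> (D1 * (bg + Lg) * ?s + D2 * growth_factor C * ?s) + \<eta> * (2 * n) + \<eta> * n"
        using i1 i2 i3 lc' by linarith
      also have "\<dots> = ?K * ?s + e / 2" using n by (simp add: \<eta>_def distrib_right)
      also have "\<dots> < e" using elim by linarith
      finally show ?case by (simp add: dist_real_def)
    qed
  qed
  have ratio: "((\<lambda>\<epsilon>. laplace_mean F k \<epsilon> \<phi> / laplace_mean F k \<epsilon> (\<lambda>_. 1)) \<longlongrightarrow> c * limit_int \<phi> / n) (at_right 0)"
    using n by (intro tendsto_divide main one) auto
  have "((\<lambda>\<epsilon>. \<integral>x. \<phi> x \<partial>gibbs_measure F k \<epsilon>) \<longlongrightarrow> c * limit_int \<phi> / n) (at_right 0)"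
  proof (rule Lim_transform_eventually[OF ratio])
    show "\<forall>\<^sub>F \<epsilon> in at_right 0. laplace_mean F k \<epsilon> \<phi> / laplace_mean F k \<epsilon> (\<lambda>_. 1) = (\<integral>x. \<phi> x \<partial>gibbs_measure F k \<epsilon>)"
      using ev by eventually_elim (intro gibbs_integral(2)[symmetric] int, auto)
  qed
  moreover have "c * limit_int \<phi> / n = (\<integral>x. \<phi> x \<partial>limit_measure F)"
    unfolding lim(2) n_def using c by simp
  ultimately show "((\<lambda>\<epsilon>. \<bar>(\<integral>x. \<phi> x \<partial>gibbs_measure F k \<epsilon>) - (\<integral>x. \<phi> x \<partial>limit_measure F)\<bar>) \<longlongrightarrow> 0) (at_right 0)"
    by (simp add: LIM_zero tendsto_rabs_zero)
qed

end

section \<open>Existence of charts and conclusion\<close>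

text \<open>
  By the normal forms, a nonzero Gram determinant is positive.
\<close>

lemma gen_jacobian_pos:
  fixes F :: "real ^ 'd \<Rightarrow> real ^ 'p"
  assumes "gen_jacobian F x \<noteq> 0"
  shows "gen_jacobian F x > 0"
proof (cases "CARD('p) \<le> CARD('d)")
  case True
  then have J: "gen_jacobian F x = sqrt (det (jacobian F (at x) ** transpose (jacobian F (at x))))"
    by (simp add: gen_jacobian_def Let_def)
  obtain \<iota> :: "'p \<Rightarrow> 'd" where "inj \<iota>"
    using card_le_inj[of "UNIV :: 'p set" "UNIV :: 'd set"] True by auto
  moreover have "det (jacobian F (at x) ** transpose (jacobian F (at x))) \<noteq> 0" using assms J by auto
  ultimately have "det (jacobian F (at x) ** transpose (jacobian F (at x))) > 0"
    by (rule full_row_rank_normal_form)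
  then show ?thesis by (simp add: J)
next
  case False
  then have J: "gen_jacobian F x = sqrt (det (transpose (jacobian F (at x)) ** jacobian F (at x)))"
    by (simp add: gen_jacobian_def Let_def)
  have "det (transpose (jacobian F (at x)) ** jacobian F (at x)) \<noteq> 0" using assms J by auto
  then have "det (transpose (jacobian F (at x)) ** jacobian F (at x)) > 0"
    by (rule injective_matrix_isometry)
  then show ?thesis by (simp add: J)
qed

text \<open>
  The constant \<open>c\<close> is the same for all zeros and all \<open>\<theta>\<close>. For submersions the chart is taken with
  distortion the \<open>(n + 2)\<close>-nd root of \<open>\<theta>\<close>, which offsets the exponent in the local statement.
\<close>

lemma local_laplace_charts:
  fixes F :: "real ^ 'd \<Rightarrow> real ^ 'p"
  assumes k: "k \<ge> 1" and F: "smooth F" and F0: "F 0 = 0"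
    and J: "\<And>x. F x = 0 \<Longrightarrow> gen_jacobian F x \<noteq> 0"
  shows "\<exists>c>0. (\<forall>z \<theta>. F z = 0 \<longrightarrow> \<theta> > 1 \<longrightarrow> (\<exists>r>0. \<exists>K\<ge>0. local_laplace F k c \<theta> z r K))"
    and "0 < emeasure (zero_set_hausdorff F) (F -` {0})"
proof -
  have "(\<exists>c>0. (\<forall>z \<theta>. F z = 0 \<longrightarrow> \<theta> > 1 \<longrightarrow> (\<exists>r>0. \<exists>K\<ge>0. local_laplace F k c \<theta> z r K)))
    \<and> 0 < emeasure (zero_set_hausdorff F) (F -` {0})"
  proof (cases "CARD('p) \<le> CARD('d)")
    case True
    obtain \<iota> :: "'p \<Rightarrow> 'd" where \<iota>: "inj \<iota>"
      using card_le_inj[of "UNIV :: 'p set" "UNIV :: 'd set"] True by auto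
    let ?c = "radial_mass k TYPE(real ^ 'p) / enn2real (flat_unit \<iota>)" and ?n = "CARD('d) - CARD('p) + 2"
    have "enn2real (flat_unit \<iota>) > 0"
      using flat_unit_pos[OF \<iota>] flat_unit_finite[OF \<iota>] by (simp add: enn2real_positive_iff)
    then have "?c > 0" using radial_mass_pos[OF k, where 'a = "real ^ 'p"] by simp
    moreover have "\<exists>r>0. \<exists>K\<ge>0. local_laplace F k ?c \<theta> z r K" if "F z = 0" "\<theta> > 1" for z \<theta>
    proof -
      have "root ?n \<theta> > 1" using that by (intro real_root_gt_1_iff[THEN iffD2]) auto
      moreover have "root ?n \<theta> ^ ?n = \<theta>" using that by (intro real_root_pow_pos) auto
      ultimately show ?thesis
        using local_laplace_submersion(1)[OF \<iota> k F that(1) J[OF that(1)], of "root ?n \<theta>"] by simp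
    qed
    moreover have "0 < emeasure (zero_set_hausdorff F) (F -` {0})"
      using local_laplace_submersion(2)[OF \<iota> k F F0 J[OF F0], of 2] by simp
    ultimately show ?thesis by blast
  next
    case False
    then have card: "CARD('d) < CARD('p)" by simp
    have "\<exists>r>0. \<exists>K\<ge>0. local_laplace F k (radial_mass k TYPE(real ^ 'd)) \<theta> z r K" if "F z = 0" "\<theta> > 1" for z \<theta>
      using local_laplace_immersion(1)[OF card k F that(1) J[OF that(1)], of \<theta>] that by simp
    moreover have "0 < emeasure (zero_set_hausdorff F) (F -` {0})"
      using local_laplace_immersion(2)[OF card k F F0 J[OF F0], of 1] by simp
    ultimately show ?thesis using radial_mass_pos[OF k, where 'a = "real ^ 'd"] by blast
  qed
  then show "\<exists>c>0. (\<forall>z \<theta>. F z = 0 \<longrightarrow> \<theta> > 1 \<longrightarrow> (\<exists>r>0. \<exists>K\<ge>0. local_laplace F k c \<theta> z r K))"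
    and "0 < emeasure (zero_set_hausdorff F) (F -` {0})" by blast+
qed

theorem theorem1:
  fixes F :: "real ^ 'd \<Rightarrow> real ^ 'p" and k :: nat and m \<alpha> R :: real
  assumes "k \<ge> 1"
    and "smooth F"
    and "F 0 = 0"
    and "\<And>x. x \<in> F -` {0} \<Longrightarrow> gen_jacobian F x \<noteq> 0"
    and "m > 0" "\<alpha> > 0" "R \<ge> 0"
    and "\<And>x. norm x \<ge> R \<Longrightarrow> norm (F x) \<ge> m * norm x powr \<alpha>"
  shows "(\<forall>\<epsilon>>0. 0 < gibbs_norm F k \<epsilon> \<and> gibbs_norm F k \<epsilon> < \<infinity> \<and> prob_space (gibbs_measure F k \<epsilon>))
    \<and> (0 < limit_norm F \<and> limit_norm F < \<infinity> \<and> prob_space (limit_measure F))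
    \<and> (\<forall>U. open U \<and> bounded U \<and> F -` {0} \<subseteq> U \<longrightarrow>
        (\<forall>\<phi>::real ^ 'd \<Rightarrow> real. continuous_on UNIV \<phi> \<longrightarrow>
          (\<exists>C\<ge>0. \<forall>x. \<bar>\<phi> x\<bar> \<le> C * exp (C * norm x powr (\<alpha> * real k))) \<longrightarrow>
            integrable (limit_measure F) \<phi>
          \<and> (\<forall>\<^sub>F \<epsilon> in at_right 0. integrable (gibbs_measure F k \<epsilon>) \<phi>)
          \<and> ((\<lambda>\<epsilon>. \<bar>(\<integral>x. \<phi> x \<partial>gibbs_measure F k \<epsilon>) - (\<integral>x. \<phi> x \<partial>limit_measure F)\<bar>)
               \<longlongrightarrow> 0) (at_right 0))
      \<and> (\<exists>A \<epsilon>bar :: real \<Rightarrow> real.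
          continuous_on {0..} A \<and> mono_on {0..} A \<and> (\<forall>c\<ge>0. A c \<ge> 0)
        \<and> continuous_on {0..} \<epsilon>bar \<and> antimono_on {0..} \<epsilon>bar \<and> (\<forall>c\<ge>0. \<epsilon>bar c > 0)
        \<and> (\<forall>(\<phi>::real ^ 'd \<Rightarrow> real) C M1. continuous_on UNIV \<phi> \<longrightarrow> C \<ge> 0 \<longrightarrow>
            (\<forall>x. \<bar>\<phi> x\<bar> \<le> C * exp (C * norm x powr (\<alpha> * real k))) \<longrightarrow>
            M1 \<ge> 0 \<longrightarrow> M1-lipschitz_on U \<phi> \<longrightarrow>
            integrable (limit_measure F) \<phi>
          \<and> (\<forall>\<epsilon>\<in>{0<..<\<epsilon>bar C}.
              integrable (gibbs_measure F k \<epsilon>) \<phi>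
            \<and> \<bar>(\<integral>x. \<phi> x \<partial>gibbs_measure F k \<epsilon>) - (\<integral>x. \<phi> x \<partial>limit_measure F)\<bar>
                \<le> A C * (1 + (SUP x\<in>U. \<bar>\<phi> x\<bar>) + M1) * \<epsilon> powr (1 / real k)))))"
proof -
  note k = assms(1) and F = assms(2) and F0 = assms(3)
  have J: "gen_jacobian F x \<noteq> 0" if "F x = 0" for x using assms(4) that by simp
  obtain c where c: "c > 0" "\<And>z \<theta>. F z = 0 \<Longrightarrow> \<theta> > 1 \<Longrightarrow> \<exists>r>0. \<exists>K\<ge>0. local_laplace F k c \<theta> z r K"
    using local_laplace_charts(1)[OF k F F0 J] by blast
  interpret laplace_setting F k m \<alpha> R c
  proof (rule laplace_setting.intro)
    show "gen_jacobian F x > 0" if "F x = 0" for x by (rule gen_jacobian_pos[OF J[OF that]])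
    show "0 < emeasure (zero_set_hausdorff F) (F -` {0})" by (rule local_laplace_charts(2)[OF k F F0 J])
  qed (use assms c in auto)
  show ?thesis
  proof (intro conjI allI impI)
    fix \<epsilon> :: real assume \<epsilon>: "\<epsilon> > 0"
    show "0 < gibbs_norm F k \<epsilon>" "gibbs_norm F k \<epsilon> < \<infinity>"
      using partition_fn_pos[OF \<epsilon>] by (simp_all add: gibbs_norm_eq[OF \<epsilon>])
    show "prob_space (gibbs_measure F k \<epsilon>)" by (rule prob_space_gibbs[OF \<epsilon>])
  next
    show "0 < limit_norm F" "limit_norm F < \<infinity>" using mass_pos by (simp_all add: limit_norm_eq)
    show "prob_space (limit_measure F)" by (rule prob_space_limit)
  next
    fix U :: "(real ^ 'd) set"
    assume "open U \<and> bounded U \<and> F -` {0} \<subseteq> U"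
    then have U: "open U" "bounded U" "F -` {0} \<subseteq> U" by auto
    show "\<exists>A \<epsilon>bar :: real \<Rightarrow> real.
          continuous_on {0..} A \<and> mono_on {0..} A \<and> (\<forall>c\<ge>0. A c \<ge> 0)
        \<and> continuous_on {0..} \<epsilon>bar \<and> antimono_on {0..} \<epsilon>bar \<and> (\<forall>c\<ge>0. \<epsilon>bar c > 0)
        \<and> (\<forall>(\<phi>::real ^ 'd \<Rightarrow> real) C M1. continuous_on UNIV \<phi> \<longrightarrow> C \<ge> 0 \<longrightarrow>
            (\<forall>x. \<bar>\<phi> x\<bar> \<le> C * exp (C * norm x powr (\<alpha> * real k))) \<longrightarrow>
            M1 \<ge> 0 \<longrightarrow> M1-lipschitz_on U \<phi> \<longrightarrow>
            integrable (limit_measure F) \<phi>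
          \<and> (\<forall>\<epsilon>\<in>{0<..<\<epsilon>bar C}.
              integrable (gibbs_measure F k \<epsilon>) \<phi>
            \<and> \<bar>(\<integral>x. \<phi> x \<partial>gibbs_measure F k \<epsilon>) - (\<integral>x. \<phi> x \<partial>limit_measure F)\<bar>
                \<le> A C * (1 + (SUP x\<in>U. \<bar>\<phi> x\<bar>) + M1) * \<epsilon> powr (1 / real k)))"
      by (rule Lipschitz_rate[OF U])
    fix \<phi> :: "real ^ 'd \<Rightarrow> real"
    assume cont: "continuous_on UNIV \<phi>" and "\<exists>C\<ge>0. \<forall>x. \<bar>\<phi> x\<bar> \<le> C * exp (C * norm x powr (\<alpha> * real k))"
    then obtain C where C: "C \<ge> 0" "\<forall>x. \<bar>\<phi> x\<bar> \<le> C * exp (C * norm x powr (\<alpha> * real k))" by blast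
    note conv = weak_convergence[OF U cont C]
    show "integrable (limit_measure F) \<phi>" by (rule conv(1))
    show "\<forall>\<^sub>F \<epsilon> in at_right 0. integrable (gibbs_measure F k \<epsilon>) \<phi>" by (rule conv(2))
    show "((\<lambda>\<epsilon>. \<bar>(\<integral>x. \<phi> x \<partial>gibbs_measure F k \<epsilon>) - (\<integral>x. \<phi> x \<partial>limit_measure F)\<bar>) \<longlongrightarrow> 0) (at_right 0)"
      by (rule conv(3))
  qed
qed

end
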